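(* Let $B$ be a subalgebra of an Artin algebra $A$ such that $\operatorname{rad} B$ is an ideal in $A$. If $\operatorname{add}\{\Omega_A^2(M) \mid M \in A\text{-mod}\}$ is of finite type, then $\operatorname{fin.dim} B$ is finite.
   Context: An Artin algebra is an algebra that is finitely generated as a module over a commutative artinian ring $R$; subalgebras of $A$ are $R$-subalgebras with the same identity element as $A$ (hence again Artin algebras). For an Artin algebra $\Lambda$, $\Lambda\text{-mod}$ is the category of finitely generated left $\Lambda$-modules, $\operatorname{rad}\Lambda$ is the Jacobson radical, and $\operatorname{pd}_\Lambda X$ is the projective dimension of the left $\Lambda$-module $X$. "Ideal" means two-sided ideal. $\Omega_A^2(M)$ denotes the second syzygy of $M$, where $\Omega_A(M)$ is the kernel of a projective cover of $M$ and $\Omega_A^2(M)=\Omega_A(\Omega_A(M))$. For a class $\mathcal{X}$ of modules in $A\text{-mod}$, $\operatorname{add}\mathcal{X}$ is the full subcategory of $A\text{-mod}$ whose objects are the finite direct sums of indecomposable direct summands of modules in $\mathcal{X}$ (up to isomorphism). A full subcategory of $A\text{-mod}$ (closed under direct summands) is of finite type if it contains only finitely many indecomposable $A$-modules up to isomorphism. The finitistic dimension of $\Lambda$ is $\operatorname{fin.dim}\Lambda = \sup\{\operatorname{pd}_\Lambda M \mid M \in \Lambda\text{-mod},\ \operatorname{pd}_\Lambda M < \infty\}$. *)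

theory Defs
  imports "HOL-Algebra.Algebra" "HOL-Library.Extended_Nat"
begin

text \<open>
  The locale \<^locale>\<open>module\<close> of HOL-Algebra requires a commutative ring of scalars.  It is used
  for the ground ring of an algebra; left modules over an arbitrary ring are introduced here,
  on the same record type and with the same axioms.
\<close>

locale left_module = R?: ring R + M?: abelian_group M
  for R :: "('a, 'b) ring_scheme" (structure) and M :: "('a, 'm, 'c) module_scheme" (structure) +
  assumes smult_closed [simp, intro]:
      "\<lbrakk>a \<in> carrier R; x \<in> carrier M\<rbrakk> \<Longrightarrow> a \<odot>\<^bsub>M\<^esub> x \<in> carrier M"
    and smult_l_distr:
      "\<lbrakk>a \<in> carrier R; b \<in> carrier R; x \<in> carrier M\<rbrakk> \<Longrightarrow>
        (a \<oplus> b) \<odot>\<^bsub>M\<^esub> x = a \<odot>\<^bsub>M\<^esub> x \<oplus>\<^bsub>M\<^esub> b \<odot>\<^bsub>M\<^esub> x"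
    and smult_r_distr:
      "\<lbrakk>a \<in> carrier R; x \<in> carrier M; y \<in> carrier M\<rbrakk> \<Longrightarrow>
        a \<odot>\<^bsub>M\<^esub> (x \<oplus>\<^bsub>M\<^esub> y) = a \<odot>\<^bsub>M\<^esub> x \<oplus>\<^bsub>M\<^esub> a \<odot>\<^bsub>M\<^esub> y"
    and smult_assoc:
      "\<lbrakk>a \<in> carrier R; b \<in> carrier R; x \<in> carrier M\<rbrakk> \<Longrightarrow>
        (a \<otimes> b) \<odot>\<^bsub>M\<^esub> x = a \<odot>\<^bsub>M\<^esub> (b \<odot>\<^bsub>M\<^esub> x)"
    and smult_one [simp]:
      "x \<in> carrier M \<Longrightarrow> \<one> \<odot>\<^bsub>M\<^esub> x = x"

definition fin_gen :: "('a, 'b) ring_scheme \<Rightarrow> ('a, 'm, 'c) module_scheme \<Rightarrow> bool" where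
  "fin_gen R M \<longleftrightarrow> (\<exists>S. finite S \<and> S \<subseteq> carrier M \<and>
     (\<forall>N. submodule N R M \<and> S \<subseteq> N \<longrightarrow> N = carrier M))"

definition mod_hom ::
  "('a, 'b) ring_scheme \<Rightarrow> ('a, 'm, 'c) module_scheme \<Rightarrow> ('a, 'n, 'd) module_scheme \<Rightarrow> ('m \<Rightarrow> 'n) set"
where
  "mod_hom R M N = {h \<in> carrier M \<rightarrow> carrier N.
     (\<forall>x\<in>carrier M. \<forall>y\<in>carrier M. h (x \<oplus>\<^bsub>M\<^esub> y) = h x \<oplus>\<^bsub>N\<^esub> h y) \<and>
     (\<forall>a\<in>carrier R. \<forall>x\<in>carrier M. h (a \<odot>\<^bsub>M\<^esub> x) = a \<odot>\<^bsub>N\<^esub> h x)}"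

definition mod_isomorphic ::
  "('a, 'b) ring_scheme \<Rightarrow> ('a, 'm, 'c) module_scheme \<Rightarrow> ('a, 'n, 'd) module_scheme \<Rightarrow> bool"
where
  "mod_isomorphic R M N \<longleftrightarrow> (\<exists>h\<in>mod_hom R M N. bij_betw h (carrier M) (carrier N))"

text \<open>
  The category of finitely generated left modules over a ring with elements of type \<open>'a\<close>.  HOL
  cannot quantify over carrier types inside a formula, so the objects have carriers in one fixed
  type, which is large enough: elements of a module with \<open>n\<close> generators correspond to cosets in
  the free module of rank \<open>n\<close>, that is, to sets of functions on \<open>{..<n}\<close>.  The lemma
  \<open>fg_modules_adequate\<close> at the end of this theory shows that every finitely generated module, on
  any carrier type, has an isomorphic copy here.  The fields \<^const>\<open>monoid.mult\<close> and \<^const>\<open>monoid.one\<close> of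
  the record are ignored.
\<close>

type_synonym 'a fg_mod = "('a, (nat \<Rightarrow> 'a) set) module"

definition fg_modules :: "('a, 'b) ring_scheme \<Rightarrow> 'a fg_mod set" where
  "fg_modules R = {M. left_module R M \<and> fin_gen R M}"


subsection \<open>Artin algebras, subalgebras and the Jacobson radical\<close>

definition artinian_cring :: "('r, 'b) ring_scheme \<Rightarrow> bool" where
  "artinian_cring R \<longleftrightarrow> cring R \<and>
     (\<forall>I. (\<forall>n::nat. ideal (I n) R \<and> I (Suc n) \<subseteq> I n) \<longrightarrow> (\<exists>k. \<forall>n\<ge>k. I n = I k))"

text \<open>An algebra is a record carrying both its ring structure and the action of the ground ring.\<close>

locale artin_algebra = module R A + ring A
  for R :: "('r, 'b) ring_scheme" and A :: "('r, 'a, 'c) module_scheme" (structure) +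
  assumes ground_artinian: "artinian_cring R"
    and smult_mult_left:
      "\<lbrakk>r \<in> carrier R; x \<in> carrier A; y \<in> carrier A\<rbrakk> \<Longrightarrow> (r \<odot> x) \<otimes> y = r \<odot> (x \<otimes> y)"
    and smult_mult_right:
      "\<lbrakk>r \<in> carrier R; x \<in> carrier A; y \<in> carrier A\<rbrakk> \<Longrightarrow> x \<otimes> (r \<odot> y) = r \<odot> (x \<otimes> y)"
    and finitely_generated: "fin_gen R A"

definition is_subalgebra :: "'a set \<Rightarrow> ('r, 'b) ring_scheme \<Rightarrow> ('r, 'a, 'c) module_scheme \<Rightarrow> bool" where
  "is_subalgebra B R A \<longleftrightarrow> subring B A \<and> submodule B R A"

definition left_ideal :: "'a set \<Rightarrow> ('a, 'b) ring_scheme \<Rightarrow> bool" where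
  "left_ideal I R \<longleftrightarrow> additive_subgroup I R \<and> (\<forall>x\<in>carrier R. \<forall>a\<in>I. x \<otimes>\<^bsub>R\<^esub> a \<in> I)"

definition maximal_left_ideal :: "'a set \<Rightarrow> ('a, 'b) ring_scheme \<Rightarrow> bool" where
  "maximal_left_ideal I R \<longleftrightarrow> left_ideal I R \<and> I \<noteq> carrier R \<and>
     (\<forall>J. left_ideal J R \<and> I \<subseteq> J \<longrightarrow> J = I \<or> J = carrier R)"

definition jacobson_radical :: "('a, 'b) ring_scheme \<Rightarrow> 'a set" where
  "jacobson_radical R = {x \<in> carrier R. \<forall>I. maximal_left_ideal I R \<longrightarrow> x \<in> I}"


subsection \<open>Projective modules, syzygies and homological dimensions\<close>

text \<open>Projectivity is the lifting property in the category of finitely generated modules.\<close>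

definition projective_mod :: "('a, 'b) ring_scheme \<Rightarrow> 'a fg_mod \<Rightarrow> bool" where
  "projective_mod R P \<longleftrightarrow> P \<in> fg_modules R \<and>
     (\<forall>M\<in>fg_modules R. \<forall>N\<in>fg_modules R. \<forall>g\<in>mod_hom R M N. \<forall>f\<in>mod_hom R P N.
        g ` carrier M = carrier N \<longrightarrow>
        (\<exists>h\<in>mod_hom R P M. \<forall>x\<in>carrier P. g (h x) = f x))"

text \<open>A projective cover is an epimorphism from a projective module with superfluous kernel.\<close>

definition projective_cover ::
  "('a, 'b) ring_scheme \<Rightarrow> 'a fg_mod \<Rightarrow> 'a fg_mod \<Rightarrow> ((nat \<Rightarrow> 'a) set \<Rightarrow> (nat \<Rightarrow> 'a) set) \<Rightarrow> bool"
where
  "projective_cover R M P p \<longleftrightarrow> projective_mod R P \<and> p \<in> mod_hom R P M \<and>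
     p ` carrier P = carrier M \<and>
     (\<forall>N. submodule N R P \<and> N <+>\<^bsub>P\<^esub> a_kernel P M p = carrier P \<longrightarrow> N = carrier P)"

text \<open>
  Syzygies are determined only up to isomorphism, so they are given by relations between
  modules: \<open>is_syzygy R M Z\<close> says that \<open>Z\<close> is the kernel of some projective cover of \<open>M\<close>.
\<close>

definition is_syzygy :: "('a, 'b) ring_scheme \<Rightarrow> 'a fg_mod \<Rightarrow> 'a fg_mod \<Rightarrow> bool" where
  "is_syzygy R M Z \<longleftrightarrow> (\<exists>P p. projective_cover R M P p \<and> Z = P\<lparr>carrier := a_kernel P M p\<rparr>)"

definition is_second_syzygy :: "('a, 'b) ring_scheme \<Rightarrow> 'a fg_mod \<Rightarrow> 'a fg_mod \<Rightarrow> bool" where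
  "is_second_syzygy R M Z \<longleftrightarrow> (\<exists>Y. is_syzygy R M Y \<and> is_syzygy R Y Z)"

definition second_syzygies :: "('a, 'b) ring_scheme \<Rightarrow> 'a fg_mod set" where
  "second_syzygies R = {Z. \<exists>M\<in>fg_modules R. is_second_syzygy R M Z}"

text \<open>
  \<open>0 \<rightarrow> P n \<rightarrow> \<dots> \<rightarrow> P 0 \<rightarrow> M \<rightarrow> 0\<close> is exact, where the augmentation is \<open>d 0\<close>, the other maps are
  \<open>d (Suc i) : P (Suc i) \<rightarrow> P i\<close>, and the complex is continued by zero modules.
\<close>

definition projective_resolution ::
  "('a, 'b) ring_scheme \<Rightarrow> 'a fg_mod \<Rightarrow> nat \<Rightarrow> (nat \<Rightarrow> 'a fg_mod) \<Rightarrow>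
    (nat \<Rightarrow> (nat \<Rightarrow> 'a) set \<Rightarrow> (nat \<Rightarrow> 'a) set) \<Rightarrow> bool"
where
  "projective_resolution R M n P d \<longleftrightarrow>
     (\<forall>i. projective_mod R (P i)) \<and>
     (\<forall>i>n. carrier (P i) = {\<zero>\<^bsub>P i\<^esub>}) \<and>
     d 0 \<in> mod_hom R (P 0) M \<and>
     (\<forall>i. d (Suc i) \<in> mod_hom R (P (Suc i)) (P i)) \<and>
     d 0 ` carrier (P 0) = carrier M \<and>
     d (Suc 0) ` carrier (P (Suc 0)) = a_kernel (P 0) M (d 0) \<and>
     (\<forall>i. d (Suc (Suc i)) ` carrier (P (Suc (Suc i))) = a_kernel (P (Suc i)) (P i) (d (Suc i)))"

text \<open>The infimum of the empty set is \<open>\<infinity>\<close>.\<close>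

definition proj_dim :: "('a, 'b) ring_scheme \<Rightarrow> 'a fg_mod \<Rightarrow> enat" where
  "proj_dim R M = Inf {enat n | n. \<exists>P d. projective_resolution R M n P d}"

definition fin_dim :: "('a, 'b) ring_scheme \<Rightarrow> enat" where
  "fin_dim R = Sup {proj_dim R M | M. M \<in> fg_modules R \<and> proj_dim R M < \<infinity>}"


subsection \<open>Direct sums and categories of finite type\<close>

definition complementary ::
  "('a, 'b) ring_scheme \<Rightarrow> ('a, 'm, 'c) module_scheme \<Rightarrow> 'm set \<Rightarrow> 'm set \<Rightarrow> bool"
where
  "complementary R M K L \<longleftrightarrow> submodule K R M \<and> submodule L R M \<and>
     K \<inter> L = {\<zero>\<^bsub>M\<^esub>} \<and> K <+>\<^bsub>M\<^esub> L = carrier M"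

definition indecomposable_mod :: "('a, 'b) ring_scheme \<Rightarrow> ('a, 'm, 'c) module_scheme \<Rightarrow> bool" where
  "indecomposable_mod R M \<longleftrightarrow> carrier M \<noteq> {\<zero>\<^bsub>M\<^esub>} \<and>
     (\<forall>K L. complementary R M K L \<longrightarrow> K = {\<zero>\<^bsub>M\<^esub>} \<or> L = {\<zero>\<^bsub>M\<^esub>})"

definition direct_summand ::
  "('a, 'b) ring_scheme \<Rightarrow> ('a, 'n, 'd) module_scheme \<Rightarrow> ('a, 'm, 'c) module_scheme \<Rightarrow> bool"
where
  "direct_summand R N M \<longleftrightarrow> (\<exists>K L. complementary R M K L \<and> mod_isomorphic R N (M\<lparr>carrier := K\<rparr>))"

definition internal_direct_sum ::
  "('a, 'b) ring_scheme \<Rightarrow> ('a, 'm, 'c) module_scheme \<Rightarrow> nat \<Rightarrow> (nat \<Rightarrow> 'm set) \<Rightarrow> bool"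
where
  "internal_direct_sum R M n K \<longleftrightarrow> (\<forall>i<n. submodule (K i) R M) \<and>
     (\<forall>x\<in>carrier M. \<exists>!f. f \<in> (\<Pi>\<^sub>E i\<in>{..<n}. K i) \<and> x = finsum M f {..<n})"

text \<open>
  The modules isomorphic to a finite direct sum of indecomposable direct summands of modules in
  \<open>Z\<close>; the sum is taken internally, which accounts for the closure under isomorphism.
\<close>

definition add_closure :: "('a, 'b) ring_scheme \<Rightarrow> 'a fg_mod set \<Rightarrow> 'a fg_mod set" where
  "add_closure R Z = {M \<in> fg_modules R. \<exists>n K. internal_direct_sum R M n K \<and>
     (\<forall>i<n. indecomposable_mod R (M\<lparr>carrier := K i\<rparr>) \<and>
            (\<exists>N\<in>Z. direct_summand R (M\<lparr>carrier := K i\<rparr>) N))}"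

definition finite_type :: "('a, 'b) ring_scheme \<Rightarrow> 'a fg_mod set \<Rightarrow> bool" where
  "finite_type R C \<longleftrightarrow> (\<exists>F. finite F \<and> F \<subseteq> C \<and>
     (\<forall>M\<in>C. indecomposable_mod R M \<longrightarrow> (\<exists>N\<in>F. mod_isomorphic R M N)))"


subsection \<open>Adequacy of the carrier type\<close>

lemma (in left_module) smult_zero_left [simp]:
  assumes x: "x \<in> carrier M" shows "\<zero> \<odot>\<^bsub>M\<^esub> x = \<zero>\<^bsub>M\<^esub>"
proof -
  have "\<zero> \<odot>\<^bsub>M\<^esub> x = \<zero> \<odot>\<^bsub>M\<^esub> x \<oplus>\<^bsub>M\<^esub> \<zero> \<odot>\<^bsub>M\<^esub> x"
    using smult_l_distr[of \<zero> \<zero> x] x by simp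
  then show ?thesis
    using x by (metis M.add.r_cancel_one' R.zero_closed smult_closed)
qed

lemma (in left_module) smult_zero_right [simp]:
  assumes a: "a \<in> carrier R" shows "a \<odot>\<^bsub>M\<^esub> \<zero>\<^bsub>M\<^esub> = \<zero>\<^bsub>M\<^esub>"
proof -
  have "a \<odot>\<^bsub>M\<^esub> \<zero>\<^bsub>M\<^esub> = a \<odot>\<^bsub>M\<^esub> \<zero>\<^bsub>M\<^esub> \<oplus>\<^bsub>M\<^esub> a \<odot>\<^bsub>M\<^esub> \<zero>\<^bsub>M\<^esub>"
    using smult_r_distr[of a "\<zero>\<^bsub>M\<^esub>" "\<zero>\<^bsub>M\<^esub>"] a by simp
  then show ?thesis
    using a by (metis M.add.r_cancel_one' M.zero_closed smult_closed)
qed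

lemma (in left_module) smult_minus_one:
  assumes x: "x \<in> carrier M" shows "(\<ominus> \<one>) \<odot>\<^bsub>M\<^esub> x = \<ominus>\<^bsub>M\<^esub> x"
proof -
  have "(\<ominus> \<one>) \<odot>\<^bsub>M\<^esub> x \<oplus>\<^bsub>M\<^esub> x = (\<ominus> \<one> \<oplus> \<one>) \<odot>\<^bsub>M\<^esub> x"
    using smult_l_distr[of "\<ominus> \<one>" \<one> x] x by simp
  also have "\<dots> = \<zero>\<^bsub>M\<^esub>" using x by (simp add: R.l_neg)
  finally show ?thesis using x by (simp add: M.minus_equality)
qed

lemma (in left_module) smult_finsum:
  assumes "finite I" "a \<in> carrier R" "f \<in> I \<rightarrow> carrier M"
  shows "a \<odot>\<^bsub>M\<^esub> finsum M f I = (\<Oplus>\<^bsub>M\<^esub>i\<in>I. a \<odot>\<^bsub>M\<^esub> f i)"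
  using assms by (induct set: finite) (auto simp: Pi_def smult_r_distr)

lemma (in left_module) submoduleI:
  assumes sub: "H \<subseteq> carrier M" and z: "\<zero>\<^bsub>M\<^esub> \<in> H"
    and add: "\<And>x y. x \<in> H \<Longrightarrow> y \<in> H \<Longrightarrow> x \<oplus>\<^bsub>M\<^esub> y \<in> H"
    and sm: "\<And>a x. a \<in> carrier R \<Longrightarrow> x \<in> H \<Longrightarrow> a \<odot>\<^bsub>M\<^esub> x \<in> H"
  shows "submodule H R M"
proof -
  have "\<ominus>\<^bsub>M\<^esub> x \<in> H" if "x \<in> H" for x
    using sm[of "\<ominus> \<one>" x] that sub smult_minus_one[of x] by auto
  then show ?thesis
    using sub z add sm
    by (intro submodule.intro subgroup.intro submodule_axioms.intro) (simp_all add: a_inv_def)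
qed

lemma (in left_module) span_surj:
  fixes n :: nat
  assumes s: "s \<in> {..<n} \<rightarrow> carrier M"
    and gen: "\<And>N. submodule N R M \<Longrightarrow> s ` {..<n} \<subseteq> N \<Longrightarrow> N = carrier M"
  shows "(\<lambda>t. \<Oplus>\<^bsub>M\<^esub>i\<in>{..<n}. t i \<odot>\<^bsub>M\<^esub> s i) ` ({..<n} \<rightarrow>\<^sub>E carrier R) = carrier M"
    (is "?\<phi> ` ?T = _")
proof -
  have cl: "(\<lambda>i. t i \<odot>\<^bsub>M\<^esub> s i) \<in> {..<n} \<rightarrow> carrier M" if "t \<in> ?T" for t
    using that s by (auto simp: PiE_def Pi_def)
  have restr: "?\<phi> (restrict u {..<n}) = ?\<phi> u" if "u \<in> {..<n} \<rightarrow> carrier R" for u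
    using that s by (intro M.finsum_cong') (auto simp: Pi_def)
  have mem: "?\<phi> u \<in> ?\<phi> ` ?T" if "u \<in> {..<n} \<rightarrow> carrier R" for u
    using restr[OF that] that by (intro image_eqI[of _ _ "restrict u {..<n}"]) auto
  have sub: "submodule (?\<phi> ` ?T) R M"
  proof (rule submoduleI)
    show "?\<phi> ` ?T \<subseteq> carrier M" using cl by (auto intro: M.finsum_closed)
    have "?\<phi> (\<lambda>i. \<zero>) = (\<Oplus>\<^bsub>M\<^esub>i\<in>{..<n}. \<zero>\<^bsub>M\<^esub>)"
      using s by (intro M.finsum_cong') (auto simp: Pi_def)
    then show "\<zero>\<^bsub>M\<^esub> \<in> ?\<phi> ` ?T" using mem[of "\<lambda>i. \<zero>"] by simp
  next
    fix x y assume "x \<in> ?\<phi> ` ?T" "y \<in> ?\<phi> ` ?T"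
    then obtain t u where t: "t \<in> ?T" "x = ?\<phi> t" and u: "u \<in> ?T" "y = ?\<phi> u" by auto
    have tu: "t i \<in> carrier R" "u i \<in> carrier R" "s i \<in> carrier M" if "i < n" for i
      using that t u s by auto
    have "x \<oplus>\<^bsub>M\<^esub> y = (\<Oplus>\<^bsub>M\<^esub>i\<in>{..<n}. t i \<odot>\<^bsub>M\<^esub> s i \<oplus>\<^bsub>M\<^esub> u i \<odot>\<^bsub>M\<^esub> s i)"
      unfolding t u using cl[OF t(1)] cl[OF u(1)] by (rule M.finsum_addf[symmetric])
    also have "\<dots> = ?\<phi> (\<lambda>i. t i \<oplus> u i)"
      using tu by (intro M.finsum_cong') (auto simp: smult_l_distr)
    finally show "x \<oplus>\<^bsub>M\<^esub> y \<in> ?\<phi> ` ?T" using mem[of "\<lambda>i. t i \<oplus> u i"] tu by (simp add: Pi_def)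
  next
    fix a x assume a: "a \<in> carrier R" and "x \<in> ?\<phi> ` ?T"
    then obtain t where t: "t \<in> ?T" "x = ?\<phi> t" by auto
    have ts: "t i \<in> carrier R" "s i \<in> carrier M" if "i < n" for i
      using that t s by auto
    have "a \<odot>\<^bsub>M\<^esub> x = (\<Oplus>\<^bsub>M\<^esub>i\<in>{..<n}. a \<odot>\<^bsub>M\<^esub> (t i \<odot>\<^bsub>M\<^esub> s i))"
      unfolding t using cl[OF t(1)] a by (intro smult_finsum) auto
    also have "\<dots> = ?\<phi> (\<lambda>i. a \<otimes> t i)"
      using ts a by (intro M.finsum_cong') (auto simp: smult_assoc)
    finally show "a \<odot>\<^bsub>M\<^esub> x \<in> ?\<phi> ` ?T" using mem[of "\<lambda>i. a \<otimes> t i"] ts a by (simp add: Pi_def)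
  qed
  have "s j \<in> ?\<phi> ` ?T" if j: "j < n" for j
  proof -
    have si: "s i \<in> carrier M" if "i < n" for i using that s by auto
    have "?\<phi> (\<lambda>i. if j = i then \<one> else \<zero>) = (\<Oplus>\<^bsub>M\<^esub>i\<in>{..<n}. if j = i then s i else \<zero>\<^bsub>M\<^esub>)"
      using si by (intro M.finsum_cong') auto
    also have "\<dots> = s j" using M.finsum_singleton[of j "{..<n}" s] j s by auto
    finally show ?thesis using mem[of "\<lambda>i. if j = i then \<one> else \<zero>"] by (auto simp: Pi_def)
  qed
  then have "s ` {..<n} \<subseteq> ?\<phi> ` ?T" by auto
  from gen[OF sub this] show ?thesis .
qed

lemma (in left_module) transport:
  fixes j :: "_ \<Rightarrow> 'n"
  assumes inj: "inj_on j (carrier M)"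
  shows "\<exists>N :: ('a, 'n) module. left_module R N \<and> mod_isomorphic R M N \<and>
           (fin_gen R M \<longrightarrow> fin_gen R N)"
proof -
  define k where "k = inv_into (carrier M) j"
  have kj [simp]: "k (j x) = x" if "x \<in> carrier M" for x
    using that inj by (simp add: k_def)
  define N :: "('a, 'n) module" where
    "N = \<lparr>carrier = j ` carrier M, monoid.mult = undefined, one = undefined, ring.zero = j \<zero>\<^bsub>M\<^esub>,
          ring.add = (\<lambda>x y. j (k x \<oplus>\<^bsub>M\<^esub> k y)), module.smult = (\<lambda>a x. j (a \<odot>\<^bsub>M\<^esub> k x))\<rparr>"
  have [simp]: "carrier N = j ` carrier M" "\<zero>\<^bsub>N\<^esub> = j \<zero>\<^bsub>M\<^esub>"
    "x \<oplus>\<^bsub>N\<^esub> y = j (k x \<oplus>\<^bsub>M\<^esub> k y)" "a \<odot>\<^bsub>N\<^esub> x = j (a \<odot>\<^bsub>M\<^esub> k x)" for a x y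
    by (simp_all add: N_def)
  have ag: "abelian_group N"
  proof (rule abelian_groupI)
    fix x assume "x \<in> carrier N"
    then obtain m where m: "m \<in> carrier M" "x = j m" by auto
    show "\<exists>y\<in>carrier N. y \<oplus>\<^bsub>N\<^esub> x = \<zero>\<^bsub>N\<^esub>"
      using m by (intro bexI[of _ "j (\<ominus>\<^bsub>M\<^esub> m)"]) (auto simp: M.l_neg)
  qed (auto simp: M.add.m_ac)
  have lm: "left_module R N"
    by (intro left_module.intro left_module_axioms.intro ag R.ring_axioms)
       (auto simp: smult_l_distr smult_r_distr smult_assoc)
  have hom: "j \<in> mod_hom R M N" by (auto simp: mod_hom_def)
  have iso: "mod_isomorphic R M N"
    unfolding mod_isomorphic_def using hom inj by (intro bexI[of _ j]) (auto simp: bij_betw_def)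
  have "fin_gen R N" if "fin_gen R M"
  proof -
    from that obtain S where S: "finite S" "S \<subseteq> carrier M"
      "\<And>H. submodule H R M \<Longrightarrow> S \<subseteq> H \<Longrightarrow> H = carrier M" unfolding fin_gen_def by blast
    have "H = carrier N" if H: "submodule H R N" "j ` S \<subseteq> H" for H
    proof -
      interpret H: submodule H R N by fact
      have Hs: "H \<subseteq> j ` carrier M" using H.subset by simp
      have "submodule {x \<in> carrier M. j x \<in> H} R M"
      proof (rule submoduleI)
        show "\<zero>\<^bsub>M\<^esub> \<in> {x \<in> carrier M. j x \<in> H}" using H.one_closed by simp
      next
        fix x y assume "x \<in> {x \<in> carrier M. j x \<in> H}" "y \<in> {x \<in> carrier M. j x \<in> H}"
        then show "x \<oplus>\<^bsub>M\<^esub> y \<in> {x \<in> carrier M. j x \<in> H}"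
          using H.m_closed[of "j x" "j y"] by simp
      next
        fix a x assume "a \<in> carrier R" "x \<in> {x \<in> carrier M. j x \<in> H}"
        then show "a \<odot>\<^bsub>M\<^esub> x \<in> {x \<in> carrier M. j x \<in> H}"
          using H.smult_closed[of a "j x"] by simp
      qed auto
      from S(3)[OF this] have "{x \<in> carrier M. j x \<in> H} = carrier M" using H(2) S(2) by auto
      then show ?thesis using Hs by auto
    qed
    then show ?thesis unfolding fin_gen_def using S(1,2) by (intro exI[of _ "j ` S"]) auto
  qed
  then show ?thesis using lm iso by blast
qed

lemma fg_modules_adequate:
  fixes R :: "('a, 'b) ring_scheme" and M :: "('a, 'm, 'c) module_scheme"
  assumes "left_module R M" and fg: "fin_gen R M"
  shows "\<exists>N\<in>fg_modules R. mod_isomorphic R M N"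
proof -
  interpret left_module R M by fact
  from fg obtain S where S: "finite S" "S \<subseteq> carrier M"
    "\<And>N. submodule N R M \<Longrightarrow> S \<subseteq> N \<Longrightarrow> N = carrier M" unfolding fin_gen_def by blast
  obtain s and n :: nat where s: "s ` {..<n} = S"
    using finite_imp_nat_seg_image_inj_on[OF S(1)] by (auto simp: lessThan_def)
  define \<phi> where "\<phi> = (\<lambda>t. \<Oplus>\<^bsub>M\<^esub>i\<in>{..<n}. t i \<odot>\<^bsub>M\<^esub> s i)"
  have surj: "\<phi> ` ({..<n} \<rightarrow>\<^sub>E carrier R) = carrier M"
    unfolding \<phi>_def using s S(2,3) by (intro span_surj) auto
  have "inj_on (\<lambda>m. {t \<in> {..<n} \<rightarrow>\<^sub>E carrier R. \<phi> t = m}) (carrier M)"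
  proof (rule inj_onI)
    fix x y assume x: "x \<in> carrier M" and
      eq: "{t \<in> {..<n} \<rightarrow>\<^sub>E carrier R. \<phi> t = x} = {t \<in> {..<n} \<rightarrow>\<^sub>E carrier R. \<phi> t = y}"
    from x surj have "x \<in> \<phi> ` ({..<n} \<rightarrow>\<^sub>E carrier R)" by simp
    then obtain t where "t \<in> {..<n} \<rightarrow>\<^sub>E carrier R" "\<phi> t = x" by blast
    with eq show "x = y" by blast
  qed
  from transport[OF this] fg show ?thesis unfolding fg_modules_def by auto
qed

end

theory Submission
  imports Defs
begin

text \<open>
  The proof compares both algebras through syzygies.  Let \<open>M\<close> be a \<open>B\<close>-module of finite projective
  dimension and \<open>Z\<close> its second syzygy, a submodule of a projective \<open>B\<close>-module and so of some \<open>B\<^sup>m\<close>.  As the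
  covers are minimal, the coordinates of \<open>Z\<close> lie in \<open>rad B\<close>, and \<open>Z\<close> is cut out by \<open>B\<close>-linear equations.
  Since \<open>rad B\<close> is an ideal of \<open>A\<close>, the set \<open>Z\<close> is closed under multiplication by \<open>A\<close> inside
  \<open>A\<^sup>m\<close>, and by Nakayama's lemma it is the syzygy of the \<open>A\<close>-module \<open>W = A\<^sup>m/Z\<close>.  A projective cover \<open>P\<close>
  of \<open>Z\<close> over \<open>A\<close> then gives an exact sequence \<open>0 \<rightarrow> \<Omega>\<^sub>A\<^sup>2(W) \<rightarrow> P \<rightarrow> Z \<rightarrow> 0\<close>
  (\<open>second_syzygy_over_A\<close>).  By hypothesis, and because there are only finitely many indecomposable projective
  \<open>A\<close>-modules, the two left terms are direct sums of copies of finitely many modules, which do not depend on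
  \<open>M\<close>.

  It remains to bound the projective dimension of \<open>Z\<close> over \<open>B\<close>, assuming it is finite, in terms of this finite list
  (\<open>uniform_bound\<close>).  This is an argument in the style of Igusa and Todorov.  The basic notion is that of a
  \<open>k\<close>-null map, one that factors through a projective module after \<open>k\<close> syzygies; the projective
  dimension of \<open>Z\<close> is at most \<open>k\<close> if and only if the identity of \<open>Z\<close> is \<open>k\<close>-null.  In an exact
  sequence \<open>0 \<rightarrow> V \<rightarrow> P \<rightarrow> Z \<rightarrow> 0\<close> with \<open>Z\<close> of finite projective dimension, sufficiently high syzygies of
  \<open>V\<close> and \<open>P\<close> are stably isomorphic.  The differences of the multiplicities in \<open>V\<close> and in \<open>P\<close>, for all pairs of direct sums for which this happens
  after \<open>n\<close> steps, form an ascending chain of subgroups of a free abelian group of finite rank, which stops; hence there is one \<open>n\<close> such that the \<open>n\<close>-th syzygies of \<open>V\<close> and \<open>P\<close> become stably isomorphic once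
  a suitable summand is added to both (\<open>uniform_identification\<close>).  This reduces the problem to the case
  that \<open>V\<close> and \<open>P\<close> are stably isomorphic (\<open>cokernel_bound\<close>).  Then the injection \<open>V \<rightarrow> P\<close> becomes
  an endomorphism \<open>h\<close> of \<open>V\<close>.  Modulo eventually null maps it can be cancelled on the left, because \<open>Z\<close>
  has finite projective dimension; the endomorphism ring is artinian, so \<open>h\<close> is invertible modulo such maps, and
  the sequence splits after as many syzygies as are needed to make the eventually null endomorphisms
  null.  That number is uniform, because all modules involved are built from one module, whose \<open>k\<close>-null
  endomorphisms form an ascending chain in a noetherian module.
\<close>

section \<open>Homomorphisms and submodules\<close>

lemma mod_homI:
  assumes "\<And>x. x \<in> carrier M \<Longrightarrow> h x \<in> carrier N"
    and "\<And>x y. x \<in> carrier M \<Longrightarrow> y \<in> carrier M \<Longrightarrow> h (x \<oplus>\<^bsub>M\<^esub> y) = h x \<oplus>\<^bsub>N\<^esub> h y"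
    and "\<And>a x. a \<in> carrier R \<Longrightarrow> x \<in> carrier M \<Longrightarrow> h (a \<odot>\<^bsub>M\<^esub> x) = a \<odot>\<^bsub>N\<^esub> h x"
  shows "h \<in> mod_hom R M N"
  using assms by (auto simp: mod_hom_def)

lemma mod_hom_closed: "h \<in> mod_hom R M N \<Longrightarrow> x \<in> carrier M \<Longrightarrow> h x \<in> carrier N"
  by (auto simp: mod_hom_def)

lemma mod_hom_add:
  "h \<in> mod_hom R M N \<Longrightarrow> x \<in> carrier M \<Longrightarrow> y \<in> carrier M \<Longrightarrow> h (x \<oplus>\<^bsub>M\<^esub> y) = h x \<oplus>\<^bsub>N\<^esub> h y"
  by (auto simp: mod_hom_def)

lemma mod_hom_smult:
  "h \<in> mod_hom R M N \<Longrightarrow> a \<in> carrier R \<Longrightarrow> x \<in> carrier M \<Longrightarrow> h (a \<odot>\<^bsub>M\<^esub> x) = a \<odot>\<^bsub>N\<^esub> h x"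
  by (auto simp: mod_hom_def)

lemma mod_hom_comp:
  "f \<in> mod_hom R M N \<Longrightarrow> g \<in> mod_hom R N L \<Longrightarrow> (\<lambda>x. g (f x)) \<in> mod_hom R M L"
  by (rule mod_homI) (simp_all add: mod_hom_closed[of f] mod_hom_closed[of g] mod_hom_add[of f] mod_hom_add[of g]
      mod_hom_smult[of f] mod_hom_smult[of g])

lemma mod_hom_id: "(\<lambda>x. x) \<in> mod_hom R M M"
  by (auto simp: mod_hom_def)

lemma mod_hom_cong:
  assumes "left_module R M" "f \<in> mod_hom R M N" "\<And>x. x \<in> carrier M \<Longrightarrow> g x = f x"
  shows "g \<in> mod_hom R M N"
proof -
  interpret left_module R M by fact
  show ?thesis using assms(2,3) by (auto simp: mod_hom_def)
qed

lemma mod_hom_zero: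
  assumes "left_module R M" "left_module R N" "h \<in> mod_hom R M N"
  shows "h \<zero>\<^bsub>M\<^esub> = \<zero>\<^bsub>N\<^esub>"
proof -
  interpret M: left_module R M by fact
  interpret N: left_module R N by fact
  have "h \<zero>\<^bsub>M\<^esub> = h (\<zero>\<^bsub>R\<^esub> \<odot>\<^bsub>M\<^esub> \<zero>\<^bsub>M\<^esub>)" by simp
  also have "\<dots> = \<zero>\<^bsub>N\<^esub>" using assms(3) by (simp add: mod_hom_smult mod_hom_closed del: M.smult_zero_left M.smult_zero_right)
  finally show ?thesis .
qed

lemma mod_hom_neg:
  assumes "left_module R M" "left_module R N" "h \<in> mod_hom R M N" "x \<in> carrier M"
  shows "h (\<ominus>\<^bsub>M\<^esub> x) = \<ominus>\<^bsub>N\<^esub> h x"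
proof -
  interpret M: left_module R M by fact
  interpret N: left_module R N by fact
  show ?thesis using assms(3,4)
    by (metis M.smult_minus_one N.smult_minus_one M.R.one_closed M.R.a_inv_closed mod_hom_smult mod_hom_closed)
qed

lemma mod_hom_minus:
  assumes "left_module R M" "left_module R N" "h \<in> mod_hom R M N" "x \<in> carrier M" "y \<in> carrier M"
  shows "h (x \<ominus>\<^bsub>M\<^esub> y) = h x \<ominus>\<^bsub>N\<^esub> h y"
proof -
  interpret M: left_module R M by fact
  show ?thesis using assms by (simp add: a_minus_def mod_hom_add mod_hom_neg[OF assms(1-3)])
qed

context abelian_group begin

lemma minus_swap: "x \<in> carrier G \<Longrightarrow> y \<in> carrier G \<Longrightarrow> \<ominus> (x \<ominus> y) = y \<ominus> x"
  by (simp add: a_minus_def minus_add a_comm)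

lemma minus_telescope:
  "x \<in> carrier G \<Longrightarrow> y \<in> carrier G \<Longrightarrow> z \<in> carrier G \<Longrightarrow> (x \<ominus> y) \<oplus> (y \<ominus> z) = x \<ominus> z"
  by (simp add: a_minus_def a_assoc r_neg1)

lemma minus_add_add:
  "x \<in> carrier G \<Longrightarrow> y \<in> carrier G \<Longrightarrow> x' \<in> carrier G \<Longrightarrow> y' \<in> carrier G \<Longrightarrow>
    (x \<oplus> x') \<ominus> (y \<oplus> y') = (x \<ominus> y) \<oplus> (x' \<ominus> y')"
  by (simp add: a_minus_def minus_add a_ac)

lemma minus_zero_iff: "x \<in> carrier G \<Longrightarrow> y \<in> carrier G \<Longrightarrow> x \<ominus> y = \<zero> \<longleftrightarrow> x = y"
  by (metis a_minus_def minus_equality minus_minus r_neg a_inv_closed)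

lemma minus_add_cancel: "x \<in> carrier G \<Longrightarrow> y \<in> carrier G \<Longrightarrow> (x \<ominus> y) \<oplus> y = x"
  by (simp add: a_minus_def a_assoc l_neg)

lemma add_minus_cancel: "x \<in> carrier G \<Longrightarrow> y \<in> carrier G \<Longrightarrow> (x \<oplus> y) \<ominus> y = x"
  by (simp add: a_minus_def a_assoc r_neg)

lemma add_minus_cancel': "x \<in> carrier G \<Longrightarrow> y \<in> carrier G \<Longrightarrow> (x \<oplus> y) \<ominus> x = y"
  using add_minus_cancel[of y x] by (simp add: a_comm)

lemma add_swap4:
  "x \<in> carrier G \<Longrightarrow> y \<in> carrier G \<Longrightarrow> x' \<in> carrier G \<Longrightarrow> y' \<in> carrier G \<Longrightarrow>
    (x \<oplus> y) \<oplus> (x' \<oplus> y') = (x \<oplus> x') \<oplus> (y \<oplus> y')"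
  by (simp add: a_ac)

end

lemma submodule_iff:
  assumes "left_module R M"
  shows "submodule H R M \<longleftrightarrow> H \<subseteq> carrier M \<and> \<zero>\<^bsub>M\<^esub> \<in> H \<and>
    (\<forall>x\<in>H. \<forall>y\<in>H. x \<oplus>\<^bsub>M\<^esub> y \<in> H) \<and> (\<forall>a\<in>carrier R. \<forall>x\<in>H. a \<odot>\<^bsub>M\<^esub> x \<in> H)"
proof -
  interpret left_module R M by fact
  show ?thesis
  proof
    assume "submodule H R M"
    then interpret H: submodule H R M .
    show "H \<subseteq> carrier M \<and> \<zero>\<^bsub>M\<^esub> \<in> H \<and>
      (\<forall>x\<in>H. \<forall>y\<in>H. x \<oplus>\<^bsub>M\<^esub> y \<in> H) \<and> (\<forall>a\<in>carrier R. \<forall>x\<in>H. a \<odot>\<^bsub>M\<^esub> x \<in> H)"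
      using H.subset H.one_closed H.m_closed H.smult_closed by simp
  next
    assume *: "H \<subseteq> carrier M \<and> \<zero>\<^bsub>M\<^esub> \<in> H \<and>
      (\<forall>x\<in>H. \<forall>y\<in>H. x \<oplus>\<^bsub>M\<^esub> y \<in> H) \<and> (\<forall>a\<in>carrier R. \<forall>x\<in>H. a \<odot>\<^bsub>M\<^esub> x \<in> H)"
    show "submodule H R M" by (rule submoduleI) (use * in auto)
  qed
qed

lemma submodule_sub: "submodule H R M \<Longrightarrow> H \<subseteq> carrier M"
  using subgroup.subset[OF submodule.axioms(1)] by fastforce

lemma submodule_in: "submodule H R M \<Longrightarrow> x \<in> H \<Longrightarrow> x \<in> carrier M"
  using submodule_sub by blast

lemma submodule_0: "submodule H R M \<Longrightarrow> \<zero>\<^bsub>M\<^esub> \<in> H"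
  using subgroup.one_closed[OF submodule.axioms(1)] by fastforce

lemma submodule_add: "submodule H R M \<Longrightarrow> x \<in> H \<Longrightarrow> y \<in> H \<Longrightarrow> x \<oplus>\<^bsub>M\<^esub> y \<in> H"
  using subgroup.m_closed[OF submodule.axioms(1)] by fastforce

lemma submodule_smult: "submodule H R M \<Longrightarrow> a \<in> carrier R \<Longrightarrow> x \<in> H \<Longrightarrow> a \<odot>\<^bsub>M\<^esub> x \<in> H"
  using submodule.smult_closed by fastforce

lemma submodule_neg: "submodule H R M \<Longrightarrow> x \<in> H \<Longrightarrow> \<ominus>\<^bsub>M\<^esub> x \<in> H"
  using subgroup.m_inv_closed[OF submodule.axioms(1)] by (fastforce simp: a_inv_def)

lemma submodule_minus: "submodule H R M \<Longrightarrow> x \<in> H \<Longrightarrow> y \<in> H \<Longrightarrow> x \<ominus>\<^bsub>M\<^esub> y \<in> H"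
  by (simp add: a_minus_def submodule_add submodule_neg)

lemma (in left_module) submodule_carrier: "submodule (carrier M) R M"
  by (intro submoduleI) auto

lemma (in left_module) submodule_zero: "submodule {\<zero>\<^bsub>M\<^esub>} R M"
  by (intro submoduleI) auto

lemma (in left_module) submodule_Int: "submodule H R M \<Longrightarrow> submodule H' R M \<Longrightarrow> submodule (H \<inter> H') R M"
  by (intro submoduleI) (auto dest: submodule_in submodule_0 submodule_add submodule_smult)

lemma (in left_module) submodule_left_module:
  assumes H: "submodule H R M"
  shows "left_module R (M\<lparr>carrier := H\<rparr>)"
proof -
  have "abelian_group (M\<lparr>carrier := H\<rparr>)"
  proof (rule abelian_groupI)
    fix x assume "x \<in> carrier (M\<lparr>carrier := H\<rparr>)"
    then show "\<exists>y\<in>carrier (M\<lparr>carrier := H\<rparr>). y \<oplus>\<^bsub>M\<lparr>carrier := H\<rparr>\<^esub> x = \<zero>\<^bsub>M\<lparr>carrier := H\<rparr>\<^esub>"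
      using submodule_neg[OF H] submodule_in[OF H] by (auto intro!: bexI[of _ "\<ominus>\<^bsub>M\<^esub> x"] simp: M.l_neg)
  qed (use submodule_in[OF H] submodule_0[OF H] submodule_add[OF H] in \<open>auto simp: M.a_ac\<close>)
  then show ?thesis
    using submodule_in[OF H] submodule_smult[OF H]
    by (intro left_module.intro left_module_axioms.intro R.ring_axioms)
       (auto simp: smult_l_distr smult_r_distr smult_assoc)
qed

lemma submodule_trans:
  assumes "left_module R M" and H: "submodule H R M"
  shows "submodule N R (M\<lparr>carrier := H\<rparr>) \<longleftrightarrow> submodule N R M \<and> N \<subseteq> H"
  unfolding submodule_iff[OF assms(1)] submodule_iff[OF left_module.submodule_left_module[OF assms]]
  using submodule_sub[OF H] by auto

lemma (in left_module) submodule_sum: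
  assumes H: "submodule H R M" "submodule H' R M"
  shows "submodule (H <+>\<^bsub>M\<^esub> H') R M"
proof (rule submoduleI)
  show "H <+>\<^bsub>M\<^esub> H' \<subseteq> carrier M"
    using submodule_in[OF H(1)] submodule_in[OF H(2)] by (auto simp: set_add_def')
  show "\<zero>\<^bsub>M\<^esub> \<in> H <+>\<^bsub>M\<^esub> H'"
    using submodule_0[OF H(1)] submodule_0[OF H(2)] M.r_zero[of "\<zero>\<^bsub>M\<^esub>"] unfolding set_add_def' by fastforce
next
  fix x y assume "x \<in> H <+>\<^bsub>M\<^esub> H'" "y \<in> H <+>\<^bsub>M\<^esub> H'"
  then obtain a b c d where s: "a \<in> H" "b \<in> H'" "c \<in> H" "d \<in> H'" "x = a \<oplus>\<^bsub>M\<^esub> b" "y = c \<oplus>\<^bsub>M\<^esub> d"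
    by (auto simp: set_add_def')
  then have "x \<oplus>\<^bsub>M\<^esub> y = (a \<oplus>\<^bsub>M\<^esub> c) \<oplus>\<^bsub>M\<^esub> (b \<oplus>\<^bsub>M\<^esub> d)"
    using H by (simp add: M.add_swap4 submodule_in)
  then show "x \<oplus>\<^bsub>M\<^esub> y \<in> H <+>\<^bsub>M\<^esub> H'"
    using submodule_add[OF H(1) s(1,3)] submodule_add[OF H(2) s(2,4)] unfolding set_add_def' by blast
next
  fix a x assume a: "a \<in> carrier R" and "x \<in> H <+>\<^bsub>M\<^esub> H'"
  then obtain u v where s: "u \<in> H" "v \<in> H'" "x = u \<oplus>\<^bsub>M\<^esub> v"
    by (auto simp: set_add_def')
  then have "a \<odot>\<^bsub>M\<^esub> x = a \<odot>\<^bsub>M\<^esub> u \<oplus>\<^bsub>M\<^esub> a \<odot>\<^bsub>M\<^esub> v"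
    using a H by (simp add: smult_r_distr submodule_in)
  then show "a \<odot>\<^bsub>M\<^esub> x \<in> H <+>\<^bsub>M\<^esub> H'"
    using submodule_smult[OF H(1) a s(1)] submodule_smult[OF H(2) a s(2)] unfolding set_add_def' by blast
qed

lemma (in left_module) subset_sum:
  assumes H: "submodule H R M" "submodule H' R M"
  shows "H \<subseteq> H <+>\<^bsub>M\<^esub> H'" "H' \<subseteq> H <+>\<^bsub>M\<^esub> H'"
proof -
  show "H \<subseteq> H <+>\<^bsub>M\<^esub> H'"
  proof
    fix x assume x: "x \<in> H"
    then have "x = x \<oplus>\<^bsub>M\<^esub> \<zero>\<^bsub>M\<^esub>" using submodule_in[OF H(1), of x] by simp
    then show "x \<in> H <+>\<^bsub>M\<^esub> H'" using x submodule_0[OF H(2)] unfolding set_add_def' by blast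
  qed
  show "H' \<subseteq> H <+>\<^bsub>M\<^esub> H'"
  proof
    fix x assume x: "x \<in> H'"
    then have "x = \<zero>\<^bsub>M\<^esub> \<oplus>\<^bsub>M\<^esub> x" using submodule_in[OF H(2), of x] by simp
    then show "x \<in> H <+>\<^bsub>M\<^esub> H'" using x submodule_0[OF H(1)] unfolding set_add_def' by blast
  qed
qed

lemma submodule_image:
  assumes "left_module R M" "left_module R N" "h \<in> mod_hom R M N" "submodule H R M"
  shows "submodule (h ` H) R N"
  unfolding submodule_iff[OF assms(2)]
proof (intro conjI ballI)
  note H = assms(4)
  show "h ` H \<subseteq> carrier N" using mod_hom_closed[OF assms(3)] submodule_in[OF H] by auto
  show "\<zero>\<^bsub>N\<^esub> \<in> h ` H" using mod_hom_zero[OF assms(1-3)] submodule_0[OF H] by force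
next
  note H = assms(4)
  fix x y assume "x \<in> h ` H" "y \<in> h ` H"
  then show "x \<oplus>\<^bsub>N\<^esub> y \<in> h ` H"
    using mod_hom_add[OF assms(3)] submodule_add[OF H] submodule_in[OF H] by (smt (verit) image_iff)
next
  note H = assms(4)
  fix a x assume "a \<in> carrier R" "x \<in> h ` H"
  then show "a \<odot>\<^bsub>N\<^esub> x \<in> h ` H"
    using mod_hom_smult[OF assms(3)] submodule_smult[OF H] submodule_in[OF H] by (smt (verit) image_iff)
qed

lemma submodule_preimage:
  assumes "left_module R M" "left_module R N" "h \<in> mod_hom R M N" "submodule H R N"
  shows "submodule {x \<in> carrier M. h x \<in> H} R M"
proof -
  interpret M: left_module R M by fact
  show ?thesis unfolding submodule_iff[OF assms(1)]
    using mod_hom_zero[OF assms(1-3)] submodule_0[OF assms(4)] submodule_add[OF assms(4)]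
      submodule_smult[OF assms(4)] mod_hom_add[OF assms(3)] mod_hom_smult[OF assms(3)] by auto
qed

lemma submodule_kernel:
  assumes "left_module R M" "left_module R N" "h \<in> mod_hom R M N"
  shows "submodule (a_kernel M N h) R M"
  using submodule_preimage[OF assms left_module.submodule_zero[OF assms(2)]]
  by (simp add: a_kernel_def')

lemma hom_inj_iff:
  assumes "left_module R M" "left_module R N" "h \<in> mod_hom R M N"
  shows "inj_on h (carrier M) \<longleftrightarrow> a_kernel M N h = {\<zero>\<^bsub>M\<^esub>}"
proof -
  interpret M: left_module R M by fact
  interpret N: left_module R N by fact
  note z = mod_hom_zero[OF assms]
  show ?thesis
  proof
    assume i: "inj_on h (carrier M)"
    have "x = \<zero>\<^bsub>M\<^esub>" if "x \<in> carrier M" "h x = \<zero>\<^bsub>N\<^esub>" for x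
      using inj_onD[OF i, of x "\<zero>\<^bsub>M\<^esub>"] z that by simp
    then show "a_kernel M N h = {\<zero>\<^bsub>M\<^esub>}" unfolding a_kernel_def' using z by blast
  next
    assume k: "a_kernel M N h = {\<zero>\<^bsub>M\<^esub>}"
    show "inj_on h (carrier M)"
    proof (rule inj_onI)
      fix x y assume xy: "x \<in> carrier M" "y \<in> carrier M" "h x = h y"
      then have "h (x \<ominus>\<^bsub>M\<^esub> y) = \<zero>\<^bsub>N\<^esub>"
        using mod_hom_minus[OF assms xy(1,2)] mod_hom_closed[OF assms(3)] by (simp add: N.minus_zero_iff)
      then have "x \<ominus>\<^bsub>M\<^esub> y \<in> a_kernel M N h" unfolding a_kernel_def' using xy by simp
      then show "x = y" using k xy M.minus_zero_iff by auto
    qed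
  qed
qed

lemma mod_hom_inverse:
  assumes "left_module R M" "left_module R N" "h \<in> mod_hom R M N" "bij_betw h (carrier M) (carrier N)"
  shows "inv_into (carrier M) h \<in> mod_hom R N M"
proof -
  interpret M: left_module R M by fact
  have i: "inj_on h (carrier M)" "h ` carrier M = carrier N" using assms(4) by (auto simp: bij_betw_def)
  show ?thesis
  proof (rule mod_homI)
    fix x assume "x \<in> carrier N" then show "inv_into (carrier M) h x \<in> carrier M"
      using i by (metis inv_into_into)
  next
    fix x y assume "x \<in> carrier N" "y \<in> carrier N"
    then obtain u v where "u \<in> carrier M" "v \<in> carrier M" "x = h u" "y = h v" unfolding i(2)[symmetric] by blast
    then show "inv_into (carrier M) h (x \<oplus>\<^bsub>N\<^esub> y) = inv_into (carrier M) h x \<oplus>\<^bsub>M\<^esub> inv_into (carrier M) h y"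
      using i by (simp add: mod_hom_add[OF assms(3), symmetric])
  next
    fix a x assume "a \<in> carrier R" "x \<in> carrier N"
    moreover from this obtain u where "u \<in> carrier M" "x = h u" unfolding i(2)[symmetric] by blast
    ultimately show "inv_into (carrier M) h (a \<odot>\<^bsub>N\<^esub> x) = a \<odot>\<^bsub>M\<^esub> inv_into (carrier M) h x"
      using i by (simp add: mod_hom_smult[OF assms(3), symmetric])
  qed
qed

lemma mod_isomorphicE:
  assumes "left_module R M" "left_module R N" "mod_isomorphic R M N"
  obtains f g where "f \<in> mod_hom R M N" "g \<in> mod_hom R N M" "bij_betw f (carrier M) (carrier N)"
    "\<And>x. x \<in> carrier M \<Longrightarrow> g (f x) = x" "\<And>y. y \<in> carrier N \<Longrightarrow> f (g y) = y"
proof -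
  from assms(3) obtain f where f: "f \<in> mod_hom R M N" "bij_betw f (carrier M) (carrier N)"
    by (auto simp: mod_isomorphic_def)
  show ?thesis
    using that[OF f(1) mod_hom_inverse[OF assms(1,2) f] f(2)] f(2)
    by (simp add: bij_betw_def f_inv_into_f)
qed

lemma mod_isomorphicI:
  assumes "f \<in> mod_hom R M N" "g \<in> mod_hom R N M"
    "\<And>x. x \<in> carrier M \<Longrightarrow> g (f x) = x" "\<And>y. y \<in> carrier N \<Longrightarrow> f (g y) = y"
  shows "mod_isomorphic R M N"
  unfolding mod_isomorphic_def
proof (rule bexI[OF _ assms(1)], rule bij_betw_byWitness[where f' = g])
  show "\<forall>a\<in>carrier M. g (f a) = a" "\<forall>a'\<in>carrier N. f (g a') = a'" using assms(3,4) by auto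
  show "f ` carrier M \<subseteq> carrier N" "g ` carrier N \<subseteq> carrier M"
    using mod_hom_closed[OF assms(1)] mod_hom_closed[OF assms(2)] by auto
qed

section \<open>Chain conditions\<close>

definition regular_module :: "('a, 'b) ring_scheme \<Rightarrow> ('a, 'a) module" where
  "regular_module R = \<lparr>carrier = carrier R, monoid.mult = (\<otimes>\<^bsub>R\<^esub>), one = \<one>\<^bsub>R\<^esub>, ring.zero = \<zero>\<^bsub>R\<^esub>,
     ring.add = (\<oplus>\<^bsub>R\<^esub>), module.smult = (\<otimes>\<^bsub>R\<^esub>)\<rparr>"

lemma regular_module_simps [simp]:
  "carrier (regular_module R) = carrier R" "\<zero>\<^bsub>regular_module R\<^esub> = \<zero>\<^bsub>R\<^esub>"
  "x \<oplus>\<^bsub>regular_module R\<^esub> y = x \<oplus>\<^bsub>R\<^esub> y" "x \<odot>\<^bsub>regular_module R\<^esub> y = x \<otimes>\<^bsub>R\<^esub> y"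
  by (simp_all add: regular_module_def)

lemma (in ring) regular_left_module:
  assumes "subring S R"
  shows "left_module (R\<lparr>carrier := S\<rparr>) (regular_module R)"
proof -
  interpret S: ring "R\<lparr>carrier := S\<rparr>" using subring_is_ring[OF assms] .
  have ag: "abelian_group (regular_module R)"
  proof (rule abelian_groupI)
    fix x assume "x \<in> carrier (regular_module R)"
    then show "\<exists>y\<in>carrier (regular_module R). y \<oplus>\<^bsub>regular_module R\<^esub> x = \<zero>\<^bsub>regular_module R\<^esub>"
      by (auto intro!: bexI[of _ "\<ominus> x"] simp: l_neg)
  qed (auto simp: a_ac)
  show ?thesis
    using subsetD[OF subringE(1)[OF assms]]
    by (intro left_module.intro left_module_axioms.intro ag S.ring_axioms)
       (simp_all add: l_distr r_distr m_assoc)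
qed

lemma (in ring) regular_left_module_self: "left_module R (regular_module R)"
proof -
  have ag: "abelian_group (regular_module R)"
  proof (rule abelian_groupI)
    fix x assume "x \<in> carrier (regular_module R)"
    then show "\<exists>y\<in>carrier (regular_module R). y \<oplus>\<^bsub>regular_module R\<^esub> x = \<zero>\<^bsub>regular_module R\<^esub>"
      by (auto intro!: bexI[of _ "\<ominus> x"] simp: l_neg)
  qed (auto simp: a_ac)
  show ?thesis
    by (intro left_module.intro left_module_axioms.intro ag ring_axioms)
       (auto simp: l_distr r_distr m_assoc)
qed

text \<open>
  Both chain conditions at once, which for modules amounts to having a composition series.
\<close>

definition fin_length :: "('a, 'b) ring_scheme \<Rightarrow> ('a, 'm, 'c) module_scheme \<Rightarrow> bool" where
  "fin_length R M \<longleftrightarrow> (\<forall>N. (\<forall>i::nat. submodule (N i) R M) \<and> (incseq N \<or> decseq N)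
     \<longrightarrow> (\<exists>k. \<forall>i\<ge>k. N i = N k))"

lemma fin_lengthD:
  assumes "fin_length R M" "\<And>i::nat. submodule (N i) R M" "incseq N \<or> decseq N"
  obtains k where "\<And>i. i \<ge> k \<Longrightarrow> N i = N k"
  using assms unfolding fin_length_def by blast

lemma fin_length_maximal:
  assumes "fin_length R M" "\<forall>N\<in>\<F>. submodule N R M" "\<F> \<noteq> {}"
  shows "\<exists>N\<in>\<F>. \<forall>N'\<in>\<F>. N \<subseteq> N' \<longrightarrow> N' = N"
proof (rule ccontr)
  assume neg: "\<not> ?thesis"
  have "\<exists>f :: nat \<Rightarrow> _. \<forall>n. f n \<in> \<F> \<and> f n \<subset> f (Suc n)"
    by (rule dependent_nat_choice) (use assms(3) neg in blast)+
  then obtain f where f: "\<And>n. f n \<in> \<F>" "\<And>n. f n \<subset> f (Suc n)" by blast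
  then have "incseq f" by (intro incseq_SucI) blast
  then obtain k where "\<And>i. i \<ge> k \<Longrightarrow> f i = f k" using fin_lengthD[OF assms(1), of f] assms(2) f(1) by metis
  then show False using f(2)[of k] by (metis le_SucI order_refl psubset_eq)
qed

lemma dcc_minimal:
  assumes dcc: "\<And>N. (\<And>i::nat. submodule (N i) R M) \<Longrightarrow> decseq N \<Longrightarrow> \<exists>k. \<forall>i\<ge>k. N i = N k"
    and "\<forall>N\<in>\<F>. submodule N R M" "\<F> \<noteq> {}"
  shows "\<exists>N\<in>\<F>. \<forall>N'\<in>\<F>. N' \<subseteq> N \<longrightarrow> N' = N"
proof (rule ccontr)
  assume neg: "\<not> ?thesis"
  have "\<exists>f :: nat \<Rightarrow> _. \<forall>n. f n \<in> \<F> \<and> f (Suc n) \<subset> f n"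
    by (rule dependent_nat_choice) (use assms(3) neg in blast)+
  then obtain f where f: "\<And>n. f n \<in> \<F>" "\<And>n. f (Suc n) \<subset> f n" by blast
  then have "decseq f" by (intro decseq_SucI) blast
  then obtain k where "\<forall>i\<ge>k. f i = f k" using dcc[of f] assms(2) f(1) by blast
  then show False using f(2)[of k] by (metis le_SucI order_refl psubset_eq)
qed

lemma fin_length_minimal:
  assumes "fin_length R M" "\<forall>N\<in>\<F>. submodule N R M" "\<F> \<noteq> {}"
  shows "\<exists>N\<in>\<F>. \<forall>N'\<in>\<F>. N' \<subseteq> N \<longrightarrow> N' = N"
  using assms(1) by (intro dcc_minimal[OF _ assms(2,3)]) (simp add: fin_length_def)

definition gen :: "('a, 'b) ring_scheme \<Rightarrow> ('a, 'm, 'c) module_scheme \<Rightarrow> 'm set \<Rightarrow> 'm set" where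
  "gen R M S = \<Inter>{N. submodule N R M \<and> S \<subseteq> N}"

lemma gen_least: "submodule N R M \<Longrightarrow> S \<subseteq> N \<Longrightarrow> gen R M S \<subseteq> N"
  by (auto simp: gen_def)

lemma gen_superset: "S \<subseteq> gen R M S"
  by (auto simp: gen_def)

lemma gen_mono: "S \<subseteq> T \<Longrightarrow> gen R M S \<subseteq> gen R M T"
  by (auto simp: gen_def)

lemma (in left_module) gen_submodule:
  assumes "S \<subseteq> carrier M" shows "submodule (gen R M S) R M"
proof (rule submoduleI)
  show "gen R M S \<subseteq> carrier M" using assms submodule_carrier by (auto simp: gen_def)
qed (auto simp: gen_def submodule_0 submodule_add submodule_smult)

lemma (in left_module) cyclic_submodule:
  assumes x: "x \<in> carrier M"
  shows "submodule {r \<odot>\<^bsub>M\<^esub> x | r. r \<in> carrier R} R M"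
proof (rule submoduleI)
  show "\<zero>\<^bsub>M\<^esub> \<in> {r \<odot>\<^bsub>M\<^esub> x | r. r \<in> carrier R}"
    using smult_zero_left[OF x] R.zero_closed by force
next
  fix y z assume "y \<in> {r \<odot>\<^bsub>M\<^esub> x | r. r \<in> carrier R}" "z \<in> {r \<odot>\<^bsub>M\<^esub> x | r. r \<in> carrier R}"
  then obtain r s where "r \<in> carrier R" "s \<in> carrier R" "y = r \<odot>\<^bsub>M\<^esub> x" "z = s \<odot>\<^bsub>M\<^esub> x" by blast
  then show "y \<oplus>\<^bsub>M\<^esub> z \<in> {r \<odot>\<^bsub>M\<^esub> x | r. r \<in> carrier R}"
    using smult_l_distr[of r s x] x by (auto intro!: exI[of _ "r \<oplus> s"])
next
  fix a y assume "a \<in> carrier R" "y \<in> {r \<odot>\<^bsub>M\<^esub> x | r. r \<in> carrier R}"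
  then obtain r where "a \<in> carrier R" "r \<in> carrier R" "y = r \<odot>\<^bsub>M\<^esub> x" by blast
  then show "a \<odot>\<^bsub>M\<^esub> y \<in> {r \<odot>\<^bsub>M\<^esub> x | r. r \<in> carrier R}"
    using smult_assoc[of a r x] x by (auto intro!: exI[of _ "a \<otimes> r"])
qed (use x in auto)

lemma (in left_module) gen_insert:
  assumes "S \<subseteq> carrier M" "x \<in> carrier M"
  shows "gen R M (insert x S) = {r \<odot>\<^bsub>M\<^esub> x | r. r \<in> carrier R} <+>\<^bsub>M\<^esub> gen R M S"
proof
  note c = cyclic_submodule[OF assms(2)]
  note g = gen_submodule[OF assms(1)]
  have "x \<in> {r \<odot>\<^bsub>M\<^esub> x | r. r \<in> carrier R}" using smult_one[OF assms(2)] R.one_closed by force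
  then show "gen R M (insert x S) \<subseteq> {r \<odot>\<^bsub>M\<^esub> x | r. r \<in> carrier R} <+>\<^bsub>M\<^esub> gen R M S"
    using subset_sum[OF c g] gen_superset[of S R M] by (intro gen_least submodule_sum c g) blast
  have s: "submodule (gen R M (insert x S)) R M" using assms by (intro gen_submodule) auto
  have "gen R M S \<subseteq> gen R M (insert x S)" by (intro gen_mono) auto
  moreover have "r \<odot>\<^bsub>M\<^esub> x \<in> gen R M (insert x S)" if "r \<in> carrier R" for r
    using submodule_smult[OF s that] gen_superset[of "insert x S" R M] by blast
  ultimately show "{r \<odot>\<^bsub>M\<^esub> x | r. r \<in> carrier R} <+>\<^bsub>M\<^esub> gen R M S \<subseteq> gen R M (insert x S)"
    unfolding set_add_def' using submodule_add[OF s] by blast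
qed

lemma (in left_module) fin_gen_iff:
  "fin_gen R M \<longleftrightarrow> (\<exists>S. finite S \<and> S \<subseteq> carrier M \<and> gen R M S = carrier M)"
proof
  assume "fin_gen R M"
  then obtain S where "finite S" "S \<subseteq> carrier M" "\<And>N. submodule N R M \<Longrightarrow> S \<subseteq> N \<Longrightarrow> N = carrier M"
    unfolding fin_gen_def by blast
  then show "\<exists>S. finite S \<and> S \<subseteq> carrier M \<and> gen R M S = carrier M"
    using gen_submodule gen_superset by metis
next
  assume "\<exists>S. finite S \<and> S \<subseteq> carrier M \<and> gen R M S = carrier M"
  then obtain S where S: "finite S" "S \<subseteq> carrier M" "gen R M S = carrier M" by blast
  then have "N = carrier M" if "submodule N R M" "S \<subseteq> N" for N
    using gen_least[OF that] submodule_sub[OF that(1)] by blast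
  then show "fin_gen R M" unfolding fin_gen_def using S by blast
qed

text \<open>
  A maximal one among the finitely generated submodules of \<open>N\<close> absorbs every further element of \<open>N\<close>.
\<close>

lemma (in left_module) fin_length_submodule_fin_gen:
  assumes "fin_length R M" "submodule N R M"
  shows "fin_gen R (M\<lparr>carrier := N\<rparr>)"
proof -
  let ?F = "{gen R M S | S. finite S \<and> S \<subseteq> N}"
  have Nc: "N \<subseteq> carrier M" using submodule_sub[OF assms(2)] .
  have F: "\<forall>H\<in>?F. submodule H R M" using Nc gen_submodule by auto
  have "?F \<noteq> {}" by blast
  from fin_length_maximal[OF assms(1) F this]
  obtain H where H: "H \<in> ?F" "\<forall>H'\<in>?F. H \<subseteq> H' \<longrightarrow> H' = H" by (elim bexE)
  then obtain S where S: "finite S" "S \<subseteq> N" "H = gen R M S" by blast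
  have "x \<in> H" if "x \<in> N" for x
  proof -
    have "finite (insert x S)" "insert x S \<subseteq> N" using S that by auto
    then have "gen R M (insert x S) \<in> ?F" by (intro CollectI exI[of _ "insert x S"]) simp
    moreover have "H \<subseteq> gen R M (insert x S)" using S(3) gen_mono[of S "insert x S" R M] by auto
    ultimately have "gen R M (insert x S) = H" using H(2) by (simp only: Ball_def)
    then show ?thesis using gen_superset[of "insert x S" R M] by blast
  qed
  moreover have "H \<subseteq> N" using gen_least[OF assms(2) S(2)] S(3) by simp
  ultimately have HN: "gen R M S = N" using S(3) by blast
  show ?thesis unfolding fin_gen_def
  proof (intro exI[of _ S] conjI allI impI)
    fix N' assume N': "submodule N' R (M\<lparr>carrier := N\<rparr>) \<and> S \<subseteq> N'"
    then have "submodule N' R M" "N' \<subseteq> N"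
      using submodule_trans[OF left_module_axioms assms(2)] by auto
    then show "N' = carrier (M\<lparr>carrier := N\<rparr>)" using gen_least[of N' R M S] N' HN by auto
  qed (use S in auto)
qed

text \<open>
  Reduces equality of two members of a chain that may ascend or descend to the case of nested members.
\<close>

lemma chain_cases:
  fixes N :: "nat \<Rightarrow> 'm set"
  assumes "incseq N \<or> decseq N" "k \<le> i"
    and "\<And>A B. A \<subseteq> B \<Longrightarrow> {A, B} = {N i, N k} \<Longrightarrow> A = B"
  shows "N i = N k"
  using assms by (auto simp: incseq_def decseq_def)

text \<open>
  A submodule of \<open>R x + H\<close> inside a larger one is recognised by two invariants: its
  intersection with \<open>H\<close>, and the left ideal of all \<open>r\<close> that occur as coefficients of \<open>x\<close>.  In a
  chain both stop.
\<close>

lemma (in left_module) fin_length_extend: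
  assumes K: "fin_length R (regular_module R)"
    and H: "submodule H R M" "fin_length R (M\<lparr>carrier := H\<rparr>)" and x: "x \<in> carrier M"
    and H': "H' = {r \<odot>\<^bsub>M\<^esub> x | r. r \<in> carrier R} <+>\<^bsub>M\<^esub> H"
  shows "submodule H' R M" "fin_length R (M\<lparr>carrier := H'\<rparr>)"
proof -
  show sH': "submodule H' R M" unfolding H' by (intro submodule_sum cyclic_submodule H x)
  have in_H': "\<exists>r\<in>carrier R. \<exists>y\<in>H. z = r \<odot>\<^bsub>M\<^esub> x \<oplus>\<^bsub>M\<^esub> y" if "z \<in> H'" for z
    using that unfolding H' set_add_def' by blast
  define lead where "lead N = {r \<in> carrier R. \<exists>y\<in>H. r \<odot>\<^bsub>M\<^esub> x \<oplus>\<^bsub>M\<^esub> y \<in> N}" for N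
  have lead_sub: "submodule (lead N) R (regular_module R)" if N: "submodule N R M" for N
    unfolding submodule_iff[OF R.regular_left_module_self]
  proof (intro conjI ballI)
    show "lead N \<subseteq> carrier (regular_module R)" by (auto simp: lead_def)
    show "\<zero>\<^bsub>regular_module R\<^esub> \<in> lead N"
      using x submodule_0[OF H(1)] submodule_0[OF N] by (auto simp: lead_def intro!: bexI[of _ "\<zero>\<^bsub>M\<^esub>"])
  next
    fix r s assume "r \<in> lead N" "s \<in> lead N"
    then obtain y z where rs: "r \<in> carrier R" "s \<in> carrier R" "y \<in> H" "z \<in> H"
      and n: "r \<odot>\<^bsub>M\<^esub> x \<oplus>\<^bsub>M\<^esub> y \<in> N" "s \<odot>\<^bsub>M\<^esub> x \<oplus>\<^bsub>M\<^esub> z \<in> N" by (auto simp: lead_def)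
    have "(r \<odot>\<^bsub>M\<^esub> x \<oplus>\<^bsub>M\<^esub> y) \<oplus>\<^bsub>M\<^esub> (s \<odot>\<^bsub>M\<^esub> x \<oplus>\<^bsub>M\<^esub> z) = (r \<oplus> s) \<odot>\<^bsub>M\<^esub> x \<oplus>\<^bsub>M\<^esub> (y \<oplus>\<^bsub>M\<^esub> z)"
      using rs x submodule_in[OF H(1)] by (simp add: smult_l_distr M.add_swap4)
    then show "r \<oplus>\<^bsub>regular_module R\<^esub> s \<in> lead N"
      using rs submodule_add[OF N n] submodule_add[OF H(1)] by (auto simp: lead_def)
  next
    fix a r assume a: "a \<in> carrier R" and "r \<in> lead N"
    then obtain y where rs: "r \<in> carrier R" "y \<in> H" and n: "r \<odot>\<^bsub>M\<^esub> x \<oplus>\<^bsub>M\<^esub> y \<in> N" by (auto simp: lead_def)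
    have "a \<odot>\<^bsub>M\<^esub> (r \<odot>\<^bsub>M\<^esub> x \<oplus>\<^bsub>M\<^esub> y) = (a \<otimes> r) \<odot>\<^bsub>M\<^esub> x \<oplus>\<^bsub>M\<^esub> a \<odot>\<^bsub>M\<^esub> y"
      using rs a x submodule_in[OF H(1)] by (simp add: smult_r_distr smult_assoc)
    then show "a \<odot>\<^bsub>regular_module R\<^esub> r \<in> lead N"
      using a rs submodule_smult[OF N a n] submodule_smult[OF H(1) a] by (auto simp: lead_def)
  qed
  have key: "A = B" if A: "submodule A R M" and B: "submodule B R M" "A \<subseteq> B" "B \<subseteq> H'"
    and eq: "A \<inter> H = B \<inter> H" "lead A = lead B" for A B
  proof
    show "B \<subseteq> A"
    proof
      fix z assume z: "z \<in> B"
      then obtain r y where ry: "r \<in> carrier R" "y \<in> H" "z = r \<odot>\<^bsub>M\<^esub> x \<oplus>\<^bsub>M\<^esub> y" using B in_H' by blast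
      then have "r \<in> lead A" using z eq(2) by (auto simp: lead_def)
      then obtain y' where y': "y' \<in> H" "r \<odot>\<^bsub>M\<^esub> x \<oplus>\<^bsub>M\<^esub> y' \<in> A" by (auto simp: lead_def)
      let ?w = "r \<odot>\<^bsub>M\<^esub> x \<oplus>\<^bsub>M\<^esub> y'"
      have c: "y \<in> carrier M" "y' \<in> carrier M" "r \<odot>\<^bsub>M\<^esub> x \<in> carrier M" using ry y' submodule_in[OF H(1)] x by auto
      have "z \<ominus>\<^bsub>M\<^esub> ?w = y \<ominus>\<^bsub>M\<^esub> y'"
        unfolding ry(3) using c M.minus_zero_iff[of "r \<odot>\<^bsub>M\<^esub> x" "r \<odot>\<^bsub>M\<^esub> x"] by (simp add: M.minus_add_add)
      moreover have "z \<ominus>\<^bsub>M\<^esub> ?w \<in> B" using submodule_minus[OF B(1) z] y' B(2) by blast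
      ultimately have "z \<ominus>\<^bsub>M\<^esub> ?w \<in> A" using eq(1) submodule_minus[OF H(1) ry(2) y'(1)] by auto
      from submodule_add[OF A this y'(2)] show "z \<in> A"
        using M.minus_add_cancel[of z ?w] c submodule_in[OF B(1) z] by simp
    qed
  qed (use B in blast)
  show "fin_length R (M\<lparr>carrier := H'\<rparr>)"
    unfolding fin_length_def submodule_trans[OF left_module_axioms sH']
  proof (intro allI impI, elim conjE)
    fix N :: "nat \<Rightarrow> _" assume N: "\<forall>i. submodule (N i) R M \<and> N i \<subseteq> H'" and ch: "incseq N \<or> decseq N"
    have "incseq (\<lambda>i. N i \<inter> H) \<or> decseq (\<lambda>i. N i \<inter> H)"
      using ch by (auto simp: incseq_def decseq_def)
    moreover have "submodule (N i \<inter> H) R (M\<lparr>carrier := H\<rparr>)" for i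
      unfolding submodule_trans[OF left_module_axioms H(1)] using N H submodule_Int by auto
    ultimately obtain k1 where k1: "\<And>i. i \<ge> k1 \<Longrightarrow> N i \<inter> H = N k1 \<inter> H"
      using fin_lengthD[OF H(2)] by meson
    have "incseq (\<lambda>i. lead (N i)) \<or> decseq (\<lambda>i. lead (N i))"
      using ch by (auto simp: incseq_def decseq_def lead_def) blast+
    moreover have "submodule (lead (N i)) R (regular_module R)" for i using lead_sub N by blast
    ultimately obtain k2 where k2: "\<And>i. i \<ge> k2 \<Longrightarrow> lead (N i) = lead (N k2)"
      using fin_lengthD[OF K] by meson
    have "N i = N (max k1 k2)" if i: "i \<ge> max k1 k2" for i
    proof (rule chain_cases[OF ch i])
      fix A B assume AB: "A \<subseteq> B" and "{A, B} = {N i, N (max k1 k2)}"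
      then have or: "A = N i \<and> B = N (max k1 k2) \<or> A = N (max k1 k2) \<and> B = N i" by (simp add: doubleton_eq_iff)
      have "N i \<inter> H = N (max k1 k2) \<inter> H" "lead (N i) = lead (N (max k1 k2))"
        using i k1[of i] k1[of "max k1 k2"] k2[of i] k2[of "max k1 k2"] by simp_all
      with or have "A \<inter> H = B \<inter> H" "lead A = lead B" by (elim disjE; simp)+
      moreover have "submodule A R M" "submodule B R M" "B \<subseteq> H'" using or N by auto
      ultimately show "A = B" using AB key by blast
    qed
    then show "\<exists>k. \<forall>i\<ge>k. N i = N k" by blast
  qed
qed

lemma (in left_module) fin_gen_fin_length:
  assumes K: "fin_length R (regular_module R)" and fg: "fin_gen R M"
  shows "fin_length R M"
proof -
  obtain S where S: "finite S" "S \<subseteq> carrier M" "gen R M S = carrier M"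
    using fg fin_gen_iff by blast
  have "\<exists>H. submodule H R M \<and> S \<subseteq> H \<and> fin_length R (M\<lparr>carrier := H\<rparr>)"
    using S(1,2)
  proof (induction S)
    case empty
    have "N = {\<zero>\<^bsub>M\<^esub>}" if "submodule N R (M\<lparr>carrier := {\<zero>\<^bsub>M\<^esub>}\<rparr>)" for N
      using submodule_sub[OF that] submodule_0[OF that] by auto
    then have "fin_length R (M\<lparr>carrier := {\<zero>\<^bsub>M\<^esub>}\<rparr>)" unfolding fin_length_def by blast
    then show ?case using submodule_zero by blast
  next
    case (insert x S)
    then obtain H where H: "submodule H R M" "S \<subseteq> H" "fin_length R (M\<lparr>carrier := H\<rparr>)" by auto
    have x: "x \<in> carrier M" using insert by auto
    let ?H' = "{r \<odot>\<^bsub>M\<^esub> x | r. r \<in> carrier R} <+>\<^bsub>M\<^esub> H"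
    have "x \<in> {r \<odot>\<^bsub>M\<^esub> x | r. r \<in> carrier R}" using smult_one[OF x] R.one_closed by force
    then have "insert x S \<subseteq> ?H'" using subset_sum[OF cyclic_submodule[OF x] H(1)] H(2) by blast
    then show ?case using fin_length_extend[OF K H(1,3) x refl] by blast
  qed
  then obtain H where H: "submodule H R M" "S \<subseteq> H" "fin_length R (M\<lparr>carrier := H\<rparr>)" by blast
  then have "H = carrier M" using gen_least[OF H(1,2)] S(3) submodule_sub[OF H(1)] by blast
  then show ?thesis using H(3) unfolding fin_length_def
    using submodule_trans[OF left_module_axioms H(1)] submodule_sub by metis
qed

text \<open>
  The images of the powers of \<open>h\<close> stop descending, say \<open>h\<^sup>k M = h\<^sup>k h M\<close>, and the injective \<open>h\<^sup>k\<close> cancels.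
\<close>

lemma fin_length_hom_bij:
  assumes "left_module R M" "fin_length R M" "h \<in> mod_hom R M M" "inj_on h (carrier M)"
  shows "h ` carrier M = carrier M"
proof -
  have pow: "(h ^^ i) \<in> mod_hom R M M" "inj_on (h ^^ i) (carrier M)" for i
  proof (induction i)
    case (Suc i)
    show "(h ^^ Suc i) \<in> mod_hom R M M" using mod_hom_comp[OF Suc(1) assms(3)] by (simp add: comp_def)
    show "inj_on (h ^^ Suc i) (carrier M)"
      using Suc(2) assms(4) mod_hom_closed[OF Suc(1)]
      by (auto intro!: comp_inj_on simp: inj_on_def)
  qed (auto simp: mod_hom_def)
  note cl = mod_hom_closed[OF pow(1)]
  have "decseq (\<lambda>i. (h ^^ i) ` carrier M)"
  proof (rule decseq_SucI)
    fix i show "(h ^^ Suc i) ` carrier M \<subseteq> (h ^^ i) ` carrier M"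
      using mod_hom_closed[OF assms(3)] by (auto simp: funpow_swap1)
  qed
  moreover have "submodule ((h ^^ i) ` carrier M) R M" for i
    using submodule_image[OF assms(1,1) pow(1) left_module.submodule_carrier[OF assms(1)]] .
  ultimately obtain k where k: "\<And>i. i \<ge> k \<Longrightarrow> (h ^^ i) ` carrier M = (h ^^ k) ` carrier M"
    using fin_lengthD[OF assms(2)] by meson
  have "x \<in> h ` carrier M" if x: "x \<in> carrier M" for x
  proof -
    have "(h ^^ k) x \<in> (h ^^ Suc k) ` carrier M" using k[of "Suc k"] x by simp
    then obtain y where y: "y \<in> carrier M" "(h ^^ k) x = (h ^^ k) (h y)"
      by (auto simp: funpow_swap1)
    then show ?thesis using inj_onD[OF pow(2) y(2) x] mod_hom_closed[OF assms(3)] by auto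
  qed
  then show ?thesis using mod_hom_closed[OF assms(3)] by blast
qed

lemma fin_length_ring_mono:
  assumes "carrier K \<subseteq> carrier R" "fin_length K M"
  shows "fin_length R M"
proof -
  have "submodule N K M" if "submodule N R M" for N
    using that assms(1) by (auto simp: submodule_def submodule_axioms_def)
  then show ?thesis using assms(2) unfolding fin_length_def by blast
qed

lemma (in ring) submodule_regular_subgroup:
  assumes "submodule I R (regular_module R)"
  shows "additive_subgroup I R"
proof (rule additive_subgroup.intro, rule group.subgroupI[OF a_group])
  note L = regular_left_module_self
  show "I \<subseteq> carrier (add_monoid R)" using submodule_sub[OF assms] by simp
  show "I \<noteq> {}" using submodule_0[OF assms] by auto
  fix a assume a: "a \<in> I"
  then have "\<ominus>\<^bsub>regular_module R\<^esub> a = \<ominus> a"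
    using abelian_group.minus_equality[of "regular_module R" "\<ominus> a" a] L submodule_in[OF assms a]
    by (simp add: left_module_def l_neg)
  then show "inv\<^bsub>add_monoid R\<^esub> a \<in> I" using submodule_neg[OF assms a] by (simp add: a_inv_def)
  fix b assume "b \<in> I"
  then show "a \<otimes>\<^bsub>add_monoid R\<^esub> b \<in> I" using submodule_add[OF assms a] by simp
qed

lemma (in cring) submodule_regular_ideal:
  assumes "submodule I R (regular_module R)"
  shows "ideal I R"
proof (rule idealI)
  show "ring R" by (rule ring_axioms)
  show "subgroup I (add_monoid R)" by (rule additive_subgroup.a_subgroup[OF submodule_regular_subgroup[OF assms]])
next
  fix a x assume a: "a \<in> I" and x: "x \<in> carrier R"
  then show "x \<otimes> a \<in> I" using submodule_smult[OF assms x a] by simp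
  then show "a \<otimes> x \<in> I" using m_comm a x submodule_in[OF assms a] by simp
qed

text \<open>
  The commutative Hopkins theorem.  Among the ideals with an ascending chain that does not stop take
  a minimal one, \<open>I\<close>.  If \<open>r I\<close> were neither \<open>0\<close> nor \<open>I\<close>, then \<open>r I\<close> and the annihilator of \<open>r\<close>
  in \<open>I\<close> would be smaller, hence noetherian, and so would be \<open>I\<close>.  Therefore every \<open>r\<close> kills \<open>I\<close> or is
  invertible on \<open>I\<close>: the ideal is a vector space with the descending chain condition, so it is finite
  dimensional.
\<close>

lemma artinian_cring_fin_length:
  fixes R (structure)
  assumes "artinian_cring R"
  shows "fin_length R (regular_module R)"
proof -
  interpret cring R using assms by (simp add: artinian_cring_def)
  interpret L: left_module R "regular_module R" by (rule regular_left_module_self)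
  let ?M = "regular_module R"
  have dcc: "\<exists>k. \<forall>i\<ge>k. N i = N k" if "\<And>i::nat. submodule (N i) R ?M" "decseq N" for N
  proof -
    have "\<forall>n. ideal (N n) R \<and> N (Suc n) \<subseteq> N n"
      using that submodule_regular_ideal by (auto simp: decseq_Suc_iff)
    then show ?thesis using assms unfolding artinian_cring_def by blast
  qed
  define bad where "bad I N \<longleftrightarrow> (\<forall>i::nat. submodule (N i) R ?M \<and> N i \<subseteq> I) \<and> incseq N
    \<and> \<not> (\<exists>k. \<forall>i\<ge>k. N i = N k)" for I N
  have no_bad: "\<not> bad (carrier R) N" for N
  proof
    assume "bad (carrier R) N"
    then have "carrier R \<in> {I. submodule I R ?M \<and> Ex (bad I)}" using L.submodule_carrier by auto
    then have "\<exists>I\<in>{I. submodule I R ?M \<and> Ex (bad I)}.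
        \<forall>J\<in>{I. submodule I R ?M \<and> Ex (bad I)}. J \<subseteq> I \<longrightarrow> J = I"
      by (intro dcc_minimal[where R = R and M = ?M] dcc) auto
    then obtain I where I0: "submodule I R ?M \<and> Ex (bad I)"
      and min0: "\<forall>J\<in>{I. submodule I R ?M \<and> Ex (bad I)}. J \<subseteq> I \<longrightarrow> J = I" by (elim bexE CollectE)
    from I0 obtain N where I: "submodule I R ?M" "bad I N" by blast
    have min: "J = I" if "submodule J R ?M" "bad J N'" "J \<subseteq> I" for J N'
      using min0 that by blast
    have Ic: "x \<in> carrier R" if "x \<in> I" for x using submodule_in[OF I(1) that] by simp
    have hom: "(\<otimes>) r \<in> mod_hom R ?M ?M" if "r \<in> carrier R" for r
      using that by (intro mod_homI) (auto simp: r_distr m_lcomm)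
    have N: "submodule (N i) R ?M" "N i \<subseteq> I" "incseq N" "\<not> (\<exists>k. \<forall>i\<ge>k. N i = N k)" for i
      using I(2) by (auto simp: bad_def)
    \<comment> \<open>every scalar acts on \<open>I\<close> as zero or invertibly\<close>
    have dich: "(\<otimes>) r ` I = I \<or> (\<forall>x\<in>I. r \<otimes> x = \<zero>)" if r: "r \<in> carrier R" for r
    proof (rule ccontr)
      assume neg: "\<not> ?thesis"
      let ?rI = "(\<otimes>) r ` I" and ?an = "{x \<in> I. r \<otimes> x = \<zero>}"
      have s1: "submodule ?rI R ?M" using submodule_image[OF L.left_module_axioms L.left_module_axioms hom[OF r] I(1)] .
      have sub1: "?rI \<subseteq> I" using submodule_smult[OF I(1) r] by auto
      have an: "?an = I \<inter> a_kernel ?M ?M ((\<otimes>) r)" using Ic by (auto simp: a_kernel_def')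
      have s2: "submodule ?an R ?M" unfolding an
        by (intro L.submodule_Int I submodule_kernel L.left_module_axioms hom r)
      have nb: "\<not> bad ?rI N'" "\<not> bad ?an N'" for N' using min[OF s1 _ sub1] min[OF s2] neg by auto
      have "incseq (\<lambda>i. (\<otimes>) r ` N i)" "incseq (\<lambda>i. N i \<inter> ?an)"
        using N(3) by (auto simp: incseq_def)
      moreover have "submodule ((\<otimes>) r ` N i) R ?M" for i
        by (intro submodule_image[OF L.left_module_axioms L.left_module_axioms hom[OF r]] N)
      moreover have "submodule (N i \<inter> ?an) R ?M" for i by (intro L.submodule_Int N s2)
      moreover have "(\<otimes>) r ` N i \<subseteq> ?rI" "N i \<inter> ?an \<subseteq> ?an" for i using N by auto
      ultimately have "\<exists>k. \<forall>i\<ge>k. (\<otimes>) r ` N i = (\<otimes>) r ` N k" "\<exists>k. \<forall>i\<ge>k. N i \<inter> ?an = N k \<inter> ?an"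
        using nb[unfolded bad_def, of "\<lambda>i. (\<otimes>) r ` N i"] nb[unfolded bad_def, of "\<lambda>i. N i \<inter> ?an"] by simp_all
      then obtain k1 k2 where k1: "\<forall>i\<ge>k1. (\<otimes>) r ` N i = (\<otimes>) r ` N k1"
        and k2: "\<forall>i\<ge>k2. N i \<inter> ?an = N k2 \<inter> ?an" by (elim exE)
      let ?k = "max k1 k2"
      have "N i = N ?k" if i: "i \<ge> ?k" for i
      proof
        show "N ?k \<subseteq> N i" using N(3) i by (auto simp: incseq_def)
        show "N i \<subseteq> N ?k"
        proof
          fix x assume x: "x \<in> N i"
          have "(\<otimes>) r ` N i = (\<otimes>) r ` N ?k"
            using k1[rule_format, of i] k1[rule_format, of ?k] i by simp
          then obtain y where y: "y \<in> N ?k" "r \<otimes> x = r \<otimes> y" using x by blast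
          have yi: "y \<in> N i" using y \<open>N ?k \<subseteq> N i\<close> by blast
          have c: "x \<in> carrier R" "y \<in> carrier R" using N(2) Ic x yi by blast+
          let ?d = "x \<ominus>\<^bsub>?M\<^esub> y"
          have d: "?d \<in> N i" using submodule_minus[OF N(1) x yi] .
          have "r \<otimes> ?d = \<zero>" using mod_hom_minus[OF L.left_module_axioms L.left_module_axioms hom[OF r], of x y] c y(2) r
              L.M.minus_zero_iff[of "r \<otimes> x" "r \<otimes> y"] by simp
          then have "?d \<in> N i \<inter> ?an" using d N(2) by blast
          moreover have "N i \<inter> ?an = N ?k \<inter> ?an"
            using k2[rule_format, of i] k2[rule_format, of ?k] i by simp
          ultimately have "?d \<in> N ?k" by blast
          from submodule_add[OF N(1) this y(1)] show "x \<in> N ?k"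
            using L.M.minus_add_cancel[of x y] c by simp
        qed
      qed
      then show False using N(4) by blast
    qed
    have inv: "(\<forall>x\<in>I. r \<otimes> x = \<zero>) \<or> (\<exists>t\<in>carrier R. \<forall>x\<in>I. t \<otimes> (r \<otimes> x) = x)" if r: "r \<in> carrier R" for r
    proof (rule disj_imp[THEN iffD2, rule_format])
      assume nz: "\<not> (\<forall>x\<in>I. r \<otimes> x = \<zero>)"
      \<comment> \<open>modulo the annihilator of \<open>I\<close> the ideals generated by the powers of \<open>r\<close> stop, so \<open>r\<^sup>k\<close> is a multiple \<open>r\<^sup>k r t\<close>; then \<open>t\<close> inverts \<open>r\<close> on \<open>I = r\<^sup>k I\<close>\<close>
      define P where "P n = {r [^] n \<otimes> t \<oplus> q | t q. t \<in> carrier R \<and> q \<in> carrier R \<and> (\<forall>x\<in>I. q \<otimes> x = \<zero>)}" for n :: nat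
      have sP: "submodule (P n) R ?M" for n
      proof (rule L.submoduleI)
        show "P n \<subseteq> carrier ?M" using r by (auto simp: P_def)
        have "\<zero> = r [^] n \<otimes> \<zero> \<oplus> \<zero>" using r by simp
        then show "\<zero>\<^bsub>?M\<^esub> \<in> P n" unfolding P_def using Ic by fastforce
      next
        fix x y assume "x \<in> P n" "y \<in> P n"
        then obtain t q t' q' where t: "t \<in> carrier R" "q \<in> carrier R" "\<forall>x\<in>I. q \<otimes> x = \<zero>" "x = r [^] n \<otimes> t \<oplus> q"
          "t' \<in> carrier R" "q' \<in> carrier R" "\<forall>x\<in>I. q' \<otimes> x = \<zero>" "y = r [^] n \<otimes> t' \<oplus> q'" by (auto simp: P_def)
        have "x \<oplus> y = r [^] n \<otimes> (t \<oplus> t') \<oplus> (q \<oplus> q')" using t r by (simp add: r_distr a_ac)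
        moreover have "\<forall>x\<in>I. (q \<oplus> q') \<otimes> x = \<zero>" using t Ic by (simp add: l_distr)
        ultimately show "x \<oplus>\<^bsub>?M\<^esub> y \<in> P n" using t unfolding P_def by auto
      next
        fix a x assume a: "a \<in> carrier R" and "x \<in> P n"
        then obtain t q where t: "t \<in> carrier R" "q \<in> carrier R" "\<forall>x\<in>I. q \<otimes> x = \<zero>" "x = r [^] n \<otimes> t \<oplus> q" by (auto simp: P_def)
        have "a \<otimes> x = r [^] n \<otimes> (a \<otimes> t) \<oplus> a \<otimes> q" using t a r by (simp add: r_distr m_lcomm)
        moreover have "\<forall>x\<in>I. (a \<otimes> q) \<otimes> x = \<zero>" using t a Ic by (simp add: m_assoc)
        ultimately show "a \<odot>\<^bsub>?M\<^esub> x \<in> P n" using t a unfolding P_def by auto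
      qed
      have "decseq P"
      proof (rule decseq_SucI, rule subsetI)
        fix n x assume "x \<in> P (Suc n)"
        then obtain t q where t: "t \<in> carrier R" "q \<in> carrier R" "\<forall>x\<in>I. q \<otimes> x = \<zero>" "x = r [^] Suc n \<otimes> t \<oplus> q" by (auto simp: P_def)
        then have "x = r [^] n \<otimes> (r \<otimes> t) \<oplus> q" using r by (simp add: m_assoc)
        then show "x \<in> P n" unfolding P_def using t r by blast
      qed
      from dcc[of P, OF sP this] obtain k where "\<forall>i\<ge>k. P i = P k" ..
      from spec[OF this, of "Suc k"] have "P (Suc k) = P k" by simp
      moreover have "r [^] k \<in> P k"
      proof -
        have "r [^] k = r [^] k \<otimes> \<one> \<oplus> \<zero>" using r by simp
        then show ?thesis unfolding P_def using Ic by fastforce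
      qed
      ultimately have "r [^] k \<in> P (Suc k)" by blast
      then obtain t q where t: "t \<in> carrier R" "q \<in> carrier R" "\<forall>x\<in>I. q \<otimes> x = \<zero>"
        "r [^] k = r [^] Suc k \<otimes> t \<oplus> q" unfolding P_def by blast
      have surj: "\<exists>y\<in>I. x = r [^] n \<otimes> y" if "x \<in> I" for x and n :: nat
        using that
      proof (induction n arbitrary: x)
        case 0 then show ?case using Ic by auto
      next
        case (Suc n)
        then obtain y where y: "y \<in> I" "x = r [^] n \<otimes> y" by blast
        moreover obtain z where z: "z \<in> I" "y = r \<otimes> z" using dich[OF r] nz y(1) by blast
        ultimately show ?case using r Ic by (auto simp: m_assoc intro!: bexI[of _ z])
      qed
      have "t \<otimes> (r \<otimes> x) = x" if x: "x \<in> I" for x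
      proof -
        obtain y where y: "y \<in> I" "x = r [^] k \<otimes> y" using surj[OF x] by blast
        have yc: "y \<in> carrier R" using Ic y by blast
        have "x = (r [^] Suc k \<otimes> t \<oplus> q) \<otimes> y" using y(2) by (subst t(4)[symmetric])
        also have "\<dots> = r [^] Suc k \<otimes> t \<otimes> y \<oplus> q \<otimes> y" using t(1-3) r yc by (simp add: l_distr)
        also have "\<dots> = r [^] Suc k \<otimes> t \<otimes> y" using t(1-3) r yc y by simp
        also have "\<dots> = t \<otimes> (r \<otimes> x)" using y(2) t(1-3) r yc by (simp add: m_ac)
        finally show ?thesis by simp
      qed
      then show "\<exists>t\<in>carrier R. \<forall>x\<in>I. t \<otimes> (r \<otimes> x) = x" using t by blast
    qed
    \<comment> \<open>one element from each gap of the chain gives a linearly independent sequence\<close>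
    have step: "\<exists>j>i. N i \<subset> N j" for i
    proof -
      obtain j where "j \<ge> i" "N j \<noteq> N i" using N(4) by blast
      moreover from this have "N i \<subseteq> N j" using N(3) by (auto simp: incseq_def)
      ultimately show ?thesis by (metis le_neq_implies_less psubsetI)
    qed
    then obtain \<nu>' where \<nu>': "\<And>i. \<nu>' i > i" "\<And>i. N i \<subset> N (\<nu>' i)" by metis
    define \<nu> where "\<nu> n = (\<nu>' ^^ n) 0" for n
    have \<nu>: "\<nu> (Suc n) = \<nu>' (\<nu> n)" for n by (simp add: \<nu>_def)
    have "\<exists>x. x \<in> N (\<nu> (Suc n)) \<and> x \<notin> N (\<nu> n)" for n using \<nu>'(2)[of "\<nu> n"] \<nu> by auto
    then obtain x where x: "\<And>n. x n \<in> N (\<nu> (Suc n))" "\<And>n. x n \<notin> N (\<nu> n)" by metis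
    have mono: "N (\<nu> m) \<subseteq> N (\<nu> n)" if "m \<le> n" for m n
      using that
    proof (induction rule: dec_induct)
      case (step n) then show ?case using \<nu>'(2)[of "\<nu> n"] \<nu>[of n] by auto
    qed simp
    have xI: "x n \<in> I" for n using x(1) N(2) by blast
    then have xc: "x n \<in> carrier R" for n using Ic by blast
    \<comment> \<open>the spans of the tails of this sequence descend strictly\<close>
    define D where "D j = gen R ?M (x ` {j..})" for j
    have sD: "submodule (D j) R ?M" for j unfolding D_def using xc by (intro L.gen_submodule) auto
    have "decseq D" unfolding D_def by (intro decseq_SucI gen_mono) auto
    from dcc[of D, OF sD this] obtain k where "\<forall>i\<ge>k. D i = D k" ..
    from spec[OF this, of "Suc k"] have "D (Suc k) = D k" by simp
    then have xk: "x k \<in> D (Suc k)" using gen_superset[of "x ` {k..}" R ?M] by (auto simp: D_def)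
    define T where "T m = gen R ?M (x ` {Suc k..<m})" for m
    have sT: "submodule (T m) R ?M" for m unfolding T_def using xc by (intro L.gen_submodule) auto
    have Tmono: "T m \<subseteq> T n" if "m \<le> n" for m n unfolding T_def using that by (intro gen_mono) auto
    have "submodule (\<Union>m. T m) R ?M"
    proof (rule L.submoduleI)
      show "(\<Union>m. T m) \<subseteq> carrier ?M" using submodule_sub[OF sT] by blast
      show "\<zero>\<^bsub>?M\<^esub> \<in> (\<Union>m. T m)" using submodule_0[OF sT] by blast
    next
      fix y z assume "y \<in> (\<Union>m. T m)" "z \<in> (\<Union>m. T m)"
      then obtain m n where "y \<in> T m" "z \<in> T n" by blast
      then have "y \<in> T (max m n)" "z \<in> T (max m n)" using Tmono[of m "max m n"] Tmono[of n "max m n"] by auto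
      from submodule_add[OF sT this] show "y \<oplus>\<^bsub>?M\<^esub> z \<in> (\<Union>m. T m)" by blast
    next
      fix a y assume "a \<in> carrier R" "y \<in> (\<Union>m. T m)"
      then show "a \<odot>\<^bsub>?M\<^esub> y \<in> (\<Union>m. T m)" using submodule_smult[OF sT] by blast
    qed
    moreover have "x ` {Suc k..} \<subseteq> (\<Union>m. T m)"
    proof
      fix z assume "z \<in> x ` {Suc k..}"
      then obtain i where "i \<ge> Suc k" "z = x i" by auto
      then have "z \<in> T (Suc i)" unfolding T_def using gen_superset[of "x ` {Suc k..<Suc i}" R ?M] by force
      then show "z \<in> (\<Union>m. T m)" by blast
    qed
    ultimately have "D (Suc k) \<subseteq> (\<Union>m. T m)" unfolding D_def by (rule gen_least)
    then obtain m0 where "x k \<in> T m0" using xk by blast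
    moreover have "x k \<notin> T m" for m
    proof (induction m)
      case 0
      have "T 0 \<subseteq> {\<zero>}" unfolding T_def using L.submodule_zero by (intro gen_least) auto
      then show ?case using x(2)[of k] submodule_0[OF N(1)] by auto
    next
      case (Suc m)
      show ?case
      proof (cases "Suc k \<le> m")
        case False
        then have "{Suc k..<Suc m} = {Suc k..<m}" by auto
        then show ?thesis using Suc by (simp add: T_def)
      next
        case True
        show ?thesis
        proof
          assume "x k \<in> T (Suc m)"
          moreover have "{Suc k..<Suc m} = insert m {Suc k..<m}" using True by auto
          ultimately have "x k \<in> gen R ?M (insert (x m) (x ` {Suc k..<m}))" by (simp add: T_def)
          then obtain r y where r: "r \<in> carrier R" and y: "y \<in> T m" and e: "x k = r \<otimes> x m \<oplus> y"
            unfolding T_def using xc by (subst (asm) L.gen_insert) (auto simp: set_add_def')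
          have yc: "y \<in> carrier R" using submodule_in[OF sT y] by simp
          have nz: "r \<otimes> x m \<noteq> \<zero>" using e y Suc yc by auto
          then obtain t where t: "t \<in> carrier R" "t \<otimes> (r \<otimes> x m) = x m" using inv[OF r] xI by blast
          have "T m \<subseteq> N (\<nu> m)" unfolding T_def
          proof (rule gen_least[OF N(1)], rule subsetI)
            fix z assume "z \<in> x ` {Suc k..<m}"
            then obtain i where "i < m" "z = x i" by auto
            then show "z \<in> N (\<nu> m)" using x(1)[of i] mono[of "Suc i" m] by auto
          qed
          moreover have "x k \<in> N (\<nu> m)" using x(1)[of k] mono[of "Suc k" m] True by auto
          ultimately have "x k \<ominus>\<^bsub>?M\<^esub> y \<in> N (\<nu> m)" using submodule_minus[OF N(1)] y by blast
          moreover have "x k \<ominus>\<^bsub>?M\<^esub> y = r \<otimes> x m"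
            using L.M.add_minus_cancel[of "r \<otimes> x m" y] e r xc yc by simp
          ultimately have "r \<otimes> x m \<in> N (\<nu> m)" by simp
          from submodule_smult[OF N(1) t(1) this] have "x m \<in> N (\<nu> m)" using t(2) by simp
          then show False using x(2) by blast
        qed
      qed
    qed
    ultimately show False by blast
  qed
  have acc: "\<exists>k. \<forall>i\<ge>k. N i = N k" if "\<And>i::nat. submodule (N i) R ?M" "incseq N" for N
    using no_bad[of N] that submodule_sub[OF that(1)] unfolding bad_def by auto
  show ?thesis unfolding fin_length_def using acc dcc by blast
qed

section \<open>Finitely generated modules\<close>

lemma fin_genI:
  assumes "finite S" "S \<subseteq> carrier M" "\<And>N. submodule N R M \<Longrightarrow> S \<subseteq> N \<Longrightarrow> N = carrier M"
  shows "fin_gen R M"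
  unfolding fin_gen_def by (intro exI[of _ S] conjI allI impI assms) auto

lemma (in ring) regular_fin_gen: "fin_gen R (regular_module R)"
proof (rule fin_genI[of "{\<one>}"])
  fix N assume N: "submodule N R (regular_module R)" "{\<one>} \<subseteq> N"
  have "x \<in> N" if "x \<in> carrier R" for x using submodule_smult[OF N(1) that, of \<one>] N(2) that by simp
  then show "N = carrier (regular_module R)" using submodule_sub[OF N(1)] by auto
qed auto

lemma submodule_ring_mono: "carrier K \<subseteq> carrier R \<Longrightarrow> submodule N R M \<Longrightarrow> submodule N K M"
  by (auto simp: submodule_def submodule_axioms_def)

lemma fin_gen_ring_mono: "carrier K \<subseteq> carrier R \<Longrightarrow> fin_gen K M \<Longrightarrow> fin_gen R M"
  unfolding fin_gen_def using submodule_ring_mono by metis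

lemma left_module_subring:
  assumes "left_module R M" "subring T R"
  shows "left_module (R\<lparr>carrier := T\<rparr>) M"
proof -
  interpret left_module R M by fact
  show ?thesis
    using subsetD[OF subringE(1)[OF assms(2)]] R.subring_is_ring[OF assms(2)]
    by (intro left_module.intro left_module_axioms.intro M.abelian_group_axioms)
       (simp_all add: smult_l_distr smult_r_distr smult_assoc)
qed

text \<open>
  The products of generators of \<open>R\<close> over \<open>T\<close> with generators of \<open>M\<close> over \<open>R\<close> generate \<open>M\<close> over \<open>T\<close>.
\<close>

lemma fin_gen_trans:
  assumes M: "left_module R M" and T: "subring T R"
    and K: "fin_gen (R\<lparr>carrier := T\<rparr>) (regular_module R)" and fg: "fin_gen R M"
  shows "fin_gen (R\<lparr>carrier := T\<rparr>) M"
proof -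
  interpret left_module R M by fact
  let ?K = "R\<lparr>carrier := T\<rparr>"
  note Ts = subsetD[OF subringE(1)[OF T]]
  interpret KM: left_module ?K M by (rule left_module_subring[OF M T])
  interpret KR: left_module ?K "regular_module R" by (rule R.regular_left_module[OF T])
  obtain T0 where T0: "finite T0" "T0 \<subseteq> carrier R"
    "\<And>N. submodule N ?K (regular_module R) \<Longrightarrow> T0 \<subseteq> N \<Longrightarrow> N = carrier R"
    using K by (auto simp: fin_gen_def)
  obtain S0 where S0: "finite S0" "S0 \<subseteq> carrier M" "\<And>N. submodule N R M \<Longrightarrow> S0 \<subseteq> N \<Longrightarrow> N = carrier M"
    using fg by (auto simp: fin_gen_def)
  let ?G = "(\<lambda>(t, s). t \<odot>\<^bsub>M\<^esub> s) ` (T0 \<times> S0)"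
  have "N = carrier M" if N: "submodule N ?K M" "?G \<subseteq> N" for N
  proof -
    have s: "a \<odot>\<^bsub>M\<^esub> s \<in> N" if s: "s \<in> S0" and a: "a \<in> carrier R" for a s
    proof -
      have sM: "s \<in> carrier M" using s S0 by auto
      have "submodule {a \<in> carrier R. a \<odot>\<^bsub>M\<^esub> s \<in> N} ?K (regular_module R)"
        by (rule KR.submoduleI)
          (use sM submodule_0[OF N(1)] submodule_add[OF N(1)] submodule_smult[OF N(1)] Ts in
            \<open>auto simp: smult_l_distr smult_assoc\<close>)
      then have "{a \<in> carrier R. a \<odot>\<^bsub>M\<^esub> s \<in> N} = carrier R"
        by (rule T0(3)) (use T0(2) s N(2) in auto)
      then show ?thesis using a by blast
    qed
    have "submodule {x \<in> carrier M. \<forall>a\<in>carrier R. a \<odot>\<^bsub>M\<^esub> x \<in> N} R M"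
      by (rule submoduleI)
        (use submodule_0[OF N(1)] submodule_add[OF N(1)] in \<open>auto simp: smult_r_distr smult_assoc[symmetric]\<close>)
    then have "{x \<in> carrier M. \<forall>a\<in>carrier R. a \<odot>\<^bsub>M\<^esub> x \<in> N} = carrier M"
      by (rule S0(3)) (use S0(2) s in auto)
    then have "carrier M \<subseteq> N" using smult_one R.one_closed by (metis (mono_tags, lifting) mem_Collect_eq subsetI)
    then show ?thesis using submodule_sub[OF N(1)] by blast
  qed
  moreover have "finite ?G" "?G \<subseteq> carrier M" using T0 S0 by auto
  ultimately show ?thesis by (intro fin_genI[of "?G"])
qed

lemma fin_gen_image:
  assumes "left_module R M" "left_module R N" "h \<in> mod_hom R M N" "h ` carrier M = carrier N" "fin_gen R M"
  shows "fin_gen R N"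
proof -
  obtain S where S: "finite S" "S \<subseteq> carrier M" "\<And>N. submodule N R M \<Longrightarrow> S \<subseteq> N \<Longrightarrow> N = carrier M"
    using assms(5) by (auto simp: fin_gen_def)
  have "H = carrier N" if H: "submodule H R N" "h ` S \<subseteq> H" for H
  proof -
    have "{x \<in> carrier M. h x \<in> H} = carrier M"
      by (rule S(3)[OF submodule_preimage[OF assms(1-3) H(1)]]) (use S(2) H(2) in auto)
    then have "h x \<in> H" if "x \<in> carrier M" for x using that by blast
    then have "carrier N \<subseteq> H" unfolding assms(4)[symmetric] by blast
    then show ?thesis using submodule_sub[OF H(1)] by blast
  qed
  moreover have "finite (h ` S)" "h ` S \<subseteq> carrier N" using S(1,2) assms(4) by auto
  ultimately show ?thesis by (intro fin_genI[of "h ` S"])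
qed

text \<open>
  A quotient module is realised on a set of representatives of the cosets, which keeps it on the
  same carrier type.
\<close>

lemma (in left_module) quotient_exists:
  assumes N: "submodule N R M"
  shows "\<exists>Q :: ('a, 'm) module. \<exists>w. left_module R Q \<and> w \<in> mod_hom R M Q \<and> w ` carrier M = carrier Q \<and> a_kernel M Q w = N"
proof -
  define c where "c x = (SOME y. y \<in> carrier M \<and> x \<ominus>\<^bsub>M\<^esub> y \<in> N)" for x
  have c: "c x \<in> carrier M" "x \<ominus>\<^bsub>M\<^esub> c x \<in> N" if "x \<in> carrier M" for x
  proof -
    have "x \<in> carrier M \<and> x \<ominus>\<^bsub>M\<^esub> x \<in> N" using that submodule_0[OF N] M.minus_zero_iff[of x x] by simp
    from someI[of "\<lambda>y. y \<in> carrier M \<and> x \<ominus>\<^bsub>M\<^esub> y \<in> N", OF this] show "c x \<in> carrier M" "x \<ominus>\<^bsub>M\<^esub> c x \<in> N"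
      by (simp_all add: c_def)
  qed
  have c_eq: "c x = c y" if xy: "x \<in> carrier M" "y \<in> carrier M" "x \<ominus>\<^bsub>M\<^esub> y \<in> N" for x y
  proof -
    have yx: "y \<ominus>\<^bsub>M\<^esub> x \<in> N" using submodule_neg[OF N xy(3)] xy by (simp add: M.minus_swap)
    have "(x \<ominus>\<^bsub>M\<^esub> z \<in> N) = (y \<ominus>\<^bsub>M\<^esub> z \<in> N)" if z: "z \<in> carrier M" for z
      using submodule_add[OF N xy(3), of "y \<ominus>\<^bsub>M\<^esub> z"] submodule_add[OF N yx, of "x \<ominus>\<^bsub>M\<^esub> z"] xy z
      by (auto simp: M.minus_telescope)
    then have "(\<lambda>z. z \<in> carrier M \<and> x \<ominus>\<^bsub>M\<^esub> z \<in> N) = (\<lambda>z. z \<in> carrier M \<and> y \<ominus>\<^bsub>M\<^esub> z \<in> N)" by blast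
    then show ?thesis by (simp add: c_def)
  qed
  have eq_c: "x \<ominus>\<^bsub>M\<^esub> y \<in> N" if xy: "x \<in> carrier M" "y \<in> carrier M" "c x = c y" for x y
  proof -
    have "c y \<ominus>\<^bsub>M\<^esub> y \<in> N" using submodule_neg[OF N c(2)[OF xy(2)]] c(1)[OF xy(2)] xy by (simp add: M.minus_swap)
    from submodule_add[OF N c(2)[OF xy(1)], unfolded xy(3), OF this] show ?thesis
      using xy c by (simp add: M.minus_telescope)
  qed
  have c_add: "c (c x \<oplus>\<^bsub>M\<^esub> y) = c (x \<oplus>\<^bsub>M\<^esub> y)" "c (y \<oplus>\<^bsub>M\<^esub> c x) = c (y \<oplus>\<^bsub>M\<^esub> x)"
    if xy: "x \<in> carrier M" "y \<in> carrier M" for x y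
  proof -
    have "(x \<oplus>\<^bsub>M\<^esub> y) \<ominus>\<^bsub>M\<^esub> (c x \<oplus>\<^bsub>M\<^esub> y) = x \<ominus>\<^bsub>M\<^esub> c x"
      using xy c(1)[OF xy(1)] M.minus_zero_iff[of y y] by (simp add: M.minus_add_add)
    then show 1: "c (c x \<oplus>\<^bsub>M\<^esub> y) = c (x \<oplus>\<^bsub>M\<^esub> y)"
      using c_eq[of "x \<oplus>\<^bsub>M\<^esub> y" "c x \<oplus>\<^bsub>M\<^esub> y"] xy c[OF xy(1)] by simp
    then show "c (y \<oplus>\<^bsub>M\<^esub> c x) = c (y \<oplus>\<^bsub>M\<^esub> x)" using xy c(1)[OF xy(1)] by (simp add: M.a_comm)
  qed
  have c_smult: "c (a \<odot>\<^bsub>M\<^esub> c x) = c (a \<odot>\<^bsub>M\<^esub> x)" if ax: "a \<in> carrier R" "x \<in> carrier M" for a x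
  proof -
    have "(\<lambda>x. a \<odot>\<^bsub>M\<^esub> x) (x \<ominus>\<^bsub>M\<^esub> c x) = a \<odot>\<^bsub>M\<^esub> x \<ominus>\<^bsub>M\<^esub> a \<odot>\<^bsub>M\<^esub> c x"
    proof -
      have "a \<odot>\<^bsub>M\<^esub> (x \<ominus>\<^bsub>M\<^esub> c x) \<oplus>\<^bsub>M\<^esub> a \<odot>\<^bsub>M\<^esub> c x = a \<odot>\<^bsub>M\<^esub> x"
        using ax c(1)[OF ax(2)] by (simp add: smult_r_distr[symmetric] M.minus_add_cancel)
      then show ?thesis using M.add_minus_cancel[of "a \<odot>\<^bsub>M\<^esub> (x \<ominus>\<^bsub>M\<^esub> c x)" "a \<odot>\<^bsub>M\<^esub> c x"] ax c(1)[OF ax(2)] by simp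
    qed
    then show ?thesis using c_eq[of "a \<odot>\<^bsub>M\<^esub> x" "a \<odot>\<^bsub>M\<^esub> c x"] submodule_smult[OF N ax(1) c(2)[OF ax(2)]] ax c(1)[OF ax(2)] by simp
  qed
  define Q :: "('a, 'm) module" where
    "Q = \<lparr>carrier = c ` carrier M, monoid.mult = undefined, one = undefined, ring.zero = c \<zero>\<^bsub>M\<^esub>,
          ring.add = (\<lambda>x y. c (x \<oplus>\<^bsub>M\<^esub> y)), module.smult = (\<lambda>a x. c (a \<odot>\<^bsub>M\<^esub> x))\<rparr>"
  have [simp]: "carrier Q = c ` carrier M" "\<zero>\<^bsub>Q\<^esub> = c \<zero>\<^bsub>M\<^esub>"
    "x \<oplus>\<^bsub>Q\<^esub> y = c (x \<oplus>\<^bsub>M\<^esub> y)" "a \<odot>\<^bsub>Q\<^esub> x = c (a \<odot>\<^bsub>M\<^esub> x)" for a x y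
    by (simp_all add: Q_def)
  have ag: "abelian_group Q"
  proof (rule abelian_groupI)
    fix x assume "x \<in> carrier Q"
    then obtain m where m: "m \<in> carrier M" "x = c m" by auto
    show "\<exists>y\<in>carrier Q. y \<oplus>\<^bsub>Q\<^esub> x = \<zero>\<^bsub>Q\<^esub>"
      using m c(1) by (intro bexI[of _ "c (\<ominus>\<^bsub>M\<^esub> m)"]) (auto simp: M.l_neg c_add)
  next
    fix x y assume "x \<in> carrier Q" "y \<in> carrier Q"
    then obtain m n where "m \<in> carrier M" "x = c m" "n \<in> carrier M" "y = c n" by auto
    then show "x \<oplus>\<^bsub>Q\<^esub> y = y \<oplus>\<^bsub>Q\<^esub> x" using M.a_comm[OF c(1) c(1), of m n] by simp
  next
    fix x y z assume "x \<in> carrier Q" "y \<in> carrier Q" "z \<in> carrier Q"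
    then obtain m n l where m: "m \<in> carrier M" "x = c m" "n \<in> carrier M" "y = c n" "l \<in> carrier M" "z = c l" by auto
    then have "c m \<in> carrier M" "c n \<in> carrier M" "c l \<in> carrier M" using c(1) by blast+
    then have "(x \<oplus>\<^bsub>Q\<^esub> y) \<oplus>\<^bsub>Q\<^esub> z = c (m \<oplus>\<^bsub>M\<^esub> n \<oplus>\<^bsub>M\<^esub> l)" "x \<oplus>\<^bsub>Q\<^esub> (y \<oplus>\<^bsub>Q\<^esub> z) = c (m \<oplus>\<^bsub>M\<^esub> (n \<oplus>\<^bsub>M\<^esub> l))"
      using m by (simp_all add: c_add)
    then show "(x \<oplus>\<^bsub>Q\<^esub> y) \<oplus>\<^bsub>Q\<^esub> z = x \<oplus>\<^bsub>Q\<^esub> (y \<oplus>\<^bsub>Q\<^esub> z)" using m by (simp add: M.a_assoc)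
  next
    fix x assume "x \<in> carrier Q"
    then obtain m where m: "m \<in> carrier M" "x = c m" by auto
    then show "\<zero>\<^bsub>Q\<^esub> \<oplus>\<^bsub>Q\<^esub> x = x" using c(1)[OF m(1)] c_add(1)[of "\<zero>\<^bsub>M\<^esub>" "c m"] c_add(2)[of m "\<zero>\<^bsub>M\<^esub>"] by simp
  qed (use c(1) in auto)
  have lm: "left_module R Q"
  proof (intro left_module.intro left_module_axioms.intro ag R.ring_axioms)
    fix a b x assume a: "a \<in> carrier R" and b: "b \<in> carrier R" and "x \<in> carrier Q"
    then obtain m where m: "m \<in> carrier M" "x = c m" by auto
    have cm: "c m \<in> carrier M" using c(1) m by blast
    show "(a \<oplus> b) \<odot>\<^bsub>Q\<^esub> x = a \<odot>\<^bsub>Q\<^esub> x \<oplus>\<^bsub>Q\<^esub> b \<odot>\<^bsub>Q\<^esub> x"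
      using a b m cm c(1) by (simp add: c_add smult_l_distr)
    show "(a \<otimes> b) \<odot>\<^bsub>Q\<^esub> x = a \<odot>\<^bsub>Q\<^esub> (b \<odot>\<^bsub>Q\<^esub> x)"
      using a b m cm c_smult[of "a \<otimes> b" m] smult_assoc[of a b m] by (simp add: c_smult)
  next
    fix a x y assume a: "a \<in> carrier R" and "x \<in> carrier Q" "y \<in> carrier Q"
    then obtain m n where m: "m \<in> carrier M" "x = c m" "n \<in> carrier M" "y = c n" by auto
    have cm: "c m \<in> carrier M" "c n \<in> carrier M" using c(1) m by blast+
    show "a \<odot>\<^bsub>Q\<^esub> (x \<oplus>\<^bsub>Q\<^esub> y) = a \<odot>\<^bsub>Q\<^esub> x \<oplus>\<^bsub>Q\<^esub> a \<odot>\<^bsub>Q\<^esub> y"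
      using a m cm c(1) by (simp add: c_add c_smult smult_r_distr)
  next
    fix x assume "x \<in> carrier Q"
    then obtain m where m: "m \<in> carrier M" "x = c m" by auto
    then show "\<one> \<odot>\<^bsub>Q\<^esub> x = x" using c(1)[OF m(1)] c_smult[of \<one> m] by simp
  qed (use c(1) in auto)
  have "c \<in> mod_hom R M Q" using c(1) by (intro mod_homI) (auto simp: c_add c_smult)
  moreover have "a_kernel M Q c = N"
  proof
    have m0: "x \<ominus>\<^bsub>M\<^esub> \<zero>\<^bsub>M\<^esub> = x" if "x \<in> carrier M" for x using M.add_minus_cancel[of x "\<zero>\<^bsub>M\<^esub>"] that by simp
    show "a_kernel M Q c \<subseteq> N" using eq_c[of _ "\<zero>\<^bsub>M\<^esub>"] m0 by (auto simp: a_kernel_def')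
    show "N \<subseteq> a_kernel M Q c" using c_eq[of _ "\<zero>\<^bsub>M\<^esub>"] m0 submodule_in[OF N] by (auto simp: a_kernel_def')
  qed
  ultimately show ?thesis using lm by (intro exI[of _ Q] exI[of _ c]) simp
qed

definition prod_module :: "('a, 'm, 'c) module_scheme \<Rightarrow> ('a, 'n, 'd) module_scheme \<Rightarrow> ('a, 'm \<times> 'n) module" where
  "prod_module M N = \<lparr>carrier = carrier M \<times> carrier N, monoid.mult = undefined, one = undefined,
     ring.zero = (\<zero>\<^bsub>M\<^esub>, \<zero>\<^bsub>N\<^esub>), ring.add = (\<lambda>x y. (fst x \<oplus>\<^bsub>M\<^esub> fst y, snd x \<oplus>\<^bsub>N\<^esub> snd y)),
     module.smult = (\<lambda>a x. (a \<odot>\<^bsub>M\<^esub> fst x, a \<odot>\<^bsub>N\<^esub> snd x))\<rparr>"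

lemma prod_module_simps [simp]:
  "carrier (prod_module M N) = carrier M \<times> carrier N" "\<zero>\<^bsub>prod_module M N\<^esub> = (\<zero>\<^bsub>M\<^esub>, \<zero>\<^bsub>N\<^esub>)"
  "x \<oplus>\<^bsub>prod_module M N\<^esub> y = (fst x \<oplus>\<^bsub>M\<^esub> fst y, snd x \<oplus>\<^bsub>N\<^esub> snd y)"
  "a \<odot>\<^bsub>prod_module M N\<^esub> x = (a \<odot>\<^bsub>M\<^esub> fst x, a \<odot>\<^bsub>N\<^esub> snd x)"
  by (simp_all add: prod_module_def)

lemma prod_left_module:
  assumes "left_module R M" "left_module R N"
  shows "left_module R (prod_module M N)"
proof -
  interpret M: left_module R M by fact
  interpret N: left_module R N by fact
  have ag: "abelian_group (prod_module M N)"
  proof (rule abelian_groupI)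
    fix x assume x: "x \<in> carrier (prod_module M N)"
    show "\<exists>y\<in>carrier (prod_module M N). y \<oplus>\<^bsub>prod_module M N\<^esub> x = \<zero>\<^bsub>prod_module M N\<^esub>"
      using x by (intro bexI[of _ "(\<ominus>\<^bsub>M\<^esub> fst x, \<ominus>\<^bsub>N\<^esub> snd x)"]) (auto simp: M.M.l_neg N.M.l_neg)
  qed (auto simp: M.M.a_ac N.M.a_ac)
  show ?thesis
    by (intro left_module.intro left_module_axioms.intro ag M.R.ring_axioms)
       (auto simp: M.smult_l_distr N.smult_l_distr M.smult_r_distr N.smult_r_distr M.smult_assoc N.smult_assoc)
qed

lemma prod_fin_gen:
  assumes "left_module R M" "left_module R N" "fin_gen R M" "fin_gen R N"
  shows "fin_gen R (prod_module M N)"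
proof -
  interpret M: left_module R M by fact
  interpret N: left_module R N by fact
  interpret P: left_module R "prod_module M N" by (rule prod_left_module[OF assms(1,2)])
  have i1: "(\<lambda>x. (x, \<zero>\<^bsub>N\<^esub>)) \<in> mod_hom R M (prod_module M N)" by (intro mod_homI) auto
  have i2: "(\<lambda>x. (\<zero>\<^bsub>M\<^esub>, x)) \<in> mod_hom R N (prod_module M N)" by (intro mod_homI) auto
  obtain S where S: "finite S" "S \<subseteq> carrier M" "\<And>H. submodule H R M \<Longrightarrow> S \<subseteq> H \<Longrightarrow> H = carrier M"
    using assms(3) by (auto simp: fin_gen_def)
  obtain T where T: "finite T" "T \<subseteq> carrier N" "\<And>H. submodule H R N \<Longrightarrow> T \<subseteq> H \<Longrightarrow> H = carrier N"
    using assms(4) by (auto simp: fin_gen_def)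
  let ?G = "(\<lambda>x. (x, \<zero>\<^bsub>N\<^esub>)) ` S \<union> (\<lambda>x. (\<zero>\<^bsub>M\<^esub>, x)) ` T"
  have "H = carrier (prod_module M N)" if H: "submodule H R (prod_module M N)" "?G \<subseteq> H" for H
  proof -
    have "{x \<in> carrier M. (x, \<zero>\<^bsub>N\<^esub>) \<in> H} = carrier M"
      by (rule S(3)[OF submodule_preimage[OF assms(1) P.left_module_axioms i1 H(1)]]) (use S(2) H(2) in auto)
    then have 1: "(x, \<zero>\<^bsub>N\<^esub>) \<in> H" if "x \<in> carrier M" for x using that by blast
    have "{x \<in> carrier N. (\<zero>\<^bsub>M\<^esub>, x) \<in> H} = carrier N"
      by (rule T(3)[OF submodule_preimage[OF assms(2) P.left_module_axioms i2 H(1)]]) (use T(2) H(2) in auto)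
    then have 2: "(\<zero>\<^bsub>M\<^esub>, x) \<in> H" if "x \<in> carrier N" for x using that by blast
    have "(x, y) \<in> H" if "x \<in> carrier M" "y \<in> carrier N" for x y
      using submodule_add[OF H(1) 1[OF that(1)] 2[OF that(2)]] that by simp
    then show ?thesis using submodule_sub[OF H(1)] by auto
  qed
  moreover have "finite ?G" "?G \<subseteq> carrier (prod_module M N)" using S T by auto
  ultimately show ?thesis by (intro fin_genI[of "?G"])
qed

subsection \<open>Free modules\<close>

definition free_module :: "('a, 'b) ring_scheme \<Rightarrow> nat \<Rightarrow> ('a, nat \<Rightarrow> 'a) module" where
  "free_module R n = \<lparr>carrier = {..<n} \<rightarrow>\<^sub>E carrier R, monoid.mult = undefined, one = undefined,
     ring.zero = (\<lambda>i\<in>{..<n}. \<zero>\<^bsub>R\<^esub>), ring.add = (\<lambda>v w. \<lambda>i\<in>{..<n}. v i \<oplus>\<^bsub>R\<^esub> w i),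
     module.smult = (\<lambda>a v. \<lambda>i\<in>{..<n}. a \<otimes>\<^bsub>R\<^esub> v i)\<rparr>"

lemma free_module_simps [simp]:
  "carrier (free_module R n) = {..<n} \<rightarrow>\<^sub>E carrier R" "\<zero>\<^bsub>free_module R n\<^esub> = (\<lambda>i\<in>{..<n}. \<zero>\<^bsub>R\<^esub>)"
  "v \<oplus>\<^bsub>free_module R n\<^esub> w = (\<lambda>i\<in>{..<n}. v i \<oplus>\<^bsub>R\<^esub> w i)"
  "a \<odot>\<^bsub>free_module R n\<^esub> v = (\<lambda>i\<in>{..<n}. a \<otimes>\<^bsub>R\<^esub> v i)"
  by (simp_all add: free_module_def)

definition unit_vector :: "('a, 'b) ring_scheme \<Rightarrow> nat \<Rightarrow> nat \<Rightarrow> nat \<Rightarrow> 'a" where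
  "unit_vector R n j = (\<lambda>i\<in>{..<n}. if i = j then \<one>\<^bsub>R\<^esub> else \<zero>\<^bsub>R\<^esub>)"

lemma (in ring) free_left_module: "left_module R (free_module R n)"
proof -
  have nth: "v i \<in> carrier R" if "v \<in> {..<n} \<rightarrow>\<^sub>E carrier R" "i < n" for v i using that by auto
  have ext: "(\<lambda>i\<in>{..<n}. f i) = v" if "v \<in> {..<n} \<rightarrow>\<^sub>E carrier R" "\<And>i. i < n \<Longrightarrow> f i = v i" for f v
    using that by (intro extensionalityI[of _ "{..<n}"]) (auto simp: PiE_def)
  have ag: "abelian_group (free_module R n)"
  proof (rule abelian_groupI)
    fix v assume v: "v \<in> carrier (free_module R n)"
    then show "\<exists>w\<in>carrier (free_module R n). w \<oplus>\<^bsub>free_module R n\<^esub> v = \<zero>\<^bsub>free_module R n\<^esub>"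
      using nth by (intro bexI[of _ "\<lambda>i\<in>{..<n}. \<ominus> v i"]) (auto simp: l_neg intro!: restrict_ext)
  qed (use nth ext in \<open>auto simp: a_ac intro!: restrict_ext\<close>)
  show ?thesis
    by (intro left_module.intro left_module_axioms.intro ag ring_axioms)
       (use nth ext in \<open>auto simp: l_distr r_distr m_assoc intro!: restrict_ext\<close>)
qed

lemma unit_vector_closed [simp]: "ring R \<Longrightarrow> unit_vector R n j \<in> {..<n} \<rightarrow>\<^sub>E carrier R"
  by (auto simp: unit_vector_def ring.ring_simprules)

lemma submodule_finsum:
  assumes "left_module R M" "submodule N R M" "\<And>i. i \<in> A \<Longrightarrow> f i \<in> N"
  shows "finsum M f A \<in> N"
proof -
  interpret left_module R M by fact
  show ?thesis
  proof (cases "finite A")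
    case True
    then show ?thesis using assms(3)
    proof (induction A)
      case (insert x F)
      then have "f \<in> F \<rightarrow> carrier M" "f x \<in> carrier M" using submodule_in[OF assms(2)] by auto
      then show ?case using insert submodule_add[OF assms(2)] by simp
    qed (use submodule_0[OF assms(2)] in auto)
  qed (use submodule_0[OF assms(2)] M.finsum_infinite in auto)
qed

lemma mod_hom_finsum:
  assumes "left_module R M" "left_module R N" "h \<in> mod_hom R M N" "finite A" "f \<in> A \<rightarrow> carrier M"
  shows "h (finsum M f A) = finsum N (\<lambda>i. h (f i)) A"
proof -
  interpret M: left_module R M by fact
  interpret N: left_module R N by fact
  show ?thesis using assms(4,5)
  proof (induction A)
    case (insert x F)
    then have "f \<in> F \<rightarrow> carrier M" "f x \<in> carrier M" "(\<lambda>i. h (f i)) \<in> F \<rightarrow> carrier N" "h (f x) \<in> carrier N"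
      using mod_hom_closed[OF assms(3)] by auto
    then show ?case using insert mod_hom_add[OF assms(3)] by simp
  qed (use mod_hom_zero[OF assms(1-3)] in auto)
qed

lemma (in ring) free_finsum_nth:
  assumes "finite A" "f \<in> A \<rightarrow> carrier (free_module R n)" "j < n"
  shows "finsum (free_module R n) f A j = (\<Oplus>i\<in>A. f i j)"
proof -
  interpret F: left_module R "free_module R n" by (rule free_left_module)
  have "(\<lambda>v. v j) \<in> mod_hom R (free_module R n) (regular_module R)"
    using assms(3) by (intro mod_homI) auto
  from mod_hom_finsum[OF free_left_module regular_left_module_self this assms(1,2)]
  have "finsum (free_module R n) f A j = finsum (regular_module R) (\<lambda>i. f i j) A" .
  also have "\<dots> = (\<Oplus>i\<in>A. f i j)"
  proof -
    interpret L: left_module R "regular_module R" by (rule regular_left_module_self)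
    show ?thesis using assms(1,2)
    proof (induction A)
      case (insert x F)
      then have "(\<lambda>i. f i j) \<in> F \<rightarrow> carrier R" "f x j \<in> carrier R" using assms(3) by auto
      then show ?case using insert L.M.finsum_insert[of F x "\<lambda>i. f i j"] by simp
    qed simp
  qed
  finally show ?thesis .
qed

lemma (in ring) free_expansion:
  assumes v: "v \<in> carrier (free_module R n)"
  shows "v = (\<Oplus>\<^bsub>free_module R n\<^esub>i\<in>{..<n}. v i \<odot>\<^bsub>free_module R n\<^esub> unit_vector R n i)"
proof -
  interpret F: left_module R "free_module R n" by (rule free_left_module)
  have u: "unit_vector R n i \<in> carrier (free_module R n)" for i
    using unit_vector_closed[OF ring_axioms] by simp
  have vi: "v i \<in> carrier R" if "i < n" for i using v that by auto
  let ?s = "\<Oplus>\<^bsub>free_module R n\<^esub>i\<in>{..<n}. v i \<odot>\<^bsub>free_module R n\<^esub> unit_vector R n i"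
  have cl: "(\<lambda>i. v i \<odot>\<^bsub>free_module R n\<^esub> unit_vector R n i) \<in> {..<n} \<rightarrow> carrier (free_module R n)"
    using vi u by (intro Pi_I F.smult_closed) auto
  then have "?s \<in> carrier (free_module R n)" by (rule F.M.finsum_closed)
  moreover have "?s j = v j" if j: "j < n" for j
  proof -
    have "?s j = (\<Oplus>i\<in>{..<n}. (v i \<odot>\<^bsub>free_module R n\<^esub> unit_vector R n i) j)"
      by (rule free_finsum_nth[OF _ cl j]) simp
    also have "\<dots> = (\<Oplus>i\<in>{..<n}. if j = i then v i else \<zero>)"
      using j vi by (intro finsum_cong') (auto simp: unit_vector_def)
    also have "\<dots> = v j" using add.finprod_singleton[of j "{..<n}" v] j vi by (simp add: finsum_def)
    finally show ?thesis .
  qed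
  ultimately show ?thesis using v by (intro extensionalityI[of _ "{..<n}"]) (auto simp: PiE_def)
qed

lemma mod_hom_free_expansion:
  assumes "left_module R M" "h \<in> mod_hom R (free_module R n) M" "v \<in> carrier (free_module R n)"
  shows "h v = (\<Oplus>\<^bsub>M\<^esub>i\<in>{..<n}. v i \<odot>\<^bsub>M\<^esub> h (unit_vector R n i))"
proof -
  interpret left_module R M by fact
  interpret F: left_module R "free_module R n" by (rule R.free_left_module)
  have u: "unit_vector R n i \<in> carrier (free_module R n)" for i
    using unit_vector_closed[OF R.ring_axioms] by simp
  have vi: "v i \<in> carrier R" if "i < n" for i using assms(3) that by auto
  have cl: "(\<lambda>i. v i \<odot>\<^bsub>free_module R n\<^esub> unit_vector R n i) \<in> {..<n} \<rightarrow> carrier (free_module R n)"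
    using vi u by (intro Pi_I F.smult_closed) auto
  have "h v = h (\<Oplus>\<^bsub>free_module R n\<^esub>i\<in>{..<n}. v i \<odot>\<^bsub>free_module R n\<^esub> unit_vector R n i)"
    using R.free_expansion[OF assms(3)] by simp
  also have "\<dots> = (\<Oplus>\<^bsub>M\<^esub>i\<in>{..<n}. h (v i \<odot>\<^bsub>free_module R n\<^esub> unit_vector R n i))"
    by (rule mod_hom_finsum[OF F.left_module_axioms assms(1,2) _ cl]) simp
  also have "\<dots> = (\<Oplus>\<^bsub>M\<^esub>i\<in>{..<n}. v i \<odot>\<^bsub>M\<^esub> h (unit_vector R n i))"
  proof (rule M.finsum_cong'[OF refl])
    show "(\<lambda>i. v i \<odot>\<^bsub>M\<^esub> h (unit_vector R n i)) \<in> {..<n} \<rightarrow> carrier M"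
      using vi mod_hom_closed[OF assms(2) u] by auto
    fix i assume "i \<in> {..<n}"
    then show "h (v i \<odot>\<^bsub>free_module R n\<^esub> unit_vector R n i) = v i \<odot>\<^bsub>M\<^esub> h (unit_vector R n i)"
      using mod_hom_smult[OF assms(2) vi u] by simp
  qed
  finally show ?thesis .
qed

lemma (in left_module) comb_hom:
  assumes s: "s \<in> {..<n} \<rightarrow> carrier M"
  shows "(\<lambda>v. \<Oplus>\<^bsub>M\<^esub>i\<in>{..<n}. v i \<odot>\<^bsub>M\<^esub> s i) \<in> mod_hom R (free_module R n) M"
proof (rule mod_homI)
  have cl: "(\<lambda>i. v i \<odot>\<^bsub>M\<^esub> s i) \<in> {..<n} \<rightarrow> carrier M" if "v \<in> {..<n} \<rightarrow>\<^sub>E carrier R" for v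
    using that s by (auto simp: PiE_def Pi_def)
  show "(\<Oplus>\<^bsub>M\<^esub>i\<in>{..<n}. v i \<odot>\<^bsub>M\<^esub> s i) \<in> carrier M" if "v \<in> carrier (free_module R n)" for v
    using cl that by (auto intro: M.finsum_closed)
  show "(\<Oplus>\<^bsub>M\<^esub>i\<in>{..<n}. (v \<oplus>\<^bsub>free_module R n\<^esub> w) i \<odot>\<^bsub>M\<^esub> s i) =
     (\<Oplus>\<^bsub>M\<^esub>i\<in>{..<n}. v i \<odot>\<^bsub>M\<^esub> s i) \<oplus>\<^bsub>M\<^esub> (\<Oplus>\<^bsub>M\<^esub>i\<in>{..<n}. w i \<odot>\<^bsub>M\<^esub> s i)"
    if vw: "v \<in> carrier (free_module R n)" "w \<in> carrier (free_module R n)" for v w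
  proof -
    have "v i \<in> carrier R" "w i \<in> carrier R" "s i \<in> carrier M" if "i < n" for i using that vw s by auto
    then have "(\<Oplus>\<^bsub>M\<^esub>i\<in>{..<n}. (v \<oplus>\<^bsub>free_module R n\<^esub> w) i \<odot>\<^bsub>M\<^esub> s i) =
       (\<Oplus>\<^bsub>M\<^esub>i\<in>{..<n}. v i \<odot>\<^bsub>M\<^esub> s i \<oplus>\<^bsub>M\<^esub> w i \<odot>\<^bsub>M\<^esub> s i)"
      by (intro M.finsum_cong') (auto simp: smult_l_distr)
    also have "\<dots> = (\<Oplus>\<^bsub>M\<^esub>i\<in>{..<n}. v i \<odot>\<^bsub>M\<^esub> s i) \<oplus>\<^bsub>M\<^esub> (\<Oplus>\<^bsub>M\<^esub>i\<in>{..<n}. w i \<odot>\<^bsub>M\<^esub> s i)"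
      using vw by (intro M.finsum_addf cl) auto
    finally show ?thesis .
  qed
  show "(\<Oplus>\<^bsub>M\<^esub>i\<in>{..<n}. (a \<odot>\<^bsub>free_module R n\<^esub> v) i \<odot>\<^bsub>M\<^esub> s i) = a \<odot>\<^bsub>M\<^esub> (\<Oplus>\<^bsub>M\<^esub>i\<in>{..<n}. v i \<odot>\<^bsub>M\<^esub> s i)"
    if av: "a \<in> carrier R" "v \<in> carrier (free_module R n)" for a v
  proof -
    have vs: "v i \<in> carrier R" "s i \<in> carrier M" if "i < n" for i using that av s by auto
    have "a \<odot>\<^bsub>M\<^esub> (\<Oplus>\<^bsub>M\<^esub>i\<in>{..<n}. v i \<odot>\<^bsub>M\<^esub> s i) = (\<Oplus>\<^bsub>M\<^esub>i\<in>{..<n}. a \<odot>\<^bsub>M\<^esub> (v i \<odot>\<^bsub>M\<^esub> s i))"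
      using av by (intro smult_finsum cl) auto
    also have "\<dots> = (\<Oplus>\<^bsub>M\<^esub>i\<in>{..<n}. (a \<odot>\<^bsub>free_module R n\<^esub> v) i \<odot>\<^bsub>M\<^esub> s i)"
      using vs av by (intro M.finsum_cong') (auto simp: smult_assoc)
    finally show ?thesis by simp
  qed
qed

lemma (in ring) free_fin_gen: "fin_gen R (free_module R n)"
  unfolding fin_gen_def
proof (intro exI[of _ "unit_vector R n ` {..<n}"] conjI allI impI)
  interpret F: left_module R "free_module R n" by (rule free_left_module)
  show "unit_vector R n ` {..<n} \<subseteq> carrier (free_module R n)" using unit_vector_closed[OF ring_axioms] by auto
  fix N assume N: "submodule N R (free_module R n) \<and> unit_vector R n ` {..<n} \<subseteq> N"
  have "v \<in> N" if v: "v \<in> carrier (free_module R n)" for v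
  proof -
    have "(\<Oplus>\<^bsub>free_module R n\<^esub>i\<in>{..<n}. v i \<odot>\<^bsub>free_module R n\<^esub> unit_vector R n i) \<in> N"
    proof (rule submodule_finsum[OF F.left_module_axioms])
      show "submodule N R (free_module R n)" using N by blast
      fix i assume "i \<in> {..<n}"
      moreover from this have "v i \<in> carrier R" using v by auto
      ultimately show "v i \<odot>\<^bsub>free_module R n\<^esub> unit_vector R n i \<in> N"
        using N by (intro submodule_smult) auto
    qed
    then show ?thesis using free_expansion[OF v] by simp
  qed
  then show "N = carrier (free_module R n)" using N submodule_sub by blast
qed simp

lemma (in left_module) free_cover:
  assumes "fin_gen R M"
  shows "\<exists>n. \<exists>p\<in>mod_hom R (free_module R n) M. p ` carrier (free_module R n) = carrier M"
proof -
  from assms obtain S where S: "finite S" "S \<subseteq> carrier M"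
    "\<And>N. submodule N R M \<Longrightarrow> S \<subseteq> N \<Longrightarrow> N = carrier M" unfolding fin_gen_def by blast
  obtain s and n :: nat where s: "s ` {..<n} = S"
    using finite_imp_nat_seg_image_inj_on[OF S(1)] by (auto simp: lessThan_def)
  have sM: "s \<in> {..<n} \<rightarrow> carrier M" using s S(2) by auto
  have "(\<lambda>t. \<Oplus>\<^bsub>M\<^esub>i\<in>{..<n}. t i \<odot>\<^bsub>M\<^esub> s i) ` carrier (free_module R n) = carrier M"
    using span_surj[OF sM] S(3) s by simp
  then show ?thesis using comb_hom[OF sM] by blast
qed

lemma free_lift:
  assumes M: "left_module R M" and N: "left_module R N"
    and g: "g \<in> mod_hom R M N" "g ` carrier M = carrier N" and f: "f \<in> mod_hom R (free_module R n) N"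
  shows "\<exists>h\<in>mod_hom R (free_module R n) M. \<forall>x\<in>carrier (free_module R n). g (h x) = f x"
proof -
  interpret M: left_module R M by fact
  interpret N: left_module R N by fact
  have u: "unit_vector R n i \<in> carrier (free_module R n)" for i
    using unit_vector_closed[OF M.R.ring_axioms] by simp
  have "\<exists>y\<in>carrier M. g y = f (unit_vector R n i)" for i
    using mod_hom_closed[OF f u, of i] g(2) by (metis imageE)
  then obtain s where s: "\<And>i. s i \<in> carrier M" "\<And>i. g (s i) = f (unit_vector R n i)" by metis
  let ?h = "\<lambda>v. \<Oplus>\<^bsub>M\<^esub>i\<in>{..<n}. v i \<odot>\<^bsub>M\<^esub> s i"
  have "g (?h v) = f v" if v: "v \<in> carrier (free_module R n)" for v
  proof -
    have vi: "v i \<in> carrier R" if "i < n" for i using v that by auto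
    have "g (?h v) = (\<Oplus>\<^bsub>N\<^esub>i\<in>{..<n}. g (v i \<odot>\<^bsub>M\<^esub> s i))"
      by (rule mod_hom_finsum[OF M N g(1)]) (use vi s in auto)
    also have "\<dots> = (\<Oplus>\<^bsub>N\<^esub>i\<in>{..<n}. v i \<odot>\<^bsub>N\<^esub> f (unit_vector R n i))"
      by (rule N.M.finsum_cong'[OF refl])
        (use vi s(1) mod_hom_closed[OF f u] in \<open>auto simp: mod_hom_smult[OF g(1)] s(2)\<close>)
    also have "\<dots> = f v" using mod_hom_free_expansion[OF N f v] by simp
    finally show ?thesis .
  qed
  then show ?thesis using M.comb_hom[of s n] s(1) by (intro bexI[of _ ?h]) auto
qed

section \<open>Projective modules and biproducts\<close>

text \<open>
  Left noetherian rings.  The condition is stated for modules, since what matters is that the kernels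
  of maps between finitely generated modules are finitely generated.
\<close>

locale noetherian_ring = ring R for R :: "('a, 'b) ring_scheme" (structure) +
  assumes submodule_fg: "\<lbrakk>M \<in> fg_modules R; submodule N R M\<rbrakk> \<Longrightarrow> M\<lparr>carrier := N\<rparr> \<in> fg_modules R"

definition arrow :: "('a, 'b) ring_scheme \<Rightarrow> 'a fg_mod \<Rightarrow> 'a fg_mod \<Rightarrow> ((nat \<Rightarrow> 'a) set \<Rightarrow> (nat \<Rightarrow> 'a) set) \<Rightarrow> bool" where
  "arrow R M N f \<longleftrightarrow> M \<in> fg_modules R \<and> N \<in> fg_modules R \<and> f \<in> mod_hom R M N"

definition ker_mod :: "('a, 'm, 'c) module_scheme \<Rightarrow> ('a, 'n, 'd) module_scheme \<Rightarrow> ('m \<Rightarrow> 'n) \<Rightarrow> ('a, 'm, 'c) module_scheme" where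
  "ker_mod M N f = M\<lparr>carrier := a_kernel M N f\<rparr>"

lemma ker_mod_simps [simp]:
  "carrier (ker_mod M N f) = {x \<in> carrier M. f x = \<zero>\<^bsub>N\<^esub>}" "\<zero>\<^bsub>ker_mod M N f\<^esub> = \<zero>\<^bsub>M\<^esub>"
  "x \<oplus>\<^bsub>ker_mod M N f\<^esub> y = x \<oplus>\<^bsub>M\<^esub> y" "a \<odot>\<^bsub>ker_mod M N f\<^esub> x = a \<odot>\<^bsub>M\<^esub> x"
  by (simp_all add: ker_mod_def a_kernel_def')

context
  fixes R :: "('a, 'b) ring_scheme"
begin

lemma fg_left_module: "M \<in> fg_modules R \<Longrightarrow> left_module R M"
  by (simp add: fg_modules_def)

lemma arrow_fg: "arrow R M N f \<Longrightarrow> M \<in> fg_modules R" "arrow R M N f \<Longrightarrow> N \<in> fg_modules R"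
  "arrow R M N f \<Longrightarrow> f \<in> mod_hom R M N"
  by (simp_all add: arrow_def)

lemma arrow_lm: "arrow R M N f \<Longrightarrow> left_module R M" "arrow R M N f \<Longrightarrow> left_module R N"
  by (simp_all add: arrow_def fg_left_module)

lemma arrow_app: "arrow R M N f \<Longrightarrow> x \<in> carrier M \<Longrightarrow> f x \<in> carrier N"
  by (auto simp: arrow_def mod_hom_closed)

lemma arrow_add: "arrow R M N f \<Longrightarrow> x \<in> carrier M \<Longrightarrow> y \<in> carrier M \<Longrightarrow> f (x \<oplus>\<^bsub>M\<^esub> y) = f x \<oplus>\<^bsub>N\<^esub> f y"
  by (auto simp: arrow_def mod_hom_add)

lemma arrow_smult: "arrow R M N f \<Longrightarrow> a \<in> carrier R \<Longrightarrow> x \<in> carrier M \<Longrightarrow> f (a \<odot>\<^bsub>M\<^esub> x) = a \<odot>\<^bsub>N\<^esub> f x"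
  by (auto simp: arrow_def mod_hom_smult)

lemma arrow_zero: "arrow R M N f \<Longrightarrow> f \<zero>\<^bsub>M\<^esub> = \<zero>\<^bsub>N\<^esub>"
  by (meson arrow_def fg_left_module mod_hom_zero)

lemma arrow_minus: "arrow R M N f \<Longrightarrow> x \<in> carrier M \<Longrightarrow> y \<in> carrier M \<Longrightarrow> f (x \<ominus>\<^bsub>M\<^esub> y) = f x \<ominus>\<^bsub>N\<^esub> f y"
  by (meson arrow_def fg_left_module mod_hom_minus)

lemma arrow_id: "M \<in> fg_modules R \<Longrightarrow> arrow R M M (\<lambda>x. x)"
  by (simp add: arrow_def mod_hom_id)

lemma arrow_comp: "arrow R M N f \<Longrightarrow> arrow R N L g \<Longrightarrow> arrow R M L (\<lambda>x. g (f x))"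
  by (auto simp: arrow_def intro: mod_hom_comp)

lemma arrow_cong: "arrow R M N f \<Longrightarrow> (\<And>x. x \<in> carrier M \<Longrightarrow> g x = f x) \<Longrightarrow> arrow R M N g"
  by (auto simp: arrow_def fg_left_module intro: mod_hom_cong)

lemma arrowI:
  assumes "M \<in> fg_modules R" "N \<in> fg_modules R" "\<And>x. x \<in> carrier M \<Longrightarrow> f x \<in> carrier N"
    "\<And>x y. x \<in> carrier M \<Longrightarrow> y \<in> carrier M \<Longrightarrow> f (x \<oplus>\<^bsub>M\<^esub> y) = f x \<oplus>\<^bsub>N\<^esub> f y"
    "\<And>a x. a \<in> carrier R \<Longrightarrow> x \<in> carrier M \<Longrightarrow> f (a \<odot>\<^bsub>M\<^esub> x) = a \<odot>\<^bsub>N\<^esub> f x"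
  shows "arrow R M N f"
  unfolding arrow_def using assms by (intro conjI mod_homI) auto

lemma arrow_plus:
  assumes "arrow R M N f" "arrow R M N g"
  shows "arrow R M N (\<lambda>x. f x \<oplus>\<^bsub>N\<^esub> g x)"
proof -
  interpret M: left_module R M by (rule arrow_lm(1)[OF assms(1)])
  interpret N: left_module R N by (rule arrow_lm(2)[OF assms(1)])
  show ?thesis
    using arrow_app[OF assms(1)] arrow_app[OF assms(2)]
    by (intro arrowI arrow_fg[OF assms(1)])
      (auto simp: arrow_add[OF assms(1)] arrow_add[OF assms(2)] arrow_smult[OF assms(1)] arrow_smult[OF assms(2)]
        N.M.add_swap4 N.smult_r_distr)
qed

lemma arrow_const_zero:
  assumes "M \<in> fg_modules R" "N \<in> fg_modules R"
  shows "arrow R M N (\<lambda>x. \<zero>\<^bsub>N\<^esub>)"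
proof -
  interpret N: left_module R N by (rule fg_left_module[OF assms(2)])
  show ?thesis by (intro arrowI assms) auto
qed

lemma arrow_neg:
  assumes "M \<in> fg_modules R"
  shows "arrow R M M (\<lambda>x. \<ominus>\<^bsub>M\<^esub> x)"
proof -
  interpret M: left_module R M by (rule fg_left_module[OF assms])
  show ?thesis
  proof (intro arrowI assms)
    fix a x assume "a \<in> carrier R" "x \<in> carrier M"
    then have "\<ominus>\<^bsub>M\<^esub> (a \<odot>\<^bsub>M\<^esub> x) \<oplus>\<^bsub>M\<^esub> a \<odot>\<^bsub>M\<^esub> x = a \<odot>\<^bsub>M\<^esub> (\<ominus>\<^bsub>M\<^esub> x) \<oplus>\<^bsub>M\<^esub> a \<odot>\<^bsub>M\<^esub> x"
      by (simp add: M.smult_r_distr[symmetric] M.M.l_neg)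
    then show "\<ominus>\<^bsub>M\<^esub> (a \<odot>\<^bsub>M\<^esub> x) = a \<odot>\<^bsub>M\<^esub> (\<ominus>\<^bsub>M\<^esub> x)"
      using \<open>a \<in> carrier R\<close> \<open>x \<in> carrier M\<close> by simp
  qed (auto simp: M.M.minus_add)
qed

lemma arrow_diff:
  assumes "arrow R M N f" "arrow R M N g"
  shows "arrow R M N (\<lambda>x. f x \<ominus>\<^bsub>N\<^esub> g x)"
  unfolding a_minus_def
  by (intro arrow_plus assms arrow_comp[OF assms(2) arrow_neg] arrow_fg[OF assms(2)])

lemma free_module_fg_copy: "ring R \<Longrightarrow> \<exists>P\<in>fg_modules R. mod_isomorphic R (free_module R n) P"
  by (intro fg_modules_adequate ring.free_left_module ring.free_fin_gen)

end

lemma surj_of_inverse: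
  assumes "g \<in> mod_hom R N M" "f \<in> mod_hom R M N" "\<And>x. x \<in> carrier M \<Longrightarrow> g (f x) = x"
  shows "g ` carrier N = carrier M"
proof
  show "g ` carrier N \<subseteq> carrier M" using mod_hom_closed[OF assms(1)] by auto
  show "carrier M \<subseteq> g ` carrier N"
  proof
    fix x assume "x \<in> carrier M"
    then show "x \<in> g ` carrier N" using mod_hom_closed[OF assms(2)] assms(3)[of x] by (metis imageI)
  qed
qed

lemma arrow_inverse:
  assumes "arrow R M N f" "bij_betw f (carrier M) (carrier N)"
  shows "\<exists>g. arrow R N M g \<and> (\<forall>x\<in>carrier M. g (f x) = x) \<and> (\<forall>y\<in>carrier N. f (g y) = y)"
proof -
  have "arrow R N M (inv_into (carrier M) f)"
    using mod_hom_inverse[OF arrow_lm[OF assms(1)] arrow_fg(3)[OF assms(1)] assms(2)] arrow_fg[OF assms(1)] by (simp add: arrow_def)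
  then show ?thesis using assms(2) by (intro exI[of _ "inv_into (carrier M) f"]) (auto simp: bij_betw_def f_inv_into_f)
qed

lemma projectiveD:
  assumes "projective_mod R P" "arrow R M N g" "g ` carrier M = carrier N" "arrow R P N f"
  obtains h where "arrow R P M h" "\<And>x. x \<in> carrier P \<Longrightarrow> g (h x) = f x"
proof -
  have "\<exists>h\<in>mod_hom R P M. \<forall>x\<in>carrier P. g (h x) = f x"
    using assms unfolding projective_mod_def arrow_def by blast
  then obtain h where "h \<in> mod_hom R P M" "\<forall>x\<in>carrier P. g (h x) = f x" ..
  then show ?thesis using that[of h] assms(2,4) by (auto simp: arrow_def)
qed

lemma projective_fg: "projective_mod R P \<Longrightarrow> P \<in> fg_modules R"
  by (simp add: projective_mod_def)

lemma projective_retract: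
  assumes "projective_mod R P" "arrow R Q P i" "arrow R P Q r" "\<And>x. x \<in> carrier Q \<Longrightarrow> r (i x) = x"
  shows "projective_mod R Q"
  unfolding projective_mod_def
proof (intro conjI ballI impI)
  show "Q \<in> fg_modules R" using assms(2) by (rule arrow_fg)
  fix M N g f assume "M \<in> fg_modules R" "N \<in> fg_modules R" "g \<in> mod_hom R M N" "f \<in> mod_hom R Q N"
    and s: "g ` carrier M = carrier N"
  then have g: "arrow R M N g" and f: "arrow R Q N f" using \<open>Q \<in> fg_modules R\<close> by (auto simp: arrow_def)
  obtain h where h: "arrow R P M h" "\<And>x. x \<in> carrier P \<Longrightarrow> g (h x) = f (r x)"
    using projectiveD[OF assms(1) g s arrow_comp[OF assms(3) f]] by blast
  have "arrow R Q M (\<lambda>x. h (i x))" using arrow_comp[OF assms(2) h(1)] .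
  moreover have "g (h (i x)) = f x" if "x \<in> carrier Q" for x
    using h(2)[OF arrow_app[OF assms(2) that]] assms(4) that by simp
  ultimately show "\<exists>h\<in>mod_hom R Q M. \<forall>x\<in>carrier Q. g (h x) = f x"
    by (intro bexI[of _ "\<lambda>x. h (i x)"]) (auto simp: arrow_def)
qed

text \<open>
  The defining lifting property quantifies over modules with the carrier type of the module itself.  The
  description as a retract of a free module is free of this, and it lets projective
  modules be handled by coordinates.
\<close>

lemma projective_iff_free_retract:
  assumes R: "ring R" and P: "P \<in> fg_modules R"
  shows "projective_mod R P \<longleftrightarrow> (\<exists>n. \<exists>i\<in>mod_hom R P (free_module R n). \<exists>r\<in>mod_hom R (free_module R n) P.
    \<forall>x\<in>carrier P. r (i x) = x)"
proof
  interpret ring R by (rule R)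
  note F = free_left_module
  note lP = fg_left_module[OF P]
  assume pr: "projective_mod R P"
  obtain n p where p: "p \<in> mod_hom R (free_module R n) P" "p ` carrier (free_module R n) = carrier P"
    using left_module.free_cover[OF lP] P by (auto simp: fg_modules_def)
  obtain F' where F': "F' \<in> fg_modules R" "mod_isomorphic R (free_module R n) F'"
    using free_module_fg_copy[OF R] by blast
  obtain f g where fg: "f \<in> mod_hom R (free_module R n) F'" "g \<in> mod_hom R F' (free_module R n)"
    "bij_betw f (carrier (free_module R n)) (carrier F')"
    "\<And>x. x \<in> carrier (free_module R n) \<Longrightarrow> g (f x) = x" "\<And>y. y \<in> carrier F' \<Longrightarrow> f (g y) = y"
    using mod_isomorphicE[OF F fg_left_module[OF F'(1)] F'(2)] by blast
  have a: "arrow R F' P (\<lambda>x. p (g x))" using mod_hom_comp[OF fg(2) p(1)] F' P by (simp add: arrow_def)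
  have "(\<lambda>x. p (g x)) ` carrier F' = carrier P"
  proof -
    have "(\<lambda>x. p (g x)) ` carrier F' = p ` (g ` carrier F')" by (simp add: image_image)
    also have "g ` carrier F' = carrier (free_module R n)"
      by (rule surj_of_inverse[OF fg(2,1,4)])
    finally show ?thesis using p(2) by simp
  qed
  from projectiveD[OF pr a this arrow_id[OF P]]
  obtain h where h: "arrow R P F' h" "\<And>x. x \<in> carrier P \<Longrightarrow> p (g (h x)) = x" by blast
  have "(\<lambda>x. g (h x)) \<in> mod_hom R P (free_module R n)" using mod_hom_comp[OF arrow_fg(3)[OF h(1)] fg(2)] .
  then show "\<exists>n. \<exists>i\<in>mod_hom R P (free_module R n). \<exists>r\<in>mod_hom R (free_module R n) P. \<forall>x\<in>carrier P. r (i x) = x"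
    using p(1) h(2) by (intro exI[of _ n] bexI[of _ p] bexI[of _ "\<lambda>x. g (h x)"]) auto
next
  interpret ring R by (rule R)
  assume "\<exists>n. \<exists>i\<in>mod_hom R P (free_module R n). \<exists>r\<in>mod_hom R (free_module R n) P. \<forall>x\<in>carrier P. r (i x) = x"
  then obtain n i r where ir: "i \<in> mod_hom R P (free_module R n)" "r \<in> mod_hom R (free_module R n) P"
    "\<forall>x\<in>carrier P. r (i x) = x" by (elim exE bexE)
  show "projective_mod R P" unfolding projective_mod_def
  proof (intro conjI ballI impI P)
    fix M N g f assume M: "M \<in> fg_modules R" "N \<in> fg_modules R" and g: "g \<in> mod_hom R M N" "f \<in> mod_hom R P N"
      "g ` carrier M = carrier N"
    obtain h where h: "h \<in> mod_hom R (free_module R n) M" "\<forall>x\<in>carrier (free_module R n). g (h x) = f (r x)"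
      using free_lift[OF fg_left_module[OF M(1)] fg_left_module[OF M(2)] g(1,3) mod_hom_comp[OF ir(2) g(2)]] by blast
    have "g (h (i x)) = f x" if "x \<in> carrier P" for x
      using h(2)[rule_format, OF mod_hom_closed[OF ir(1) that]] ir(3) that by simp
    then show "\<exists>h\<in>mod_hom R P M. \<forall>x\<in>carrier P. g (h x) = f x"
      using mod_hom_comp[OF ir(1) h(1)] by (intro bexI[of _ "\<lambda>x. h (i x)"]) auto
  qed
qed

lemma projective_of_free_iso:
  assumes R: "ring R" and P: "P \<in> fg_modules R" and iso: "mod_isomorphic R (free_module R n) P"
  shows "projective_mod R P"
proof -
  interpret ring R by (rule R)
  obtain f g where fg: "f \<in> mod_hom R (free_module R n) P" "g \<in> mod_hom R P (free_module R n)"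
    "bij_betw f (carrier (free_module R n)) (carrier P)"
    "\<And>x. x \<in> carrier (free_module R n) \<Longrightarrow> g (f x) = x" "\<And>y. y \<in> carrier P \<Longrightarrow> f (g y) = y"
    using mod_isomorphicE[OF free_left_module fg_left_module[OF P] iso] by blast
  show ?thesis unfolding projective_iff_free_retract[OF R P] using fg(1,2,5) by blast
qed

definition cover :: "('a, 'b) ring_scheme \<Rightarrow> 'a fg_mod \<Rightarrow> 'a fg_mod \<Rightarrow> ((nat \<Rightarrow> 'a) set \<Rightarrow> (nat \<Rightarrow> 'a) set) \<Rightarrow> bool" where
  "cover R M P p \<longleftrightarrow> projective_mod R P \<and> arrow R P M p \<and> p ` carrier P = carrier M"

lemma coverD: "cover R M P p \<Longrightarrow> projective_mod R P" "cover R M P p \<Longrightarrow> arrow R P M p"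
  "cover R M P p \<Longrightarrow> p ` carrier P = carrier M"
  by (simp_all add: cover_def)

lemma cover_exists:
  assumes R: "ring R" and M: "M \<in> fg_modules R"
  shows "\<exists>P p. cover R M P p"
proof -
  interpret ring R by (rule R)
  note lM = fg_left_module[OF M]
  obtain n p where p: "p \<in> mod_hom R (free_module R n) M" "p ` carrier (free_module R n) = carrier M"
    using left_module.free_cover[OF lM] M by (auto simp: fg_modules_def)
  obtain P where P: "P \<in> fg_modules R" "mod_isomorphic R (free_module R n) P"
    using free_module_fg_copy[OF R] by blast
  obtain f g where fg: "f \<in> mod_hom R (free_module R n) P" "g \<in> mod_hom R P (free_module R n)"
    "bij_betw f (carrier (free_module R n)) (carrier P)"
    "\<And>x. x \<in> carrier (free_module R n) \<Longrightarrow> g (f x) = x" "\<And>y. y \<in> carrier P \<Longrightarrow> f (g y) = y"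
    using mod_isomorphicE[OF free_left_module fg_left_module[OF P(1)] P(2)] by blast
  have a: "arrow R P M (\<lambda>x. p (g x))" using mod_hom_comp[OF fg(2) p(1)] M P by (simp add: arrow_def)
  have "(\<lambda>x. p (g x)) ` carrier P = p ` (g ` carrier P)" by (simp add: image_image)
  also have "g ` carrier P = carrier (free_module R n)"
    by (rule surj_of_inverse[OF fg(2,1,4)])
  finally have "cover R M P (\<lambda>x. p (g x))" using a p(2) projective_of_free_iso[OF R P] unfolding cover_def by simp
  then show ?thesis by (intro exI)
qed

lemma cover_lift:
  assumes "cover R M P p" "cover R N Q q" "arrow R M N f"
  obtains F where "arrow R P Q F" "\<And>x. x \<in> carrier P \<Longrightarrow> q (F x) = f (p x)"
  using projectiveD[OF coverD(1)[OF assms(1)] coverD(2,3)[OF assms(2)] arrow_comp[OF coverD(2)[OF assms(1)] assms(3)]]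
  by blast

lemma projective_self_cover: "projective_mod R P \<Longrightarrow> cover R P P (\<lambda>x. x)"
  by (simp add: cover_def arrow_id projective_fg)

text \<open>
  Direct sums are described by their injections and projections.  As a relation this covers both the
  construction of a sum of two modules and the decomposition of a given module.
\<close>

definition biproduct :: "('a, 'b) ring_scheme \<Rightarrow> 'a fg_mod \<Rightarrow> 'a fg_mod \<Rightarrow> 'a fg_mod \<Rightarrow>
    ((nat \<Rightarrow> 'a) set \<Rightarrow> (nat \<Rightarrow> 'a) set) \<Rightarrow> ((nat \<Rightarrow> 'a) set \<Rightarrow> (nat \<Rightarrow> 'a) set) \<Rightarrow>
    ((nat \<Rightarrow> 'a) set \<Rightarrow> (nat \<Rightarrow> 'a) set) \<Rightarrow> ((nat \<Rightarrow> 'a) set \<Rightarrow> (nat \<Rightarrow> 'a) set) \<Rightarrow> bool" where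
  "biproduct R T M N i j p q \<longleftrightarrow> arrow R M T i \<and> arrow R N T j \<and> arrow R T M p \<and> arrow R T N q \<and>
     (\<forall>x\<in>carrier M. p (i x) = x \<and> q (i x) = \<zero>\<^bsub>N\<^esub>) \<and> (\<forall>x\<in>carrier N. q (j x) = x \<and> p (j x) = \<zero>\<^bsub>M\<^esub>) \<and>
     (\<forall>x\<in>carrier T. x = i (p x) \<oplus>\<^bsub>T\<^esub> j (q x))"

lemma biproductD:
  assumes "biproduct R T M N i j p q"
  shows "arrow R M T i" "arrow R N T j" "arrow R T M p" "arrow R T N q"
    "x \<in> carrier M \<Longrightarrow> p (i x) = x" "x \<in> carrier M \<Longrightarrow> q (i x) = \<zero>\<^bsub>N\<^esub>"
    "y \<in> carrier N \<Longrightarrow> q (j y) = y" "y \<in> carrier N \<Longrightarrow> p (j y) = \<zero>\<^bsub>M\<^esub>"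
    "z \<in> carrier T \<Longrightarrow> i (p z) \<oplus>\<^bsub>T\<^esub> j (q z) = z"
  using assms by (auto simp: biproduct_def)

lemma biproduct_exists:
  assumes M: "M \<in> fg_modules R" and N: "N \<in> fg_modules R"
  shows "\<exists>T i j p q. biproduct R T M N i j p q"
proof -
  note lM = fg_left_module[OF M] and lN = fg_left_module[OF N]
  interpret M: left_module R M by (rule lM)
  interpret N: left_module R N by (rule lN)
  note lP = prod_left_module[OF lM lN]
  have "fin_gen R (prod_module M N)" using prod_fin_gen[OF lM lN] M N by (simp add: fg_modules_def)
  then obtain T where T: "T \<in> fg_modules R" "mod_isomorphic R (prod_module M N) T"
    using fg_modules_adequate[OF lP] by blast
  obtain f g where fg: "f \<in> mod_hom R (prod_module M N) T" "g \<in> mod_hom R T (prod_module M N)"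
    "bij_betw f (carrier (prod_module M N)) (carrier T)"
    "\<And>x. x \<in> carrier (prod_module M N) \<Longrightarrow> g (f x) = x" "\<And>y. y \<in> carrier T \<Longrightarrow> f (g y) = y"
    using mod_isomorphicE[OF lP fg_left_module[OF T(1)] T(2)] by blast
  have i1: "(\<lambda>x. (x, \<zero>\<^bsub>N\<^esub>)) \<in> mod_hom R M (prod_module M N)" by (intro mod_homI) auto
  have i2: "(\<lambda>x. (\<zero>\<^bsub>M\<^esub>, x)) \<in> mod_hom R N (prod_module M N)" by (intro mod_homI) auto
  have p1: "fst \<in> mod_hom R (prod_module M N) M" "snd \<in> mod_hom R (prod_module M N) N" by (intro mod_homI; auto)+
  have "biproduct R T M N (\<lambda>x. f (x, \<zero>\<^bsub>N\<^esub>)) (\<lambda>x. f (\<zero>\<^bsub>M\<^esub>, x)) (\<lambda>x. fst (g x)) (\<lambda>x. snd (g x))"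
    unfolding biproduct_def
  proof (intro conjI ballI)
    fix x assume x: "x \<in> carrier T"
    have gx: "g x \<in> carrier M \<times> carrier N" using mod_hom_closed[OF fg(2) x] by simp
    then have "f (fst (g x), \<zero>\<^bsub>N\<^esub>) \<oplus>\<^bsub>T\<^esub> f (\<zero>\<^bsub>M\<^esub>, snd (g x)) = f (g x)"
      by (subst mod_hom_add[OF fg(1), symmetric]) auto
    then show "x = f (fst (g x), \<zero>\<^bsub>N\<^esub>) \<oplus>\<^bsub>T\<^esub> f (\<zero>\<^bsub>M\<^esub>, snd (g x))" using fg(5)[OF x] by simp
  qed (use M N T fg(4) mod_hom_comp[OF i1 fg(1)] mod_hom_comp[OF i2 fg(1)] mod_hom_comp[OF fg(2) p1(1)]
      mod_hom_comp[OF fg(2) p1(2)] in \<open>auto simp: arrow_def\<close>)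
  then show ?thesis by blast
qed

text \<open>The two universal properties of a biproduct.\<close>

lemma biproduct_copair:
  assumes B: "biproduct R T M N i j p q" and f: "arrow R M L f" and g: "arrow R N L g"
  shows "arrow R T L (\<lambda>x. f (p x) \<oplus>\<^bsub>L\<^esub> g (q x))"
    "x \<in> carrier M \<Longrightarrow> f (p (i x)) \<oplus>\<^bsub>L\<^esub> g (q (i x)) = f x"
    "y \<in> carrier N \<Longrightarrow> f (p (j y)) \<oplus>\<^bsub>L\<^esub> g (q (j y)) = g y"
proof -
  interpret L: left_module R L by (rule arrow_lm(2)[OF f])
  note D = biproductD[OF B]
  show "arrow R T L (\<lambda>x. f (p x) \<oplus>\<^bsub>L\<^esub> g (q x))" by (intro arrow_plus arrow_comp[OF D(3) f] arrow_comp[OF D(4) g])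
  show "x \<in> carrier M \<Longrightarrow> f (p (i x)) \<oplus>\<^bsub>L\<^esub> g (q (i x)) = f x"
    using arrow_zero[OF g] arrow_app[OF f] by (simp add: D)
  show "y \<in> carrier N \<Longrightarrow> f (p (j y)) \<oplus>\<^bsub>L\<^esub> g (q (j y)) = g y"
    using arrow_zero[OF f] arrow_app[OF g] by (simp add: D)
qed

lemma biproduct_pair:
  assumes B: "biproduct R T M N i j p q" and f: "arrow R L M f" and g: "arrow R L N g"
  shows "arrow R L T (\<lambda>x. i (f x) \<oplus>\<^bsub>T\<^esub> j (g x))"
    "x \<in> carrier L \<Longrightarrow> p (i (f x) \<oplus>\<^bsub>T\<^esub> j (g x)) = f x"
    "x \<in> carrier L \<Longrightarrow> q (i (f x) \<oplus>\<^bsub>T\<^esub> j (g x)) = g x"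
proof -
  note D = biproductD[OF B]
  interpret M: left_module R M by (rule arrow_lm(1)[OF D(1)])
  interpret N: left_module R N by (rule arrow_lm(1)[OF D(2)])
  show "arrow R L T (\<lambda>x. i (f x) \<oplus>\<^bsub>T\<^esub> j (g x))" by (intro arrow_plus arrow_comp[OF f D(1)] arrow_comp[OF g D(2)])
  assume x: "x \<in> carrier L"
  note c = arrow_app[OF f x] arrow_app[OF g x]
  show "p (i (f x) \<oplus>\<^bsub>T\<^esub> j (g x)) = f x" "q (i (f x) \<oplus>\<^bsub>T\<^esub> j (g x)) = g x"
    using c by (simp_all add: arrow_add[OF D(3)] arrow_add[OF D(4)] arrow_app[OF D(1)] arrow_app[OF D(2)] D(5-8))
qed

lemma biproduct_projective:
  assumes B: "biproduct R T P Q i j p q" and P: "projective_mod R P" and Q: "projective_mod R Q"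
  shows "projective_mod R T"
  unfolding projective_mod_def
proof (intro conjI ballI impI)
  note D = biproductD[OF B]
  show T: "T \<in> fg_modules R" using D(1) by (rule arrow_fg)
  fix M N g f assume M: "M \<in> fg_modules R" "N \<in> fg_modules R" and g0: "g \<in> mod_hom R M N" and f0: "f \<in> mod_hom R T N"
    and s: "g ` carrier M = carrier N"
  then have g: "arrow R M N g" and f: "arrow R T N f" using T by (auto simp: arrow_def)
  interpret N: left_module R N using M by (intro fg_left_module)
  obtain h where h: "arrow R P M h" "\<And>x. x \<in> carrier P \<Longrightarrow> g (h x) = f (i x)"
    using projectiveD[OF P g s arrow_comp[OF D(1) f]] by blast
  obtain k where k: "arrow R Q M k" "\<And>x. x \<in> carrier Q \<Longrightarrow> g (k x) = f (j x)"
    using projectiveD[OF Q g s arrow_comp[OF D(2) f]] by blast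
  have "g (h (p x) \<oplus>\<^bsub>M\<^esub> k (q x)) = f x" if x: "x \<in> carrier T" for x
  proof -
    note c = arrow_app[OF D(3) x] arrow_app[OF D(4) x]
    have "g (h (p x) \<oplus>\<^bsub>M\<^esub> k (q x)) = f (i (p x)) \<oplus>\<^bsub>N\<^esub> f (j (q x))"
      using c by (simp add: arrow_add[OF g] arrow_app[OF h(1)] arrow_app[OF k(1)] h(2) k(2))
    also have "\<dots> = f (i (p x) \<oplus>\<^bsub>T\<^esub> j (q x))" using c by (simp add: arrow_add[OF f] arrow_app[OF D(1)] arrow_app[OF D(2)])
    finally show ?thesis using D(9)[OF x] by simp
  qed
  then show "\<exists>h\<in>mod_hom R T M. \<forall>x\<in>carrier T. g (h x) = f x"
    using biproduct_copair(1)[OF B h(1) k(1)] by (auto simp: arrow_def intro!: bexI[of _ "\<lambda>x. h (p x) \<oplus>\<^bsub>M\<^esub> k (q x)"])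
qed

lemma zero_module_fg:
  assumes "ring R"
  shows "\<exists>Z\<in>fg_modules R. carrier Z = {\<zero>\<^bsub>Z\<^esub>}"
proof -
  obtain Z where Z: "Z \<in> fg_modules R" "mod_isomorphic R (free_module R 0) Z"
    using free_module_fg_copy[OF assms] by blast
  interpret Z: left_module R Z by (rule fg_left_module[OF Z(1)])
  obtain f where "bij_betw f (carrier (free_module R 0)) (carrier Z)" using Z(2) by (auto simp: mod_isomorphic_def)
  moreover have "\<exists>a. carrier (free_module R 0) = {a}" by auto
  ultimately obtain b where "carrier Z = {b}" by (auto simp: bij_betw_def)
  then have "carrier Z = {\<zero>\<^bsub>Z\<^esub>}" using Z.M.zero_closed by auto
  then show ?thesis using Z(1) by blast
qed

lemma zero_module_projective:
  assumes "Z \<in> fg_modules R" "carrier Z = {\<zero>\<^bsub>Z\<^esub>}"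
  shows "projective_mod R Z"
  unfolding projective_mod_def
proof (intro conjI ballI impI)
  fix M N g f assume M: "M \<in> fg_modules R" "N \<in> fg_modules R" "g \<in> mod_hom R M N" "f \<in> mod_hom R Z N"
  have "arrow R Z M (\<lambda>x. \<zero>\<^bsub>M\<^esub>)" using assms M by (intro arrow_const_zero)
  moreover have "g \<zero>\<^bsub>M\<^esub> = f \<zero>\<^bsub>Z\<^esub>"
    using mod_hom_zero[OF fg_left_module[OF M(1)] fg_left_module[OF M(2)] M(3)]
      mod_hom_zero[OF fg_left_module[OF assms(1)] fg_left_module[OF M(2)] M(4)] by simp
  ultimately show "\<exists>h\<in>mod_hom R Z M. \<forall>x\<in>carrier Z. g (h x) = f x"
    using assms(2) by (intro bexI[of _ "\<lambda>x. \<zero>\<^bsub>M\<^esub>"]) (auto simp: arrow_def)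
qed (rule assms)

section \<open>Maps that vanish after taking syzygies\<close>

text \<open>
  A map is \<open>k\<close>-null if the map that it induces on \<open>k\<close>-th syzygies factors through a projective
  module; equivalently, it induces zero on all extension groups of degree above \<open>k\<close>.  The identity of
  \<open>M\<close> is \<open>k\<close>-null if and only if \<open>M\<close> has projective dimension at most \<open>k\<close>.
\<close>

primrec null :: "('a, 'b) ring_scheme \<Rightarrow> nat \<Rightarrow> 'a fg_mod \<Rightarrow> 'a fg_mod \<Rightarrow>
    ((nat \<Rightarrow> 'a) set \<Rightarrow> (nat \<Rightarrow> 'a) set) \<Rightarrow> bool" where
  "null R 0 M N f \<longleftrightarrow> (\<exists>Q u v. projective_mod R Q \<and> arrow R M Q u \<and> arrow R Q N v \<and>
     (\<forall>x\<in>carrier M. f x = v (u x)))"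
| "null R (Suc k) M N f \<longleftrightarrow> arrow R M N f \<and> (\<exists>P p Q q F. cover R M P p \<and> cover R N Q q \<and> arrow R P Q F \<and>
     (\<forall>x\<in>carrier P. q (F x) = f (p x)) \<and> null R k (ker_mod P M p) (ker_mod Q N q) F)"

lemma null_arrow: "null R k M N f \<Longrightarrow> arrow R M N f"
proof (cases k)
  case 0
  assume "null R k M N f"
  then obtain Q u v where "arrow R M Q u" "arrow R Q N v" "\<forall>x\<in>carrier M. f x = v (u x)" using 0 by auto
  then show ?thesis using arrow_cong[OF arrow_comp] by blast
qed auto

lemma null_cong:
  assumes "null R k M N f" "\<And>x. x \<in> carrier M \<Longrightarrow> g x = f x"
  shows "null R k M N g"
proof (cases k)
  case 0
  then show ?thesis using assms by auto
next
  case (Suc k')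
  from assms(1) obtain P p Q q F where *: "cover R M P p" "cover R N Q q" "arrow R P Q F"
     "\<forall>x\<in>carrier P. q (F x) = f (p x)" "null R k' (ker_mod P M p) (ker_mod Q N q) F" unfolding Suc by auto
  have "\<forall>x\<in>carrier P. q (F x) = g (p x)" using *(4) assms(2) arrow_app[OF coverD(2)[OF *(1)]] by simp
  moreover have "arrow R M N g" using arrow_cong[OF null_arrow[OF assms(1)] assms(2)] .
  ultimately show ?thesis unfolding Suc null.simps(2) using * by (intro conjI exI) auto
qed

lemma submodule_minus_eq:
  assumes "left_module R M" "submodule H R M" "x \<in> H" "y \<in> H"
  shows "x \<ominus>\<^bsub>M\<lparr>carrier := H\<rparr>\<^esub> y = x \<ominus>\<^bsub>M\<^esub> y"
proof -
  interpret left_module R M by fact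
  interpret H: left_module R "M\<lparr>carrier := H\<rparr>" using submodule_left_module[OF assms(2)] .
  have "\<ominus>\<^bsub>M\<lparr>carrier := H\<rparr>\<^esub> y = \<ominus>\<^bsub>M\<^esub> y"
    using submodule_neg[OF assms(2,4)] submodule_in[OF assms(2,4)]
    using assms(4) by (intro H.M.minus_equality) (auto simp: M.l_neg)
  then show ?thesis by (simp add: a_minus_def)
qed

lemma ker_minus_eq:
  assumes "arrow R P M p" "x \<in> carrier (ker_mod P M p)" "y \<in> carrier (ker_mod P M p)"
  shows "x \<ominus>\<^bsub>ker_mod P M p\<^esub> y = x \<ominus>\<^bsub>P\<^esub> y"
  using assms(2,3) unfolding ker_mod_def
  by (intro submodule_minus_eq[OF arrow_lm(1)[OF assms(1)]
        submodule_kernel[OF arrow_lm[OF assms(1)] arrow_fg(3)[OF assms(1)]]]) auto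

context noetherian_ring begin

lemma ker_fg: "arrow R P M p \<Longrightarrow> ker_mod P M p \<in> fg_modules R"
  unfolding ker_mod_def by (intro submodule_fg submodule_kernel) (auto intro: arrow_lm arrow_fg)

lemma arrow_into_ker:
  assumes "arrow R L Q d" "arrow R Q N q" "\<And>x. x \<in> carrier L \<Longrightarrow> q (d x) = \<zero>\<^bsub>N\<^esub>"
  shows "arrow R L (ker_mod Q N q) d"
  using assms arrow_app[OF assms(1)] arrow_add[OF assms(1)] arrow_smult[OF assms(1)]
  by (intro arrowI ker_fg[OF assms(2)]) (auto intro: arrow_fg)

lemma arrow_ker_incl:
  assumes "arrow R Q N q" shows "arrow R (ker_mod Q N q) Q (\<lambda>x. x)"
  using assms by (intro arrowI ker_fg[OF assms]) (auto intro: arrow_fg)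

lemma arrow_ker:
  assumes F: "arrow R P Q F" and p: "arrow R P M p" and q: "arrow R Q N q" and f: "arrow R M N f"
    and c: "\<And>x. x \<in> carrier P \<Longrightarrow> q (F x) = f (p x)"
  shows "arrow R (ker_mod P M p) (ker_mod Q N q) F"
  by (rule arrow_into_ker[OF arrow_comp[OF arrow_ker_incl[OF p] F] q]) (auto simp: c arrow_zero[OF f])

lemma null_comp:
  assumes "null R k M N f" "arrow R M' M e" "arrow R N N' g"
  shows "null R k M' N' (\<lambda>x. g (f (e x)))"
  using assms
proof (induction k arbitrary: M N f M' N' e g)
  case 0
  then obtain Q u v where Q: "projective_mod R Q" "arrow R M Q u" "arrow R Q N v" "\<forall>x\<in>carrier M. f x = v (u x)" by auto
  show ?case unfolding null.simps(1)
    by (rule exI[of _ Q], rule exI[of _ "\<lambda>x. u (e x)"], rule exI[of _ "\<lambda>x. g (v x)"])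
      (use Q arrow_comp[OF 0(2) Q(2)] arrow_comp[OF Q(3) 0(3)] arrow_app[OF 0(2)] in auto)
next
  case (Suc k)
  from Suc.prems(1) obtain P p Q q F where *: "cover R M P p" "cover R N Q q" "arrow R P Q F"
     "\<forall>x\<in>carrier P. q (F x) = f (p x)" "null R k (ker_mod P M p) (ker_mod Q N q) F" by auto
  have f: "arrow R M N f" using Suc.prems(1) by simp
  obtain P' p' where P': "cover R M' P' p'" using cover_exists[OF ring_axioms arrow_fg(1)[OF Suc.prems(2)]] by blast
  obtain Q' q' where Q': "cover R N' Q' q'" using cover_exists[OF ring_axioms arrow_fg(2)[OF Suc.prems(3)]] by blast
  obtain E where E: "arrow R P' P E" "\<And>x. x \<in> carrier P' \<Longrightarrow> p (E x) = e (p' x)"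
    using cover_lift[OF P' *(1) Suc.prems(2)] by blast
  obtain G where G: "arrow R Q Q' G" "\<And>x. x \<in> carrier Q \<Longrightarrow> q' (G x) = g (q x)"
    using cover_lift[OF *(2) Q' Suc.prems(3)] by blast
  have "null R k (ker_mod P' M' p') (ker_mod Q' N' q') (\<lambda>x. G (F (E x)))"
    using Suc.IH[OF *(5) arrow_ker[OF E(1) coverD(2)[OF P'] coverD(2)[OF *(1)] Suc.prems(2) E(2)]
        arrow_ker[OF G(1) coverD(2)[OF *(2)] coverD(2)[OF Q'] Suc.prems(3) G(2)]] .
  moreover have "arrow R M' N' (\<lambda>x. g (f (e x)))"
    using arrow_comp[OF arrow_comp[OF Suc.prems(2) f] Suc.prems(3)] .
  moreover have "arrow R P' Q' (\<lambda>x. G (F (E x)))" using arrow_comp[OF arrow_comp[OF E(1) *(3)] G(1)] .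
  moreover have "\<forall>x\<in>carrier P'. q' (G (F (E x))) = g (f (e (p' x)))"
    using E G *(4) arrow_app[OF E(1)] arrow_app[OF *(3)] by simp
  ultimately show ?case unfolding null.simps(2) using P' Q' by (intro conjI exI) auto
qed

lemma null_projective_id: "projective_mod R Q \<Longrightarrow> null R k Q Q (\<lambda>x. x)"
proof (induction k arbitrary: Q)
  case 0
  then show ?case using arrow_id[OF projective_fg[OF 0]] by auto
next
  case (Suc k)
  note Q = projective_fg[OF Suc.prems]
  interpret Q: left_module R Q by (rule fg_left_module[OF Q])
  have "projective_mod R (ker_mod Q Q (\<lambda>x. x))"
    by (rule zero_module_projective[OF ker_fg[OF arrow_id[OF Q]]]) auto
  from Suc.IH[OF this] show ?case unfolding null.simps(2)
    using arrow_id[OF Q] projective_self_cover[OF Suc.prems] by (intro conjI exI) auto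
qed

lemma null_0_null:
  assumes "null R 0 M N f" shows "null R k M N f"
proof -
  from assms obtain Q u v where Q: "projective_mod R Q" "arrow R M Q u" "arrow R Q N v" "\<forall>x\<in>carrier M. f x = v (u x)" by auto
  show ?thesis using null_cong[OF null_comp[OF null_projective_id[OF Q(1)] Q(2,3)]] Q(4) by simp
qed

lemma null_through_projective:
  assumes "projective_mod R Q" "arrow R M Q u" "arrow R Q N v"
  shows "null R k M N (\<lambda>x. v (u x))"
  by (rule null_0_null) (use assms in auto)

text \<open>
  Two lifts of the same map differ by a map into the kernel that factors through a projective module,
  so \<open>k\<close>-nullity does not depend on the choice of the covers and of the lift.  This needs sums of
  \<open>k\<close>-null maps, whose treatment in turn needs the independence in the degree below: both are
  established by one induction.
\<close>

lemma null_independent_step: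
  assumes add: "\<And>M N f g. null R k M N f \<Longrightarrow> null R k M N g \<Longrightarrow> null R k M N (\<lambda>x. f x \<oplus>\<^bsub>N\<^esub> g x)"
    and n: "null R (Suc k) M N f" and P': "cover R M P' p'" and Q': "cover R N Q' q'"
    and F': "arrow R P' Q' F'" "\<And>x. x \<in> carrier P' \<Longrightarrow> q' (F' x) = f (p' x)"
  shows "null R k (ker_mod P' M p') (ker_mod Q' N q') F'"
proof -
  from n obtain P p Q q F where *: "cover R M P p" "cover R N Q q" "arrow R P Q F"
     "\<forall>x\<in>carrier P. q (F x) = f (p x)" "null R k (ker_mod P M p) (ker_mod Q N q) F" by auto
  have f: "arrow R M N f" using n by simp
  interpret N: left_module R N by (rule arrow_lm(2)[OF f])
  interpret Q': left_module R Q' by (rule arrow_lm(2)[OF F'(1)])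
  have idM: "arrow R M M (\<lambda>x. x)" "arrow R N N (\<lambda>x. x)" using f arrow_id arrow_fg by blast+
  obtain a where a: "arrow R P' P a" "\<And>x. x \<in> carrier P' \<Longrightarrow> p (a x) = p' x"
    using cover_lift[OF P' *(1) idM(1)] by blast
  obtain b where b: "arrow R Q Q' b" "\<And>x. x \<in> carrier Q \<Longrightarrow> q' (b x) = q x"
    using cover_lift[OF *(2) Q' idM(2)] by blast
  have bFa: "arrow R P' Q' (\<lambda>x. b (F (a x)))" using arrow_comp[OF arrow_comp[OF a(1) *(3)] b(1)] .
  define d where "d x = F' x \<ominus>\<^bsub>Q'\<^esub> b (F (a x))" for x
  have d: "arrow R P' Q' d" unfolding d_def using arrow_diff[OF F'(1) bFa] .
  have "q' (d x) = \<zero>\<^bsub>N\<^esub>" if x: "x \<in> carrier P'" for x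
  proof -
    have "q' (b (F (a x))) = f (p' x)" using x a b *(4) arrow_app[OF a(1)] arrow_app[OF *(3)] by simp
    moreover have "f (p' x) \<in> carrier N" using x arrow_app[OF f] arrow_app[OF coverD(2)[OF P']] by blast
    ultimately show ?thesis unfolding d_def
      using x arrow_app[OF F'(1) x] arrow_app[OF bFa x] F'(2)[OF x]
      by (simp add: arrow_minus[OF coverD(2)[OF Q']] N.M.minus_zero_iff)
  qed
  then have d': "arrow R P' (ker_mod Q' N q') d" by (rule arrow_into_ker[OF d coverD(2)[OF Q']])
  have 1: "null R k (ker_mod P' M p') (ker_mod Q' N q') (\<lambda>x. b (F (a x)))"
    by (rule null_comp[OF *(5) arrow_ker[OF a(1) coverD(2)[OF P'] coverD(2)[OF *(1)] idM(1) a(2)]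
          arrow_ker[OF b(1) coverD(2)[OF *(2)] coverD(2)[OF Q'] idM(2) b(2)]])
  have 2: "null R k (ker_mod P' M p') (ker_mod Q' N q') (\<lambda>x. d x)"
    by (rule null_through_projective[OF coverD(1)[OF P'] arrow_ker_incl[OF coverD(2)[OF P']] d'])
  show ?thesis
  proof (rule null_cong[OF add[OF 2 1]])
    fix x assume "x \<in> carrier (ker_mod P' M p')"
    then show "F' x = d x \<oplus>\<^bsub>ker_mod Q' N q'\<^esub> b (F (a x))"
      using arrow_app[OF F'(1)] arrow_app[OF bFa] by (simp add: d_def Q'.M.minus_add_cancel)
  qed
qed

lemma null_add:
  assumes "null R k M N f" "null R k M N g"
  shows "null R k M N (\<lambda>x. f x \<oplus>\<^bsub>N\<^esub> g x)"
  using assms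
proof (induction k arbitrary: M N f g)
  case 0
  obtain Q u v where Q: "projective_mod R Q" "arrow R M Q u" "arrow R Q N v" "\<forall>x\<in>carrier M. f x = v (u x)"
    using 0(1) by auto
  obtain Q' u' v' where Q': "projective_mod R Q'" "arrow R M Q' u'" "arrow R Q' N v'" "\<forall>x\<in>carrier M. g x = v' (u' x)"
    using 0(2) by auto
  obtain T i j p q where B: "biproduct R T Q Q' i j p q"
    using biproduct_exists[OF projective_fg[OF Q(1)] projective_fg[OF Q'(1)]] by blast
  note pair = biproduct_pair[OF B Q(2) Q'(2)] and copair = biproduct_copair[OF B Q(3) Q'(3)]
  show ?case unfolding null.simps(1)
    by (rule exI[of _ T], rule exI[of _ "\<lambda>x. i (u x) \<oplus>\<^bsub>T\<^esub> j (u' x)"], rule exI[of _ "\<lambda>x. v (p x) \<oplus>\<^bsub>N\<^esub> v' (q x)"])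
      (use Q(4) Q'(4) pair copair(1) biproduct_projective[OF B Q(1) Q'(1)] in auto)
next
  case (Suc k)
  have f: "arrow R M N f" and g: "arrow R M N g" using Suc.prems by auto
  obtain P p where P: "cover R M P p" using cover_exists[OF ring_axioms arrow_fg(1)[OF f]] by blast
  obtain Q q where Q: "cover R N Q q" using cover_exists[OF ring_axioms arrow_fg(2)[OF f]] by blast
  obtain F where F: "arrow R P Q F" "\<And>x. x \<in> carrier P \<Longrightarrow> q (F x) = f (p x)" using cover_lift[OF P Q f] by blast
  obtain G where G: "arrow R P Q G" "\<And>x. x \<in> carrier P \<Longrightarrow> q (G x) = g (p x)" using cover_lift[OF P Q g] by blast
  have "null R k (ker_mod P M p) (ker_mod Q N q) (\<lambda>x. F x \<oplus>\<^bsub>ker_mod Q N q\<^esub> G x)"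
    by (intro Suc.IH null_independent_step[OF Suc.IH Suc.prems(1) P Q F] null_independent_step[OF Suc.IH Suc.prems(2) P Q G])
  then have "null R k (ker_mod P M p) (ker_mod Q N q) (\<lambda>x. F x \<oplus>\<^bsub>Q\<^esub> G x)" by simp
  moreover have "\<forall>x\<in>carrier P. q (F x \<oplus>\<^bsub>Q\<^esub> G x) = f (p x) \<oplus>\<^bsub>N\<^esub> g (p x)"
    using F G arrow_app[OF F(1)] arrow_app[OF G(1)] by (simp add: arrow_add[OF coverD(2)[OF Q]])
  ultimately show ?case unfolding null.simps(2)
    using P Q arrow_plus[OF f g] arrow_plus[OF F(1) G(1)] by (intro conjI exI) auto
qed

lemma null_lift:
  assumes "null R (Suc k) M N f" "cover R M P p" "cover R N Q q" "arrow R P Q F"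
    "\<And>x. x \<in> carrier P \<Longrightarrow> q (F x) = f (p x)"
  shows "null R k (ker_mod P M p) (ker_mod Q N q) F"
  using null_independent_step[OF null_add assms] .

lemma null_unlift:
  assumes "null R k (ker_mod P M p) (ker_mod Q N q) F" "cover R M P p" "cover R N Q q" "arrow R P Q F"
    "arrow R M N f" "\<And>x. x \<in> carrier P \<Longrightarrow> q (F x) = f (p x)"
  shows "null R (Suc k) M N f"
  unfolding null.simps(2) using assms by (intro conjI exI) auto

lemma null_Suc: "null R k M N f \<Longrightarrow> null R (Suc k) M N f"
proof (induction k arbitrary: M N f)
  case 0 then show ?case by (rule null_0_null)
next
  case (Suc k)
  from Suc.prems obtain P p Q q F where *: "cover R M P p" "cover R N Q q" "arrow R P Q F"
     "\<forall>x\<in>carrier P. q (F x) = f (p x)" "null R k (ker_mod P M p) (ker_mod Q N q) F" by auto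
  show ?case using null_unlift[OF Suc.IH[OF *(5)] *(1-3)] *(4) Suc.prems by simp
qed

lemma null_mono: "null R k M N f \<Longrightarrow> k \<le> l \<Longrightarrow> null R l M N f"
  by (induction l) (auto simp del: null.simps simp: le_Suc_eq intro: null_Suc)

lemma null_neg:
  assumes "null R k M N f" shows "null R k M N (\<lambda>x. \<ominus>\<^bsub>N\<^esub> f x)"
  using null_comp[OF assms arrow_id arrow_neg] null_arrow[OF assms] arrow_fg by blast

lemma null_id_projective: "null R 0 M M (\<lambda>x. x) \<longleftrightarrow> projective_mod R M"
proof
  assume "null R 0 M M (\<lambda>x. x)"
  then obtain Q u v where Q: "projective_mod R Q" "arrow R M Q u" "arrow R Q M v" "\<forall>x\<in>carrier M. x = v (u x)" by auto
  show "projective_mod R M" using projective_retract[OF Q(1-3)] Q(4) by simp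
qed (rule null_projective_id)

lemma null_id_lift:
  assumes "null R (Suc k) M M (\<lambda>x. x)" "cover R M P p"
  shows "null R k (ker_mod P M p) (ker_mod P M p) (\<lambda>x. x)"
  by (rule null_lift[OF assms assms(2)]) (auto intro: arrow_id projective_fg coverD(1)[OF assms(2)])

lemma null_id_unlift:
  assumes "null R k (ker_mod P M p) (ker_mod P M p) (\<lambda>x. x)" "cover R M P p"
  shows "null R (Suc k) M M (\<lambda>x. x)"
  by (rule null_unlift[OF assms assms(2)])
    (auto intro: arrow_id projective_fg coverD(1)[OF assms(2)] arrow_fg(2)[OF coverD(2)[OF assms(2)]])

subsection \<open>Congruence of maps modulo null maps\<close>

definition null_cong_maps where
  "null_cong_maps k M N f g \<longleftrightarrow> arrow R M N f \<and> arrow R M N g \<and> null R k M N (\<lambda>x. f x \<ominus>\<^bsub>N\<^esub> g x)"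

abbreviation (input) ncong ("_: _ \<approx> _ on _ to _") where
  "k: f \<approx> g on M to N \<equiv> null_cong_maps k M N f g"

lemma nceq_arrows: "k: f \<approx> g on M to N \<Longrightarrow> arrow R M N f" "k: f \<approx> g on M to N \<Longrightarrow> arrow R M N g"
  by (simp_all add: null_cong_maps_def)

lemma null_zero:
  assumes "M \<in> fg_modules R" "N \<in> fg_modules R"
  shows "null R k M N (\<lambda>x. \<zero>\<^bsub>N\<^esub>)"
proof -
  obtain Z where Z: "Z \<in> fg_modules R" "carrier Z = {\<zero>\<^bsub>Z\<^esub>}" using zero_module_fg[OF ring_axioms] by blast
  show ?thesis
    using null_through_projective[OF zero_module_projective[OF Z] arrow_const_zero[OF assms(1) Z(1)] arrow_const_zero[OF Z(1) assms(2)]] .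
qed

lemma nceq_refl:
  assumes "arrow R M N f" "\<And>x. x \<in> carrier M \<Longrightarrow> g x = f x"
  shows "k: f \<approx> g on M to N"
proof -
  interpret N: left_module R N by (rule arrow_lm(2)[OF assms(1)])
  have "null R k M N (\<lambda>x. f x \<ominus>\<^bsub>N\<^esub> g x)"
    by (rule null_cong[OF null_zero[OF arrow_fg(1,2)[OF assms(1)]]])
      (use assms(2) arrow_app[OF assms(1)] in \<open>simp add: N.M.minus_zero_iff\<close>)
  then show ?thesis using assms arrow_cong[OF assms] by (simp add: null_cong_maps_def)
qed

lemma nceq_sym:
  assumes "k: f \<approx> g on M to N" shows "k: g \<approx> f on M to N"
proof -
  note a = nceq_arrows[OF assms]
  interpret N: left_module R N by (rule arrow_lm(2)[OF a(1)])
  have "null R k M N (\<lambda>x. g x \<ominus>\<^bsub>N\<^esub> f x)"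
    by (rule null_cong[OF null_neg[of k M N "\<lambda>x. f x \<ominus>\<^bsub>N\<^esub> g x"]])
      (use assms arrow_app[OF a(1)] arrow_app[OF a(2)] in \<open>simp_all add: N.M.minus_swap null_cong_maps_def\<close>)
  then show ?thesis using a by (simp add: null_cong_maps_def)
qed

lemma nceq_trans:
  assumes "k: f \<approx> g on M to N" "k: g \<approx> h on M to N" shows "k: f \<approx> h on M to N"
proof -
  note a = nceq_arrows[OF assms(1)] nceq_arrows[OF assms(2)]
  interpret N: left_module R N by (rule arrow_lm(2)[OF a(1)])
  have "null R k M N (\<lambda>x. (f x \<ominus>\<^bsub>N\<^esub> g x) \<oplus>\<^bsub>N\<^esub> (g x \<ominus>\<^bsub>N\<^esub> h x))"
    using assms by (intro null_add) (simp_all add: null_cong_maps_def)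
  then have "null R k M N (\<lambda>x. f x \<ominus>\<^bsub>N\<^esub> h x)"
    by (rule null_cong) (use arrow_app[OF a(1)] arrow_app[OF a(2)] arrow_app[OF a(4)] in \<open>simp add: N.M.minus_telescope\<close>)
  then show ?thesis using a by (simp add: null_cong_maps_def)
qed

lemma nceq_comp:
  assumes "k: f \<approx> g on M to N" "arrow R M' M e" "arrow R N N' h"
  shows "k: (\<lambda>x. h (f (e x))) \<approx> (\<lambda>x. h (g (e x))) on M' to N'"
proof -
  note a = nceq_arrows[OF assms(1)]
  have "null R k M' N' (\<lambda>x. h (f (e x) \<ominus>\<^bsub>N\<^esub> g (e x)))"
    using null_comp[OF _ assms(2,3), of k "\<lambda>x. f x \<ominus>\<^bsub>N\<^esub> g x"] assms(1) by (simp add: null_cong_maps_def)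
  then have "null R k M' N' (\<lambda>x. h (f (e x)) \<ominus>\<^bsub>N'\<^esub> h (g (e x)))"
    by (rule null_cong) (use arrow_app[OF assms(2)] arrow_app[OF a(1)] arrow_app[OF a(2)] in \<open>simp add: arrow_minus[OF assms(3)]\<close>)
  then show ?thesis
    using arrow_comp[OF arrow_comp[OF assms(2) a(1)] assms(3)] arrow_comp[OF arrow_comp[OF assms(2) a(2)] assms(3)]
    by (simp add: null_cong_maps_def)
qed

lemma nceq_pre: "k: f \<approx> g on M to N \<Longrightarrow> arrow R M' M e \<Longrightarrow> k: (\<lambda>x. f (e x)) \<approx> (\<lambda>x. g (e x)) on M' to N"
  using nceq_comp[of k M N f g M' e N "\<lambda>x. x"] nceq_arrows arrow_id arrow_fg by blast

lemma nceq_post: "k: f \<approx> g on M to N \<Longrightarrow> arrow R N N' h \<Longrightarrow> k: (\<lambda>x. h (f x)) \<approx> (\<lambda>x. h (g x)) on M to N'"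
  using nceq_comp[of k M N f g M "\<lambda>x. x" N' h] nceq_arrows arrow_id arrow_fg by blast

lemma nceq_mono: "k: f \<approx> g on M to N \<Longrightarrow> k \<le> l \<Longrightarrow> l: f \<approx> g on M to N"
  by (auto simp: null_cong_maps_def intro: null_mono)

lemma nceq_add:
  assumes "k: f \<approx> g on M to N" "k: f' \<approx> g' on M to N"
  shows "k: (\<lambda>x. f x \<oplus>\<^bsub>N\<^esub> f' x) \<approx> (\<lambda>x. g x \<oplus>\<^bsub>N\<^esub> g' x) on M to N"
proof -
  note a = nceq_arrows[OF assms(1)] nceq_arrows[OF assms(2)]
  interpret N: left_module R N by (rule arrow_lm(2)[OF a(1)])
  have "null R k M N (\<lambda>x. (f x \<ominus>\<^bsub>N\<^esub> g x) \<oplus>\<^bsub>N\<^esub> (f' x \<ominus>\<^bsub>N\<^esub> g' x))"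
    using assms by (intro null_add) (simp_all add: null_cong_maps_def)
  then have "null R k M N (\<lambda>x. (f x \<oplus>\<^bsub>N\<^esub> f' x) \<ominus>\<^bsub>N\<^esub> (g x \<oplus>\<^bsub>N\<^esub> g' x))"
    by (rule null_cong) (use a[THEN arrow_app] in \<open>simp add: N.M.minus_add_add\<close>)
  then show ?thesis using arrow_plus[OF a(1,3)] arrow_plus[OF a(2,4)] by (simp add: null_cong_maps_def)
qed

lemma null_iff_nceq:
  "null R k M N f \<longleftrightarrow> k: f \<approx> (\<lambda>x. \<zero>\<^bsub>N\<^esub>) on M to N"
proof
  assume n: "null R k M N f"
  note f = null_arrow[OF n]
  interpret N: left_module R N by (rule arrow_lm(2)[OF f])
  have "null R k M N (\<lambda>x. f x \<ominus>\<^bsub>N\<^esub> \<zero>\<^bsub>N\<^esub>)"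
    by (rule null_cong[OF n]) (use arrow_app[OF f] N.M.add_minus_cancel[of _ "\<zero>\<^bsub>N\<^esub>"] in simp)
  then show "k: f \<approx> (\<lambda>x. \<zero>\<^bsub>N\<^esub>) on M to N"
    using f arrow_const_zero[OF arrow_fg(1,2)[OF f]] by (simp add: null_cong_maps_def)
next
  assume n: "k: f \<approx> (\<lambda>x. \<zero>\<^bsub>N\<^esub>) on M to N"
  note f = nceq_arrows(1)[OF n]
  interpret N: left_module R N by (rule arrow_lm(2)[OF f])
  show "null R k M N f"
    by (rule null_cong[of R k M N "\<lambda>x. f x \<ominus>\<^bsub>N\<^esub> \<zero>\<^bsub>N\<^esub>"])
      (use n arrow_app[OF f] N.M.add_minus_cancel[of _ "\<zero>\<^bsub>N\<^esub>"] in \<open>simp_all add: null_cong_maps_def\<close>)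
qed

lemma nceq_null: "k: f \<approx> g on M to N \<Longrightarrow> null R k M N f \<Longrightarrow> null R k M N g"
  unfolding null_iff_nceq using nceq_sym nceq_trans by blast

lemma nceq_lift:
  assumes n: "Suc k: f \<approx> g on M to N" and P: "cover R M P p" and Q: "cover R N Q q"
    and F: "arrow R P Q F" "\<And>x. x \<in> carrier P \<Longrightarrow> q (F x) = f (p x)"
    and G: "arrow R P Q G" "\<And>x. x \<in> carrier P \<Longrightarrow> q (G x) = g (p x)"
  shows "k: F \<approx> G on (ker_mod P M p) to (ker_mod Q N q)"
proof -
  note a = nceq_arrows[OF n]
  note kF = arrow_ker[OF F(1) coverD(2)[OF P] coverD(2)[OF Q] a(1) F(2)]
  note kG = arrow_ker[OF G(1) coverD(2)[OF P] coverD(2)[OF Q] a(2) G(2)]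
  have "null R k (ker_mod P M p) (ker_mod Q N q) (\<lambda>x. F x \<ominus>\<^bsub>Q\<^esub> G x)"
  proof (rule null_lift[OF _ P Q arrow_diff[OF F(1) G(1)]])
    show "null R (Suc k) M N (\<lambda>x. f x \<ominus>\<^bsub>N\<^esub> g x)" using n by (simp add: null_cong_maps_def)
  qed (use F G arrow_app[OF F(1)] arrow_app[OF G(1)] in \<open>simp add: arrow_minus[OF coverD(2)[OF Q]]\<close>)
  then have "null R k (ker_mod P M p) (ker_mod Q N q) (\<lambda>x. F x \<ominus>\<^bsub>ker_mod Q N q\<^esub> G x)"
    by (rule null_cong) (rule ker_minus_eq[OF coverD(2)[OF Q] arrow_app[OF kF] arrow_app[OF kG]])
  then show ?thesis using kF kG by (simp add: null_cong_maps_def)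
qed

lemma nceq_0_lift:
  assumes "0: f \<approx> g on M to N" "cover R M P p" "cover R N Q q"
    "arrow R P Q F" "\<And>x. x \<in> carrier P \<Longrightarrow> q (F x) = f (p x)"
    "arrow R P Q G" "\<And>x. x \<in> carrier P \<Longrightarrow> q (G x) = g (p x)"
  shows "0: F \<approx> G on (ker_mod P M p) to (ker_mod Q N q)"
  by (rule nceq_lift[OF nceq_mono[OF assms(1)] assms(2-)]) simp

end

section \<open>Short exact sequences\<close>

definition short_exact :: "('a, 'b) ring_scheme \<Rightarrow> 'a fg_mod \<Rightarrow> 'a fg_mod \<Rightarrow> 'a fg_mod \<Rightarrow>
    ((nat \<Rightarrow> 'a) set \<Rightarrow> (nat \<Rightarrow> 'a) set) \<Rightarrow> ((nat \<Rightarrow> 'a) set \<Rightarrow> (nat \<Rightarrow> 'a) set) \<Rightarrow> bool" where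
  "short_exact R W Y Z f \<pi> \<longleftrightarrow> arrow R W Y f \<and> arrow R Y Z \<pi> \<and> inj_on f (carrier W) \<and>
     \<pi> ` carrier Y = carrier Z \<and> (\<forall>y\<in>carrier Y. \<pi> y = \<zero>\<^bsub>Z\<^esub> \<longleftrightarrow> y \<in> f ` carrier W)"

lemma short_exactD:
  assumes "short_exact R W Y Z f \<pi>"
  shows "arrow R W Y f" "arrow R Y Z \<pi>" "inj_on f (carrier W)" "\<pi> ` carrier Y = carrier Z"
    "x \<in> carrier W \<Longrightarrow> \<pi> (f x) = \<zero>\<^bsub>Z\<^esub>" "y \<in> carrier Y \<Longrightarrow> \<pi> y = \<zero>\<^bsub>Z\<^esub> \<Longrightarrow> \<exists>x\<in>carrier W. y = f x"
  using assms by (auto simp: short_exact_def arrow_app)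

lemma short_exactI:
  assumes "arrow R W Y f" "arrow R Y Z \<pi>" "\<And>x y. x \<in> carrier W \<Longrightarrow> y \<in> carrier W \<Longrightarrow> f x = f y \<Longrightarrow> x = y"
    "\<And>z. z \<in> carrier Z \<Longrightarrow> \<exists>y\<in>carrier Y. \<pi> y = z"
    "\<And>x. x \<in> carrier W \<Longrightarrow> \<pi> (f x) = \<zero>\<^bsub>Z\<^esub>" "\<And>y. y \<in> carrier Y \<Longrightarrow> \<pi> y = \<zero>\<^bsub>Z\<^esub> \<Longrightarrow> \<exists>x\<in>carrier W. y = f x"
  shows "short_exact R W Y Z f \<pi>"
proof -
  have "\<pi> ` carrier Y = carrier Z" using assms(4) arrow_app[OF assms(2)] by (auto simp: image_iff)
  moreover have "inj_on f (carrier W)" by (rule inj_onI) (rule assms(3))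
  moreover have "\<forall>y\<in>carrier Y. \<pi> y = \<zero>\<^bsub>Z\<^esub> \<longleftrightarrow> y \<in> f ` carrier W" using assms(5,6) by (auto simp: image_iff)
  ultimately show ?thesis unfolding short_exact_def using assms(1,2) by simp
qed

text \<open>A map that lands in the image of an injective map factors through it.\<close>

lemma arrow_factor_inj:
  assumes f: "arrow R W Y f" "inj_on f (carrier W)" and e: "arrow R L Y e"
    and im: "\<And>x. x \<in> carrier L \<Longrightarrow> \<exists>w\<in>carrier W. e x = f w"
  shows "\<exists>r. arrow R L W r \<and> (\<forall>x\<in>carrier L. f (r x) = e x)"
proof -
  from im obtain r where r: "\<And>x. x \<in> carrier L \<Longrightarrow> r x \<in> carrier W" "\<And>x. x \<in> carrier L \<Longrightarrow> e x = f (r x)"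
    by metis
  interpret L: left_module R L by (rule arrow_lm(1)[OF e])
  interpret W: left_module R W by (rule arrow_lm(1)[OF f(1)])
  have "arrow R L W r"
  proof (intro arrowI arrow_fg(1)[OF e] arrow_fg(1)[OF f(1)] r(1))
    fix x y assume xy: "x \<in> carrier L" "y \<in> carrier L"
    then have "f (r (x \<oplus>\<^bsub>L\<^esub> y)) = f (r x \<oplus>\<^bsub>W\<^esub> r y)"
      using r by (simp add: arrow_add[OF f(1)] r(2)[symmetric] arrow_add[OF e])
    then show "r (x \<oplus>\<^bsub>L\<^esub> y) = r x \<oplus>\<^bsub>W\<^esub> r y" using inj_onD[OF f(2)] r(1) xy by simp
  next
    fix a x assume ax: "a \<in> carrier R" "x \<in> carrier L"
    then have "f (r (a \<odot>\<^bsub>L\<^esub> x)) = f (a \<odot>\<^bsub>W\<^esub> r x)"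
      using r by (simp add: arrow_smult[OF f(1)] r(2)[symmetric] arrow_smult[OF e])
    then show "r (a \<odot>\<^bsub>L\<^esub> x) = a \<odot>\<^bsub>W\<^esub> r x" using inj_onD[OF f(2)] r(1) ax by simp
  qed
  then show ?thesis using r(2) by auto
qed

lemma short_exact_split:
  assumes E: "short_exact R W Y Z f \<pi>" and Z: "projective_mod R Z"
  shows "\<exists>t r. biproduct R Y W Z f t r \<pi>"
proof -
  note D = short_exactD[OF E]
  interpret W: left_module R W by (rule arrow_lm(1)[OF D(1)])
  interpret Y: left_module R Y by (rule arrow_lm(1)[OF D(2)])
  interpret Z: left_module R Z by (rule arrow_lm(2)[OF D(2)])
  obtain t where t: "arrow R Z Y t" "\<And>z. z \<in> carrier Z \<Longrightarrow> \<pi> (t z) = z"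
    using projectiveD[OF Z D(2,4) arrow_id[OF projective_fg[OF Z]]] by blast
  have d: "arrow R Y Y (\<lambda>y. y \<ominus>\<^bsub>Y\<^esub> t (\<pi> y))"
    by (intro arrow_diff arrow_id arrow_fg(1)[OF D(2)] arrow_comp[OF D(2) t(1)])
  have "\<exists>w\<in>carrier W. y \<ominus>\<^bsub>Y\<^esub> t (\<pi> y) = f w" if y: "y \<in> carrier Y" for y
    using y arrow_app[OF D(2)] arrow_app[OF t(1)] t(2)
    by (intro D(6)) (auto simp: arrow_minus[OF D(2)] Z.M.minus_zero_iff)
  then obtain r where r: "arrow R Y W r" "\<And>y. y \<in> carrier Y \<Longrightarrow> f (r y) = y \<ominus>\<^bsub>Y\<^esub> t (\<pi> y)"
    using arrow_factor_inj[OF D(1,3) d] by blast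
  have "biproduct R Y W Z f t r \<pi>"
    unfolding biproduct_def
  proof (intro conjI ballI)
    fix x assume x: "x \<in> carrier W"
    note fx = arrow_app[OF D(1) x]
    have "f (r (f x)) = f x" using r(2)[OF fx] D(5)[OF x] arrow_zero[OF t(1)] fx Y.M.add_minus_cancel[of "f x" "\<zero>\<^bsub>Y\<^esub>"] by simp
    then show "r (f x) = x" using inj_onD[OF D(3)] x arrow_app[OF r(1) fx] by blast
    show "\<pi> (f x) = \<zero>\<^bsub>Z\<^esub>" by (rule D(5)[OF x])
  next
    fix z assume z: "z \<in> carrier Z"
    note tz = arrow_app[OF t(1) z]
    have "f (r (t z)) = f \<zero>\<^bsub>W\<^esub>" using r(2)[OF tz] t(2)[OF z] tz by (simp add: Y.M.minus_zero_iff arrow_zero[OF D(1)])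
    then show "r (t z) = \<zero>\<^bsub>W\<^esub>" using inj_onD[OF D(3)] arrow_app[OF r(1) tz] by blast
    show "\<pi> (t z) = z" by (rule t(2)[OF z])
  next
    fix y assume y: "y \<in> carrier Y"
    show "y = f (r y) \<oplus>\<^bsub>Y\<^esub> t (\<pi> y)"
      using r(2)[OF y] y arrow_app[OF t(1) arrow_app[OF D(2) y]] by (simp add: Y.M.minus_add_cancel)
  qed (fact D t(1) r(1))+
  then show ?thesis by blast
qed

text \<open>
  The horseshoe lemma.  The middle term is covered by the direct sum of covers of the outer
  terms, by means of a lift of the cover of \<open>Z\<close> along \<open>\<pi>\<close>.
\<close>

lemma (in noetherian_ring) horseshoe:
  assumes E: "short_exact R W Y Z f \<pi>"
  shows "\<exists>PX pX PY pY PZ pZ F G. cover R W PX pX \<and> cover R Y PY pY \<and> cover R Z PZ pZ \<and>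
    arrow R PX PY F \<and> arrow R PY PZ G \<and> (\<forall>x\<in>carrier PX. pY (F x) = f (pX x)) \<and>
    (\<forall>y\<in>carrier PY. pZ (G y) = \<pi> (pY y)) \<and>
    short_exact R (ker_mod PX W pX) (ker_mod PY Y pY) (ker_mod PZ Z pZ) F G"
proof -
  note D = short_exactD[OF E]
  interpret W: left_module R W by (rule arrow_lm(1)[OF D(1)])
  interpret Y: left_module R Y by (rule arrow_lm(1)[OF D(2)])
  interpret Z: left_module R Z by (rule arrow_lm(2)[OF D(2)])
  obtain PX pX where PX: "cover R W PX pX" using cover_exists[OF ring_axioms arrow_fg(1)[OF D(1)]] by blast
  obtain PZ pZ where PZ: "cover R Z PZ pZ" using cover_exists[OF ring_axioms arrow_fg(2)[OF D(2)]] by blast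
  note aX = coverD(2)[OF PX] and aZ = coverD(2)[OF PZ]
  interpret PX: left_module R PX by (rule arrow_lm(1)[OF aX])
  interpret PZ: left_module R PZ by (rule arrow_lm(1)[OF aZ])
  obtain s where s: "arrow R PZ Y s" "\<And>z. z \<in> carrier PZ \<Longrightarrow> \<pi> (s z) = pZ z"
    using projectiveD[OF coverD(1)[OF PZ] D(2,4) aZ] by blast
  obtain PY i j p q where B: "biproduct R PY PX PZ i j p q"
    using biproduct_exists[OF arrow_fg(1)[OF aX] arrow_fg(1)[OF aZ]] by blast
  note BD = biproductD[OF B]
  interpret PY: left_module R PY by (rule arrow_lm(2)[OF BD(1)])
  define pY where "pY y = f (pX (p y)) \<oplus>\<^bsub>Y\<^esub> s (q y)" for y
  have aY: "arrow R PY Y pY" and pi: "\<And>x. x \<in> carrier PX \<Longrightarrow> pY (i x) = f (pX x)"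
    and pj: "\<And>z. z \<in> carrier PZ \<Longrightarrow> pY (j z) = s z"
    unfolding pY_def using biproduct_copair[OF B arrow_comp[OF aX D(1)] s(1)] by auto
  have pij: "pY (i x \<oplus>\<^bsub>PY\<^esub> j z) = f (pX x) \<oplus>\<^bsub>Y\<^esub> s z" if "x \<in> carrier PX" "z \<in> carrier PZ" for x z
    using that pi pj arrow_add[OF aY] arrow_app[OF BD(1)] arrow_app[OF BD(2)] by simp
  have qij: "q (i x \<oplus>\<^bsub>PY\<^esub> j z) = z" if "x \<in> carrier PX" "z \<in> carrier PZ" for x z
    using that arrow_add[OF BD(4)] arrow_app[OF BD(1)] arrow_app[OF BD(2)] BD(6,7) by simp
  have surj: "pY ` carrier PY = carrier Y"
  proof
    show "pY ` carrier PY \<subseteq> carrier Y" using arrow_app[OF aY] by blast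
    show "carrier Y \<subseteq> pY ` carrier PY"
    proof
      fix y assume y: "y \<in> carrier Y"
      then have "\<pi> y \<in> pZ ` carrier PZ" using coverD(3)[OF PZ] arrow_app[OF D(2)] by simp
      then obtain z where z: "z \<in> carrier PZ" "\<pi> y = pZ z" by blast
      have "\<pi> (y \<ominus>\<^bsub>Y\<^esub> s z) = \<zero>\<^bsub>Z\<^esub>" using y z s arrow_app[OF s(1)] arrow_app[OF D(2)] arrow_app[OF aZ]
        by (simp add: arrow_minus[OF D(2)] Z.M.minus_zero_iff)
      then obtain x where x: "x \<in> carrier W" "y \<ominus>\<^bsub>Y\<^esub> s z = f x" using D(6)[of "y \<ominus>\<^bsub>Y\<^esub> s z"] y arrow_app[OF s(1) z(1)] by auto
      then have "x \<in> pX ` carrier PX" using coverD(3)[OF PX] by simp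
      then obtain w where w: "w \<in> carrier PX" "x = pX w" by blast
      have "y = pY (i w \<oplus>\<^bsub>PY\<^esub> j z)"
        using pij[OF w(1) z(1)] x(2) w(2) Y.M.minus_add_cancel[OF y arrow_app[OF s(1) z(1)]] by simp
      then show "y \<in> pY ` carrier PY" using arrow_app[OF BD(1) w(1)] arrow_app[OF BD(2) z(1)] by blast
    qed
  qed
  have cY: "cover R Y PY pY" unfolding cover_def
    using biproduct_projective[OF B coverD(1)[OF PX] coverD(1)[OF PZ]] aY surj by simp
  have cF: "pY (i x) = f (pX x)" if "x \<in> carrier PX" for x using pi that .
  have cP: "pZ (q y) = \<pi> (pY y)" if y: "y \<in> carrier PY" for y
  proof -
    note py = arrow_app[OF BD(3) y] arrow_app[OF BD(4) y]
    have "\<pi> (pY y) = \<pi> (f (pX (p y))) \<oplus>\<^bsub>Z\<^esub> \<pi> (s (q y))" unfolding pY_def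
      using py arrow_app[OF aX] arrow_app[OF D(1)] arrow_app[OF s(1)] by (simp add: arrow_add[OF D(2)])
    then show ?thesis using D(5) s(2) py arrow_app[OF aX] arrow_app[OF aZ] by simp
  qed
  have "short_exact R (ker_mod PX W pX) (ker_mod PY Y pY) (ker_mod PZ Z pZ) i q"
  proof (rule short_exactI)
    show "arrow R (ker_mod PX W pX) (ker_mod PY Y pY) i" by (rule arrow_ker[OF BD(1) aX aY D(1) cF])
    show "arrow R (ker_mod PY Y pY) (ker_mod PZ Z pZ) q" by (rule arrow_ker[OF BD(4) aY aZ D(2) cP])
  next
    fix x y assume xy: "x \<in> carrier (ker_mod PX W pX)" "y \<in> carrier (ker_mod PX W pX)" "i x = i y"
    then have xy': "x \<in> carrier PX" "y \<in> carrier PX" by simp_all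
    note e = BD(5)[OF xy'(1)] BD(5)[OF xy'(2)]
    show "x = y" using arg_cong[OF xy(3), of p] by (simp only: e)
  next
    fix z assume "z \<in> carrier (ker_mod PZ Z pZ)"
    then have z: "z \<in> carrier PZ" "pZ z = \<zero>\<^bsub>Z\<^esub>" by auto
    obtain x where x: "x \<in> carrier W" "s z = f x" using D(6)[of "s z"] s z arrow_app[OF s(1)] by auto
    then have "x \<in> pX ` carrier PX" using coverD(3)[OF PX] by simp
    then obtain w where w: "w \<in> carrier PX" "x = pX w" by blast
    have nw: "\<ominus>\<^bsub>PX\<^esub> w \<in> carrier PX" using w by simp
    have "f (pX (\<ominus>\<^bsub>PX\<^esub> w)) = \<ominus>\<^bsub>Y\<^esub> f x"
      using w x mod_hom_neg[OF arrow_lm[OF aX] arrow_fg(3)[OF aX]] mod_hom_neg[OF arrow_lm[OF D(1)] arrow_fg(3)[OF D(1)]] by simp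
    then have "pY (i (\<ominus>\<^bsub>PX\<^esub> w) \<oplus>\<^bsub>PY\<^esub> j z) = \<zero>\<^bsub>Y\<^esub>"
      using pij[OF nw z(1)] x arrow_app[OF D(1) x(1)] by (simp add: Y.M.l_neg)
    then show "\<exists>y\<in>carrier (ker_mod PY Y pY). q y = z"
      using qij[OF nw z(1)] arrow_app[OF BD(1) nw] arrow_app[OF BD(2) z(1)]
      by (intro bexI[of _ "i (\<ominus>\<^bsub>PX\<^esub> w) \<oplus>\<^bsub>PY\<^esub> j z"]) auto
  next
    fix x assume "x \<in> carrier (ker_mod PX W pX)"
    then show "q (i x) = \<zero>\<^bsub>ker_mod PZ Z pZ\<^esub>" using BD(6) by simp
  next
    fix y assume "y \<in> carrier (ker_mod PY Y pY)" "q y = \<zero>\<^bsub>ker_mod PZ Z pZ\<^esub>"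
    then have y: "y \<in> carrier PY" "pY y = \<zero>\<^bsub>Y\<^esub>" "q y = \<zero>\<^bsub>PZ\<^esub>" by auto
    note py = arrow_app[OF BD(3) y(1)]
    have "f (pX (p y)) = \<zero>\<^bsub>Y\<^esub>" using y(2,3) arrow_zero[OF s(1)] arrow_app[OF D(1) arrow_app[OF aX py]] by (simp add: pY_def)
    then have "pX (p y) = \<zero>\<^bsub>W\<^esub>" using inj_onD[OF D(3), of "pX (p y)" "\<zero>\<^bsub>W\<^esub>"] arrow_zero[OF D(1)] arrow_app[OF aX py] by simp
    moreover have "y = i (p y)" using BD(9)[OF y(1)] y(3) arrow_zero[OF BD(2)] arrow_app[OF BD(1) py] by simp
    moreover have "p y \<in> carrier (ker_mod PX W pX)" using py calculation(1) by simp
    ultimately show "\<exists>x\<in>carrier (ker_mod PX W pX). y = i x" by (intro bexI[of _ "p y"])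
  qed
  then show ?thesis
    by (intro exI[of _ PX] exI[of _ pX] exI[of _ PY] exI[of _ pY] exI[of _ PZ] exI[of _ pZ] exI[of _ i] exI[of _ q]
        conjI ballI PX cY PZ BD(1,4) cF cP)
qed

context noetherian_ring begin

text \<open>
  If the cokernel of \<open>f\<close> has finite projective dimension, then \<open>f\<close> becomes a split monomorphism after
  taking enough syzygies, so it may be cancelled.
\<close>

lemma null_cancel_mono:
  assumes "short_exact R W Y Z f \<pi>" "null R d Z Z (\<lambda>x. x)" "arrow R U W \<gamma>" "null R k U Y (\<lambda>x. f (\<gamma> x))" "d \<le> k"
  shows "null R k U W \<gamma>"
  using assms
proof (induction d arbitrary: W Y Z f \<pi> U \<gamma> k)
  case 0
  then have "projective_mod R Z" using null_id_projective by blast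
  then obtain t r where "biproduct R Y W Z f t r \<pi>" using short_exact_split[OF 0(1)] by blast
  note B = biproductD[OF this]
  have "null R k U W (\<lambda>x. r (f (\<gamma> x)))"
    using null_comp[OF 0(4) arrow_id B(3)] arrow_fg(1)[OF 0(3)] by simp
  then show ?case by (rule null_cong) (use B(5) arrow_app[OF 0(3)] in simp)
next
  case (Suc d)
  obtain k' where k: "k = Suc k'" using Suc.prems(5) by (cases k) auto
  obtain PX pX PY pY PZ pZ F G where H: "cover R W PX pX" "cover R Y PY pY" "cover R Z PZ pZ"
    "arrow R PX PY F" "\<forall>x\<in>carrier PX. pY (F x) = f (pX x)"
    "short_exact R (ker_mod PX W pX) (ker_mod PY Y pY) (ker_mod PZ Z pZ) F G"
    using horseshoe[OF Suc.prems(1)] by metis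
  obtain PU pU where PU: "cover R U PU pU" using cover_exists[OF ring_axioms arrow_fg(1)[OF Suc.prems(3)]] by blast
  obtain \<Gamma> where \<Gamma>: "arrow R PU PX \<Gamma>" "\<And>x. x \<in> carrier PU \<Longrightarrow> pX (\<Gamma> x) = \<gamma> (pU x)"
    using cover_lift[OF PU H(1) Suc.prems(3)] by blast
  have "null R k' (ker_mod PU U pU) (ker_mod PY Y pY) (\<lambda>x. F (\<Gamma> x))"
    by (rule null_lift[OF Suc.prems(4)[unfolded k] PU H(2) arrow_comp[OF \<Gamma>(1) H(4)]])
      (use H(5) \<Gamma>(2) arrow_app[OF \<Gamma>(1)] in simp)
  from Suc.IH[OF H(6) null_id_lift[OF Suc.prems(2) H(3)]
      arrow_ker[OF \<Gamma>(1) coverD(2)[OF PU] coverD(2)[OF H(1)] Suc.prems(3) \<Gamma>(2)] this]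
  have "null R k' (ker_mod PU U pU) (ker_mod PX W pX) \<Gamma>" using Suc.prems(5) k by simp
  then show ?case unfolding k by (rule null_unlift[OF _ PU H(1) \<Gamma>(1) Suc.prems(3) \<Gamma>(2)])
qed

text \<open>
  In the opposite direction, a sequence whose maps become split after \<open>k\<close> syzygies has a
  cokernel of projective dimension at most \<open>k + 1\<close>.  For \<open>k = 0\<close> the sequence is compared with a
  projective cover \<open>P\<close> of \<open>Z\<close> with kernel \<open>K\<close>.  A lift \<open>s : P \<rightarrow> Y\<close> restricts to \<open>u\<^sub>0 : K \<rightarrow> W\<close>,
  which is null since \<open>f\<close> splits up to null maps; a lift \<open>w : Y \<rightarrow> P\<close> exists since \<open>\<pi>\<close> is null; and
  the identity of \<open>K\<close> is the sum of \<open>1 - w s\<close> and \<open>w f u\<^sub>0\<close>, two null maps.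
\<close>

lemma null_id_of_split:
  assumes "short_exact R W Y Z f \<pi>" "arrow R Y W g" "k: (\<lambda>x. g (f x)) \<approx> (\<lambda>x. x) on W to W" "null R k Y Z \<pi>"
  shows "null R (Suc k) Z Z (\<lambda>x. x)"
  using assms
proof (induction k arbitrary: W Y Z f \<pi> g)
  case 0
  note D = short_exactD[OF 0(1)]
  obtain P \<kappa> where P: "cover R Z P \<kappa>" using cover_exists[OF ring_axioms arrow_fg(2)[OF D(2)]] by blast
  note aP = coverD(2)[OF P]
  let ?K = "ker_mod P Z \<kappa>"
  interpret P: left_module R P by (rule arrow_lm(1)[OF aP])
  interpret Z: left_module R Z by (rule arrow_lm(2)[OF aP])
  obtain Q u v where Q: "projective_mod R Q" "arrow R Y Q u" "arrow R Q Z v" "\<forall>x\<in>carrier Y. \<pi> x = v (u x)"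
    using 0(4) by auto
  obtain v' where v': "arrow R Q P v'" "\<And>x. x \<in> carrier Q \<Longrightarrow> \<kappa> (v' x) = v x"
    using projectiveD[OF Q(1) aP coverD(3)[OF P] Q(3)] by blast
  define w where "w y = v' (u y)" for y
  have w: "arrow R Y P w" "\<And>y. y \<in> carrier Y \<Longrightarrow> \<kappa> (w y) = \<pi> y"
    unfolding w_def using arrow_comp[OF Q(2) v'(1)] v'(2) Q(4) arrow_app[OF Q(2)] by auto
  obtain s where s: "arrow R P Y s" "\<And>x. x \<in> carrier P \<Longrightarrow> \<pi> (s x) = \<kappa> x"
    using projectiveD[OF coverD(1)[OF P] D(2,4) aP] by blast
  have sK: "arrow R ?K Y s" using arrow_comp[OF arrow_ker_incl[OF aP] s(1)] .
  obtain u0 where u0: "arrow R ?K W u0" "\<And>x. x \<in> carrier ?K \<Longrightarrow> f (u0 x) = s x"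
    using arrow_factor_inj[OF D(1,3) sK] D(6) s arrow_app[OF s(1)] by fastforce
  have wf: "arrow R W ?K (\<lambda>x. w (f x))"
    by (rule arrow_into_ker[OF arrow_comp[OF D(1) w(1)] aP]) (use w(2) D(5) arrow_app[OF D(1)] in simp)
  have e: "arrow R P ?K (\<lambda>x. x \<ominus>\<^bsub>P\<^esub> w (s x))"
  proof (rule arrow_into_ker[OF arrow_diff[OF arrow_id[OF arrow_fg(1)[OF aP]] arrow_comp[OF s(1) w(1)]] aP])
    fix x assume x: "x \<in> carrier P"
    then show "\<kappa> (x \<ominus>\<^bsub>P\<^esub> w (s x)) = \<zero>\<^bsub>Z\<^esub>"
      using arrow_app[OF s(1)] arrow_app[OF w(1)] arrow_app[OF aP] s(2) w(2)
      by (simp add: arrow_minus[OF aP] Z.M.minus_zero_iff)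
  qed
  have "null R 0 ?K W (\<lambda>x. g (s x))"
    by (rule null_through_projective[OF coverD(1)[OF P] arrow_ker_incl[OF aP] arrow_comp[OF s(1) 0(2)]])
  then have "null R 0 ?K W (\<lambda>x. g (f (u0 x)))" by (rule null_cong) (simp add: u0(2))
  then have "null R 0 ?K W u0" using nceq_null[OF nceq_pre[OF 0(3) u0(1)]] by simp
  then have 1: "null R 0 ?K ?K (\<lambda>x. w (f (u0 x)))"
    using null_comp[OF _ arrow_id wf, of 0 ?K u0] arrow_fg(1)[OF u0(1)] by simp
  have 2: "null R 0 ?K ?K (\<lambda>x. x \<ominus>\<^bsub>P\<^esub> w (s x))"
    by (rule null_through_projective[OF coverD(1)[OF P] arrow_ker_incl[OF aP] e])
  have "null R 0 ?K ?K (\<lambda>x. x)"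
    by (rule null_cong[OF null_add[OF 2 1]])
      (use u0(2) arrow_app[OF s(1)] arrow_app[OF w(1)] in \<open>simp add: P.M.minus_add_cancel\<close>)
  then show ?case by (rule null_id_unlift[OF _ P])
next
  case (Suc k)
  obtain PX pX PY pY PZ pZ F G where H: "cover R W PX pX" "cover R Y PY pY" "cover R Z PZ pZ"
    "arrow R PX PY F" "arrow R PY PZ G" "\<forall>x\<in>carrier PX. pY (F x) = f (pX x)"
    "\<forall>y\<in>carrier PY. pZ (G y) = \<pi> (pY y)"
    "short_exact R (ker_mod PX W pX) (ker_mod PY Y pY) (ker_mod PZ Z pZ) F G"
    using horseshoe[OF Suc.prems(1)] by metis
  obtain L where L: "arrow R PY PX L" "\<And>x. x \<in> carrier PY \<Longrightarrow> pX (L x) = g (pY x)"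
    using cover_lift[OF H(2,1) Suc.prems(2)] by blast
  have 1: "k: (\<lambda>x. L (F x)) \<approx> (\<lambda>x. x) on (ker_mod PX W pX) to (ker_mod PX W pX)"
    by (rule nceq_lift[OF Suc.prems(3) H(1,1) arrow_comp[OF H(4) L(1)] _ arrow_id[OF arrow_fg(1)[OF H(4)]]])
      (use H(6) L(2) arrow_app[OF H(4)] in auto)
  have 2: "null R k (ker_mod PY Y pY) (ker_mod PZ Z pZ) G"
    by (rule null_lift[OF Suc.prems(4) H(2,3,5)]) (use H(7) in simp)
  show ?case
    by (rule null_id_unlift[OF Suc.IH[OF H(8) arrow_ker[OF L(1) coverD(2)[OF H(2)] coverD(2)[OF H(1)] Suc.prems(2) L(2)] 1 2] H(3)])
qed

section \<open>The monoid of stable isomorphism classes\<close>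

definition stably_iso where
  "stably_iso M N \<longleftrightarrow> (\<exists>f g. arrow R M N f \<and> arrow R N M g \<and>
     0: (\<lambda>x. g (f x)) \<approx> (\<lambda>x. x) on M to M \<and> 0: (\<lambda>x. f (g x)) \<approx> (\<lambda>x. x) on N to N)"

lemma stably_iso_fg: "stably_iso M N \<Longrightarrow> M \<in> fg_modules R" "stably_iso M N \<Longrightarrow> N \<in> fg_modules R"
  by (auto simp: stably_iso_def dest: arrow_fg)

lemma stably_iso_refl: "M \<in> fg_modules R \<Longrightarrow> stably_iso M M"
  unfolding stably_iso_def using arrow_id nceq_refl[OF arrow_id] by (intro exI[of _ "\<lambda>x. x"]) auto

lemma stably_iso_sym: "stably_iso M N \<Longrightarrow> stably_iso N M"
  unfolding stably_iso_def by blast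

lemma stably_iso_trans:
  assumes "stably_iso M N" "stably_iso N L" shows "stably_iso M L"
proof -
  obtain f g where fg: "arrow R M N f" "arrow R N M g"
    "0: (\<lambda>x. g (f x)) \<approx> (\<lambda>x. x) on M to M" "0: (\<lambda>x. f (g x)) \<approx> (\<lambda>x. x) on N to N"
    using assms(1) unfolding stably_iso_def by blast
  obtain h k where hk: "arrow R N L h" "arrow R L N k"
    "0: (\<lambda>x. k (h x)) \<approx> (\<lambda>x. x) on N to N" "0: (\<lambda>x. h (k x)) \<approx> (\<lambda>x. x) on L to L"
    using assms(2) unfolding stably_iso_def by blast
  have "0: (\<lambda>x. g (k (h (f x)))) \<approx> (\<lambda>x. x) on M to M"
    using nceq_trans[OF nceq_comp[OF hk(3) fg(1,2)] fg(3)] .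
  moreover have "0: (\<lambda>x. h (f (g (k x)))) \<approx> (\<lambda>x. x) on L to L"
    using nceq_trans[OF nceq_comp[OF fg(4) hk(2,1)] hk(4)] .
  ultimately show ?thesis unfolding stably_iso_def
    using arrow_comp[OF fg(1) hk(1)] arrow_comp[OF hk(2) fg(2)]
    by (intro exI[of _ "\<lambda>x. h (f x)"] exI[of _ "\<lambda>x. g (k x)"]) simp
qed

lemma stably_iso_of_inverse:
  assumes "arrow R M N f" "arrow R N M g" "\<And>x. x \<in> carrier M \<Longrightarrow> g (f x) = x" "\<And>y. y \<in> carrier N \<Longrightarrow> f (g y) = y"
  shows "stably_iso M N"
  unfolding stably_iso_def using assms arrow_fg
  by (intro exI[of _ f] exI[of _ g] conjI nceq_sym[OF nceq_refl] arrow_id) auto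

lemma stably_iso_iso:
  assumes "M \<in> fg_modules R" "N \<in> fg_modules R" "mod_isomorphic R M N"
  shows "stably_iso M N"
  using mod_isomorphicE[OF fg_left_module[OF assms(1)] fg_left_module[OF assms(2)] assms(3)]
  by (metis arrow_def assms(1,2) stably_iso_of_inverse)

lemma stably_iso_ker:
  assumes "stably_iso M N" "cover R M P p" "cover R N Q q"
  shows "stably_iso (ker_mod P M p) (ker_mod Q N q)"
proof -
  obtain f g where fg: "arrow R M N f" "arrow R N M g"
    "0: (\<lambda>x. g (f x)) \<approx> (\<lambda>x. x) on M to M" "0: (\<lambda>x. f (g x)) \<approx> (\<lambda>x. x) on N to N"
    using assms(1) unfolding stably_iso_def by blast
  note P = assms(2) and Q = assms(3)
  obtain F where F: "arrow R P Q F" "\<And>x. x \<in> carrier P \<Longrightarrow> q (F x) = f (p x)" using cover_lift[OF P Q fg(1)] by blast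
  obtain G where G: "arrow R Q P G" "\<And>x. x \<in> carrier Q \<Longrightarrow> p (G x) = g (q x)" using cover_lift[OF Q P fg(2)] by blast
  note I = arrow_id[OF arrow_fg(1)[OF F(1)]] arrow_id[OF arrow_fg(1)[OF G(1)]]
  have "0: (\<lambda>x. G (F x)) \<approx> (\<lambda>x. x) on (ker_mod P M p) to (ker_mod P M p)"
    by (rule nceq_0_lift[OF fg(3) P P arrow_comp[OF F(1) G(1)] _ I(1)]) (use F G arrow_app[OF F(1)] in auto)
  moreover have "0: (\<lambda>x. F (G x)) \<approx> (\<lambda>x. x) on (ker_mod Q N q) to (ker_mod Q N q)"
    by (rule nceq_0_lift[OF fg(4) Q Q arrow_comp[OF G(1) F(1)] _ I(2)]) (use F G arrow_app[OF G(1)] in auto)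
  ultimately show ?thesis unfolding stably_iso_def
    using arrow_ker[OF F(1) coverD(2)[OF P] coverD(2)[OF Q] fg(1) F(2)]
      arrow_ker[OF G(1) coverD(2)[OF Q] coverD(2)[OF P] fg(2) G(2)] by blast
qed

lemma stably_iso_biproduct:
  assumes B: "biproduct R T M N i j p q" and B': "biproduct R T' M' N' i' j' p' q'"
    and M: "stably_iso M M'" and N: "stably_iso N N'"
  shows "stably_iso T T'"
proof -
  obtain f g where fg: "arrow R M M' f" "arrow R M' M g"
    "0: (\<lambda>x. g (f x)) \<approx> (\<lambda>x. x) on M to M" "0: (\<lambda>x. f (g x)) \<approx> (\<lambda>x. x) on M' to M'"
    using M unfolding stably_iso_def by blast
  obtain h k where hk: "arrow R N N' h" "arrow R N' N k"
    "0: (\<lambda>x. k (h x)) \<approx> (\<lambda>x. x) on N to N" "0: (\<lambda>x. h (k x)) \<approx> (\<lambda>x. x) on N' to N'"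
    using N unfolding stably_iso_def by blast
  have half: "arrow R T T' (\<lambda>x. i' (f (p x)) \<oplus>\<^bsub>T'\<^esub> j' (h (q x))) \<and>
    0: (\<lambda>x. i (g (p' (i' (f (p x)) \<oplus>\<^bsub>T'\<^esub> j' (h (q x))))) \<oplus>\<^bsub>T\<^esub> j (k (q' (i' (f (p x)) \<oplus>\<^bsub>T'\<^esub> j' (h (q x))))))
      \<approx> (\<lambda>x. x) on T to T"
    if B: "biproduct R T M N i j p q" and B': "biproduct R T' M' N' i' j' p' q'"
      and fg: "arrow R M M' f" "arrow R M' M g" "0: (\<lambda>x. g (f x)) \<approx> (\<lambda>x. x) on M to M"
      and hk: "arrow R N N' h" "arrow R N' N k" "0: (\<lambda>x. k (h x)) \<approx> (\<lambda>x. x) on N to N"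
    for T T' M M' N N' i j p q i' j' p' q' f g h k
  proof -
    note D = biproductD[OF B]
    note pair = biproduct_pair[OF B' arrow_comp[OF D(3) fg(1)] arrow_comp[OF D(4) hk(1)]]
    have "0: (\<lambda>x. i (g (f (p x))) \<oplus>\<^bsub>T\<^esub> j (k (h (q x)))) \<approx> (\<lambda>x. i (p x) \<oplus>\<^bsub>T\<^esub> j (q x)) on T to T"
      by (intro nceq_add nceq_comp[OF fg(3) D(3,1)] nceq_comp[OF hk(3) D(4,2)])
    then have e: "0: (\<lambda>x. i (g (f (p x))) \<oplus>\<^bsub>T\<^esub> j (k (h (q x)))) \<approx> (\<lambda>x. x) on T to T"
      by (rule nceq_trans[OF _ nceq_refl[OF arrow_cong[OF arrow_id[OF arrow_fg(1)[OF D(3)]]]]]) (simp_all add: D(9))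
    have "0: (\<lambda>x. i (g (p' (i' (f (p x)) \<oplus>\<^bsub>T'\<^esub> j' (h (q x))))) \<oplus>\<^bsub>T\<^esub> j (k (q' (i' (f (p x)) \<oplus>\<^bsub>T'\<^esub> j' (h (q x))))))
      \<approx> (\<lambda>x. x) on T to T"
      by (rule nceq_trans[OF nceq_sym[OF nceq_refl[OF nceq_arrows(1)[OF e]]] e]) (simp add: pair)
    then show ?thesis using pair(1) by simp
  qed
  show ?thesis unfolding stably_iso_def
    using half[OF B B' fg(1-3) hk(1-3)] half[OF B' B fg(2,1,4) hk(2,1,4)]
    by (intro exI[of _ "\<lambda>x. i' (f (p x)) \<oplus>\<^bsub>T'\<^esub> j' (h (q x))"] exI[of _ "\<lambda>y. i (g (p' y)) \<oplus>\<^bsub>T\<^esub> j (k (q' y))"]) simp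
qed

lemma stably_iso_projective_summand:
  assumes "biproduct R T M P i j p q" "projective_mod R P"
  shows "stably_iso M T"
proof -
  note D = biproductD[OF assms(1)]
  have "0: (\<lambda>x. i (p x) \<oplus>\<^bsub>T\<^esub> \<zero>\<^bsub>T\<^esub>) \<approx> (\<lambda>x. i (p x) \<oplus>\<^bsub>T\<^esub> j (q x)) on T to T"
  proof (intro nceq_add nceq_refl[OF arrow_comp[OF D(3,1)]])
    show "0: (\<lambda>x. \<zero>\<^bsub>T\<^esub>) \<approx> (\<lambda>x. j (q x)) on T to T"
      using null_through_projective[OF assms(2) D(4,2)] null_iff_nceq nceq_sym by blast
  qed simp
  moreover interpret T: left_module R T by (rule arrow_lm(1)[OF D(3)])
  have "0: (\<lambda>x. i (p x)) \<approx> (\<lambda>x. i (p x) \<oplus>\<^bsub>T\<^esub> \<zero>\<^bsub>T\<^esub>) on T to T"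
    by (rule nceq_refl[OF arrow_comp[OF D(3,1)]]) (use arrow_app[OF arrow_comp[OF D(3,1)]] in simp)
  moreover have "0: (\<lambda>x. i (p x) \<oplus>\<^bsub>T\<^esub> j (q x)) \<approx> (\<lambda>x. x) on T to T"
    by (rule nceq_sym[OF nceq_refl[OF arrow_id[OF arrow_fg(1)[OF D(3)]]]]) (simp add: D(9))
  ultimately have "0: (\<lambda>x. i (p x)) \<approx> (\<lambda>x. x) on T to T" using nceq_trans by blast
  moreover have "0: (\<lambda>x. p (i x)) \<approx> (\<lambda>x. x) on M to M"
    by (rule nceq_sym[OF nceq_refl[OF arrow_id[OF arrow_fg(1)[OF D(1)]]]]) (simp add: D(5))
  ultimately show ?thesis unfolding stably_iso_def using D(1,3) by blast
qed

lemma biproduct_ker: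
  assumes B: "biproduct R T M N i j p q" and P: "cover R M P a" and Q: "cover R N Q b"
  shows "\<exists>S s I J A C. cover R T S s \<and> biproduct R (ker_mod S T s) (ker_mod P M a) (ker_mod Q N b) I J A C"
proof -
  note D = biproductD[OF B]
  note aP = coverD(2)[OF P] and aQ = coverD(2)[OF Q]
  interpret M: left_module R M by (rule arrow_lm(2)[OF aP])
  interpret N: left_module R N by (rule arrow_lm(2)[OF aQ])
  obtain S I J A C where B': "biproduct R S P Q I J A C"
    using biproduct_exists[OF arrow_fg(1)[OF aP] arrow_fg(1)[OF aQ]] by blast
  note D' = biproductD[OF B']
  define s where "s y = i (a (A y)) \<oplus>\<^bsub>T\<^esub> j (b (C y))" for y
  note co = biproduct_copair[OF B' arrow_comp[OF aP D(1)] arrow_comp[OF aQ D(2)], folded s_def]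
  note pr = biproduct_pair[OF B arrow_comp[OF D'(3) aP] arrow_comp[OF D'(4) aQ], folded s_def]
  have "s ` carrier S = carrier T"
  proof
    show "s ` carrier S \<subseteq> carrier T" using arrow_app[OF co(1)] by blast
    show "carrier T \<subseteq> s ` carrier S"
    proof
      fix x assume x: "x \<in> carrier T"
      have "p x \<in> a ` carrier P" "q x \<in> b ` carrier Q"
        using coverD(3)[OF P] coverD(3)[OF Q] arrow_app[OF D(3) x] arrow_app[OF D(4) x] by auto
      then obtain u v where uv: "u \<in> carrier P" "p x = a u" "v \<in> carrier Q" "q x = b v" by blast
      have "s (I u \<oplus>\<^bsub>S\<^esub> J v) = s (I u) \<oplus>\<^bsub>T\<^esub> s (J v)"
        using arrow_add[OF co(1)] arrow_app[OF D'(1)] arrow_app[OF D'(2)] uv by simp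
      also have "\<dots> = x" using co(2,3) uv D(9)[OF x] by simp
      finally show "x \<in> s ` carrier S" using arrow_app[OF D'(1) uv(1)] arrow_app[OF D'(2) uv(3)]
          left_module.axioms(2)[OF arrow_lm(2)[OF D'(1)]] by (metis abelian_monoid.a_closed abelian_group.axioms(1) image_eqI)
    qed
  qed
  then have c: "cover R T S s" unfolding cover_def
    using biproduct_projective[OF B' coverD(1)[OF P] coverD(1)[OF Q]] co(1) by simp
  have ai: "arrow R (ker_mod P M a) (ker_mod S T s) I" by (rule arrow_ker[OF D'(1) aP co(1) D(1) co(2)])
  have aj: "arrow R (ker_mod Q N b) (ker_mod S T s) J" by (rule arrow_ker[OF D'(2) aQ co(1) D(2) co(3)])
  have aA: "arrow R (ker_mod S T s) (ker_mod P M a) A" by (rule arrow_ker[OF D'(3) co(1) aP D(3)]) (simp add: pr)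
  have aC: "arrow R (ker_mod S T s) (ker_mod Q N b) C" by (rule arrow_ker[OF D'(4) co(1) aQ D(4)]) (simp add: pr)
  have "biproduct R (ker_mod S T s) (ker_mod P M a) (ker_mod Q N b) I J A C"
    unfolding biproduct_def using ai aj aA aC D'(5-9) by auto
  then show ?thesis using c by blast
qed

lemma biproduct_assoc:
  assumes B1: "biproduct R T1 M N i1 j1 p1 q1" and B: "biproduct R T T1 L i j p q" and B2: "biproduct R T2 N L i2 j2 p2 q2"
  shows "biproduct R T M T2 (\<lambda>x. i (i1 x)) (\<lambda>y. i (j1 (p2 y)) \<oplus>\<^bsub>T\<^esub> j (q2 y)) (\<lambda>x. p1 (p x)) (\<lambda>x. i2 (q1 (p x)) \<oplus>\<^bsub>T2\<^esub> j2 (q x))"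
  unfolding biproduct_def
proof (intro conjI ballI)
  note D1 = biproductD[OF B1] and D = biproductD[OF B] and D2 = biproductD[OF B2]
  interpret T: left_module R T by (rule arrow_lm(1)[OF D(3)])
  interpret T1: left_module R T1 by (rule arrow_lm(1)[OF D1(3)])
  interpret T2: left_module R T2 by (rule arrow_lm(1)[OF D2(3)])
  interpret M: left_module R M by (rule arrow_lm(1)[OF D1(1)])
  note pr = biproduct_pair[OF B arrow_comp[OF D2(3) D1(2)] D2(4)]
  note pr2 = biproduct_pair[OF B2 arrow_comp[OF D(3) D1(4)] D(4)]
  show "arrow R M T (\<lambda>x. i (i1 x))" by (rule arrow_comp[OF D1(1) D(1)])
  show "arrow R T2 T (\<lambda>y. i (j1 (p2 y)) \<oplus>\<^bsub>T\<^esub> j (q2 y))" by (rule pr(1))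
  show "arrow R T M (\<lambda>x. p1 (p x))" by (rule arrow_comp[OF D(3) D1(3)])
  show "arrow R T T2 (\<lambda>x. i2 (q1 (p x)) \<oplus>\<^bsub>T2\<^esub> j2 (q x))" by (rule pr2(1))
  fix x assume x: "x \<in> carrier M"
  show "p1 (p (i (i1 x))) = x" using x D1(1,5) D(5) by (simp add: arrow_app[OF D1(1)])
  show "i2 (q1 (p (i (i1 x)))) \<oplus>\<^bsub>T2\<^esub> j2 (q (i (i1 x))) = \<zero>\<^bsub>T2\<^esub>"
    using x D(5,6) D1(6) by (simp add: arrow_app[OF D1(1)] arrow_zero[OF D2(1)] arrow_zero[OF D2(2)])
next
  note D1 = biproductD[OF B1] and D = biproductD[OF B] and D2 = biproductD[OF B2]
  note pr = biproduct_pair[OF B arrow_comp[OF D2(3) D1(2)] D2(4)]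
  fix y assume y: "y \<in> carrier T2"
  note c = arrow_app[OF D2(3) y] arrow_app[OF D2(4) y]
  show "i2 (q1 (p (i (j1 (p2 y)) \<oplus>\<^bsub>T\<^esub> j (q2 y)))) \<oplus>\<^bsub>T2\<^esub> j2 (q (i (j1 (p2 y)) \<oplus>\<^bsub>T\<^esub> j (q2 y))) = y"
    using pr(2,3)[OF y] D1(7)[OF c(1)] D2(9)[OF y] by simp
  show "p1 (p (i (j1 (p2 y)) \<oplus>\<^bsub>T\<^esub> j (q2 y))) = \<zero>\<^bsub>M\<^esub>" using pr(2)[OF y] D1(8)[OF c(1)] by simp
next
  note D1 = biproductD[OF B1] and D = biproductD[OF B] and D2 = biproductD[OF B2]
  interpret T: left_module R T by (rule arrow_lm(1)[OF D(3)])
  note pr2 = biproduct_pair[OF B2 arrow_comp[OF D(3) D1(4)] D(4)]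
  fix x assume x: "x \<in> carrier T"
  note c = arrow_app[OF D(3) x] arrow_app[OF D(4) x]
  note c1 = arrow_app[OF D1(3) c(1)] arrow_app[OF D1(4) c(1)]
  have "i (i1 (p1 (p x))) \<oplus>\<^bsub>T\<^esub> i (j1 (q1 (p x))) = i (p x)"
    using arrow_add[OF D(1) arrow_app[OF D1(1) c1(1)] arrow_app[OF D1(2) c1(2)]] D1(9)[OF c(1)] by simp
  then have "i (i1 (p1 (p x))) \<oplus>\<^bsub>T\<^esub> (i (j1 (q1 (p x))) \<oplus>\<^bsub>T\<^esub> j (q x)) = x"
    using D(9)[OF x] arrow_app[OF D(1) arrow_app[OF D1(1) c1(1)]] arrow_app[OF D(1) arrow_app[OF D1(2) c1(2)]]
      arrow_app[OF D(2) c(2)] by (simp add: T.M.a_assoc[symmetric])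
  then show "x = i (i1 (p1 (p x))) \<oplus>\<^bsub>T\<^esub> (i (j1 (p2 (i2 (q1 (p x)) \<oplus>\<^bsub>T2\<^esub> j2 (q x)))) \<oplus>\<^bsub>T\<^esub> j (q2 (i2 (q1 (p x)) \<oplus>\<^bsub>T2\<^esub> j2 (q x))))"
    using pr2(2,3)[OF x] by simp
qed

lemma biproduct_commute: "biproduct R T M N i j p q \<Longrightarrow> biproduct R T N M j i q p"
proof -
  assume B: "biproduct R T M N i j p q"
  note D = biproductD[OF B]
  interpret T: left_module R T by (rule arrow_lm(1)[OF D(3)])
  have "x = j (q x) \<oplus>\<^bsub>T\<^esub> i (p x)" if x: "x \<in> carrier T" for x
    by (rule trans[OF D(9)[OF x, symmetric] T.M.a_comm[OF arrow_app[OF D(1) arrow_app[OF D(3) x]] arrow_app[OF D(2) arrow_app[OF D(4) x]]]])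
  then show ?thesis unfolding biproduct_def by (intro conjI ballI D(1-8))
qed

text \<open>
  The classes of modules up to projective summands form a commutative monoid under direct sums, and taking
  syzygies is an endomorphism of it.  The unit class consists of the projective modules.
\<close>

definition stable_class where "stable_class M = {N. stably_iso M N}"

definition stable_sum where
  "stable_sum W Y = {L. \<exists>M\<in>W. \<exists>N\<in>Y. \<exists>T i j p q. biproduct R T M N i j p q \<and> stably_iso T L}"

definition stable_monoid where
  "stable_monoid = \<lparr>carrier = stable_class ` fg_modules R, monoid.mult = stable_sum,
     one = {L. \<exists>Z\<in>fg_modules R. carrier Z = {\<zero>\<^bsub>Z\<^esub>} \<and> stably_iso Z L}\<rparr>"

definition syz where
  "syz W = {L. \<exists>M\<in>W. \<exists>P p. cover R M P p \<and> stably_iso (ker_mod P M p) L}"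

lemma stable_class_eq_iff:
  assumes "M \<in> fg_modules R" shows "stable_class M = stable_class N \<longleftrightarrow> stably_iso M N"
proof
  assume "stable_class M = stable_class N"
  then show "stably_iso M N" using stably_iso_refl[OF assms] stably_iso_sym unfolding stable_class_def by blast
next
  assume "stably_iso M N"
  then show "stable_class M = stable_class N" unfolding stable_class_def using stably_iso_trans stably_iso_sym by blast
qed

lemma stable_sum_class:
  assumes B: "biproduct R T M N i j p q"
  shows "stable_sum (stable_class M) (stable_class N) = stable_class T"
proof
  show "stable_sum (stable_class M) (stable_class N) \<subseteq> stable_class T"
  proof
    fix L assume "L \<in> stable_sum (stable_class M) (stable_class N)"
    then obtain M' N' T' i' j' p' q' where *: "stably_iso M M'" "stably_iso N N'" "biproduct R T' M' N' i' j' p' q'" "stably_iso T' L"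
      unfolding stable_sum_def stable_class_def by blast
    show "L \<in> stable_class T" unfolding stable_class_def
      using stably_iso_trans[OF stably_iso_biproduct[OF B *(3,1,2)] *(4)] by simp
  qed
  show "stable_class T \<subseteq> stable_sum (stable_class M) (stable_class N)"
  proof
    fix L assume "L \<in> stable_class T"
    then have "stably_iso T L" by (simp add: stable_class_def)
    moreover have "M \<in> stable_class M" "N \<in> stable_class N"
      using stably_iso_refl[OF arrow_fg(1)[OF biproductD(1)[OF B]]] stably_iso_refl[OF arrow_fg(1)[OF biproductD(2)[OF B]]]
      by (simp_all add: stable_class_def)
    ultimately show "L \<in> stable_sum (stable_class M) (stable_class N)" unfolding stable_sum_def using B by blast
  qed
qed

lemma stable_one_class:
  assumes "Z \<in> fg_modules R" "carrier Z = {\<zero>\<^bsub>Z\<^esub>}"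
  shows "\<one>\<^bsub>stable_monoid\<^esub> = stable_class Z"
proof -
  have "stably_iso Z Z'" if Z': "Z' \<in> fg_modules R" "carrier Z' = {\<zero>\<^bsub>Z'\<^esub>}" for Z'
    by (rule stably_iso_of_inverse[OF arrow_const_zero[OF assms(1) Z'(1)] arrow_const_zero[OF Z'(1) assms(1)]])
      (use assms Z' in auto)
  then have 1: "stably_iso Z L" if "Z' \<in> fg_modules R" "carrier Z' = {\<zero>\<^bsub>Z'\<^esub>}" "stably_iso Z' L" for Z' L
    by (rule stably_iso_trans[OF _ that(3)]) (rule that)+
  have "(\<exists>Z'\<in>fg_modules R. carrier Z' = {\<zero>\<^bsub>Z'\<^esub>} \<and> stably_iso Z' L) \<longleftrightarrow> stably_iso Z L" for L
  proof
    show "stably_iso Z L \<Longrightarrow> \<exists>Z'\<in>fg_modules R. carrier Z' = {\<zero>\<^bsub>Z'\<^esub>} \<and> stably_iso Z' L"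
      using assms by (intro bexI[of _ Z] conjI)
  qed (elim bexE conjE, rule 1)
  then show ?thesis by (simp add: stable_monoid_def stable_class_def)
qed

lemma syz_class:
  assumes "cover R M P p"
  shows "syz (stable_class M) = stable_class (ker_mod P M p)"
proof
  show "syz (stable_class M) \<subseteq> stable_class (ker_mod P M p)"
  proof
    fix L assume "L \<in> syz (stable_class M)"
    then obtain M' P' p' where *: "stably_iso M M'" "cover R M' P' p'" "stably_iso (ker_mod P' M' p') L"
      unfolding syz_def stable_class_def by blast
    show "L \<in> stable_class (ker_mod P M p)" unfolding stable_class_def
      using stably_iso_trans[OF stably_iso_ker[OF *(1) assms *(2)] *(3)] by simp
  qed
  show "stable_class (ker_mod P M p) \<subseteq> syz (stable_class M)"
  proof
    fix L assume "L \<in> stable_class (ker_mod P M p)"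
    then have "stably_iso (ker_mod P M p) L" by (simp add: stable_class_def)
    moreover have "M \<in> stable_class M"
      using stably_iso_refl[OF arrow_fg(2)[OF coverD(2)[OF assms]]] by (simp add: stable_class_def)
    ultimately show "L \<in> syz (stable_class M)" unfolding syz_def using assms by blast
  qed
qed

lemma stable_comm_monoid: "comm_monoid stable_monoid"
proof (rule comm_monoidI)
  obtain Z where Z: "Z \<in> fg_modules R" "carrier Z = {\<zero>\<^bsub>Z\<^esub>}" using zero_module_fg[OF ring_axioms] by blast
  interpret Z: left_module R Z by (rule fg_left_module[OF Z(1)])
  note 1 = stable_one_class[OF Z]
  have c: "carrier stable_monoid = stable_class ` fg_modules R" and m: "\<And>W Y. W \<otimes>\<^bsub>stable_monoid\<^esub> Y = stable_sum W Y"
    by (simp_all add: stable_monoid_def)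
  show "\<one>\<^bsub>stable_monoid\<^esub> \<in> carrier stable_monoid" unfolding 1 c using Z by blast
  fix W assume "W \<in> carrier stable_monoid"
  then obtain M where M: "M \<in> fg_modules R" "W = stable_class M" unfolding c by blast
  interpret M: left_module R M by (rule fg_left_module[OF M(1)])
  have "biproduct R M Z M (\<lambda>x. \<zero>\<^bsub>M\<^esub>) (\<lambda>x. x) (\<lambda>x. \<zero>\<^bsub>Z\<^esub>) (\<lambda>x. x)"
    unfolding biproduct_def using arrow_const_zero[OF Z(1) M(1)] arrow_const_zero[OF M(1) Z(1)] arrow_id[OF M(1)] Z(2) by auto
  then show "\<one>\<^bsub>stable_monoid\<^esub> \<otimes>\<^bsub>stable_monoid\<^esub> W = W" unfolding 1 m M(2) by (rule stable_sum_class)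
  fix Y assume "Y \<in> carrier stable_monoid"
  then obtain N where N: "N \<in> fg_modules R" "Y = stable_class N" unfolding c by blast
  obtain T i j p q where B: "biproduct R T M N i j p q" using biproduct_exists[OF M(1) N(1)] by blast
  note T = arrow_fg(2)[OF biproductD(1)[OF B]]
  have XY: "stable_sum W Y = stable_class T" unfolding M N by (rule stable_sum_class[OF B])
  show "W \<otimes>\<^bsub>stable_monoid\<^esub> Y \<in> carrier stable_monoid" unfolding m XY c using T by blast
  show "W \<otimes>\<^bsub>stable_monoid\<^esub> Y = Y \<otimes>\<^bsub>stable_monoid\<^esub> W"
    unfolding m XY using stable_sum_class[OF biproduct_commute[OF B]] M N by simp
  fix V assume "V \<in> carrier stable_monoid"
  then obtain L where L: "L \<in> fg_modules R" "V = stable_class L" unfolding c by blast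
  obtain T2 i2 j2 p2 q2 where B2: "biproduct R T2 N L i2 j2 p2 q2" using biproduct_exists[OF N(1) L(1)] by blast
  obtain T' i' j' p' q' where B': "biproduct R T' T L i' j' p' q'" using biproduct_exists[OF T L(1)] by blast
  have "stable_sum W (stable_class T2) = stable_class T'" unfolding M
    by (rule stable_sum_class[OF biproduct_assoc[OF B B' B2]])
  then show "W \<otimes>\<^bsub>stable_monoid\<^esub> Y \<otimes>\<^bsub>stable_monoid\<^esub> V = W \<otimes>\<^bsub>stable_monoid\<^esub> (Y \<otimes>\<^bsub>stable_monoid\<^esub> V)"
    unfolding m XY using stable_sum_class[OF B'] stable_sum_class[OF B2] N L by simp
qed

lemma syz_hom: "syz \<in> hom stable_monoid stable_monoid"
proof (rule homI)
  have c: "carrier stable_monoid = stable_class ` fg_modules R" and m: "\<And>W Y. W \<otimes>\<^bsub>stable_monoid\<^esub> Y = stable_sum W Y"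
    by (simp_all add: stable_monoid_def)
  fix W assume "W \<in> carrier stable_monoid"
  then obtain M where M: "M \<in> fg_modules R" "W = stable_class M" unfolding c by blast
  obtain P a where P: "cover R M P a" using cover_exists[OF ring_axioms M(1)] by blast
  show "syz W \<in> carrier stable_monoid" unfolding M(2) syz_class[OF P] c using ker_fg[OF coverD(2)[OF P]] by blast
  fix Y assume "Y \<in> carrier stable_monoid"
  then obtain N where N: "N \<in> fg_modules R" "Y = stable_class N" unfolding c by blast
  obtain Q b where Q: "cover R N Q b" using cover_exists[OF ring_axioms N(1)] by blast
  obtain T i j p q where B: "biproduct R T M N i j p q" using biproduct_exists[OF M(1) N(1)] by blast
  obtain S s I J A C where K: "cover R T S s" "biproduct R (ker_mod S T s) (ker_mod P M a) (ker_mod Q N b) I J A C"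
    using biproduct_ker[OF B P Q] by blast
  show "syz (W \<otimes>\<^bsub>stable_monoid\<^esub> Y) = syz W \<otimes>\<^bsub>stable_monoid\<^esub> syz Y"
    unfolding m M N stable_sum_class[OF B] syz_class[OF P] syz_class[OF Q] syz_class[OF K(1)] stable_sum_class[OF K(2)] ..
qed

text \<open>
  If the third term of a short exact sequence is projective, the sequence splits and the first two
  terms agree stably.  The horseshoe lemma reduces the general case to this one.
\<close>

lemma syz_pow_eq:
  assumes "short_exact R W Y Z f \<pi>" "null R d Z Z (\<lambda>x. x)"
  shows "(syz ^^ d) (stable_class W) = (syz ^^ d) (stable_class Y)"
  using assms
proof (induction d arbitrary: W Y Z f \<pi>)
  case 0
  then have Z: "projective_mod R Z" using null_id_projective by blast
  then obtain t r where "biproduct R Y W Z f t r \<pi>" using short_exact_split[OF 0(1)] by blast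
  then have "stably_iso W Y" using Z by (rule stably_iso_projective_summand)
  then show ?case using stable_class_eq_iff stably_iso_fg(1) by simp
next
  case (Suc d)
  obtain PX pX PY pY PZ pZ F G where H: "cover R W PX pX" "cover R Y PY pY" "cover R Z PZ pZ"
    "short_exact R (ker_mod PX W pX) (ker_mod PY Y pY) (ker_mod PZ Z pZ) F G"
    using horseshoe[OF Suc.prems(1)] by metis
  from Suc.IH[OF H(4) null_id_lift[OF Suc.prems(2) H(3)]] show ?case
    by (simp add: funpow_swap1 syz_class[OF H(1), symmetric] syz_class[OF H(2), symmetric])
qed

text \<open>
  By the horseshoe lemma there is an exact sequence of \<open>n\<close>-th syzygies; passing to it lowers the projective
  dimension of the third term by at most \<open>n\<close>.
\<close>

lemma short_exact_shift:
  assumes "short_exact R W Y Z f \<pi>"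
  shows "\<exists>W' Y' Z' f' \<pi>'. short_exact R W' Y' Z' f' \<pi>' \<and> stable_class W' = (syz ^^ n) (stable_class W) \<and>
    stable_class Y' = (syz ^^ n) (stable_class Y) \<and>
    (\<forall>m. null R m Z' Z' (\<lambda>x. x) \<longrightarrow> null R (m + n) Z Z (\<lambda>x. x)) \<and>
    (\<forall>m. null R m Z Z (\<lambda>x. x) \<longrightarrow> null R m Z' Z' (\<lambda>x. x))"
proof (induction n)
  case 0
  show ?case by (intro exI[of _ W] exI[of _ Y] exI[of _ Z] exI[of _ f] exI[of _ \<pi>]) (use assms in simp)
next
  case (Suc n)
  then obtain W' Y' Z' f' \<pi>' where *: "short_exact R W' Y' Z' f' \<pi>'" "stable_class W' = (syz ^^ n) (stable_class W)"
    "stable_class Y' = (syz ^^ n) (stable_class Y)" "\<forall>m. null R m Z' Z' (\<lambda>x. x) \<longrightarrow> null R (m + n) Z Z (\<lambda>x. x)"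
    "\<forall>m. null R m Z Z (\<lambda>x. x) \<longrightarrow> null R m Z' Z' (\<lambda>x. x)" by blast
  obtain PX pX PY pY PZ pZ F G where H: "cover R W' PX pX" "cover R Y' PY pY" "cover R Z' PZ pZ"
    "short_exact R (ker_mod PX W' pX) (ker_mod PY Y' pY) (ker_mod PZ Z' pZ) F G"
    using horseshoe[OF *(1)] by metis
  have "null R (m + Suc n) Z Z (\<lambda>x. x)" if "null R m (ker_mod PZ Z' pZ) (ker_mod PZ Z' pZ) (\<lambda>x. x)" for m
    using *(4)[rule_format, OF null_id_unlift[OF that H(3)]] by simp
  moreover have "null R m (ker_mod PZ Z' pZ) (ker_mod PZ Z' pZ) (\<lambda>x. x)" if "null R m Z Z (\<lambda>x. x)" for m
    using null_id_lift[OF null_Suc H(3)] *(5) that by blast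
  ultimately show ?case using H(4) syz_class[OF H(1)] syz_class[OF H(2)] *(2,3)
    by (intro exI[of _ "ker_mod PX W' pX"] exI[of _ "ker_mod PY Y' pY"] exI[of _ "ker_mod PZ Z' pZ"] exI[of _ F] exI[of _ G]) simp
qed

end

section \<open>Ascending chains of subgroups of a free abelian group of finite rank\<close>

lemma int_subgroup_times:
  fixes S :: "int set"
  assumes "\<And>x y. x \<in> S \<Longrightarrow> y \<in> S \<Longrightarrow> x - y \<in> S" "x \<in> S"
  shows "c * x \<in> S"
proof -
  have z: "0 \<in> S" using assms(1)[OF assms(2,2)] by simp
  show ?thesis
  proof (induction c rule: int_induct[where k = 0])
    case (step1 i)
    have "0 - x \<in> S" using assms z by blast
    from assms(1)[OF step1(2) this] show ?case by (simp add: algebra_simps)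
  next
    case (step2 i)
    from assms(1)[OF step2(2) assms(2)] show ?case by (simp add: algebra_simps)
  qed (use z in simp)
qed

text \<open>
  Once the least positive member of the union has been reached, division with remainder shows that nothing is added.
\<close>

lemma int_subgroups_stop:
  fixes E :: "nat \<Rightarrow> int set"
  assumes ne: "\<And>n. E n \<noteq> {}" and diff: "\<And>n x y. x \<in> E n \<Longrightarrow> y \<in> E n \<Longrightarrow> x - y \<in> E n" and mono: "incseq E"
  shows "\<exists>k. \<forall>n. E n \<subseteq> E k"
proof (cases "\<exists>n x. x \<in> E n \<and> x > 0")
  case True
  define m where "m = (LEAST m. m > 0 \<and> (\<exists>n. int m \<in> E n))"
  from True obtain n x where "x \<in> E n" "x > 0" by blast
  then have "nat x > 0 \<and> (\<exists>n. int (nat x) \<in> E n)" by auto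
  then have m: "m > 0 \<and> (\<exists>n. int m \<in> E n)" unfolding m_def by (rule LeastI)
  then obtain k where k: "int m \<in> E k" by blast
  have "x \<in> E k" if x: "x \<in> E n" for n x
  proof -
    have mn: "E k \<subseteq> E (max n k)" "E n \<subseteq> E (max n k)" using mono by (auto simp: incseq_def)
    have "(x div int m) * int m \<in> E (max n k)" using k mn int_subgroup_times[of "E (max n k)"] diff by blast
    then have "x - (x div int m) * int m \<in> E (max n k)" using x mn diff by blast
    then have r: "x mod int m \<in> E (max n k)" by (simp add: minus_div_mult_eq_mod)
    have "x mod int m = 0"
    proof (rule ccontr)
      assume "x mod int m \<noteq> 0"
      moreover have "0 \<le> x mod int m" "x mod int m < int m" using m by auto
      ultimately have "nat (x mod int m) > 0 \<and> (\<exists>n. int (nat (x mod int m)) \<in> E n)" "nat (x mod int m) < m" using r by auto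
      then show False using not_less_Least[of "nat (x mod int m)" "\<lambda>m. m > 0 \<and> (\<exists>n. int m \<in> E n)"] unfolding m_def by blast
    qed
    then have "x = (x div int m) * int m" by (metis add.right_neutral div_mult_mod_eq)
    moreover have "(x div int m) * int m \<in> E k" using k int_subgroup_times[of "E k"] diff by blast
    ultimately show ?thesis by simp
  qed
  then show ?thesis by blast
next
  case False
  have z: "0 \<in> E n" for n using ne[of n] diff[of _ n] by (metis diff_self ex_in_conv)
  have "x = 0" if "x \<in> E n" for n x
    using False diff[OF z that] that by (metis diff_0 neg_0_less_iff_less linorder_neqE)
  then show ?thesis using z by (intro exI[of _ 0]) auto
qed

text \<open>
  Induction on the rank, applied to the vectors with last coordinate zero, while the last
  coordinates form a chain of subgroups of the integers.  Only the coordinates below \<open>r\<close> are compared, so that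
  vectors can be functions on all natural numbers.
\<close>

lemma int_vector_subgroups_stop:
  fixes E :: "nat \<Rightarrow> (nat \<Rightarrow> int) set"
  assumes "\<And>n. E n \<noteq> {}" "\<And>n v w. v \<in> E n \<Longrightarrow> w \<in> E n \<Longrightarrow> (\<lambda>i. v i - w i) \<in> E n" "incseq E"
  shows "\<exists>k. \<forall>n. \<forall>v\<in>E n. \<exists>w\<in>E k. \<forall>i<r. v i = w i"
  using assms
proof (induction r arbitrary: E)
  case 0 then show ?case by auto
next
  case (Suc r)
  have z: "(\<lambda>i. 0) \<in> E n" for n
  proof -
    obtain v where "v \<in> E n" using Suc.prems(1)[of n] by blast
    then show ?thesis using Suc.prems(2)[of v n v] by simp
  qed
  have mono: "E m \<subseteq> E n" if "m \<le> n" for m n using Suc.prems(3) that by (auto simp: incseq_def)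
  let ?E' = "\<lambda>n. {v \<in> E n. v r = 0}"
  have "\<exists>k. \<forall>n. \<forall>v\<in>?E' n. \<exists>w\<in>?E' k. \<forall>i<r. v i = w i"
  proof (rule Suc.IH)
    show "incseq ?E'" unfolding incseq_def using mono by blast
  qed (use z Suc.prems(2) in auto)
  then obtain k1 where k1: "\<And>n v. v \<in> ?E' n \<Longrightarrow> \<exists>w\<in>?E' k1. \<forall>i<r. v i = w i" by blast
  have "\<exists>k. \<forall>n. (\<lambda>v. v r) ` E n \<subseteq> (\<lambda>v. v r) ` E k"
  proof (rule int_subgroups_stop)
    fix n x y assume "x \<in> (\<lambda>v. v r) ` E n" "y \<in> (\<lambda>v. v r) ` E n"
    then show "x - y \<in> (\<lambda>v. v r) ` E n" using Suc.prems(2) by (force simp: image_iff)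
  next
    show "incseq (\<lambda>n. (\<lambda>v. v r) ` E n)" unfolding incseq_def using mono by (intro allI impI image_mono)
  qed (use Suc.prems(1) in auto)
  then obtain k2 where k2: "\<And>n. (\<lambda>v. v r) ` E n \<subseteq> (\<lambda>v. v r) ` E k2" by blast
  have "\<exists>w\<in>E (max k1 k2). \<forall>i<Suc r. v i = w i" if v: "v \<in> E n" for n v
  proof -
    obtain u where u: "u \<in> E k2" "v r = u r" using k2[of n] v by blast
    have uv: "u \<in> E (max n k2)" "v \<in> E (max n k2)" using u v mono[of k2 "max n k2"] mono[of n "max n k2"] by auto
    then have "(\<lambda>i. v i - u i) \<in> ?E' (max n k2)" using Suc.prems(2) u by simp
    then obtain w where w: "w \<in> ?E' k1" "\<forall>i<r. v i - u i = w i" using k1 by blast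
    have uw: "u \<in> E (max k1 k2)" "w \<in> E (max k1 k2)" using u w mono[of k2 "max k1 k2"] mono[of k1 "max k1 k2"] by auto
    have "(\<lambda>i. u i - (0 - w i)) \<in> E (max k1 k2)" using Suc.prems(2)[OF uw(1) Suc.prems(2)[OF z uw(2)]] .
    moreover have "\<forall>i<Suc r. v i = u i - (0 - w i)" using w u(2) by (auto simp: less_Suc_eq algebra_simps)
    ultimately show ?thesis by (intro bexI[of _ "\<lambda>i. u i - (0 - w i)"])
  qed
  then show ?case by (intro exI[of _ "max k1 k2"]) simp
qed

context comm_monoid begin

definition multi_pow :: "nat \<Rightarrow> (nat \<Rightarrow> 'a) \<Rightarrow> (nat \<Rightarrow> nat) \<Rightarrow> 'a" where
  "multi_pow r x a = finprod G (\<lambda>i. x i [^] a i) {..<r}"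

lemma multi_pow_closed: "(\<And>i. i < r \<Longrightarrow> x i \<in> carrier G) \<Longrightarrow> multi_pow r x a \<in> carrier G"
  unfolding multi_pow_def by (intro finprod_closed) auto

lemma multi_pow_add:
  "(\<And>i. i < r \<Longrightarrow> x i \<in> carrier G) \<Longrightarrow> multi_pow r x (\<lambda>i. a i + b i) = multi_pow r x a \<otimes> multi_pow r x b"
proof -
  assume x: "\<And>i. i < r \<Longrightarrow> x i \<in> carrier G"
  have "multi_pow r x (\<lambda>i. a i + b i) = finprod G (\<lambda>i. x i [^] a i \<otimes> x i [^] b i) {..<r}"
    unfolding multi_pow_def using x by (intro finprod_cong') (auto simp: nat_pow_mult)
  also have "\<dots> = multi_pow r x a \<otimes> multi_pow r x b"
    unfolding multi_pow_def using x by (intro finprod_multf) auto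
  finally show ?thesis .
qed

lemma multi_pow_cong:
  "(\<And>i. i < r \<Longrightarrow> x i \<in> carrier G) \<Longrightarrow> (\<And>i. i < r \<Longrightarrow> a i = b i) \<Longrightarrow> multi_pow r x a = multi_pow r x b"
  unfolding multi_pow_def by (intro finprod_cong') auto

lemma multi_pow_zero: "multi_pow r x (\<lambda>i. 0) = \<one>"
  unfolding multi_pow_def by simp

lemma multi_pow_unit:
  "(\<And>i. i < r \<Longrightarrow> x i \<in> carrier G) \<Longrightarrow> j < r \<Longrightarrow> multi_pow r x (\<lambda>i. if j = i then 1 else 0) = x j"
proof -
  assume x: "\<And>i. i < r \<Longrightarrow> x i \<in> carrier G" and j: "j < r"
  have "multi_pow r x (\<lambda>i. if j = i then 1 else 0) = finprod G (\<lambda>i. if j = i then x i else \<one>) {..<r}"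
    unfolding multi_pow_def using x by (intro finprod_cong') auto
  also have "\<dots> = x j" using finprod_singleton[of j "{..<r}" x] j x by auto
  finally show ?thesis .
qed

lemma multi_pow_in:
  assumes "\<one> \<in> H" "\<And>x y. x \<in> H \<Longrightarrow> y \<in> H \<Longrightarrow> x \<otimes> y \<in> H" "H \<subseteq> carrier G" "\<And>i. i < r \<Longrightarrow> x i \<in> H"
  shows "multi_pow r x a \<in> H"
  using assms(4)
proof (induction r)
  case (Suc r)
  have pw: "y [^] n \<in> H" if "y \<in> H" for y and n :: nat using that assms(1-2) by (induction n) auto
  have "multi_pow (Suc r) x a = x r [^] a r \<otimes> multi_pow r x a"
    unfolding multi_pow_def lessThan_Suc using Suc.prems assms(3) by (subst finprod_insert) (auto intro!: nat_pow_closed)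
  then show ?case using Suc pw assms(2) by simp
qed (simp add: multi_pow_def assms(1))

text \<open>
  Two elements that an endomorphism identifies eventually are identified, up to cancellation, after
  a number of steps that depends only on the generators: the differences of exponent vectors that
  are identified after \<open>n\<close> steps form an ascending chain of subgroups of a free abelian group of finite rank.
\<close>

lemma uniform_identification:
  assumes w: "\<omega> \<in> hom G G" and x: "\<And>i. i < r \<Longrightarrow> x i \<in> carrier G"
  shows "\<exists>k. \<forall>n a b. (\<omega> ^^ n) (multi_pow r x a) = (\<omega> ^^ n) (multi_pow r x b) \<longrightarrow>
    (\<exists>c. (\<omega> ^^ k) (multi_pow r x a) \<otimes> (\<omega> ^^ k) (multi_pow r x c) =
         (\<omega> ^^ k) (multi_pow r x b) \<otimes> (\<omega> ^^ k) (multi_pow r x c))"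
proof -
  let ?m = "multi_pow r x"
  note cl = multi_pow_closed[OF x]
  have wn: "(\<omega> ^^ n) y \<in> carrier G" if "y \<in> carrier G" for n y
    using that w by (induction n) (auto simp: hom_def)
  have wm: "(\<omega> ^^ n) (y \<otimes> z) = (\<omega> ^^ n) y \<otimes> (\<omega> ^^ n) z" if "y \<in> carrier G" "z \<in> carrier G" for n y z
    using that wn w by (induction n) (auto simp: hom_def)
  define E where "E n = {v. \<exists>a b. (\<forall>i. v i = int (a i) - int (b i)) \<and> (\<omega> ^^ n) (?m a) = (\<omega> ^^ n) (?m b)}" for n
  have step: "(\<omega> ^^ n) y = (\<omega> ^^ n) z" if "(\<omega> ^^ m) y = (\<omega> ^^ m) z" "m \<le> n" for m n y z
    using that(2,1) by (induction n rule: dec_induct) auto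
  have mono: "incseq E"
  proof (rule incseq_SucI, rule subsetI)
    fix n v assume "v \<in> E n"
    then obtain a b where "\<forall>i. v i = int (a i) - int (b i)" "(\<omega> ^^ n) (?m a) = (\<omega> ^^ n) (?m b)" unfolding E_def by blast
    then show "v \<in> E (Suc n)" unfolding E_def by (intro CollectI exI[of _ a] exI[of _ b]) simp
  qed
  have "\<exists>k. \<forall>n. \<forall>v\<in>E n. \<exists>w\<in>E k. \<forall>i<r. v i = w i"
  proof (rule int_vector_subgroups_stop[OF _ _ mono])
    fix n
    have "(\<lambda>i. 0) \<in> E n" unfolding E_def by (auto intro!: exI[of _ "\<lambda>i. 0 :: nat"])
    then show "E n \<noteq> {}" by blast
    fix v v' assume "v \<in> E n" "v' \<in> E n"
    then obtain a b a' b' where ab: "\<forall>i. v i = int (a i) - int (b i)" "(\<omega> ^^ n) (?m a) = (\<omega> ^^ n) (?m b)"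
      "\<forall>i. v' i = int (a' i) - int (b' i)" "(\<omega> ^^ n) (?m a') = (\<omega> ^^ n) (?m b')" unfolding E_def by blast
    have "(\<omega> ^^ n) (?m (\<lambda>i. a i + b' i)) = (\<omega> ^^ n) (?m (\<lambda>i. b i + a' i))"
      using ab by (simp add: multi_pow_add[OF x] wm cl)
    moreover have "\<forall>i. v i - v' i = int (a i + b' i) - int (b i + a' i)" using ab by simp
    ultimately show "(\<lambda>i. v i - v' i) \<in> E n" unfolding E_def
      by (intro CollectI exI[of _ "\<lambda>i. a i + b' i"] exI[of _ "\<lambda>i. b i + a' i"] conjI)
  qed
  then obtain k where k: "\<And>n v. v \<in> E n \<Longrightarrow> \<exists>w\<in>E k. \<forall>i<r. v i = w i" by blast
  have "\<exists>c. (\<omega> ^^ k) (?m a) \<otimes> (\<omega> ^^ k) (?m c) = (\<omega> ^^ k) (?m b) \<otimes> (\<omega> ^^ k) (?m c)"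
    if e: "(\<omega> ^^ n) (?m a) = (\<omega> ^^ n) (?m b)" for n a b
  proof -
    have "(\<lambda>i. int (a i) - int (b i)) \<in> E n" unfolding E_def using e by blast
    then obtain v where v: "v \<in> E k" "\<forall>i<r. int (a i) - int (b i) = v i" using k by blast
    then obtain a' b' where ab: "\<forall>i. v i = int (a' i) - int (b' i)" "(\<omega> ^^ k) (?m a') = (\<omega> ^^ k) (?m b')" unfolding E_def by blast
    have "a i + b' i = b i + a' i" if "i < r" for i
    proof -
      have "int (a i) - int (b i) = int (a' i) - int (b' i)" using v(2) ab(1) that by simp
      then show ?thesis by linarith
    qed
    then have "?m (\<lambda>i. a i + b' i) = ?m (\<lambda>i. b i + a' i)" by (intro multi_pow_cong x)
    then have "(\<omega> ^^ k) (?m a \<otimes> ?m b') = (\<omega> ^^ k) (?m b \<otimes> ?m a')" by (simp add: multi_pow_add[OF x])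
    then show ?thesis using ab(2) by (auto simp: wm cl)
  qed
  then show ?thesis by blast
qed

end

section \<open>A uniform bound for projective dimensions\<close>

text \<open>
  Module-finite algebras over a commutative artinian ring, seen as rings \<open>R\<close> with a central
  subring \<open>T\<close> over which finitely generated \<open>R\<close>-modules satisfy both chain conditions.
\<close>

locale finite_length_algebra = noetherian_ring +
  fixes T
  assumes T_subring: "subring T R"
    and T_central: "\<lbrakk>t \<in> T; a \<in> carrier R\<rbrakk> \<Longrightarrow> t \<otimes> a = a \<otimes> t"
    and T_length: "M \<in> fg_modules R \<Longrightarrow> fin_length (R\<lparr>carrier := T\<rparr>) M"
begin

lemma arrow_scalar:
  assumes "t \<in> T" "M \<in> fg_modules R"
  shows "arrow R M M (\<lambda>x. t \<odot>\<^bsub>M\<^esub> x)"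
proof -
  interpret M: left_module R M by (rule fg_left_module[OF assms(2)])
  have t: "t \<in> carrier R" using subringE(1)[OF T_subring] assms(1) by blast
  show ?thesis using t assms(1)
    by (intro arrowI assms) (simp_all add: M.smult_r_distr M.smult_assoc[symmetric] T_central)
qed

text \<open>
  A homomorphism is determined by its values on generators, so chains of submodules of a module of
  homomorphisms stop because chains of submodules of the target do.
\<close>

lemma hom_chain_stops:
  assumes M: "M \<in> fg_modules R" and N: "N \<in> fg_modules R"
    and H: "\<And>k f. f \<in> H k \<Longrightarrow> arrow R M N f" "\<And>k. (\<lambda>x. \<zero>\<^bsub>N\<^esub>) \<in> H k"
      "\<And>k f g. f \<in> H k \<Longrightarrow> g \<in> H k \<Longrightarrow> (\<lambda>x. f x \<oplus>\<^bsub>N\<^esub> g x) \<in> H k"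
      "\<And>k f t. f \<in> H k \<Longrightarrow> t \<in> T \<Longrightarrow> (\<lambda>x. t \<odot>\<^bsub>N\<^esub> f x) \<in> H k"
      "\<And>k f g. f \<in> H k \<Longrightarrow> (\<And>x. x \<in> carrier M \<Longrightarrow> g x = f x) \<Longrightarrow> g \<in> H k"
    and ch: "incseq H \<or> decseq H"
  shows "\<exists>k. \<forall>i\<ge>k. H i = H k"
proof -
  let ?K = "R\<lparr>carrier := T\<rparr>"
  interpret N: left_module R N by (rule fg_left_module[OF N])
  note T = subsetD[OF subringE(1)[OF T_subring]]
  have m1: "\<ominus> \<one> \<in> T" using subringE(3,5)[OF T_subring] by blast
  have Hneg: "(\<lambda>x. \<ominus>\<^bsub>N\<^esub> f x) \<in> H k" if "f \<in> H k" for f k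
    using H(5)[OF H(4)[OF that m1]] N.smult_minus_one arrow_app[OF H(1)[OF that]] by simp
  interpret KN: left_module ?K N by (rule left_module_subring[OF fg_left_module[OF N] T_subring])
  obtain S where S: "finite S" "S \<subseteq> carrier M" "\<And>N. submodule N R M \<Longrightarrow> S \<subseteq> N \<Longrightarrow> N = carrier M"
    using M by (auto simp: fg_modules_def fin_gen_def)
  obtain s and n :: nat where s: "s ` {..<n} = S"
    using finite_imp_nat_seg_image_inj_on[OF S(1)] by (auto simp: lessThan_def)
  have sM: "s i \<in> carrier M" if "i < n" for i using that s S(2) by blast
  \<comment> \<open>the values at the \<open>j\<close>-th generator of those maps in \<open>A\<close> that vanish at all earlier ones\<close>
  define V where "V A j = {f (s j) | f. f \<in> A \<and> (\<forall>l<j. f (s l) = \<zero>\<^bsub>N\<^esub>)}" for A j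
  have sub: "submodule (V (H k) j) ?K N" if j: "j < n" for k j
  proof (rule KN.submoduleI)
    have sl: "s l \<in> carrier M" if "l \<le> j" for l using sM j that by simp
    show "V (H k) j \<subseteq> carrier N" by (auto simp: V_def intro: arrow_app[OF H(1) sl[OF order_refl]])
    show "\<zero>\<^bsub>N\<^esub> \<in> V (H k) j" unfolding V_def using H(2)[of k] by (intro CollectI exI[of _ "\<lambda>x. \<zero>\<^bsub>N\<^esub>"]) simp
    fix x y assume "x \<in> V (H k) j" "y \<in> V (H k) j"
    then obtain f g where fg: "f \<in> H k" "\<forall>l<j. f (s l) = \<zero>\<^bsub>N\<^esub>" "x = f (s j)" "g \<in> H k" "\<forall>l<j. g (s l) = \<zero>\<^bsub>N\<^esub>" "y = g (s j)"
      unfolding V_def by blast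
    show "x \<oplus>\<^bsub>N\<^esub> y \<in> V (H k) j" unfolding V_def
      using H(3)[OF fg(1,4)] fg by (intro CollectI exI[of _ "\<lambda>x. f x \<oplus>\<^bsub>N\<^esub> g x"]) simp
  next
    fix a x assume a: "a \<in> carrier ?K" and "x \<in> V (H k) j"
    then obtain f where fg: "f \<in> H k" "\<forall>l<j. f (s l) = \<zero>\<^bsub>N\<^esub>" "x = f (s j)" unfolding V_def by blast
    have "a \<odot>\<^bsub>N\<^esub> \<zero>\<^bsub>N\<^esub> = \<zero>\<^bsub>N\<^esub>" using a T by simp
    then show "a \<odot>\<^bsub>N\<^esub> x \<in> V (H k) j" unfolding V_def
      using H(4)[OF fg(1)] a fg by (intro CollectI exI[of _ "\<lambda>x. a \<odot>\<^bsub>N\<^esub> f x"]) simp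
  qed
  have Vmono: "V A j \<subseteq> V B j" if "A \<subseteq> B" for A B j unfolding V_def using that by blast
  have "\<exists>k. \<forall>i\<ge>k. V (H i) j = V (H k) j" if j: "j < n" for j
  proof -
    have "incseq (\<lambda>k. V (H k) j) \<or> decseq (\<lambda>k. V (H k) j)"
      using ch unfolding incseq_def decseq_def by (elim disjE) (simp_all add: Vmono)
    from fin_lengthD[OF T_length[OF N] sub[OF j] this] show ?thesis by metis
  qed
  then obtain \<kappa> where \<kappa>: "\<And>j i. j < n \<Longrightarrow> i \<ge> \<kappa> j \<Longrightarrow> V (H i) j = V (H (\<kappa> j)) j" by metis
  define k where "k = Max (insert 0 (\<kappa> ` {..<n}))"
  have k: "V (H i) j = V (H k) j" if "j < n" "i \<ge> k" for i j
  proof -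
    have "\<kappa> j \<le> k" unfolding k_def using that(1) by (intro Max_ge) auto
    then show ?thesis using \<kappa>[OF that(1), of i] \<kappa>[OF that(1), of k] that(2) by simp
  qed
  have key: "B \<subseteq> A" if AB: "A \<subseteq> B" "A \<in> range H" "B \<in> range H" and V: "\<And>j. j < n \<Longrightarrow> V A j = V B j" for A B
  proof
    fix f assume f: "f \<in> B"
    obtain a b where ab: "A = H a" "B = H b" using AB by blast
    have "\<exists>g\<in>A. \<forall>l<j. f (s l) = g (s l)" if "j \<le> n" for j
      using that
    proof (induction j)
      case 0 then show ?case using H(2)[of a] ab(1) by blast
    next
      case (Suc j)
      then obtain g where g: "g \<in> A" "\<forall>l<j. f (s l) = g (s l)" by auto
      have gH: "g \<in> H a" "g \<in> H b" "f \<in> H b" using g f AB(1) ab by auto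
      note ga = H(1)[OF gH(1)] H(1)[OF gH(3)]
      let ?d = "\<lambda>x. f x \<ominus>\<^bsub>N\<^esub> g x"
      have "?d \<in> B" unfolding a_minus_def ab(2) by (rule H(3)[OF gH(3) Hneg[OF gH(2)]])
      moreover have "\<forall>l<j. ?d (s l) = \<zero>\<^bsub>N\<^esub>"
        using g(2) arrow_app[OF ga(1)] sM Suc.prems by (simp add: N.M.minus_zero_iff)
      ultimately have "?d (s j) \<in> V B j" unfolding V_def by (intro CollectI exI[of _ ?d] conjI refl)
      then have "?d (s j) \<in> V A j" using V Suc.prems by simp
      then obtain g' where g': "g' \<in> A" "\<forall>l<j. g' (s l) = \<zero>\<^bsub>N\<^esub>" "?d (s j) = g' (s j)" unfolding V_def by blast
      have "(\<lambda>x. g' x \<oplus>\<^bsub>N\<^esub> g x) \<in> A" using H(3)[OF _ gH(1), of g'] g'(1) ab(1) by simp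
      moreover have "f (s l) = g' (s l) \<oplus>\<^bsub>N\<^esub> g (s l)" if l: "l < Suc j" for l
      proof (cases "l = j")
        case True
        have "s j \<in> carrier M" using sM Suc.prems by simp
        then show ?thesis unfolding True g'(3)[symmetric]
          using arrow_app[OF ga(1)] arrow_app[OF ga(2)] by (simp add: N.M.minus_add_cancel)
      next
        case False
        then have "l < j" "s l \<in> carrier M" using l sM Suc.prems by auto
        then show ?thesis using g(2) g'(2) arrow_app[OF ga(1)] by simp
      qed
      ultimately show ?case by (intro bexI[of _ "\<lambda>x. g' x \<oplus>\<^bsub>N\<^esub> g x"]) auto
    qed
    then obtain g where g: "g \<in> A" "\<forall>l<n. f (s l) = g (s l)" by blast
    have ga: "arrow R M N g" "arrow R M N f" using H(1)[of g a] H(1)[of f b] g(1) f ab by simp_all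
    interpret M: left_module R M by (rule fg_left_module[OF M])
    have "submodule {x \<in> carrier M. f x = g x} R M"
      by (rule M.submoduleI)
        (auto simp: arrow_zero[OF ga(1)] arrow_zero[OF ga(2)] arrow_add[OF ga(1)] arrow_add[OF ga(2)]
          arrow_smult[OF ga(1)] arrow_smult[OF ga(2)])
    then have "{x \<in> carrier M. f x = g x} = carrier M" by (rule S(3)) (use g(2) s S(2) in auto)
    then have "f x = g x" if "x \<in> carrier M" for x using that by blast
    from H(5)[of g a f, OF _ this] show "f \<in> A" using g(1) ab by simp
  qed
  have "H i = H k" if i: "i \<ge> k" for i
  proof -
    have "V (H i) j = V (H k) j" if "j < n" for j using k[OF that i] .
    moreover have "H i \<subseteq> H k \<or> H k \<subseteq> H i" using ch i by (auto simp: incseq_def decseq_def)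
    ultimately show ?thesis using key[of "H i" "H k"] key[of "H k" "H i"] by auto
  qed
  then show ?thesis by blast
qed

text \<open>
  The \<open>k\<close>-null endomorphisms form an ascending chain as \<open>k\<close> grows.
\<close>

lemma null_bound_exists:
  assumes G: "G \<in> fg_modules R"
  shows "\<exists>k0. \<forall>k \<gamma>. null R k G G \<gamma> \<longrightarrow> null R k0 G G \<gamma>"
proof -
  have "\<exists>k. \<forall>i\<ge>k. {\<gamma>. null R i G G \<gamma>} = {\<gamma>. null R k G G \<gamma>}"
  proof (rule hom_chain_stops[OF G G])
    fix k f t assume "f \<in> {\<gamma>. null R k G G \<gamma>}" "t \<in> T"
    then show "(\<lambda>x. t \<odot>\<^bsub>G\<^esub> f x) \<in> {\<gamma>. null R k G G \<gamma>}"
      using null_comp[OF _ arrow_id[OF G] arrow_scalar[OF _ G]] by simp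
  qed (use null_zero[OF G G] null_add in \<open>auto simp del: null.simps simp: incseq_def intro: null_arrow null_cong null_mono\<close>)
  then obtain k0 where k0: "\<forall>i\<ge>k0. {\<gamma>. null R i G G \<gamma>} = {\<gamma>. null R k0 G G \<gamma>}" ..
  have "null R k0 G G \<gamma>" if "null R k G G \<gamma>" for k \<gamma>
    using null_mono[OF that, of "max k k0"] k0[rule_format, of "max k k0"] by (auto simp del: null.simps)
  then show ?thesis by blast
qed

text \<open>
  A degree from which on nothing more becomes null among the endomorphisms of \<open>G\<close> serves for all
  modules obtained from \<open>G\<close> by retracts, direct sums and stable isomorphisms.
\<close>

inductive built_from for G where
  retract: "arrow R M G u \<Longrightarrow> arrow R G M v \<Longrightarrow> (\<And>x. x \<in> carrier M \<Longrightarrow> v (u x) = x) \<Longrightarrow> built_from G M"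
| sum: "biproduct R S M N i j p q \<Longrightarrow> built_from G M \<Longrightarrow> built_from G N \<Longrightarrow> built_from G S"
| iso: "stably_iso M N \<Longrightarrow> built_from G M \<Longrightarrow> built_from G N"

lemma null_bound_left:
  assumes "built_from G M" "\<And>k \<gamma>. null R k G N \<gamma> \<Longrightarrow> null R k0 G N \<gamma>" "null R k M N \<gamma>"
  shows "null R k0 M N \<gamma>"
  using assms(1,3)
proof (induction arbitrary: \<gamma>)
  case (retract M u v)
  note N = arrow_fg(2)[OF null_arrow[OF retract(4)]]
  have "null R k0 G N (\<lambda>x. \<gamma> (v x))"
    using assms(2)[of k] null_comp[OF retract(4) retract(2) arrow_id[OF N]] by simp
  from null_comp[OF this retract(1) arrow_id[OF N]] show ?case by (rule null_cong) (simp add: retract(3))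
next
  case (sum S M M' i j p q)
  note D = biproductD[OF sum(1)] and a = null_arrow[OF sum(6)]
  note N = arrow_id[OF arrow_fg(2)[OF a]]
  have "null R k0 M N (\<lambda>x. \<gamma> (i x))" "null R k0 M' N (\<lambda>x. \<gamma> (j x))"
    using sum.IH null_comp[OF sum(6) D(1) N] null_comp[OF sum(6) D(2) N] by blast+
  from null_add[OF null_comp[OF this(1) D(3) N] null_comp[OF this(2) D(4) N]] show ?case
    by (rule null_cong)
      (simp add: D(9) arrow_add[OF a, symmetric] arrow_app[OF D(1)] arrow_app[OF D(2)] arrow_app[OF D(3)] arrow_app[OF D(4)])
next
  case (iso M M')
  obtain f g where fg: "arrow R M M' f" "arrow R M' M g" "0: (\<lambda>x. f (g x)) \<approx> (\<lambda>x. x) on M' to M'"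
    using iso(1) unfolding stably_iso_def by blast
  note a = null_arrow[OF iso(4)]
  note N = arrow_id[OF arrow_fg(2)[OF a]]
  have "null R k0 M N (\<lambda>x. \<gamma> (f x))" using iso.IH null_comp[OF iso(4) fg(1) N] by blast
  from null_comp[OF this fg(2) N] have "null R k0 M' N (\<lambda>x. \<gamma> (f (g x)))" .
  then show ?case using nceq_null[OF nceq_mono[OF nceq_post[OF fg(3) a]]] by blast
qed

lemma null_bound_right:
  assumes "built_from G N" "\<And>k \<gamma>. null R k M G \<gamma> \<Longrightarrow> null R k0 M G \<gamma>" "null R k M N \<gamma>"
  shows "null R k0 M N \<gamma>"
  using assms(1,3)
proof (induction arbitrary: \<gamma>)
  case (retract N u v)
  note M = arrow_id[OF arrow_fg(1)[OF null_arrow[OF retract(4)]]]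
  have "null R k0 M G (\<lambda>x. u (\<gamma> x))" using assms(2)[of k] null_comp[OF retract(4) M retract(1)] by simp
  from null_comp[OF this M retract(2)] show ?case
    by (rule null_cong) (simp add: retract(3) arrow_app[OF null_arrow[OF retract(4)]])
next
  case (sum S N N' i j p q)
  note D = biproductD[OF sum(1)] and a = null_arrow[OF sum(6)]
  note M = arrow_id[OF arrow_fg(1)[OF a]]
  have "null R k0 M N (\<lambda>x. p (\<gamma> x))" "null R k0 M N' (\<lambda>x. q (\<gamma> x))"
    using sum.IH null_comp[OF sum(6) M D(3)] null_comp[OF sum(6) M D(4)] by blast+
  from null_add[OF null_comp[OF this(1) M D(1)] null_comp[OF this(2) M D(2)]] show ?case
    by (rule null_cong) (simp add: D(9) arrow_app[OF a])
next
  case (iso N N')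
  obtain f g where fg: "arrow R N N' f" "arrow R N' N g" "0: (\<lambda>x. f (g x)) \<approx> (\<lambda>x. x) on N' to N'"
    using iso(1) unfolding stably_iso_def by blast
  note a = null_arrow[OF iso(4)]
  note M = arrow_id[OF arrow_fg(1)[OF a]]
  have "null R k0 M N (\<lambda>x. g (\<gamma> x))" using iso.IH null_comp[OF iso(4) M fg(2)] by blast
  from null_comp[OF this M fg(1)] have "null R k0 M N' (\<lambda>x. f (g (\<gamma> x)))" .
  then show ?case using nceq_null[OF nceq_mono[OF nceq_pre[OF fg(3) a]]] by blast
qed

text \<open>
  The direct sum of the given modules has each of them as a retract.
\<close>

lemma common_overmodule:
  assumes "finite \<G>" "\<G> \<subseteq> fg_modules R"
  shows "\<exists>G\<in>fg_modules R. \<forall>M\<in>\<G>. built_from G M"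
proof -
  have "\<exists>G\<in>fg_modules R. \<forall>M\<in>\<G>. \<exists>u v. arrow R M G u \<and> arrow R G M v \<and> (\<forall>x\<in>carrier M. v (u x) = x)"
    using assms
  proof (induction \<G>)
    case empty then show ?case using zero_module_fg[OF ring_axioms] by blast
  next
    case (insert M \<G>)
    then obtain G where G: "G \<in> fg_modules R"
      "\<forall>M\<in>\<G>. \<exists>u v. arrow R M G u \<and> arrow R G M v \<and> (\<forall>x\<in>carrier M. v (u x) = x)" by auto
    have M: "M \<in> fg_modules R" using insert.prems by simp
    obtain S i j p q where B: "biproduct R S M G i j p q" using biproduct_exists[OF M G(1)] by blast
    note D = biproductD[OF B]
    have "\<exists>u v. arrow R L S u \<and> arrow R S L v \<and> (\<forall>x\<in>carrier L. v (u x) = x)" if L: "L \<in> insert M \<G>" for L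
    proof (cases "L = M")
      case True
      then show ?thesis using D(1,3,5) by blast
    next
      case False
      then obtain u v where uv: "arrow R L G u" "arrow R G L v" "\<forall>x\<in>carrier L. v (u x) = x" using L G(2) by blast
      show ?thesis using arrow_comp[OF uv(1) D(2)] arrow_comp[OF D(4) uv(2)] uv(3) D(7) arrow_app[OF uv(1)]
        by (intro exI[of _ "\<lambda>x. j (u x)"] exI[of _ "\<lambda>x. v (q x)"]) simp
    qed
    then show ?case using arrow_fg(2)[OF D(1)] by blast
  qed
  then obtain G where G: "G \<in> fg_modules R"
    "\<forall>M\<in>\<G>. \<exists>u v. arrow R M G u \<and> arrow R G M v \<and> (\<forall>x\<in>carrier M. v (u x) = x)" ..
  have "built_from G M" if M: "M \<in> \<G>" for M
  proof -
    obtain u v where "arrow R M G u" "arrow R G M v" "\<forall>x\<in>carrier M. v (u x) = x" using G(2) M by blast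
    then show ?thesis using retract[of M G u v] by simp
  qed
  then show ?thesis using G(1) by blast
qed

text \<open>
  If \<open>U\<close> and \<open>V\<close> are stably isomorphic, \<open>f : U \<rightarrow> V\<close> is injective with cokernel of finite projective
  dimension, and eventually null endomorphisms of \<open>U\<close> are \<open>k\<close>-null, then the
  cokernel has projective dimension at most \<open>k + 1\<close>.  Modulo the null maps, \<open>f\<close> becomes an element
  \<open>h\<close> of the endomorphism ring that can be cancelled on the left; as the ideals \<open>h\<^sup>m End(U)\<close> form a
  descending chain, \<open>h\<close> is invertible.
\<close>

lemma cokernel_bound:
  assumes E: "short_exact R U V Z f \<pi>" and iso: "stably_iso U V" and d: "null R d Z Z (\<lambda>x. x)"
    and bound: "\<And>l \<gamma>. null R l U U \<gamma> \<Longrightarrow> null R k U U \<gamma>"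
  shows "null R (Suc k) Z Z (\<lambda>x. x)"
proof -
  note D = short_exactD[OF E]
  note U = arrow_fg(1)[OF D(1)] and V = arrow_fg(2)[OF D(1)]
  interpret U: left_module R U by (rule fg_left_module[OF U])
  obtain \<theta>' \<theta> where th: "arrow R U V \<theta>'" "arrow R V U \<theta>" "0: (\<lambda>x. \<theta>' (\<theta> x)) \<approx> (\<lambda>x. x) on V to V"
    using iso unfolding stably_iso_def by blast
  note th0 = nceq_mono[OF th(3), of k, simplified]
  define h where "h x = \<theta> (f x)" for x
  have h: "arrow R U U h" unfolding h_def using arrow_comp[OF D(1) th(2)] .
  \<comment> \<open>left cancellation of \<open>h\<close>, the one place where the projective dimension of \<open>Z\<close> enters\<close>
  have cancel: "k: \<alpha> \<approx> \<beta> on U to U"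
    if ab: "arrow R U U \<alpha>" "arrow R U U \<beta>" and e: "k: (\<lambda>x. h (\<alpha> x)) \<approx> (\<lambda>x. h (\<beta> x)) on U to U" for \<alpha> \<beta>
  proof -
    have "k: (\<lambda>x. \<theta>' (\<theta> (f (\<alpha> x)))) \<approx> (\<lambda>x. \<theta>' (\<theta> (f (\<beta> x)))) on U to V"
      using nceq_post[OF e th(1)] by (simp add: h_def)
    then have "k: (\<lambda>x. f (\<alpha> x)) \<approx> (\<lambda>x. f (\<beta> x)) on U to V"
      using nceq_pre[OF th0 arrow_comp[OF ab(1) D(1)]] nceq_pre[OF th0 arrow_comp[OF ab(2) D(1)]] nceq_sym nceq_trans by meson
    then have "null R k U V (\<lambda>x. f (\<alpha> x) \<ominus>\<^bsub>V\<^esub> f (\<beta> x))" by (simp add: null_cong_maps_def)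
    then have "null R k U V (\<lambda>x. f (\<alpha> x \<ominus>\<^bsub>U\<^esub> \<beta> x))"
      by (rule null_cong) (simp add: arrow_minus[OF D(1)] arrow_app[OF ab(1)] arrow_app[OF ab(2)])
    then have "null R (max k d) U V (\<lambda>x. f (\<alpha> x \<ominus>\<^bsub>U\<^esub> \<beta> x))" by (rule null_mono) simp
    from null_cancel_mono[OF E d arrow_diff[OF ab] this] have "null R k U U (\<lambda>x. \<alpha> x \<ominus>\<^bsub>U\<^esub> \<beta> x)"
      using bound by simp
    then show ?thesis using ab by (simp add: null_cong_maps_def)
  qed
  have hm: "arrow R U U (h ^^ m)" for m
    by (induction m) (use arrow_id[OF U] arrow_comp[OF _ h] in \<open>auto simp: id_def comp_def\<close>)
  have hmc: "arrow R U U (\<lambda>x. (h ^^ m) (\<alpha> x))" if "arrow R U U \<alpha>" for m \<alpha> using arrow_comp[OF that hm] .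
  define H where "H m = {\<gamma>. \<exists>\<delta>. arrow R U U \<delta> \<and> k: \<gamma> \<approx> (\<lambda>x. (h ^^ m) (\<delta> x)) on U to U}" for m
  have "\<exists>m. \<forall>i\<ge>m. H i = H m"
  proof (rule hom_chain_stops[OF U U])
    show "arrow R U U \<gamma>" if "\<gamma> \<in> H m" for m \<gamma> using that unfolding H_def by (auto dest: nceq_arrows(1))
    have z: "arrow R U U (\<lambda>x. \<zero>\<^bsub>U\<^esub>)" using arrow_const_zero[OF U U] .
    show "(\<lambda>x. \<zero>\<^bsub>U\<^esub>) \<in> H m" for m unfolding H_def
      using z nceq_refl[OF z, of "\<lambda>x. (h ^^ m) \<zero>\<^bsub>U\<^esub>" k] arrow_zero[OF hm] by blast
    show "(\<lambda>x. \<gamma> x \<oplus>\<^bsub>U\<^esub> \<gamma>' x) \<in> H m" if gg: "\<gamma> \<in> H m" "\<gamma>' \<in> H m" for m \<gamma> \<gamma>'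
    proof -
      obtain \<delta> \<delta>' where dd: "arrow R U U \<delta>" "k: \<gamma> \<approx> (\<lambda>x. (h ^^ m) (\<delta> x)) on U to U"
        "arrow R U U \<delta>'" "k: \<gamma>' \<approx> (\<lambda>x. (h ^^ m) (\<delta>' x)) on U to U" using gg unfolding H_def by blast
      have "k: (\<lambda>x. (h ^^ m) (\<delta> x) \<oplus>\<^bsub>U\<^esub> (h ^^ m) (\<delta>' x)) \<approx> (\<lambda>x. (h ^^ m) (\<delta> x \<oplus>\<^bsub>U\<^esub> \<delta>' x)) on U to U"
        by (rule nceq_refl[OF arrow_plus[OF hmc[OF dd(1)] hmc[OF dd(3)]]])
          (simp add: arrow_add[OF hm] arrow_app[OF dd(1)] arrow_app[OF dd(3)])
      from nceq_trans[OF nceq_add[OF dd(2,4)] this] show ?thesis unfolding H_def using arrow_plus[OF dd(1,3)] by blast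
    qed
    show "(\<lambda>x. t \<odot>\<^bsub>U\<^esub> \<gamma> x) \<in> H m" if gt: "\<gamma> \<in> H m" and that: "t \<in> T" for m \<gamma> t
    proof -
      obtain \<delta> where dd: "arrow R U U \<delta>" "k: \<gamma> \<approx> (\<lambda>x. (h ^^ m) (\<delta> x)) on U to U" using gt unfolding H_def by blast
      have t: "t \<in> carrier R" using that subringE(1)[OF T_subring] by blast
      note td = arrow_comp[OF dd(1) arrow_scalar[OF that U]]
      have "k: (\<lambda>x. t \<odot>\<^bsub>U\<^esub> (h ^^ m) (\<delta> x)) \<approx> (\<lambda>x. (h ^^ m) (t \<odot>\<^bsub>U\<^esub> \<delta> x)) on U to U"
        by (rule nceq_refl[OF arrow_comp[OF hmc[OF dd(1)] arrow_scalar[OF that U]]])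
          (simp add: arrow_smult[OF hm t] arrow_app[OF dd(1)])
      from nceq_trans[OF nceq_post[OF dd(2) arrow_scalar[OF that U]] this] show ?thesis unfolding H_def using td by blast
    qed
    show "\<gamma>' \<in> H m" if g: "\<gamma> \<in> H m" "\<And>x. x \<in> carrier U \<Longrightarrow> \<gamma>' x = \<gamma> x" for m \<gamma> \<gamma>'
    proof -
      obtain \<delta> where dd: "arrow R U U \<delta>" "k: \<gamma> \<approx> (\<lambda>x. (h ^^ m) (\<delta> x)) on U to U" using g(1) unfolding H_def by blast
      from nceq_trans[OF nceq_sym[OF nceq_refl[OF nceq_arrows(1)[OF dd(2)] g(2)]] dd(2)] show ?thesis
        unfolding H_def using dd(1) by blast
    qed
    have "decseq H"
    proof (rule decseq_SucI, rule subsetI)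
      fix m \<gamma> assume "\<gamma> \<in> H (Suc m)"
      then obtain \<delta> where dd: "arrow R U U \<delta>" "k: \<gamma> \<approx> (\<lambda>x. (h ^^ Suc m) (\<delta> x)) on U to U" unfolding H_def by blast
      then have "k: \<gamma> \<approx> (\<lambda>x. (h ^^ m) (h (\<delta> x))) on U to U" by (simp add: funpow_swap1)
      then show "\<gamma> \<in> H m" unfolding H_def using arrow_comp[OF dd(1) h] by blast
    qed
    then show "incseq H \<or> decseq H" ..
  qed
  then obtain m where m: "\<forall>i\<ge>m. H i = H m" ..
  have "(\<lambda>x. (h ^^ m) x) \<in> H m" unfolding H_def using arrow_id[OF U] nceq_refl[OF hm, of "\<lambda>x. (h ^^ m) x" m k] by blast
  then have "(\<lambda>x. (h ^^ m) x) \<in> H (Suc m)" using m[rule_format, of "Suc m"] by simp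
  then obtain \<delta> where dl: "arrow R U U \<delta>" "k: (\<lambda>x. (h ^^ m) x) \<approx> (\<lambda>x. (h ^^ Suc m) (\<delta> x)) on U to U" unfolding H_def by blast
  have "k: \<alpha> \<approx> \<beta> on U to U" if "arrow R U U \<alpha>" "arrow R U U \<beta>"
    "k: (\<lambda>x. (h ^^ m) (\<alpha> x)) \<approx> (\<lambda>x. (h ^^ m) (\<beta> x)) on U to U" for \<alpha> \<beta> m
    using that(3)
  proof (induction m)
    case (Suc m)
    then have "k: (\<lambda>x. h ((h ^^ m) (\<alpha> x))) \<approx> (\<lambda>x. h ((h ^^ m) (\<beta> x))) on U to U" by simp
    then show ?case using cancel[OF hmc[OF that(1)] hmc[OF that(2)]] Suc.IH by blast
  qed simp
  from this[OF arrow_id[OF U] arrow_comp[OF dl(1) h], of m] dl(2)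
  have right: "k: (\<lambda>x. x) \<approx> (\<lambda>x. h (\<delta> x)) on U to U" by (simp add: funpow_swap1)
  have "k: (\<lambda>x. h x) \<approx> (\<lambda>x. h (\<delta> (h x))) on U to U" using nceq_pre[OF right h] .
  then have left: "k: (\<lambda>x. x) \<approx> (\<lambda>x. \<delta> (h x)) on U to U"
    using cancel[OF arrow_id[OF U] arrow_comp[OF h dl(1)]] by simp
  define g where "g y = \<delta> (\<theta> y)" for y
  have g: "arrow R V U g" unfolding g_def using arrow_comp[OF th(2) dl(1)] .
  have gf: "k: (\<lambda>x. g (f x)) \<approx> (\<lambda>x. x) on U to U" using nceq_sym[OF left] by (simp add: g_def h_def)
  have "k: (\<lambda>y. \<theta>' (\<theta> y)) \<approx> (\<lambda>y. \<theta>' (\<theta> (f (g y)))) on V to V"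
    using nceq_comp[OF right th(2,1)] by (simp add: h_def g_def)
  then have "k: (\<lambda>y. y) \<approx> (\<lambda>y. f (g y)) on V to V"
    using nceq_trans[OF nceq_sym[OF th0] nceq_trans[OF _ nceq_pre[OF th0 arrow_comp[OF g D(1)]]]] by blast
  from nceq_post[OF this D(2)] have "k: \<pi> \<approx> (\<lambda>y. \<pi> (f (g y))) on V to Z" by simp
  moreover have "k: (\<lambda>y. \<zero>\<^bsub>Z\<^esub>) \<approx> (\<lambda>y. \<pi> (f (g y))) on V to Z"
    by (rule nceq_refl[OF arrow_const_zero[OF V arrow_fg(2)[OF D(2)]]]) (simp add: D(5) arrow_app[OF g])
  ultimately have "null R k V Z \<pi>" unfolding null_iff_nceq using nceq_sym nceq_trans by blast
  from null_id_of_split[OF E g gf this] show ?thesis .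
qed

text \<open>
  The direct sum of the given sequence with the identity of \<open>M\<close>; its cokernel is again \<open>Z\<close>.
\<close>

lemma short_exact_add:
  assumes E: "short_exact R U V Z f \<pi>" and B: "biproduct R S U M i j p q" and B': "biproduct R S' V M i' j' p' q'"
  shows "short_exact R S S' Z (\<lambda>x. i' (f (p x)) \<oplus>\<^bsub>S'\<^esub> j' (q x)) (\<lambda>y. \<pi> (p' y))"
proof (rule short_exactI)
  note D = short_exactD[OF E] and BD = biproductD[OF B] and BD' = biproductD[OF B']
  interpret S: left_module R S by (rule arrow_lm(1)[OF BD(3)])
  note pr = biproduct_pair[OF B' arrow_comp[OF BD(3) D(1)] BD(4)]
  show "arrow R S S' (\<lambda>x. i' (f (p x)) \<oplus>\<^bsub>S'\<^esub> j' (q x))" by (rule pr(1))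
  show "arrow R S' Z (\<lambda>y. \<pi> (p' y))" by (rule arrow_comp[OF BD'(3) D(2)])
  show "\<pi> (p' (i' (f (p x)) \<oplus>\<^bsub>S'\<^esub> j' (q x))) = \<zero>\<^bsub>Z\<^esub>" if "x \<in> carrier S" for x
    using pr(2)[OF that] D(5) arrow_app[OF BD(3) that] by simp
  show "x = y" if xy: "x \<in> carrier S" "y \<in> carrier S" and
    e: "i' (f (p x)) \<oplus>\<^bsub>S'\<^esub> j' (q x) = i' (f (p y)) \<oplus>\<^bsub>S'\<^esub> j' (q y)" for x y
  proof -
    have "f (p x) = f (p y)" using arg_cong[OF e, of p'] pr(2)[OF xy(1)] pr(2)[OF xy(2)] by (simp only:)
    then have 1: "p x = p y" using inj_onD[OF D(3)] arrow_app[OF BD(3)] xy by blast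
    have 2: "q x = q y" using arg_cong[OF e, of q'] pr(3)[OF xy(1)] pr(3)[OF xy(2)] by (simp only:)
    have "x = i (p x) \<oplus>\<^bsub>S\<^esub> j (q x)" using BD(9)[OF xy(1)] by (simp only:)
    also have "\<dots> = y" unfolding 1 2 by (rule BD(9)[OF xy(2)])
    finally show ?thesis .
  qed
  show "\<exists>y\<in>carrier S'. \<pi> (p' y) = z" if z: "z \<in> carrier Z" for z
  proof -
    have "z \<in> \<pi> ` carrier V" using z D(4) by simp
    then obtain v where "v \<in> carrier V" "\<pi> v = z" by blast
    then show ?thesis using BD'(5) arrow_app[OF BD'(1)] by (intro bexI[of _ "i' v"]) simp_all
  qed
  show "\<exists>x\<in>carrier S. y = i' (f (p x)) \<oplus>\<^bsub>S'\<^esub> j' (q x)" if y: "y \<in> carrier S'" "\<pi> (p' y) = \<zero>\<^bsub>Z\<^esub>" for y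
  proof -
    obtain u where u: "u \<in> carrier U" "p' y = f u" using D(6)[OF arrow_app[OF BD'(3) y(1)] y(2)] by blast
    let ?x = "i u \<oplus>\<^bsub>S\<^esub> j (q' y)"
    note q'y = arrow_app[OF BD'(4) y(1)]
    have x: "?x \<in> carrier S" using arrow_app[OF BD(1) u(1)] arrow_app[OF BD(2) q'y] by simp
    interpret U: left_module R U by (rule arrow_lm(1)[OF BD(1)])
    interpret M: left_module R M by (rule arrow_lm(1)[OF BD(2)])
    have "p ?x = u" "q ?x = q' y"
      using u(1) q'y by (simp_all add: arrow_add[OF BD(3)] arrow_add[OF BD(4)] arrow_app[OF BD(1)] arrow_app[OF BD(2)] BD(5-8))
    then have "i' (f (p ?x)) \<oplus>\<^bsub>S'\<^esub> j' (q ?x) = y" using BD'(9)[OF y(1)] u(2) by simp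
    then show ?thesis using x by (intro bexI[of _ ?x]) (simp only:)
  qed
qed

lemma stable_carrier: "carrier stable_monoid = stable_class ` fg_modules R"
  by (simp add: stable_monoid_def)

lemma stable_mult: "X' \<otimes>\<^bsub>stable_monoid\<^esub> Y = stable_sum X' Y"
  by (simp add: stable_monoid_def)

lemma syz_one: "syz \<one>\<^bsub>stable_monoid\<^esub> = \<one>\<^bsub>stable_monoid\<^esub>"
proof -
  obtain Z where Z: "Z \<in> fg_modules R" "carrier Z = {\<zero>\<^bsub>Z\<^esub>}" using zero_module_fg[OF ring_axioms] by blast
  note c = projective_self_cover[OF zero_module_projective[OF Z]]
  have "carrier (ker_mod Z Z (\<lambda>x. x)) = {\<zero>\<^bsub>ker_mod Z Z (\<lambda>x. x)\<^esub>}" using Z(2) by auto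
  then show ?thesis using stable_one_class[OF Z] stable_one_class[OF ker_fg[OF coverD(2)[OF c]]] syz_class[OF c] by simp
qed

lemma syz_pow_hom: "(syz ^^ n) \<in> hom stable_monoid stable_monoid"
proof (induction n)
  case (Suc n)
  have "(\<lambda>c. syz ((syz ^^ n) c)) \<in> hom stable_monoid stable_monoid"
    using hom_compose[OF Suc syz_hom] by (simp add: comp_def)
  then show ?case by (simp add: comp_def)
qed (simp add: hom_def)

text \<open>
  The projective dimensions of all modules \<open>Z\<close> in exact sequences \<open>0 \<rightarrow> V \<rightarrow> P \<rightarrow> Z \<rightarrow> 0\<close>, where
  \<open>V\<close> and \<open>P\<close> are stably direct sums of finitely many fixed modules, are bounded as long as they are finite.
  Indeed high syzygies of \<open>V\<close> and \<open>P\<close> agree stably, so for a uniform \<open>n\<close> the \<open>n\<close>-th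
  syzygies agree after a common summand \<open>C\<close> is added.  The sequence of \<open>n\<close>-th syzygies, with \<open>C\<close> added to its
  first two terms, has stably isomorphic first two terms, which are built from one fixed module \<open>G\<close>; this
  makes the bound for its cokernel uniform.
\<close>

theorem uniform_bound:
  fixes F :: "nat \<Rightarrow> 'a fg_mod"
  assumes F: "\<And>i. i < r \<Longrightarrow> F i \<in> fg_modules R"
  defines "cls \<equiv> comm_monoid.multi_pow stable_monoid r (\<lambda>i. stable_class (F i))"
  shows "\<exists>b. \<forall>V P Z f \<pi> d v w. short_exact R V P Z f \<pi> \<and> stable_class V = cls v \<and> stable_class P = cls w \<and>
    null R d Z Z (\<lambda>x. x) \<longrightarrow> null R b Z Z (\<lambda>x. x)"
proof -
  interpret S: comm_monoid stable_monoid by (rule stable_comm_monoid)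
  have Fc: "stable_class (F i) \<in> carrier stable_monoid" if "i < r" for i using F[OF that] stable_carrier by blast
  note cls_closed = S.multi_pow_closed[of r "\<lambda>i. stable_class (F i)", OF Fc, folded cls_def]
  obtain n where n: "\<And>m a b. (syz ^^ m) (cls a) = (syz ^^ m) (cls b) \<Longrightarrow>
    \<exists>c. (syz ^^ n) (cls a) \<otimes>\<^bsub>stable_monoid\<^esub> (syz ^^ n) (cls c) = (syz ^^ n) (cls b) \<otimes>\<^bsub>stable_monoid\<^esub> (syz ^^ n) (cls c)"
    using S.uniform_identification[OF syz_hom, of r "\<lambda>i. stable_class (F i)", OF Fc] unfolding cls_def by blast
  note wc = hom_in_carrier[OF syz_pow_hom, of _ n]
  have "\<exists>M. M \<in> fg_modules R \<and> (i < r \<longrightarrow> (syz ^^ n) (stable_class (F i)) = stable_class M)" for i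
    using wc[OF Fc, of i] zero_module_fg[OF ring_axioms] unfolding stable_carrier by (cases "i < r") blast+
  then obtain M where M: "\<And>i. M i \<in> fg_modules R" "\<And>i. i < r \<Longrightarrow> (syz ^^ n) (stable_class (F i)) = stable_class (M i)"
    by metis
  obtain G where G: "G \<in> fg_modules R" "\<forall>N\<in>M ` {..<r}. built_from G N"
    using common_overmodule[of "M ` {..<r}"] M(1) by blast
  define H where "H = {c \<in> carrier stable_monoid. \<exists>N. built_from G N \<and> (syz ^^ n) c = stable_class N}"
  have built_fg: "N \<in> fg_modules R" if "built_from G N" for N
    using that by cases (auto dest: arrow_fg biproductD(1) stably_iso_fg)
  have "cls a \<in> H" for a
    unfolding cls_def
  proof (rule S.multi_pow_in)
    obtain Z where Z: "Z \<in> fg_modules R" "carrier Z = {\<zero>\<^bsub>Z\<^esub>}" using zero_module_fg[OF ring_axioms] by blast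
    have "built_from G Z"
      by (rule retract[OF arrow_const_zero[OF Z(1) G(1)] arrow_const_zero[OF G(1) Z(1)]]) (use Z in simp)
    moreover have "(syz ^^ n) \<one>\<^bsub>stable_monoid\<^esub> = \<one>\<^bsub>stable_monoid\<^esub>" by (induction n) (simp_all add: syz_one)
    ultimately show "\<one>\<^bsub>stable_monoid\<^esub> \<in> H" unfolding H_def using stable_one_class[OF Z] S.one_closed by auto
  next
    fix x y assume "x \<in> H" "y \<in> H"
    then obtain N N' where N: "x \<in> carrier stable_monoid" "built_from G N" "(syz ^^ n) x = stable_class N"
      "y \<in> carrier stable_monoid" "built_from G N'" "(syz ^^ n) y = stable_class N'" unfolding H_def by blast
    obtain Q i j p q where B: "biproduct R Q N N' i j p q" using biproduct_exists[OF built_fg[OF N(2)] built_fg[OF N(5)]] by blast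
    have "(syz ^^ n) (x \<otimes>\<^bsub>stable_monoid\<^esub> y) = stable_class Q"
      using hom_mult[OF syz_pow_hom N(1,4), of n] N(3,6) stable_sum_class[OF B] stable_mult by simp
    then show "x \<otimes>\<^bsub>stable_monoid\<^esub> y \<in> H" unfolding H_def using sum[OF B N(2,5)] N(1,4) by auto
  next
    show "H \<subseteq> carrier stable_monoid" unfolding H_def by blast
    show "stable_class (F i) \<in> H" if "i < r" for i unfolding H_def using Fc[OF that] M(2)[OF that] G(2) that by blast
  qed
  then have built: "built_from G N" if "N \<in> fg_modules R" "stable_class N = (syz ^^ n) (cls a)" for N a
  proof -
    obtain N' where "built_from G N'" "(syz ^^ n) (cls a) = stable_class N'" using \<open>cls a \<in> H\<close> unfolding H_def by blast
    moreover from this have "stably_iso N' N" using that stable_class_eq_iff[OF that(1)] stably_iso_sym by auto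
    ultimately show ?thesis by (blast intro: iso)
  qed
  obtain k where k: "\<And>l \<gamma>. null R l G G \<gamma> \<Longrightarrow> null R k G G \<gamma>" using null_bound_exists[OF G(1)] by blast
  have "null R (Suc k + n) Z Z (\<lambda>x. x)"
    if E: "short_exact R V P Z f \<pi>" and v: "stable_class V = cls v" and w: "stable_class P = cls w" and d: "null R d Z Z (\<lambda>x. x)"
    for V P Z f \<pi> d v w
  proof -
    have "(syz ^^ d) (cls v) = (syz ^^ d) (cls w)" using syz_pow_eq[OF E d] v w by simp
    then obtain c where c: "(syz ^^ n) (cls v) \<otimes>\<^bsub>stable_monoid\<^esub> (syz ^^ n) (cls c) = (syz ^^ n) (cls w) \<otimes>\<^bsub>stable_monoid\<^esub> (syz ^^ n) (cls c)"
      using n by blast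
    obtain V' P' Z' f' \<pi>' where E': "short_exact R V' P' Z' f' \<pi>'" "stable_class V' = (syz ^^ n) (cls v)"
      "stable_class P' = (syz ^^ n) (cls w)" "\<forall>m. null R m Z' Z' (\<lambda>x. x) \<longrightarrow> null R (m + n) Z Z (\<lambda>x. x)"
      "\<forall>m. null R m Z Z (\<lambda>x. x) \<longrightarrow> null R m Z' Z' (\<lambda>x. x)" using short_exact_shift[OF E, of n] v w by auto
    note V' = arrow_fg(1)[OF short_exactD(1)[OF E'(1)]] and P' = arrow_fg(2)[OF short_exactD(1)[OF E'(1)]]
    obtain C where C: "C \<in> fg_modules R" "(syz ^^ n) (cls c) = stable_class C" using wc[OF cls_closed] unfolding stable_carrier by blast
    obtain Q i j p q where B: "biproduct R Q V' C i j p q" using biproduct_exists[OF V' C(1)] by blast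
    obtain Q' i' j' p' q' where B': "biproduct R Q' P' C i' j' p' q'" using biproduct_exists[OF P' C(1)] by blast
    note Q = arrow_fg(2)[OF biproductD(1)[OF B]]
    have "stable_class Q = stable_class Q'"
      using c stable_sum_class[OF B] stable_sum_class[OF B'] unfolding stable_mult E'(2,3)[symmetric] C(2) by simp
    then have iso: "stably_iso Q Q'" using stable_class_eq_iff[OF Q] by blast
    have "built_from G Q" by (rule sum[OF B built[OF V' E'(2)] built[OF C(1) C(2)[symmetric]]])
    then have bl: "null R k Q G \<gamma>" if "null R l Q G \<gamma>" for l \<gamma>
      by (rule null_bound_left[OF _ k that])
    have bd: "null R k Q Q \<gamma>" if "null R l Q Q \<gamma>" for l \<gamma>
      by (rule null_bound_right[OF \<open>built_from G Q\<close> bl that])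
    have "null R (Suc k) Z' Z' (\<lambda>x. x)"
      by (rule cokernel_bound[OF short_exact_add[OF E'(1) B B'] iso _ bd]) (use E'(5) d in blast)
    then show ?thesis using E'(4) by blast
  qed
  then show ?thesis by (intro exI[of _ "Suc k + n"]) blast
qed

end

section \<open>Fitting decompositions and projective covers\<close>

lemma fin_length_stops:
  assumes "fin_length R M" "\<And>i::nat. submodule (N i) R M" "incseq N \<or> decseq N"
  shows "\<exists>k. \<forall>i\<ge>k. N i = N k"
  using assms by (simp add: fin_length_def)

lemma complementaryI:
  assumes "left_module R M" "submodule K R M" "submodule L R M" "\<And>x. x \<in> K \<Longrightarrow> x \<in> L \<Longrightarrow> x = \<zero>\<^bsub>M\<^esub>"
    "\<And>x. x \<in> carrier M \<Longrightarrow> \<exists>y\<in>K. \<exists>z\<in>L. x = y \<oplus>\<^bsub>M\<^esub> z"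
  shows "complementary R M K L"
proof -
  interpret left_module R M by fact
  have "K \<inter> L = {\<zero>\<^bsub>M\<^esub>}" using assms(4) submodule_0[OF assms(2)] submodule_0[OF assms(3)] by blast
  moreover have "K <+>\<^bsub>M\<^esub> L = carrier M"
  proof
    show "K <+>\<^bsub>M\<^esub> L \<subseteq> carrier M" by (rule submodule_sub[OF submodule_sum[OF assms(2,3)]])
    show "carrier M \<subseteq> K <+>\<^bsub>M\<^esub> L"
    proof
      fix x assume "x \<in> carrier M"
      from assms(5)[OF this] show "x \<in> K <+>\<^bsub>M\<^esub> L" unfolding set_add_def' by blast
    qed
  qed
  ultimately show ?thesis unfolding complementary_def using assms(2,3) by simp
qed

lemma complementaryD:
  assumes "complementary R M K L"
  shows "submodule K R M" "submodule L R M" "x \<in> K \<Longrightarrow> x \<in> L \<Longrightarrow> x = \<zero>\<^bsub>M\<^esub>"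
    "x \<in> carrier M \<Longrightarrow> \<exists>y\<in>K. \<exists>z\<in>L. x = y \<oplus>\<^bsub>M\<^esub> z"
proof -
  show "submodule K R M" "submodule L R M" using assms by (auto simp: complementary_def)
  have i: "K \<inter> L = {\<zero>\<^bsub>M\<^esub>}" and s: "K <+>\<^bsub>M\<^esub> L = carrier M" using assms by (simp_all add: complementary_def)
  show "x \<in> K \<Longrightarrow> x \<in> L \<Longrightarrow> x = \<zero>\<^bsub>M\<^esub>" using i by blast
  show "x \<in> carrier M \<Longrightarrow> \<exists>y\<in>K. \<exists>z\<in>L. x = y \<oplus>\<^bsub>M\<^esub> z" unfolding s[symmetric] set_add_def' by blast
qed

lemma (in noetherian_ring) complementary_biproduct:
  assumes M: "M \<in> fg_modules R" and C: "complementary R M K L"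
  shows "\<exists>p q. biproduct R M (M\<lparr>carrier := K\<rparr>) (M\<lparr>carrier := L\<rparr>) (\<lambda>x. x) (\<lambda>x. x) p q"
proof -
  interpret M: left_module R M by (rule fg_left_module[OF M])
  note D = complementaryD[OF C]
  note in_K = submodule_in[OF D(1)] and in_L = submodule_in[OF D(2)]
  obtain p q where pq: "\<And>x. x \<in> carrier M \<Longrightarrow> p x \<in> K" "\<And>x. x \<in> carrier M \<Longrightarrow> q x \<in> L"
    "\<And>x. x \<in> carrier M \<Longrightarrow> x = p x \<oplus>\<^bsub>M\<^esub> q x" using D(4) by metis
  have uniq: "p x = y \<and> q x = z" if yz: "y \<in> K" "z \<in> L" "x = y \<oplus>\<^bsub>M\<^esub> z" for x y z
  proof -
    have c: "y \<in> carrier M" "z \<in> carrier M" using yz in_K in_L by auto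
    then have x: "x \<in> carrier M" using yz(3) by simp
    note c' = in_K[OF pq(1)[OF x]] in_L[OF pq(2)[OF x]]
    have e: "p x \<oplus>\<^bsub>M\<^esub> q x = y \<oplus>\<^bsub>M\<^esub> z" using pq(3)[OF x] yz(3) by (simp only:)
    have "p x \<ominus>\<^bsub>M\<^esub> y = (p x \<oplus>\<^bsub>M\<^esub> q x) \<ominus>\<^bsub>M\<^esub> (y \<oplus>\<^bsub>M\<^esub> q x)"
      using c c' M.M.minus_zero_iff[of "q x" "q x"] by (simp add: M.M.minus_add_add)
    also have "\<dots> = z \<ominus>\<^bsub>M\<^esub> q x" unfolding e
      using c c' M.M.minus_zero_iff[of y y] by (simp add: M.M.minus_add_add)
    finally have d: "p x \<ominus>\<^bsub>M\<^esub> y = z \<ominus>\<^bsub>M\<^esub> q x" .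
    have "p x \<ominus>\<^bsub>M\<^esub> y \<in> K" using submodule_minus[OF D(1) pq(1)[OF x] yz(1)] .
    moreover have "p x \<ominus>\<^bsub>M\<^esub> y \<in> L" unfolding d using submodule_minus[OF D(2) yz(2) pq(2)[OF x]] .
    ultimately have z: "p x \<ominus>\<^bsub>M\<^esub> y = \<zero>\<^bsub>M\<^esub>" by (rule D(3))
    then have "p x = y" using c c' by (simp add: M.M.minus_zero_iff)
    moreover have "z = q x" using z unfolding d using c c' by (simp add: M.M.minus_zero_iff)
    ultimately show ?thesis by simp
  qed
  note fK = submodule_fg[OF M D(1)] and fL = submodule_fg[OF M D(2)]
  have add: "p (x \<oplus>\<^bsub>M\<^esub> y) = p x \<oplus>\<^bsub>M\<^esub> p y \<and> q (x \<oplus>\<^bsub>M\<^esub> y) = q x \<oplus>\<^bsub>M\<^esub> q y" if xy: "x \<in> carrier M" "y \<in> carrier M" for x y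
  proof (rule uniq)
    note c = in_K[OF pq(1)[OF xy(1)]] in_L[OF pq(2)[OF xy(1)]] in_K[OF pq(1)[OF xy(2)]] in_L[OF pq(2)[OF xy(2)]]
    have "x \<oplus>\<^bsub>M\<^esub> y = (p x \<oplus>\<^bsub>M\<^esub> q x) \<oplus>\<^bsub>M\<^esub> (p y \<oplus>\<^bsub>M\<^esub> q y)"
      by (rule arg_cong2[where f = "ring.add M", OF pq(3)[OF xy(1)] pq(3)[OF xy(2)]])
    then show "x \<oplus>\<^bsub>M\<^esub> y = (p x \<oplus>\<^bsub>M\<^esub> p y) \<oplus>\<^bsub>M\<^esub> (q x \<oplus>\<^bsub>M\<^esub> q y)" using M.M.add_swap4 c by (simp only:)
  qed (use pq submodule_add[OF D(1)] submodule_add[OF D(2)] xy in simp_all)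
  have sm: "p (a \<odot>\<^bsub>M\<^esub> x) = a \<odot>\<^bsub>M\<^esub> p x \<and> q (a \<odot>\<^bsub>M\<^esub> x) = a \<odot>\<^bsub>M\<^esub> q x" if ax: "a \<in> carrier R" "x \<in> carrier M" for a x
  proof (rule uniq)
    note c = in_K[OF pq(1)[OF ax(2)]] in_L[OF pq(2)[OF ax(2)]]
    have "a \<odot>\<^bsub>M\<^esub> x = a \<odot>\<^bsub>M\<^esub> (p x \<oplus>\<^bsub>M\<^esub> q x)"
      by (rule arg_cong[where f = "\<lambda>x. a \<odot>\<^bsub>M\<^esub> x", OF pq(3)[OF ax(2)]])
    then show "a \<odot>\<^bsub>M\<^esub> x = a \<odot>\<^bsub>M\<^esub> p x \<oplus>\<^bsub>M\<^esub> a \<odot>\<^bsub>M\<^esub> q x" using M.smult_r_distr[OF ax(1) c] by (simp only:)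
  qed (use pq submodule_smult[OF D(1)] submodule_smult[OF D(2)] ax in simp_all)
  have ap: "arrow R M (M\<lparr>carrier := K\<rparr>) p" and aq: "arrow R M (M\<lparr>carrier := L\<rparr>) q"
    using pq add sm M fK fL by (intro arrowI; simp)+
  have inc: "arrow R (M\<lparr>carrier := K\<rparr>) M (\<lambda>x. x)" "arrow R (M\<lparr>carrier := L\<rparr>) M (\<lambda>x. x)"
    using M fK fL in_K in_L by (intro arrowI; simp)+
  have z: "\<zero>\<^bsub>M\<^esub> \<in> K" "\<zero>\<^bsub>M\<^esub> \<in> L" using submodule_0[OF D(1)] submodule_0[OF D(2)] .
  have pK: "p x = x \<and> q x = \<zero>\<^bsub>M\<^esub>" if "x \<in> K" for x using uniq[OF that z(2)] in_K[OF that] by simp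
  have qL: "p x = \<zero>\<^bsub>M\<^esub> \<and> q x = x" if "x \<in> L" for x using uniq[OF z(1) that] in_L[OF that] by simp
  have "biproduct R M (M\<lparr>carrier := K\<rparr>) (M\<lparr>carrier := L\<rparr>) (\<lambda>x. x) (\<lambda>x. x) p q"
    unfolding biproduct_def using pK qL pq(3) by (intro conjI ballI ap aq inc) simp_all
  then show ?thesis by blast
qed

context finite_length_algebra begin

lemma fg_fin_length: "M \<in> fg_modules R \<Longrightarrow> fin_length R M"
  using fin_length_ring_mono[OF _ T_length] subringE(1)[OF T_subring] by simp

lemma arrow_pow: "arrow R M M h \<Longrightarrow> arrow R M M (h ^^ k)"
proof (induction k)
  case 0
  then show ?case using arrow_id[OF arrow_fg(1)[OF 0]] by (simp add: id_def)
next
  case (Suc k)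
  then show ?case using arrow_comp[OF Suc.IH[OF Suc.prems] Suc.prems] by (simp add: comp_def)
qed

text \<open>Fitting's lemma, as a projection onto the stable image along the stable kernel.\<close>

lemma fitting:
  assumes h: "arrow R M M h"
  shows "\<exists>k e. k > 0 \<and> arrow R M M e \<and> e ` carrier M = (h ^^ k) ` carrier M \<and>
    (\<forall>y\<in>(h ^^ k) ` carrier M. e y = y) \<and> (\<forall>x\<in>carrier M. e x = \<zero>\<^bsub>M\<^esub> \<longleftrightarrow> (h ^^ k) x = \<zero>\<^bsub>M\<^esub>)"
proof -
  note M = arrow_fg(1)[OF h]
  note lM = fg_left_module[OF M]
  interpret M: left_module R M by (rule lM)
  note hk = arrow_pow[OF h]
  have im: "submodule ((h ^^ i) ` carrier M) R M" for i
    by (rule submodule_image[OF lM lM arrow_fg(3)[OF hk] M.submodule_carrier])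
  have ke: "submodule (a_kernel M M (h ^^ i)) R M" for i
    by (rule submodule_kernel[OF lM lM arrow_fg(3)[OF hk]])
  have "decseq (\<lambda>i. (h ^^ i) ` carrier M)"
    by (rule decseq_SucI) (use arrow_app[OF h] in \<open>auto simp: funpow_swap1\<close>)
  from fin_length_stops[OF fg_fin_length[OF M] im disjI2[OF this]]
  obtain k1 where k1: "\<forall>i\<ge>k1. (h ^^ i) ` carrier M = (h ^^ k1) ` carrier M" ..
  have "incseq (\<lambda>i. a_kernel M M (h ^^ i))"
    by (rule incseq_SucI) (use arrow_zero[OF h] in \<open>auto simp: a_kernel_def'\<close>)
  from fin_length_stops[OF fg_fin_length[OF M] ke disjI1[OF this]]
  obtain k2 where k2: "\<forall>i\<ge>k2. a_kernel M M (h ^^ i) = a_kernel M M (h ^^ k2)" ..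
  define k where "k = Suc (max k1 k2)"
  let ?h = "h ^^ k"
  have im2: "?h ` carrier M = (h ^^ (k + k)) ` carrier M" using k1[rule_format, of k] k1[rule_format, of "k + k"] by (simp add: k_def)
  have ke2: "a_kernel M M ?h = a_kernel M M (h ^^ (k + k))" using k2[rule_format, of k] k2[rule_format, of "k + k"] by (simp add: k_def)
  have "\<exists>y\<in>?h ` carrier M. ?h y = ?h x" if x: "x \<in> carrier M" for x
  proof -
    have "?h x \<in> (h ^^ (k + k)) ` carrier M" using im2 x by blast
    then obtain z where "z \<in> carrier M" "?h x = ?h (?h z)" by (auto simp: funpow_add)
    then show ?thesis by (intro bexI[of _ "?h z"]) simp_all
  qed
  then obtain e where e: "\<And>x. x \<in> carrier M \<Longrightarrow> e x \<in> ?h ` carrier M" "\<And>x. x \<in> carrier M \<Longrightarrow> ?h (e x) = ?h x" by metis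
  have inj: "y = z" if yz: "y \<in> ?h ` carrier M" "z \<in> ?h ` carrier M" "?h y = ?h z" for y z
  proof -
    have c: "y \<in> carrier M" "z \<in> carrier M" using yz submodule_in[OF im] by auto
    have "y \<ominus>\<^bsub>M\<^esub> z \<in> ?h ` carrier M" using submodule_minus[OF im yz(1,2)] .
    then obtain u where u: "u \<in> carrier M" "y \<ominus>\<^bsub>M\<^esub> z = ?h u" by blast
    have "?h (?h u) = \<zero>\<^bsub>M\<^esub>" unfolding u(2)[symmetric] arrow_minus[OF hk c] yz(3)
      using M.M.minus_zero_iff arrow_app[OF hk c(2)] by simp
    then have "u \<in> a_kernel M M ?h" unfolding ke2 using u(1) by (simp add: a_kernel_def' funpow_add)
    then have "y \<ominus>\<^bsub>M\<^esub> z = \<zero>\<^bsub>M\<^esub>" using u(2) by (simp add: a_kernel_def')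
    then show ?thesis using c by (simp add: M.M.minus_zero_iff)
  qed
  have ec: "e x \<in> carrier M" if "x \<in> carrier M" for x using submodule_in[OF im e(1)[OF that]] .
  have ae: "arrow R M M e"
  proof (intro arrowI M ec)
    fix x y assume xy: "x \<in> carrier M" "y \<in> carrier M"
    show "e (x \<oplus>\<^bsub>M\<^esub> y) = e x \<oplus>\<^bsub>M\<^esub> e y"
      by (rule inj) (use xy e ec submodule_add[OF im] in \<open>simp_all add: arrow_add[OF hk]\<close>)
  next
    fix a x assume ax: "a \<in> carrier R" "x \<in> carrier M"
    show "e (a \<odot>\<^bsub>M\<^esub> x) = a \<odot>\<^bsub>M\<^esub> e x"
      by (rule inj) (use ax e ec submodule_smult[OF im] in \<open>simp_all add: arrow_smult[OF hk]\<close>)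
  qed
  have fixp: "e y = y" if y: "y \<in> ?h ` carrier M" for y
    by (rule inj) (use y e submodule_in[OF im y] in auto)
  have "e ` carrier M = ?h ` carrier M"
  proof
    show "e ` carrier M \<subseteq> ?h ` carrier M" using e(1) by blast
    show "?h ` carrier M \<subseteq> e ` carrier M"
    proof
      fix y assume y: "y \<in> ?h ` carrier M"
      show "y \<in> e ` carrier M" using imageI[OF submodule_in[OF im y], of e] unfolding fixp[OF y] .
    qed
  qed
  moreover have "e x = \<zero>\<^bsub>M\<^esub> \<longleftrightarrow> ?h x = \<zero>\<^bsub>M\<^esub>" if x: "x \<in> carrier M" for x
  proof
    show "e x = \<zero>\<^bsub>M\<^esub> \<Longrightarrow> ?h x = \<zero>\<^bsub>M\<^esub>" using e(2)[OF x] arrow_zero[OF hk] by simp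
    assume "?h x = \<zero>\<^bsub>M\<^esub>"
    then have "?h (e x) = ?h \<zero>\<^bsub>M\<^esub>" using e(2)[OF x] arrow_zero[OF hk] by simp
    then show "e x = \<zero>\<^bsub>M\<^esub>" by (rule inj[OF e(1)[OF x] submodule_0[OF im]])
  qed
  ultimately show ?thesis using ae fixp by (intro exI[of _ k] exI[of _ e]) (simp add: k_def)
qed

text \<open>
  A projective cover is obtained from a minimal direct summand \<open>L\<close> of a projective module that still
  maps onto \<open>M\<close>.  If a submodule \<open>N\<close> of \<open>L\<close> maps onto \<open>M\<close>, then a lift gives an
  endomorphism \<open>h\<close> of \<open>L\<close> over \<open>M\<close> with image in \<open>N\<close>; its stable image is a summand over \<open>M\<close>, hence all of \<open>L\<close>.
\<close>

lemma projective_cover_exists: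
  assumes M: "M \<in> fg_modules R"
  shows "\<exists>P p. projective_cover R M P p"
proof -
  obtain P p where P: "cover R M P p" using cover_exists[OF ring_axioms M] by blast
  note ap = coverD(2)[OF P]
  note fP = arrow_fg(1)[OF ap]
  interpret P: left_module R P by (rule fg_left_module[OF fP])
  define good where "good L \<longleftrightarrow> (\<exists>e. arrow R P P e \<and> e ` carrier P = L \<and> (\<forall>x\<in>L. e x = x)) \<and> p ` L = carrier M" for L
  have good_sub: "submodule L R P" if "good L" for L
  proof -
    obtain e where e: "arrow R P P e" "e ` carrier P = L"
      using \<open>good L\<close>[unfolded good_def] by (elim exE conjE) (rule that; assumption)
    show ?thesis
      using submodule_image[OF arrow_lm(1)[OF e(1)] arrow_lm(1)[OF e(1)] arrow_fg(3)[OF e(1)] P.submodule_carrier] e(2) by simp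
  qed
  have "good (carrier P)" unfolding good_def using arrow_id[OF fP] coverD(3)[OF P] by (auto intro!: exI[of _ "\<lambda>x. x"])
  then have ne: "Collect good \<noteq> {}" by blast
  have all: "\<forall>L\<in>Collect good. submodule L R P" using good_sub by blast
  from fin_length_minimal[OF fg_fin_length[OF fP] all ne]
  obtain L where L0: "good L" and min0: "\<forall>L'\<in>Collect good. L' \<subseteq> L \<longrightarrow> L' = L" by (elim bexE CollectE)
  note L = L0
  have min: "L' = L" if "good L'" "L' \<subseteq> L" for L' using min0 that by blast
  note sL = good_sub[OF L]
  let ?L = "P\<lparr>carrier := L\<rparr>"
  obtain e where e: "arrow R P P e" "e ` carrier P = L" "\<forall>x\<in>L. e x = x" and pL: "p ` L = carrier M"
    using L[unfolded good_def] by (elim exE conjE) (rule that; assumption)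
  note fL = submodule_fg[OF fP sL]
  have incl: "arrow R ?L P (\<lambda>x. x)" using submodule_in[OF sL] by (intro arrowI fL fP) simp_all
  have eL: "arrow R P ?L e" using e(2) by (intro arrowI fL fP) (auto simp: arrow_add[OF e(1)] arrow_smult[OF e(1)])
  have prL: "projective_mod R ?L" by (rule projective_retract[OF coverD(1)[OF P] incl eL]) (use e(3) in simp)
  have apL: "arrow R ?L M p" using arrow_comp[OF incl ap] by simp
  have "N = carrier ?L" if N: "submodule N R ?L" and s: "N <+>\<^bsub>?L\<^esub> a_kernel ?L M p = carrier ?L" for N
  proof -
    let ?N = "P\<lparr>carrier := N\<rparr>"
    have N': "submodule N R P" "N \<subseteq> L" using N submodule_trans[OF P.left_module_axioms sL] by auto
    note fN = submodule_fg[OF fP N'(1)]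
    interpret M: left_module R M by (rule fg_left_module[OF M])
    have inN: "arrow R ?N P (\<lambda>x. x)" "arrow R ?N ?L (\<lambda>x. x)" using submodule_in[OF N'(1)] N'(2) by (intro arrowI fL fN fP; auto)+
    have pN: "p ` carrier ?N = carrier M"
    proof
      show "p ` carrier ?N \<subseteq> carrier M" using arrow_app[OF arrow_comp[OF inN(1) ap]] by auto
      show "carrier M \<subseteq> p ` carrier ?N"
      proof
        fix y assume "y \<in> carrier M"
        then obtain l where l: "l \<in> L" "y = p l" using pL by blast
        then have "l \<in> N <+>\<^bsub>?L\<^esub> a_kernel ?L M p" using s by simp
        then obtain n c where nc: "n \<in> N" "c \<in> L" "p c = \<zero>\<^bsub>M\<^esub>" "l = n \<oplus>\<^bsub>P\<^esub> c" unfolding set_add_def' a_kernel_def' by auto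
        then have "p l = p n" using arrow_add[OF ap] submodule_in[OF N'(1)] submodule_in[OF sL] arrow_app[OF ap] by simp
        then show "y \<in> p ` carrier ?N" using l nc(1) by auto
      qed
    qed
    obtain h where h: "arrow R ?L ?N h" "\<And>x. x \<in> carrier ?L \<Longrightarrow> p (h x) = p x"
      using projectiveD[OF prL arrow_comp[OF inN(1) ap] pN apL] by blast
    have hL: "arrow R ?L ?L h" using arrow_comp[OF h(1) inN(2)] .
    obtain k e' where k: "k > 0" "arrow R ?L ?L e'" "e' ` carrier ?L = (h ^^ k) ` carrier ?L" "\<forall>y\<in>(h ^^ k) ` carrier ?L. e' y = y"
      using fitting[OF hL] by (elim exE conjE) (rule that; assumption)
    have pk: "p ((h ^^ i) x) = p x" if "x \<in> L" for i x
      using that h(2) arrow_app[OF arrow_pow[OF hL]] by (induction i) auto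
    let ?L' = "(h ^^ k) ` L"
    have subL': "?L' \<subseteq> L" using arrow_app[OF arrow_pow[OF hL, of k]] by auto
    have "good ?L'" unfolding good_def
    proof (intro conjI exI[of _ "\<lambda>x. e' (e x)"])
      show "arrow R P P (\<lambda>x. e' (e x))" using arrow_comp[OF arrow_comp[OF eL k(2)] incl] .
      have "(\<lambda>x. e' (e x)) ` carrier P = e' ` L" using e(2) by (simp add: image_image[symmetric])
      then show "(\<lambda>x. e' (e x)) ` carrier P = ?L'" using k(3) by simp
      show "\<forall>x\<in>?L'. e' (e x) = x" using k(4) e(3) subL' by auto
      have "p ` ?L' = p ` L" using pk by (auto simp: image_image)
      then show "p ` ?L' = carrier M" using pL by simp
    qed
    from min[OF this subL'] have eq: "?L' = L" .
    have "(h ^^ k) x \<in> N" if "x \<in> L" for x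
    proof -
      obtain k' where k': "k = Suc k'" using k(1) by (cases k) auto
      have "(h ^^ k') x \<in> carrier ?L" using arrow_app[OF arrow_pow[OF hL]] that by simp
      then show ?thesis using arrow_app[OF h(1)] k' by simp
    qed
    then have "?L' \<subseteq> N" by (rule image_subsetI)
    then have "L \<subseteq> N" unfolding eq .
    then show ?thesis using N'(2) by auto
  qed
  then have "projective_cover R M ?L p" unfolding projective_cover_def
    using prL arrow_fg(3)[OF apL] pL by auto
  then show ?thesis by blast
qed

section \<open>Indecomposable modules\<close>

text \<open>
  Fitting's decomposition into the stable image and the stable kernel has a trivial term.
\<close>

lemma indecomposable_endo:
  assumes ind: "indecomposable_mod R M" and h: "arrow R M M h"
  shows "bij_betw h (carrier M) (carrier M) \<or> (\<exists>k. \<forall>x\<in>carrier M. (h ^^ k) x = \<zero>\<^bsub>M\<^esub>)"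
proof -
  note M = arrow_fg(1)[OF h]
  note lM = fg_left_module[OF M]
  interpret M: left_module R M by (rule lM)
  obtain k e where k: "k > 0" and e: "arrow R M M e" "e ` carrier M = (h ^^ k) ` carrier M"
    "\<forall>y\<in>(h ^^ k) ` carrier M. e y = y" "\<forall>x\<in>carrier M. e x = \<zero>\<^bsub>M\<^esub> \<longleftrightarrow> (h ^^ k) x = \<zero>\<^bsub>M\<^esub>"
    using fitting[OF h] by (elim exE conjE) (rule that; assumption)
  note hk = arrow_pow[OF h, of k]
  let ?I = "(h ^^ k) ` carrier M" and ?K = "a_kernel M M e"
  have sI: "submodule ?I R M" by (rule submodule_image[OF lM lM arrow_fg(3)[OF hk] M.submodule_carrier])
  have sK: "submodule ?K R M" by (rule submodule_kernel[OF lM lM arrow_fg(3)[OF e(1)]])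
  have "complementary R M ?I ?K"
  proof (rule complementaryI[OF lM sI sK])
    show "x = \<zero>\<^bsub>M\<^esub>" if "x \<in> ?I" "x \<in> ?K" for x using that e(3) by (simp add: a_kernel_def')
    fix x assume x: "x \<in> carrier M"
    have ex: "e x \<in> ?I" "e x \<in> carrier M" using e(2) x arrow_app[OF e(1) x] by auto
    have "e (e x) = e x" using e(3) ex(1) by blast
    then have "x \<ominus>\<^bsub>M\<^esub> e x \<in> ?K" using x ex(2) by (simp add: a_kernel_def' arrow_minus[OF e(1)] M.M.minus_zero_iff)
    moreover have "x = e x \<oplus>\<^bsub>M\<^esub> (x \<ominus>\<^bsub>M\<^esub> e x)"
      using x ex M.M.minus_add_cancel[OF x ex(2)] by (simp add: M.M.a_comm)
    ultimately show "\<exists>y\<in>?I. \<exists>z\<in>?K. x = y \<oplus>\<^bsub>M\<^esub> z" using ex(1) by blast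
  qed
  then consider "?I = {\<zero>\<^bsub>M\<^esub>}" | "?K = {\<zero>\<^bsub>M\<^esub>}" using ind unfolding indecomposable_mod_def by blast
  then show ?thesis
  proof cases
    case 1
    then show ?thesis by blast
  next
    case 2
    have "a_kernel M M (h ^^ k) = ?K" unfolding a_kernel_def' using e(4) by blast
    then have "inj_on (h ^^ k) (carrier M)" unfolding hom_inj_iff[OF lM lM arrow_fg(3)[OF hk]] using 2 by simp
    then have "inj_on h (carrier M)"
    proof (intro inj_onI)
      fix x y assume i: "inj_on (h ^^ k) (carrier M)" and xy: "x \<in> carrier M" "y \<in> carrier M" "h x = h y"
      obtain k' where "k = Suc k'" using k by (cases k) auto
      then have "(h ^^ k) x = (h ^^ k) y" using xy(3) by (simp add: funpow_swap1)
      then show "x = y" using inj_onD[OF i] xy by blast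
    qed
    then show ?thesis using fin_length_hom_bij[OF lM fg_fin_length[OF M] arrow_fg(3)[OF h]] by (simp add: bij_betw_def)
  qed
qed

text \<open>
  The endomorphism ring of an indecomposable module is local: after normalising \<open>u + v\<close> to the identity,
  if \<open>u\<close> is not bijective then it is nilpotent, and \<open>v = 1 - u\<close> is injective.
\<close>

lemma indecomposable_local:
  assumes ind: "indecomposable_mod R M" and u: "arrow R M M u" and v: "arrow R M M v"
    and b: "bij_betw (\<lambda>x. u x \<oplus>\<^bsub>M\<^esub> v x) (carrier M) (carrier M)"
  shows "bij_betw u (carrier M) (carrier M) \<or> bij_betw v (carrier M) (carrier M)"
proof (rule disj_imp[THEN iffD2, rule_format])
  assume nu: "\<not> bij_betw u (carrier M) (carrier M)"
  note M = arrow_fg(1)[OF u]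
  note lM = fg_left_module[OF M]
  interpret M: left_module R M by (rule lM)
  let ?s = "\<lambda>x. u x \<oplus>\<^bsub>M\<^esub> v x"
  obtain w where w': "arrow R M M w" "\<forall>x\<in>carrier M. w (?s x) = x" "\<forall>x\<in>carrier M. ?s (w x) = x"
    using arrow_inverse[OF arrow_plus[OF u v] b] by (elim exE conjE) (rule that; assumption)
  note w = w'(1) bspec[OF w'(2)] bspec[OF w'(3)]
  have wu: "arrow R M M (\<lambda>x. w (u x))" and wv: "arrow R M M (\<lambda>x. w (v x))" using arrow_comp[OF u w(1)] arrow_comp[OF v w(1)] .
  have sw: "bij_betw t (carrier M) (carrier M)" if "bij_betw (\<lambda>x. w (t x)) (carrier M) (carrier M)" "arrow R M M t" for t
  proof -
    have "bij_betw (?s \<circ> (\<lambda>x. w (t x))) (carrier M) (carrier M)" using bij_betw_trans[OF that(1) b] .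
    then show ?thesis by (rule iffD1[OF bij_betw_cong, rotated]) (use w(3) arrow_app[OF that(2)] in simp)
  qed
  have "\<not> bij_betw (\<lambda>x. w (u x)) (carrier M) (carrier M)" using sw u nu by blast
  then obtain k where k: "\<forall>x\<in>carrier M. ((\<lambda>x. w (u x)) ^^ k) x = \<zero>\<^bsub>M\<^esub>" using indecomposable_endo[OF ind wu] by blast
  have "a_kernel M M (\<lambda>x. w (v x)) = {\<zero>\<^bsub>M\<^esub>}"
  proof -
    have "x = \<zero>\<^bsub>M\<^esub>" if x: "x \<in> carrier M" "w (v x) = \<zero>\<^bsub>M\<^esub>" for x
    proof -
      have "w (u x) = x" using w(2)[OF x(1)] x arrow_app[OF u] arrow_app[OF v] arrow_app[OF wu] by (simp add: arrow_add[OF w(1)])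
      then have "((\<lambda>x. w (u x)) ^^ i) x = x" for i by (induction i) auto
      from this[of k] show ?thesis using k x(1) by simp
    qed
    then show ?thesis using arrow_zero[OF wv] by (auto simp: a_kernel_def')
  qed
  then have "inj_on (\<lambda>x. w (v x)) (carrier M)" using hom_inj_iff[OF lM lM arrow_fg(3)[OF wv]] by simp
  then have "bij_betw (\<lambda>x. w (v x)) (carrier M) (carrier M)"
    using fin_length_hom_bij[OF lM fg_fin_length[OF M] arrow_fg(3)[OF wv]] by (simp add: bij_betw_def)
  then show "bij_betw v (carrier M) (carrier M)" using sw v by blast
qed

lemma indecomposable_local_sum:
  fixes m :: nat
  assumes ind: "indecomposable_mod R M" and M: "M \<in> fg_modules R" and t: "\<And>l. l < m \<Longrightarrow> arrow R M M (t l)"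
    and b: "bij_betw (\<lambda>x. \<Oplus>\<^bsub>M\<^esub>l\<in>{..<m}. t l x) (carrier M) (carrier M)"
  shows "\<exists>l<m. bij_betw (t l) (carrier M) (carrier M)"
proof -
  interpret M: left_module R M by (rule fg_left_module[OF M])
  have ar: "arrow R M M (\<lambda>x. \<Oplus>\<^bsub>M\<^esub>l\<in>{..<m}. t l x)" if "\<And>l. l < m \<Longrightarrow> arrow R M M (t l)" for m
    using that
  proof (induction m)
    case 0 then show ?case using arrow_const_zero[OF M M] by simp
  next
    case (Suc m)
    have ts: "\<And>l. l < Suc m \<Longrightarrow> arrow R M M (t l)" using Suc.prems .
    have "arrow R M M (\<lambda>x. t m x \<oplus>\<^bsub>M\<^esub> (\<Oplus>\<^bsub>M\<^esub>l\<in>{..<m}. t l x))" using Suc.IH ts by (intro arrow_plus) simp_all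
    then show ?case
      by (rule arrow_cong) (use arrow_app[OF ts] in \<open>simp add: lessThan_Suc Pi_def\<close>)
  qed
  show ?thesis using t b
  proof (induction m)
    case 0
    then have "carrier M = (\<lambda>x. \<zero>\<^bsub>M\<^esub>) ` carrier M" by (simp add: bij_betw_def)
    then have "carrier M \<subseteq> {\<zero>\<^bsub>M\<^esub>}" by auto
    then show ?case using ind M.M.zero_closed unfolding indecomposable_mod_def by blast
  next
    case (Suc m)
    have ts: "\<And>l. l < Suc m \<Longrightarrow> arrow R M M (t l)" using Suc.prems(1) .
    have "bij_betw (\<lambda>x. t m x \<oplus>\<^bsub>M\<^esub> (\<Oplus>\<^bsub>M\<^esub>l\<in>{..<m}. t l x)) (carrier M) (carrier M)"
      by (rule iffD1[OF bij_betw_cong Suc.prems(2)]) (use arrow_app[OF ts] in \<open>simp add: lessThan_Suc Pi_def\<close>)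
    from indecomposable_local[OF ind _ _ this] ts ar
    have "bij_betw (t m) (carrier M) (carrier M) \<or> bij_betw (\<lambda>x. \<Oplus>\<^bsub>M\<^esub>l\<in>{..<m}. t l x) (carrier M) (carrier M)" by simp
    then show ?case
    proof
      assume "bij_betw (\<lambda>x. \<Oplus>\<^bsub>M\<^esub>l\<in>{..<m}. t l x) (carrier M) (carrier M)"
      from Suc.IH[OF _ this] ts show ?thesis using less_Suc_eq by auto
    qed blast
  qed
qed

text \<open>
  Retracts up to an automorphism.  For an indecomposable \<open>L\<close> this form is inherited by one term
  of a decomposition of \<open>M\<close>: if \<open>v u\<close> is a sum of two endomorphisms and bijective, so is one of the two.
\<close>

definition retract_of where
  "retract_of L M \<longleftrightarrow> (\<exists>u v. arrow R L M u \<and> arrow R M L v \<and> bij_betw (\<lambda>x. v (u x)) (carrier L) (carrier L))"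

text \<open>
  A minimal submodule of \<open>M\<close> without this property would be decomposable, and an indecomposable
  retract of a direct sum is a retract of one of the two terms.
\<close>

lemma finitely_many_indecomposable_retracts:
  assumes M: "M \<in> fg_modules R"
  shows "\<exists>\<P>. finite \<P> \<and> \<P> \<subseteq> fg_modules R \<and>
    (\<forall>L. indecomposable_mod R L \<longrightarrow> retract_of L M \<longrightarrow> (\<exists>N\<in>\<P>. mod_isomorphic R L N))"
proof (rule ccontr)
  define good where "good H \<longleftrightarrow> (\<exists>\<P>. finite \<P> \<and> \<P> \<subseteq> fg_modules R \<and>
    (\<forall>L. indecomposable_mod R L \<longrightarrow> retract_of L (M\<lparr>carrier := H\<rparr>) \<longrightarrow> (\<exists>N\<in>\<P>. mod_isomorphic R L N)))" for H
  interpret M: left_module R M by (rule fg_left_module[OF M])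
  assume "\<not> ?thesis"
  then have "\<not> good (carrier M)" unfolding good_def by simp
  then have ne: "{H. submodule H R M \<and> \<not> good H} \<noteq> {}" using M.submodule_carrier by blast
  have all: "\<forall>H\<in>{H. submodule H R M \<and> \<not> good H}. submodule H R M" by blast
  from fin_length_minimal[OF fg_fin_length[OF M] all ne]
  obtain H where H: "submodule H R M" "\<not> good H" and min: "\<And>H'. submodule H' R M \<Longrightarrow> \<not> good H' \<Longrightarrow> H' \<subseteq> H \<Longrightarrow> H' = H"
    by blast
  let ?H = "M\<lparr>carrier := H\<rparr>"
  note fH = submodule_fg[OF M H(1)]
  note lH = fg_left_module[OF fH]
  interpret H: left_module R ?H by (rule lH)
  have H0: "H \<noteq> {\<zero>\<^bsub>M\<^esub>}"
  proof
    assume z: "H = {\<zero>\<^bsub>M\<^esub>}"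
    have "\<not> (indecomposable_mod R L \<and> retract_of L ?H)" for L
    proof
      assume "indecomposable_mod R L \<and> retract_of L ?H"
      then obtain u v where L: "indecomposable_mod R L" "arrow R L ?H u" "arrow R ?H L v" "bij_betw (\<lambda>x. v (u x)) (carrier L) (carrier L)"
        unfolding retract_of_def by blast
      have "v (u x) = \<zero>\<^bsub>L\<^esub>" if "x \<in> carrier L" for x
        using arrow_app[OF L(2) that] z arrow_zero[OF L(3)] by simp
      then have "carrier L \<subseteq> {\<zero>\<^bsub>L\<^esub>}" using L(4) unfolding bij_betw_def by blast
      moreover have "\<zero>\<^bsub>L\<^esub> \<in> carrier L" using left_module.submodule_zero[OF arrow_lm(1)[OF L(2)]] submodule_sub by blast
      ultimately show False using L(1) unfolding indecomposable_mod_def by blast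
    qed
    then have "good H" unfolding good_def by (intro exI[of _ "{}"]) simp
    then show False using H(2) by blast
  qed
  have "\<not> indecomposable_mod R ?H"
  proof
    assume ind: "indecomposable_mod R ?H"
    have "mod_isomorphic R L ?H" if L: "indecomposable_mod R L" "retract_of L ?H" for L
    proof -
      obtain u v where uv: "arrow R L ?H u" "arrow R ?H L v" "bij_betw (\<lambda>x. v (u x)) (carrier L) (carrier L)"
        using L(2) unfolding retract_of_def by blast
      note lL = arrow_lm(1)[OF uv(1)]
      interpret L: left_module R L by (rule lL)
      obtain w where w: "arrow R L L w" "\<forall>x\<in>carrier L. w (v (u x)) = x" "\<forall>x\<in>carrier L. v (u (w x)) = x"
        using arrow_inverse[OF arrow_comp[OF uv(1,2)] uv(3)] by blast
      have t: "arrow R L ?H (\<lambda>x. u (w x))" using arrow_comp[OF w(1) uv(1)] .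
      let ?t = "\<lambda>x. u (w x)"
      have sI: "submodule (?t ` carrier L) R ?H" by (rule submodule_image[OF lL lH arrow_fg(3)[OF t] L.submodule_carrier])
      have sK: "submodule (a_kernel ?H L v) R ?H" by (rule submodule_kernel[OF lH lL arrow_fg(3)[OF uv(2)]])
      have "complementary R ?H (?t ` carrier L) (a_kernel ?H L v)"
      proof (rule complementaryI[OF lH sI sK])
        fix x assume "x \<in> ?t ` carrier L" "x \<in> a_kernel ?H L v"
        then obtain y where y: "y \<in> carrier L" "x = ?t y" "v x = \<zero>\<^bsub>L\<^esub>" by (auto simp: a_kernel_def')
        then have "y = \<zero>\<^bsub>L\<^esub>" using w(3) by simp
        then show "x = \<zero>\<^bsub>?H\<^esub>" using y(2) arrow_zero[OF t] by simp
      next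
        fix x assume x: "x \<in> carrier ?H"
        note vx = arrow_app[OF uv(2) x]
        note tvx = arrow_app[OF t vx]
        have "v (x \<ominus>\<^bsub>?H\<^esub> ?t (v x)) = \<zero>\<^bsub>L\<^esub>" using arrow_minus[OF uv(2) x tvx] w(3) vx by (simp add: L.M.minus_zero_iff)
        then have "x \<ominus>\<^bsub>?H\<^esub> ?t (v x) \<in> a_kernel ?H L v" using H.M.minus_closed[OF x tvx] by (simp add: a_kernel_def')
        moreover have "x = ?t (v x) \<oplus>\<^bsub>?H\<^esub> (x \<ominus>\<^bsub>?H\<^esub> ?t (v x))"
          using H.M.minus_add_cancel[OF x tvx] H.M.a_comm[OF tvx H.M.minus_closed[OF x tvx]] by (simp only:)
        ultimately show "\<exists>y\<in>?t ` carrier L. \<exists>z\<in>a_kernel ?H L v. x = y \<oplus>\<^bsub>?H\<^esub> z" using vx by blast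
      qed
      then consider "?t ` carrier L = {\<zero>\<^bsub>?H\<^esub>}" | "a_kernel ?H L v = {\<zero>\<^bsub>?H\<^esub>}" using ind unfolding indecomposable_mod_def by blast
      then show ?thesis
      proof cases
        case 1
        have "x = \<zero>\<^bsub>L\<^esub>" if x: "x \<in> carrier L" for x
        proof -
          have "?t x = \<zero>\<^bsub>?H\<^esub>" using 1 x by blast
          then have "v (?t x) = \<zero>\<^bsub>L\<^esub>" using arrow_zero[OF uv(2)] by simp
          then show ?thesis using w(3) x by simp
        qed
        then have "carrier L = {\<zero>\<^bsub>L\<^esub>}" using L.M.zero_closed by blast
        then show ?thesis using L(1) unfolding indecomposable_mod_def by blast
      next
        case 2
        have "?t (v x) = x" if x: "x \<in> carrier ?H" for x
        proof -
          note vx = arrow_app[OF uv(2) x]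
          note tvx = arrow_app[OF t vx]
          have "v (?t (v x)) = v x" using w(3) vx by simp
          then show ?thesis using inj_onD[OF iffD2[OF hom_inj_iff[OF lH lL arrow_fg(3)[OF uv(2)]] 2]] tvx x by blast
        qed
        then show ?thesis using mod_isomorphicI[OF arrow_fg(3)[OF t] arrow_fg(3)[OF uv(2)]] w(3) by blast
      qed
    qed
    then have "good H" unfolding good_def using fH by (intro exI[of _ "{?H}"]) simp
    then show False using H(2) by blast
  qed
  then obtain K1 K2 where K: "complementary R ?H K1 K2" "K1 \<noteq> {\<zero>\<^bsub>M\<^esub>}" "K2 \<noteq> {\<zero>\<^bsub>M\<^esub>}"
    using H0 unfolding indecomposable_mod_def by auto
  note KD = complementaryD[OF K(1)]
  have sK: "submodule K1 R M" "K1 \<subseteq> H" "submodule K2 R M" "K2 \<subseteq> H"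
    using KD(1,2) submodule_trans[OF M.left_module_axioms H(1)] by auto
  have "K1 \<noteq> H"
  proof
    assume "K1 = H"
    then have "x = \<zero>\<^bsub>M\<^esub>" if "x \<in> K2" for x using KD(3)[of x] that sK(4) by auto
    then show False using K(3) submodule_0[OF sK(3)] by blast
  qed
  moreover have "K2 \<noteq> H"
  proof
    assume "K2 = H"
    then have "x = \<zero>\<^bsub>M\<^esub>" if "x \<in> K1" for x using KD(3)[of x] that sK(2) by auto
    then show False using K(2) submodule_0[OF sK(1)] by blast
  qed
  ultimately have "good K1" "good K2" using min[OF sK(1) _ sK(2)] min[OF sK(3) _ sK(4)] by blast+
  obtain \<P>1 where P1: "finite \<P>1" "\<P>1 \<subseteq> fg_modules R"
      "\<forall>L. indecomposable_mod R L \<longrightarrow> retract_of L (M\<lparr>carrier := K1\<rparr>) \<longrightarrow> (\<exists>N\<in>\<P>1. mod_isomorphic R L N)"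
    using \<open>good K1\<close>[unfolded good_def] by (elim exE conjE) (rule that; assumption)
  obtain \<P>2 where P2: "finite \<P>2" "\<P>2 \<subseteq> fg_modules R"
      "\<forall>L. indecomposable_mod R L \<longrightarrow> retract_of L (M\<lparr>carrier := K2\<rparr>) \<longrightarrow> (\<exists>N\<in>\<P>2. mod_isomorphic R L N)"
    using \<open>good K2\<close>[unfolded good_def] by (elim exE conjE) (rule that; assumption)
  obtain p q where B: "biproduct R ?H (?H\<lparr>carrier := K1\<rparr>) (?H\<lparr>carrier := K2\<rparr>) (\<lambda>x. x) (\<lambda>x. x) p q"
    using complementary_biproduct[OF fH K(1)] by blast
  note BD = biproductD[OF B[simplified]]
  have "\<exists>N\<in>\<P>1 \<union> \<P>2. mod_isomorphic R L N" if L: "indecomposable_mod R L" "retract_of L ?H" for L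
  proof -
    obtain u v where uv: "arrow R L ?H u" "arrow R ?H L v" "bij_betw (\<lambda>x. v (u x)) (carrier L) (carrier L)"
      using L(2) unfolding retract_of_def by blast
    note a1 = arrow_comp[OF uv(1) BD(3)] and a2 = arrow_comp[OF uv(1) BD(4)]
    note b1 = arrow_comp[OF BD(1) uv(2)] and b2 = arrow_comp[OF BD(2) uv(2)]
    have "bij_betw (\<lambda>x. v (p (u x)) \<oplus>\<^bsub>L\<^esub> v (q (u x))) (carrier L) (carrier L)"
    proof (rule iffD1[OF bij_betw_cong uv(3)])
      fix x assume x: "x \<in> carrier L"
      note ux = arrow_app[OF uv(1) x]
      have "p (u x) \<oplus>\<^bsub>?H\<^esub> q (u x) = u x" using BD(9)[OF ux] by simp
      then show "v (u x) = v (p (u x)) \<oplus>\<^bsub>L\<^esub> v (q (u x))"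
        using arrow_add[OF uv(2) arrow_app[OF BD(1) arrow_app[OF BD(3) ux]] arrow_app[OF BD(2) arrow_app[OF BD(4) ux]]] by (simp only:)
    qed
    then have "bij_betw (\<lambda>x. v (p (u x))) (carrier L) (carrier L) \<or> bij_betw (\<lambda>x. v (q (u x))) (carrier L) (carrier L)"
      by (rule indecomposable_local[OF L(1) arrow_comp[OF a1 b1] arrow_comp[OF a2 b2]])
    then have "retract_of L (M\<lparr>carrier := K1\<rparr>) \<or> retract_of L (M\<lparr>carrier := K2\<rparr>)"
      unfolding retract_of_def using a1 b1 a2 b2 by blast
    then show ?thesis using P1(3) P2(3) L(1) by blast
  qed
  then have "good H" unfolding good_def using P1(1,2) P2(1,2) by (intro exI[of _ "\<P>1 \<union> \<P>2"]) simp
  then show False using H(2) by blast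
qed

text \<open>
  An indecomposable projective module is a retract of a free module, hence, its endomorphism ring being
  local, of the regular module.
\<close>

lemma finitely_many_indecomposable_projectives:
  "\<exists>\<P>. finite \<P> \<and> \<P> \<subseteq> fg_modules R \<and>
    (\<forall>L. projective_mod R L \<longrightarrow> indecomposable_mod R L \<longrightarrow> (\<exists>N\<in>\<P>. mod_isomorphic R L N))"
proof -
  note lR = regular_left_module_self
  interpret A: left_module R "regular_module R" by (rule lR)
  obtain A where A: "A \<in> fg_modules R" "mod_isomorphic R (regular_module R) A" using fg_modules_adequate[OF lR regular_fin_gen] by blast
  obtain a b where ab: "a \<in> mod_hom R (regular_module R) A" "b \<in> mod_hom R A (regular_module R)"
    "bij_betw a (carrier (regular_module R)) (carrier A)"
    "\<And>x. x \<in> carrier (regular_module R) \<Longrightarrow> b (a x) = x" "\<And>y. y \<in> carrier A \<Longrightarrow> a (b y) = y"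
    using mod_isomorphicE[OF lR fg_left_module[OF A(1)] A(2)] by blast
  have "retract_of L A" if L: "projective_mod R L" "indecomposable_mod R L" for L
  proof -
    note fL = projective_fg[OF L(1)]
    note lL = fg_left_module[OF fL]
    interpret L: left_module R L by (rule lL)
    obtain m i r where ir: "i \<in> mod_hom R L (free_module R m)" "r \<in> mod_hom R (free_module R m) L" "\<forall>x\<in>carrier L. r (i x) = x"
      using L(1) projective_iff_free_retract[OF ring_axioms fL] by blast
    have e: "r (unit_vector R m l) \<in> carrier L" for l
      using mod_hom_closed[OF ir(2)] unit_vector_closed[OF ring_axioms] by simp
    define u where "u l x = a (i x l)" for l x
    define v where "v l y = b y \<odot>\<^bsub>L\<^esub> r (unit_vector R m l)" for l y
    have il: "i x l \<in> carrier R" if "l < m" "x \<in> carrier L" for l x using mod_hom_closed[OF ir(1) that(2)] that(1) by auto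
    have u: "arrow R L A (u l)" if l: "l < m" for l
    proof (intro arrowI fL A(1))
      show "u l x \<in> carrier A" if "x \<in> carrier L" for x using mod_hom_closed[OF ab(1)] il[OF l that] by (simp add: u_def)
      show "u l (x \<oplus>\<^bsub>L\<^esub> y) = u l x \<oplus>\<^bsub>A\<^esub> u l y" if "x \<in> carrier L" "y \<in> carrier L" for x y
        using mod_hom_add[OF ab(1), of "i x l" "i y l"] il[OF l] that l by (simp add: u_def mod_hom_add[OF ir(1)])
      show "u l (c \<odot>\<^bsub>L\<^esub> x) = c \<odot>\<^bsub>A\<^esub> u l x" if "c \<in> carrier R" "x \<in> carrier L" for c x
        using mod_hom_smult[OF ab(1), of c "i x l"] il[OF l] that l by (simp add: u_def mod_hom_smult[OF ir(1)])
    qed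
    have bc: "b y \<in> carrier R" if "y \<in> carrier A" for y using mod_hom_closed[OF ab(2) that] by simp
    have v: "arrow R A L (v l)" for l
      by (intro arrowI fL A(1)) (simp_all add: v_def e bc mod_hom_add[OF ab(2)] mod_hom_smult[OF ab(2)] L.smult_l_distr L.smult_assoc)
    have "bij_betw (\<lambda>x. \<Oplus>\<^bsub>L\<^esub>l\<in>{..<m}. v l (u l x)) (carrier L) (carrier L)"
    proof (rule iffD1[OF bij_betw_cong bij_betw_id[unfolded id_def]])
      fix x assume x: "x \<in> carrier L"
      have "(\<Oplus>\<^bsub>L\<^esub>l\<in>{..<m}. v l (u l x)) = (\<Oplus>\<^bsub>L\<^esub>l\<in>{..<m}. i x l \<odot>\<^bsub>L\<^esub> r (unit_vector R m l))"
        by (rule L.M.finsum_cong'[OF refl]) (use il x e ab(4) in \<open>auto simp: u_def v_def\<close>)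
      also have "\<dots> = r (i x)" using mod_hom_free_expansion[OF lL ir(2) mod_hom_closed[OF ir(1) x]] by simp
      also have "\<dots> = x" using ir(3) x by blast
      finally show "x = (\<Oplus>\<^bsub>L\<^esub>l\<in>{..<m}. v l (u l x))" by (rule sym)
    qed
    from indecomposable_local_sum[OF L(2) fL arrow_comp[OF u v] this]
    obtain l where "l < m" "bij_betw (\<lambda>x. v l (u l x)) (carrier L) (carrier L)" by blast
    then show ?thesis unfolding retract_of_def using u v by blast
  qed
  then show ?thesis using finitely_many_indecomposable_retracts[OF A(1)] by meson
qed

text \<open>
  Induction over decompositions: a minimal summand without the property \<open>Q\<close> would split into two smaller ones.
\<close>

lemma summand_induct:
  assumes M: "M \<in> fg_modules R"
    and zero: "Q {\<zero>\<^bsub>M\<^esub>}"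
    and ind: "\<And>K L. complementary R M K L \<Longrightarrow> indecomposable_mod R (M\<lparr>carrier := K\<rparr>) \<Longrightarrow> Q K"
    and sum: "\<And>K K1 K2. submodule K R M \<Longrightarrow> complementary R (M\<lparr>carrier := K\<rparr>) K1 K2 \<Longrightarrow> Q K1 \<Longrightarrow> Q K2 \<Longrightarrow> Q K"
  shows "Q (carrier M)"
proof (rule ccontr)
  interpret M: left_module R M by (rule fg_left_module[OF M])
  note lM = M.left_module_axioms
  assume nq: "\<not> Q (carrier M)"
  have "complementary R M (carrier M) {\<zero>\<^bsub>M\<^esub>}"
    by (rule complementaryI[OF lM M.submodule_carrier M.submodule_zero]) auto
  then have ne: "{K. (\<exists>L. complementary R M K L) \<and> \<not> Q K} \<noteq> {}" using nq by blast
  have all: "\<forall>K\<in>{K. (\<exists>L. complementary R M K L) \<and> \<not> Q K}. submodule K R M" using complementaryD(1) by blast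
  from fin_length_minimal[OF fg_fin_length[OF M] all ne]
  obtain K where K0: "(\<exists>L. complementary R M K L) \<and> \<not> Q K"
    and min0: "\<forall>K'\<in>{K. (\<exists>L. complementary R M K L) \<and> \<not> Q K}. K' \<subseteq> K \<longrightarrow> K' = K" by (elim bexE CollectE)
  have min: "K' = K" if "complementary R M K' L'" "\<not> Q K'" "K' \<subseteq> K" for K' L'
    using min0 that by blast
  obtain L where K: "complementary R M K L" "\<not> Q K" using K0 by blast
  note D = complementaryD[OF K(1)]
  let ?K = "M\<lparr>carrier := K\<rparr>"
  have "K \<noteq> {\<zero>\<^bsub>M\<^esub>}" using K(2) zero by blast
  moreover have "\<not> indecomposable_mod R ?K" using ind[OF K(1)] K(2) by blast
  ultimately obtain K1 K2 where K12: "complementary R ?K K1 K2" "K1 \<noteq> {\<zero>\<^bsub>M\<^esub>}" "K2 \<noteq> {\<zero>\<^bsub>M\<^esub>}"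
    unfolding indecomposable_mod_def by auto
  note E = complementaryD[OF K12(1)]
  have sK: "submodule K1 R M" "K1 \<subseteq> K" "submodule K2 R M" "K2 \<subseteq> K" using E(1,2) submodule_trans[OF lM D(1)] by auto
  have step: "complementary R M N1 (N2 <+>\<^bsub>M\<^esub> L)" if N: "complementary R ?K N1 N2" "submodule N1 R M" "N1 \<subseteq> K" "submodule N2 R M" "N2 \<subseteq> K" for N1 N2
  proof (rule complementaryI[OF lM N(2) M.submodule_sum[OF N(4) D(2)]])
    note F = complementaryD[OF N(1)]
    fix x assume x: "x \<in> N1" "x \<in> N2 <+>\<^bsub>M\<^esub> L"
    then obtain y l where yl: "y \<in> N2" "l \<in> L" "x = y \<oplus>\<^bsub>M\<^esub> l" unfolding set_add_def' by blast
    have c: "x \<in> carrier M" "y \<in> carrier M" "l \<in> carrier M" using x(1) yl submodule_in[OF N(2)] submodule_in[OF N(4)] submodule_in[OF D(2)] by auto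
    have "x \<ominus>\<^bsub>M\<^esub> y = l" unfolding yl(3) by (rule M.M.add_minus_cancel'[OF c(2,3)])
    moreover have "x \<ominus>\<^bsub>M\<^esub> y \<in> K" using submodule_minus[OF D(1)] x(1) yl(1) N(3,5) by blast
    ultimately have "l = \<zero>\<^bsub>M\<^esub>" using D(3) yl(2) by blast
    then have "x = y" using yl(3) c by simp
    then show "x = \<zero>\<^bsub>M\<^esub>" using F(3)[of x] x(1) yl(1) by simp
  next
    note F = complementaryD[OF N(1)]
    fix x assume "x \<in> carrier M"
    then obtain k l where kl: "k \<in> K" "l \<in> L" "x = k \<oplus>\<^bsub>M\<^esub> l" using D(4) by blast
    obtain y z where yz: "y \<in> N1" "z \<in> N2" "k = y \<oplus>\<^bsub>M\<^esub> z" using F(4)[of k] kl(1) by auto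
    have "x = y \<oplus>\<^bsub>M\<^esub> (z \<oplus>\<^bsub>M\<^esub> l)" unfolding kl(3) yz(3)
      by (rule M.M.a_assoc[OF submodule_in[OF N(2) yz(1)] submodule_in[OF N(4) yz(2)] submodule_in[OF D(2) kl(2)]])
    moreover have "z \<oplus>\<^bsub>M\<^esub> l \<in> N2 <+>\<^bsub>M\<^esub> L" unfolding set_add_def' using yz(2) kl(2) by blast
    ultimately show "\<exists>y\<in>N1. \<exists>z\<in>N2 <+>\<^bsub>M\<^esub> L. x = y \<oplus>\<^bsub>M\<^esub> z" using yz(1) by blast
  qed
  have sw: "complementary R ?K K2 K1"
  proof (rule complementaryI[OF M.submodule_left_module[OF D(1)] E(2,1)])
    show "x = \<zero>\<^bsub>?K\<^esub>" if "x \<in> K2" "x \<in> K1" for x using E(3) that by blast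
    fix x assume "x \<in> carrier ?K"
    then obtain y z where yz: "y \<in> K1" "z \<in> K2" "x = y \<oplus>\<^bsub>M\<^esub> z" using E(4)[of x] by auto
    then have "x = z \<oplus>\<^bsub>?K\<^esub> y" using M.M.a_comm[OF submodule_in[OF sK(1) yz(1)] submodule_in[OF sK(3) yz(2)]] by simp
    then show "\<exists>y\<in>K2. \<exists>z\<in>K1. x = y \<oplus>\<^bsub>?K\<^esub> z" using yz by blast
  qed
  have "K1 \<noteq> K"
  proof
    assume "K1 = K"
    then have "x = \<zero>\<^bsub>M\<^esub>" if "x \<in> K2" for x using E(3)[of x] that sK(4) by auto
    then show False using K12(3) submodule_0[OF sK(3)] by blast
  qed
  moreover have "K2 \<noteq> K"
  proof
    assume "K2 = K"
    then have "x = \<zero>\<^bsub>M\<^esub>" if "x \<in> K1" for x using E(3)[of x] that sK(2) by auto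
    then show False using K12(2) submodule_0[OF sK(1)] by blast
  qed
  ultimately have "Q K1" "Q K2" using min[OF step[OF K12(1) sK]] min[OF step[OF sw sK(3,4,1,2)]] sK(2,4) by blast+
  then show False using sum[OF D(1) K12(1)] K(2) by blast
qed

end

section \<open>Projective dimension\<close>

lemma projective_cover_cover:
  assumes "projective_cover R M P p" "M \<in> fg_modules R" shows "cover R M P p"
  using assms projective_fg[of R P] by (simp add: projective_cover_def cover_def arrow_def)

lemma projective_cover_superfluous:
  assumes "projective_cover R M P p" "submodule N R P" "N <+>\<^bsub>P\<^esub> a_kernel P M p = carrier P" shows "N = carrier P"
  using assms by (simp add: projective_cover_def)

context noetherian_ring begin

lemma resolutionD:
  assumes "projective_resolution R M n P d"
  shows "projective_mod R (P i)" "i > n \<Longrightarrow> carrier (P i) = {\<zero>\<^bsub>P i\<^esub>}" "d 0 \<in> mod_hom R (P 0) M"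
    "d (Suc i) \<in> mod_hom R (P (Suc i)) (P i)" "d 0 ` carrier (P 0) = carrier M"
    "d (Suc 0) ` carrier (P (Suc 0)) = a_kernel (P 0) M (d 0)"
    "d (Suc (Suc i)) ` carrier (P (Suc (Suc i))) = a_kernel (P (Suc i)) (P i) (d (Suc i))"
proof -
  note c = assms[unfolded projective_resolution_def]
  note c1 = conjunct2[OF c] note c2 = conjunct2[OF c1] note c3 = conjunct2[OF c2] note c4 = conjunct2[OF c3]
  note c5 = conjunct2[OF c4]
  show "projective_mod R (P i)" by (rule spec[OF conjunct1[OF c]])
  show "i > n \<Longrightarrow> carrier (P i) = {\<zero>\<^bsub>P i\<^esub>}" by (rule mp[OF spec[OF conjunct1[OF c1]]])
  show "d 0 \<in> mod_hom R (P 0) M" by (rule conjunct1[OF c2])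
  show "d (Suc i) \<in> mod_hom R (P (Suc i)) (P i)" by (rule spec[OF conjunct1[OF c3]])
  show "d 0 ` carrier (P 0) = carrier M" by (rule conjunct1[OF c4])
  show "d (Suc 0) ` carrier (P (Suc 0)) = a_kernel (P 0) M (d 0)" by (rule conjunct1[OF c5])
  show "d (Suc (Suc i)) ` carrier (P (Suc (Suc i))) = a_kernel (P (Suc i)) (P i) (d (Suc i))"
    by (rule spec[OF conjunct2[OF c5]])
qed

text \<open>
  Resolutions of length \<open>n\<close> exist exactly if the identity is \<open>n\<close>-null: removing or adding the
  first term of a resolution corresponds to passing to the kernel of the augmentation or back.
\<close>

lemma resolution_null:
  assumes "M \<in> fg_modules R" "projective_resolution R M n P d"
  shows "null R n M M (\<lambda>x. x)"
  using assms
proof (induction n arbitrary: M P d)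
  case 0
  note P = resolutionD(1)[OF 0(2)] and d0 = resolutionD(3)[OF 0(2)] and d1 = resolutionD(4)[OF 0(2), of 0]
    and s = resolutionD(5)[OF 0(2)] and k = resolutionD(6)[OF 0(2)]
  have z: "carrier (P (Suc 0)) = {\<zero>\<^bsub>P (Suc 0)\<^esub>}" by (rule resolutionD(2)[OF 0(2)]) simp
  have a0: "arrow R (P 0) M (d 0)" and a1: "arrow R (P (Suc 0)) (P 0) (d (Suc 0))"
    using d0 d1 0(1) projective_fg[OF P] by (simp_all add: arrow_def)
  have "a_kernel (P 0) M (d 0) = {\<zero>\<^bsub>P 0\<^esub>}" unfolding k[symmetric] z using arrow_zero[OF a1] by simp
  then have "bij_betw (d 0) (carrier (P 0)) (carrier M)"
    using hom_inj_iff[OF arrow_lm[OF a0] d0] s by (simp add: bij_betw_def)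
  then obtain g where g: "arrow R M (P 0) g" "\<forall>y\<in>carrier M. d 0 (g y) = y" using arrow_inverse[OF a0] by blast
  show ?case by (rule null_cong[OF null_through_projective[OF P g(1) a0]]) (use g(2) in simp)
next
  case (Suc n)
  note P = resolutionD(1)[OF Suc.prems(2)] and z = resolutionD(2)[OF Suc.prems(2)] and d0 = resolutionD(3)[OF Suc.prems(2)]
    and d1 = resolutionD(4)[OF Suc.prems(2)] and s = resolutionD(5)[OF Suc.prems(2)]
    and k = resolutionD(6)[OF Suc.prems(2)] and k' = resolutionD(7)[OF Suc.prems(2)]
  have a0: "arrow R (P 0) M (d 0)" and a1: "arrow R (P (Suc 0)) (P 0) (d (Suc 0))"
    using d0 d1 Suc.prems(1) projective_fg[OF P] by (simp_all add: arrow_def)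
  have c: "cover R M (P 0) (d 0)" unfolding cover_def using P a0 s by simp
  let ?K = "ker_mod (P 0) M (d 0)"
  have a1': "arrow R (P (Suc 0)) ?K (d (Suc 0))"
  proof (rule arrow_into_ker[OF a1 a0])
    fix x assume "x \<in> carrier (P (Suc 0))"
    then have "d (Suc 0) x \<in> a_kernel (P 0) M (d 0)" unfolding k[symmetric] by blast
    then show "d 0 (d (Suc 0) x) = \<zero>\<^bsub>M\<^esub>" by (simp add: a_kernel_def')
  qed
  have "projective_resolution R ?K n (\<lambda>i. P (Suc i)) (\<lambda>i. d (Suc i))"
    unfolding projective_resolution_def
    using P z d1 k k' arrow_fg(3)[OF a1'] by (auto simp: a_kernel_def')
  from Suc.IH[OF ker_fg[OF a0] this] show ?case by (rule null_id_unlift[OF _ c])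
qed

lemma null_resolution:
  assumes "M \<in> fg_modules R" "null R n M M (\<lambda>x. x)"
  shows "\<exists>P d. projective_resolution R M n P d"
  using assms
proof (induction n arbitrary: M)
  case 0
  obtain Z where Z: "Z \<in> fg_modules R" "carrier Z = {\<zero>\<^bsub>Z\<^esub>}" using zero_module_fg[OF ring_axioms] by blast
  note pZ = zero_module_projective[OF Z]
  have pM: "projective_mod R M" using 0(2) null_id_projective by blast
  define P where "P = case_nat M (\<lambda>i. Z)"
  define d where "d = case_nat (\<lambda>x. x) (case_nat (\<lambda>x. \<zero>\<^bsub>M\<^esub>) (\<lambda>i x. \<zero>\<^bsub>Z\<^esub>))"
  have 1: "d (Suc i) \<in> mod_hom R (P (Suc i)) (P i)" for i
    using arrow_fg(3)[OF arrow_const_zero[OF Z(1) 0(1)]] arrow_fg(3)[OF arrow_const_zero[OF Z(1) Z(1)]]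
    by (cases i) (simp_all add: d_def P_def)
  have m0: "\<zero>\<^bsub>M\<^esub> \<in> carrier M" using left_module.submodule_zero[OF fg_left_module[OF 0(1)]] submodule_sub by blast
  have 2: "d (Suc (Suc i)) ` carrier (P (Suc (Suc i))) = a_kernel (P (Suc i)) (P i) (d (Suc i))" for i
    using Z(2) by (cases i) (simp_all add: d_def P_def a_kernel_def')
  have "projective_resolution R M 0 P d" unfolding projective_resolution_def
  proof (intro conjI allI impI 1 2)
    show "projective_mod R (P i)" for i using pM pZ by (cases i) (simp_all add: P_def)
    show "carrier (P i) = {\<zero>\<^bsub>P i\<^esub>}" if "i > 0" for i using Z(2) that by (cases i) (simp_all add: P_def)
    show "d 0 \<in> mod_hom R (P 0) M" using mod_hom_id by (simp add: d_def P_def)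
    show "d 0 ` carrier (P 0) = carrier M" by (simp add: d_def P_def)
    have "a_kernel (P 0) M (d 0) = {\<zero>\<^bsub>M\<^esub>}" unfolding a_kernel_def' using m0 by (simp add: d_def P_def) blast
    moreover have "d (Suc 0) ` carrier (P (Suc 0)) = {\<zero>\<^bsub>M\<^esub>}" using Z(2) by (simp add: d_def P_def)
    ultimately show "d (Suc 0) ` carrier (P (Suc 0)) = a_kernel (P 0) M (d 0)" by simp
  qed
  then show ?case by (intro exI)
next
  case (Suc n)
  obtain P0 p0 where c: "cover R M P0 p0" using cover_exists[OF ring_axioms Suc.prems(1)] by blast
  note a0 = coverD(2)[OF c]
  obtain P' d' where res: "projective_resolution R (ker_mod P0 M p0) n P' d'"
    using Suc.IH[OF ker_fg[OF a0] null_id_lift[OF Suc.prems(2) c]] by blast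
  define P where "P = case_nat P0 P'"
  define d where "d = case_nat p0 d'"
  have [simp]: "P 0 = P0" "P (Suc i) = P' i" "d 0 = p0" "d (Suc i) = d' i" for i by (simp_all add: P_def d_def)
  note P' = resolutionD(1)[OF res] and z = resolutionD(2)[OF res] and d0 = resolutionD(3)[OF res]
    and d1 = resolutionD(4)[OF res] and s = resolutionD(5)[OF res] and k = resolutionD(6)[OF res] and k' = resolutionD(7)[OF res]
  have d0': "d' 0 \<in> mod_hom R (P' 0) P0" using mod_hom_comp[OF d0 arrow_fg(3)[OF arrow_ker_incl[OF a0]]] by simp
  have "projective_resolution R M (Suc n) P d" unfolding projective_resolution_def
  proof (intro conjI allI impI)
    show "projective_mod R (P i)" for i using P' coverD(1)[OF c] by (cases i) simp_all
    show "carrier (P i) = {\<zero>\<^bsub>P i\<^esub>}" if "i > Suc n" for i using z that by (cases i) simp_all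
    show "d 0 \<in> mod_hom R (P 0) M" using arrow_fg(3)[OF a0] by simp
    show "d (Suc i) \<in> mod_hom R (P (Suc i)) (P i)" for i using d0' d1 by (cases i) simp_all
    show "d 0 ` carrier (P 0) = carrier M" using coverD(3)[OF c] by simp
    show "d (Suc 0) ` carrier (P (Suc 0)) = a_kernel (P 0) M (d 0)" using s by (simp add: a_kernel_def')
    show "d (Suc (Suc i)) ` carrier (P (Suc (Suc i))) = a_kernel (P (Suc i)) (P i) (d (Suc i))" for i
      using k k' by (cases i) (simp_all add: a_kernel_def')
  qed
  then show ?case by (intro exI)
qed

lemma fin_dim_le:
  assumes "\<And>M n. M \<in> fg_modules R \<Longrightarrow> null R n M M (\<lambda>x. x) \<Longrightarrow> null R b M M (\<lambda>x. x)"
  shows "fin_dim R \<le> enat b"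
  unfolding fin_dim_def
proof (rule Sup_least)
  fix e assume "e \<in> {proj_dim R M | M. M \<in> fg_modules R \<and> proj_dim R M < \<infinity>}"
  then obtain M where M: "M \<in> fg_modules R" "proj_dim R M < \<infinity>" "e = proj_dim R M" by blast
  have "\<exists>n P d. projective_resolution R M n P d"
  proof (rule ccontr)
    assume "\<nexists>n P d. projective_resolution R M n P d"
    then have "{enat n | n. \<exists>P d. projective_resolution R M n P d} = {}" by simp
    then have "proj_dim R M = Inf {}" unfolding proj_dim_def by (rule arg_cong)
    then show False using M(2) by (simp add: top_enat_def)
  qed
  then obtain n P d where "projective_resolution R M n P d" by blast
  from null_resolution[OF M(1) assms[OF M(1) resolution_null[OF M(1) this]]]
  have "\<exists>P d. projective_resolution R M b P d" .
  then have "enat b \<in> {enat n | n. \<exists>P d. projective_resolution R M n P d}" by simp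
  then show "e \<le> enat b" unfolding M(3) proj_dim_def by (rule Inf_lower)
qed

end

section \<open>The Jacobson radical\<close>

lemma (in ring) left_ideal_iff_submodule: "left_ideal I R \<longleftrightarrow> submodule I R (regular_module R)"
proof
  assume "left_ideal I R"
  then interpret additive_subgroup I R by (simp add: left_ideal_def)
  show "submodule I R (regular_module R)"
    by (rule left_module.submoduleI[OF regular_left_module_self])
      (use \<open>left_ideal I R\<close> a_subset in \<open>auto simp: left_ideal_def\<close>)
next
  assume s: "submodule I R (regular_module R)"
  then show "left_ideal I R" unfolding left_ideal_def
    using submodule_regular_subgroup submodule_smult[OF s] by simp
qed

text \<open>
  Otherwise a maximal left ideal would contain \<open>d\<close>, and with \<open>a\<close> it would contain \<open>1\<close>.
\<close>

lemma (in ring) jacobson_radical_left_inverse: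
  assumes fl: "fin_length R (regular_module R)" and a: "a \<in> jacobson_radical R" and d: "d \<in> carrier R" "d \<oplus> a = \<one>"
  shows "\<exists>c\<in>carrier R. c \<otimes> d = \<one>"
proof (rule ccontr)
  assume nc: "\<not> ?thesis"
  let ?M = "regular_module R"
  interpret L: left_module R ?M by (rule regular_left_module_self)
  let ?C = "{r \<odot>\<^bsub>?M\<^esub> d | r. r \<in> carrier R}"
  have C: "submodule ?C R ?M" by (rule L.cyclic_submodule) (use d in simp)
  let ?F = "{N. submodule N R ?M \<and> ?C \<subseteq> N \<and> \<one> \<notin> N}"
  have "?C \<in> ?F" using C nc by auto
  then have ne: "?F \<noteq> {}" by blast
  have all: "\<forall>N\<in>?F. submodule N R ?M" by blast
  from fin_length_maximal[OF fl all ne]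
  obtain I where I: "submodule I R ?M \<and> ?C \<subseteq> I \<and> \<one> \<notin> I" and max: "\<forall>N\<in>?F. I \<subseteq> N \<longrightarrow> N = I" by (elim bexE CollectE)
  have "maximal_left_ideal I R" unfolding maximal_left_ideal_def
  proof (intro conjI allI impI)
    show "left_ideal I R" using I left_ideal_iff_submodule by blast
    show "I \<noteq> carrier R" using I by auto
    fix J assume "left_ideal J R \<and> I \<subseteq> J"
    then have J: "submodule J R ?M" "I \<subseteq> J" using left_ideal_iff_submodule by auto
    show "J = I \<or> J = carrier R"
    proof (cases "\<one> \<in> J")
      case True
      have "x \<in> J" if "x \<in> carrier R" for x using submodule_smult[OF J(1) that True] that by simp
      then show ?thesis using submodule_sub[OF J(1)] by auto
    next
      case False
      then have "J \<in> ?F" using J I by blast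
      then show ?thesis using max J(2) by blast
    qed
  qed
  then have aI: "a \<in> I" using a unfolding jacobson_radical_def by blast
  have "d = \<one> \<odot>\<^bsub>?M\<^esub> d" using d by simp
  then have "d \<in> ?C" using one_closed by blast
  then have "d \<in> I" using I by blast
  from submodule_add[OF conjunct1[OF I] this aI] show False using I d(2) by simp
qed

section \<open>Subalgebras whose radical is an ideal\<close>

text \<open>
  The two algebras are module-finite over the same central subring, so a module over the larger one can be
  regarded as a finitely generated module over the smaller one, with the same carrier and operations.
\<close>

locale radical_pair = A: finite_length_algebra A T + B: finite_length_algebra "A\<lparr>carrier := B\<rparr>" T
  for A :: "('a, 'c) ring_scheme" (structure) and T B +
  assumes B_subring: "subring B A"
    and rad: "ideal (jacobson_radical (A\<lparr>carrier := B\<rparr>)) A"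
    and restrict_fg: "M \<in> fg_modules A \<Longrightarrow> M \<in> fg_modules (A\<lparr>carrier := B\<rparr>)"
begin

abbreviation B_ring ("\<B>") where "\<B> \<equiv> A\<lparr>carrier := B\<rparr>"

abbreviation radical ("\<J>") where "\<J> \<equiv> jacobson_radical \<B>"

lemma B_in: "b \<in> B \<Longrightarrow> b \<in> carrier A"
  using subringE(1)[OF B_subring] by blast

lemma rad_in_B: "j \<in> \<J> \<Longrightarrow> j \<in> B"
  by (simp add: jacobson_radical_def)

lemma restrict_hom: "f \<in> mod_hom A M N \<Longrightarrow> f \<in> mod_hom \<B> M N"
  using B_in by (auto simp: mod_hom_def)

lemma restrict_arrow: "arrow A M N f \<Longrightarrow> arrow \<B> M N f"
  by (simp add: arrow_def restrict_fg restrict_hom)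

lemma restrict_biproduct: "biproduct A S M N i j p q \<Longrightarrow> biproduct \<B> S M N i j p q"
  using restrict_arrow by (simp add: biproduct_def)

lemma rad_left_inverse: "a \<in> \<J> \<Longrightarrow> \<exists>c\<in>B. c \<otimes> (\<one> \<ominus> a) = \<one>"
proof -
  assume a: "a \<in> \<J>"
  obtain A' where A': "A' \<in> fg_modules \<B>" "mod_isomorphic \<B> (regular_module \<B>) A'"
    using fg_modules_adequate[OF B.regular_left_module_self B.regular_fin_gen] by blast
  obtain f g where fg: "f \<in> mod_hom \<B> (regular_module \<B>) A'" "bij_betw f (carrier (regular_module \<B>)) (carrier A')"
    using A'(2) unfolding mod_isomorphic_def by blast
  note lm = B.regular_left_module_self fg_left_module[OF A'(1)]
  have inj: "inj_on f (carrier (regular_module \<B>))" using fg(2) by (simp add: bij_betw_def)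
  have "fin_length \<B> (regular_module \<B>)"
    unfolding fin_length_def
  proof (intro allI impI, elim conjE)
    fix N assume N: "\<forall>i::nat. submodule (N i) \<B> (regular_module \<B>)" and ch: "incseq N \<or> decseq N"
    have "submodule (f ` N i) \<B> A'" for i using submodule_image[OF lm fg(1)] N by blast
    moreover have "incseq (\<lambda>i. f ` N i) \<or> decseq (\<lambda>i. f ` N i)"
      using ch unfolding incseq_def decseq_def by (elim disjE) (simp_all add: image_mono)
    ultimately have "\<exists>k. \<forall>i\<ge>k. f ` N i = f ` N k" by (rule fin_length_stops[OF B.fg_fin_length[OF A'(1)]])
    then obtain k where k: "\<forall>i\<ge>k. f ` N i = f ` N k" ..
    have "N i = N k" if "i \<ge> k" for i
      using inj_on_image_eq_iff[OF inj submodule_sub submodule_sub, of "N i" \<B> "N k" \<B>] k that N by blast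
    then show "\<exists>k. \<forall>i\<ge>k. N i = N k" by blast
  qed
  moreover have "\<one> \<ominus> a \<in> B" using rad_in_B[OF a] subringE(3,5,7)[OF B_subring] by (simp add: a_minus_def)
  moreover have "(\<one> \<ominus> a) \<oplus> a = \<one>" using B_in[OF rad_in_B[OF a]] by (simp add: A.minus_add_cancel)
  ultimately show ?thesis using B.jacobson_radical_left_inverse[OF _ a, of "\<one> \<ominus> a"] by simp
qed

text \<open>
  Nakayama's lemma for submodules of a free \<open>A\<close>-module whose coordinates lie in the radical of \<open>B\<close>.  In a
  maximal proper submodule \<open>N'\<close> above \<open>N\<close> one would have \<open>x = n + b j x\<close> with \<open>j\<close> in the radical
  and \<open>x \<notin> N'\<close>; but \<open>b j\<close> is in the radical as well, by hypothesis, so \<open>1 - b j\<close> has a left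
  inverse and \<open>x\<close> is a multiple of \<open>n\<close>.
\<close>

lemma rad_superfluous:
  assumes P: "P \<in> fg_modules A" and t: "t \<in> mod_hom A (free_module A m) P" and S: "S \<subseteq> carrier (free_module A m)"
    and J: "\<And>z l. z \<in> S \<Longrightarrow> l < m \<Longrightarrow> z l \<in> \<J>"
    and N: "submodule N A P" "N <+>\<^bsub>P\<^esub> t ` S = carrier P"
  shows "N = carrier P"
proof (rule ccontr)
  assume nN: "N \<noteq> carrier P"
  interpret P: left_module A P by (rule fg_left_module[OF P])
  interpret J: ideal \<J> A by (rule rad)
  let ?F = "{N'. submodule N' A P \<and> N \<subseteq> N' \<and> N' \<noteq> carrier P}"
  have ne: "?F \<noteq> {}" using N(1) nN by blast
  have all: "\<forall>N'\<in>?F. submodule N' A P" by blast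
  from fin_length_maximal[OF A.fg_fin_length[OF P] all ne]
  obtain N' where N': "submodule N' A P \<and> N \<subseteq> N' \<and> N' \<noteq> carrier P" and max: "\<forall>H\<in>?F. N' \<subseteq> H \<longrightarrow> H = N'" by (elim bexE CollectE)
  note sN' = conjunct1[OF N']
  have "\<not> t ` S \<subseteq> N'"
  proof
    assume s: "t ` S \<subseteq> N'"
    have "x \<in> N'" if "x \<in> carrier P" for x
    proof -
      have "x \<in> N <+>\<^bsub>P\<^esub> t ` S" using that N(2) by simp
      then obtain y z where "y \<in> N" "z \<in> t ` S" "x = y \<oplus>\<^bsub>P\<^esub> z" unfolding set_add_def' by blast
      then show ?thesis using s N' submodule_add[OF sN'] by blast
    qed
    then show False using N' submodule_sub[OF sN'] by blast
  qed
  then obtain z where z: "z \<in> S" "t z \<notin> N'" by blast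
  have zc: "z \<in> carrier (free_module A m)" using z S by blast
  have "t z = (\<Oplus>\<^bsub>P\<^esub>l\<in>{..<m}. z l \<odot>\<^bsub>P\<^esub> t (unit_vector A m l))" by (rule mod_hom_free_expansion[OF P.left_module_axioms t zc])
  then have "\<exists>l\<in>{..<m}. z l \<odot>\<^bsub>P\<^esub> t (unit_vector A m l) \<notin> N'"
    using submodule_finsum[OF P.left_module_axioms sN', of "{..<m}" "\<lambda>l. z l \<odot>\<^bsub>P\<^esub> t (unit_vector A m l)"] z(2) by auto
  then obtain l where l: "l < m" "z l \<odot>\<^bsub>P\<^esub> t (unit_vector A m l) \<notin> N'" by blast
  define j x where "j = z l" and "x = t (unit_vector A m l)"
  have j: "j \<in> \<J>" "j \<in> carrier A" using J[OF z(1) l(1)] B_in rad_in_B by (auto simp: j_def)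
  have x: "x \<in> carrier P" unfolding x_def using mod_hom_closed[OF t] unit_vector_closed[OF A.ring_axioms] by simp
  have jx: "j \<odot>\<^bsub>P\<^esub> x \<notin> N'" "j \<odot>\<^bsub>P\<^esub> x \<in> carrier P" using l(2) j(2) x by (simp_all add: j_def x_def)
  let ?C = "{r \<odot>\<^bsub>P\<^esub> (j \<odot>\<^bsub>P\<^esub> x) | r. r \<in> carrier A}"
  have C: "submodule ?C A P" by (rule P.cyclic_submodule[OF jx(2)])
  have "j \<odot>\<^bsub>P\<^esub> x = \<one> \<odot>\<^bsub>P\<^esub> (j \<odot>\<^bsub>P\<^esub> x)" using jx by simp
  then have "j \<odot>\<^bsub>P\<^esub> x \<in> ?C" using A.one_closed by blast
  then have "j \<odot>\<^bsub>P\<^esub> x \<in> N' <+>\<^bsub>P\<^esub> ?C" "N' \<subseteq> N' <+>\<^bsub>P\<^esub> ?C" using P.subset_sum[OF sN' C] by blast+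
  then have "N' <+>\<^bsub>P\<^esub> ?C = carrier P"
    using max P.submodule_sum[OF sN' C] jx(1) N' by blast
  then have "x \<in> N' <+>\<^bsub>P\<^esub> ?C" using x by simp
  then obtain n b where nb: "n \<in> N'" "b \<in> carrier A" "x = n \<oplus>\<^bsub>P\<^esub> b \<odot>\<^bsub>P\<^esub> (j \<odot>\<^bsub>P\<^esub> x)" unfolding set_add_def' by blast
  have bj: "b \<otimes> j \<in> \<J>" "b \<otimes> j \<in> carrier A" using J.I_l_closed[OF j(1) nb(2)] nb(2) j(2) by auto
  obtain c where c: "c \<in> B" "c \<otimes> (\<one> \<ominus> b \<otimes> j) = \<one>" using rad_left_inverse[OF bj(1)] by blast
  have nc: "n \<in> carrier P" using submodule_in[OF sN' nb(1)] .
  have "(\<one> \<ominus> b \<otimes> j) \<odot>\<^bsub>P\<^esub> x \<oplus>\<^bsub>P\<^esub> (b \<otimes> j) \<odot>\<^bsub>P\<^esub> x = x"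
    using bj x by (simp add: P.smult_l_distr[symmetric] A.minus_add_cancel)
  moreover have "n \<oplus>\<^bsub>P\<^esub> (b \<otimes> j) \<odot>\<^bsub>P\<^esub> x = x" using nb(2,3) j(2) x by (simp add: P.smult_assoc)
  ultimately have "(\<one> \<ominus> b \<otimes> j) \<odot>\<^bsub>P\<^esub> x = n"
    using P.M.add_minus_cancel[of "(\<one> \<ominus> b \<otimes> j) \<odot>\<^bsub>P\<^esub> x" "(b \<otimes> j) \<odot>\<^bsub>P\<^esub> x"]
      P.M.add_minus_cancel[of n "(b \<otimes> j) \<odot>\<^bsub>P\<^esub> x"] bj x nc by simp
  then have "(\<one> \<ominus> b \<otimes> j) \<odot>\<^bsub>P\<^esub> x \<in> N'" using nb(1) by simp
  from submodule_smult[OF sN' B_in[OF c(1)] this] have "c \<odot>\<^bsub>P\<^esub> ((\<one> \<ominus> b \<otimes> j) \<odot>\<^bsub>P\<^esub> x) \<in> N'" .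
  then have "x \<in> N'" using c bj x B_in[OF c(1)] by (simp add: P.smult_assoc[symmetric])
  then show False using jx(1) submodule_smult[OF sN' j(2)] by blast
qed

lemma free_restrict: "v \<in> carrier (free_module \<B> n) \<Longrightarrow> v \<in> carrier (free_module A n)"
  using B_in by (auto simp: PiE_def Pi_def)

text \<open>
  A homomorphism of free \<open>B\<close>-modules is given by a matrix, which acts on the free \<open>A\<close>-modules as well.
\<close>

lemma extend_free_hom:
  assumes f: "f \<in> mod_hom \<B> (free_module \<B> m) (free_module \<B> n)"
  shows "\<exists>g\<in>mod_hom A (free_module A m) (free_module A n). \<forall>v\<in>carrier (free_module \<B> m). g v = f v"
proof -
  let ?FA = "free_module A n"
  interpret FA: left_module A ?FA by (rule A.free_left_module)
  have lB: "left_module \<B> ?FA" by (rule left_module_subring[OF FA.left_module_axioms B_subring])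
  have uv: "unit_vector \<B> m l = unit_vector A m l" for l by (simp add: unit_vector_def cong: if_cong)
  have u: "unit_vector A m l \<in> carrier (free_module \<B> m)" for l using unit_vector_closed[OF B.ring_axioms, of m l] uv by simp
  have s: "f (unit_vector A m l) \<in> carrier ?FA" for l by (rule free_restrict[OF mod_hom_closed[OF f u]])
  define g where "g v = (\<Oplus>\<^bsub>?FA\<^esub>l\<in>{..<m}. v l \<odot>\<^bsub>?FA\<^esub> f (unit_vector A m l))" for v
  have g: "g \<in> mod_hom A (free_module A m) ?FA" unfolding g_def by (rule FA.comb_hom) (use s in simp)
  have f': "f \<in> mod_hom \<B> (free_module \<B> m) ?FA"
  proof (rule mod_homI)
    show "f x \<in> carrier ?FA" if "x \<in> carrier (free_module \<B> m)" for x by (rule free_restrict[OF mod_hom_closed[OF f that]])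
    show "f (x \<oplus>\<^bsub>free_module \<B> m\<^esub> y) = f x \<oplus>\<^bsub>?FA\<^esub> f y" if "x \<in> carrier (free_module \<B> m)" "y \<in> carrier (free_module \<B> m)" for x y
      using mod_hom_add[OF f that] by simp
    show "f (a \<odot>\<^bsub>free_module \<B> m\<^esub> x) = a \<odot>\<^bsub>?FA\<^esub> f x" if "a \<in> carrier \<B>" "x \<in> carrier (free_module \<B> m)" for a x
      using mod_hom_smult[OF f that] by simp
  qed
  have "g v = f v" if "v \<in> carrier (free_module \<B> m)" for v
    using mod_hom_free_expansion[OF lB f' that] by (simp only: g_def uv)
  then show ?thesis using g by blast
qed

text \<open>
  A second syzygy \<open>Z\<close> of a \<open>B\<close>-module, embedded in a free module with coordinates in the
  radical of \<open>B\<close>, is cut out by \<open>B\<close>-linear equations.  As the radical absorbs \<open>A\<close>, multiplication by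
  elements of \<open>A\<close> preserves the equations, so \<open>Z\<close> is an \<open>A\<close>-module, and it is the syzygy of an \<open>A\<close>-module.
\<close>

lemma second_syzygy_over_A:
  assumes M: "M \<in> fg_modules \<B>"
  shows "\<exists>Z V P p. V \<in> second_syzygies A \<and> projective_mod A P \<and> V \<in> fg_modules A \<and> short_exact \<B> V P Z (\<lambda>x. x) p \<and>
    (\<forall>n. null \<B> n Z Z (\<lambda>x. x) \<longrightarrow> null \<B> (n + 2) M M (\<lambda>x. x)) \<and>
    (\<forall>n. null \<B> n M M (\<lambda>x. x) \<longrightarrow> null \<B> n Z Z (\<lambda>x. x))"
proof -
  obtain P0 p0 where c0: "cover \<B> M P0 p0" using cover_exists[OF B.ring_axioms M] by blast
  note a0 = coverD(2)[OF c0]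
  let ?Y = "ker_mod P0 M p0"
  note fY = B.ker_fg[OF a0]
  obtain n0 i0 r0 where i0: "i0 \<in> mod_hom \<B> P0 (free_module \<B> n0)" "r0 \<in> mod_hom \<B> (free_module \<B> n0) P0" "\<forall>x\<in>carrier P0. r0 (i0 x) = x"
    using iffD1[OF projective_iff_free_retract[OF B.ring_axioms projective_fg[OF coverD(1)[OF c0]]] coverD(1)[OF c0]]
    by (elim exE bexE) (rule that; assumption)
  have psi: "i0 \<in> mod_hom \<B> ?Y (free_module \<B> n0)" using mod_hom_comp[OF arrow_fg(3)[OF B.arrow_ker_incl[OF a0]] i0(1)] .
  have psi_inj: "y = \<zero>\<^bsub>?Y\<^esub>" if y: "y \<in> carrier ?Y" "i0 y = \<zero>\<^bsub>free_module \<B> n0\<^esub>" for y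
  proof -
    have "r0 (i0 y) = y" using i0(3) y(1) by simp
    moreover have "r0 \<zero>\<^bsub>free_module \<B> n0\<^esub> = \<zero>\<^bsub>P0\<^esub>" by (rule mod_hom_zero[OF B.free_left_module arrow_lm(1)[OF a0] i0(2)])
    ultimately show ?thesis unfolding y(2) by simp
  qed
  obtain Q q where pc: "projective_cover \<B> ?Y Q q" using B.projective_cover_exists[OF fY] by blast
  have c1: "cover \<B> ?Y Q q" by (rule projective_cover_cover[OF pc fY])
  have super: "\<And>N. submodule N \<B> Q \<Longrightarrow> N <+>\<^bsub>Q\<^esub> a_kernel Q ?Y q = carrier Q \<Longrightarrow> N = carrier Q"
    by (rule projective_cover_superfluous[OF pc])
  note a1 = coverD(2)[OF c1]
  note fQ = arrow_fg(1)[OF a1]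
  interpret Q: left_module \<B> Q by (rule fg_left_module[OF fQ])
  let ?Z = "ker_mod Q ?Y q"
  note fZ = B.ker_fg[OF a1]
  obtain m i r where ir: "i \<in> mod_hom \<B> Q (free_module \<B> m)" "r \<in> mod_hom \<B> (free_module \<B> m) Q" "\<forall>x\<in>carrier Q. r (i x) = x"
    using iffD1[OF projective_iff_free_retract[OF B.ring_axioms fQ] coverD(1)[OF c1]]
    by (elim exE bexE) (rule that; assumption)
  interpret FB: left_module \<B> "free_module \<B> m" by (rule B.free_left_module)
  interpret FA: left_module A "free_module A m" by (rule A.free_left_module)
  interpret RB: left_module \<B> "regular_module \<B>" by (rule B.regular_left_module_self)
  interpret J: ideal \<J> A by (rule rad)
  \<comment> \<open>a superfluous submodule has all coordinates in the radical\<close>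
  have coord: "i z l \<in> \<J>" if z: "z \<in> carrier ?Z" and l: "l < m" for z l
  proof -
    have zQ: "z \<in> carrier Q" "q z = \<zero>\<^bsub>?Y\<^esub>" using z by auto
    have h: "(\<lambda>x. i x l) \<in> mod_hom \<B> Q (regular_module \<B>)"
      using l mod_hom_closed[OF ir(1)] by (intro mod_homI) (auto simp: mod_hom_add[OF ir(1)] mod_hom_smult[OF ir(1)])
    note izB = mod_hom_closed[OF h zQ(1)]
    have "i z l \<in> I" if I: "maximal_left_ideal I \<B>" for I
    proof (rule ccontr)
      assume nI: "i z l \<notin> I"
      have sI: "submodule I \<B> (regular_module \<B>)" and mI: "\<And>H. left_ideal H \<B> \<Longrightarrow> I \<subseteq> H \<Longrightarrow> H = I \<or> H = carrier \<B>"
        using I B.left_ideal_iff_submodule unfolding maximal_left_ideal_def by auto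
      let ?C = "{b \<odot>\<^bsub>regular_module \<B>\<^esub> i z l | b. b \<in> carrier \<B>}"
      have sC: "submodule ?C \<B> (regular_module \<B>)" by (rule RB.cyclic_submodule[OF izB])
      let ?H = "I <+>\<^bsub>regular_module \<B>\<^esub> ?C"
      have "i z l = \<one>\<^bsub>\<B>\<^esub> \<odot>\<^bsub>regular_module \<B>\<^esub> i z l" using RB.smult_one[OF izB] by simp
      then have "i z l \<in> ?C" using B.one_closed by blast
      then have "i z l \<in> ?H" "I \<subseteq> ?H" using RB.subset_sum[OF sI sC] by blast+
      then have H: "?H = carrier \<B>" using mI[of ?H] B.left_ideal_iff_submodule RB.submodule_sum[OF sI sC] nI by blast
      let ?N = "{x \<in> carrier Q. i x l \<in> I}"
      have sN: "submodule ?N \<B> Q" by (rule submodule_preimage[OF Q.left_module_axioms RB.left_module_axioms h sI])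
      have sk: "submodule (a_kernel Q ?Y q) \<B> Q" by (rule submodule_kernel[OF arrow_lm[OF a1] arrow_fg(3)[OF a1]])
      have "carrier Q \<subseteq> ?N <+>\<^bsub>Q\<^esub> a_kernel Q ?Y q"
      proof
        fix x assume x: "x \<in> carrier Q"
        have "i x l \<in> ?H" unfolding H using mod_hom_closed[OF h x] by simp
        then obtain y b where yb: "y \<in> I" "b \<in> carrier \<B>" "i x l = y \<oplus>\<^bsub>regular_module \<B>\<^esub> b \<odot>\<^bsub>regular_module \<B>\<^esub> i z l"
          unfolding set_add_def' by blast
        have bz: "b \<odot>\<^bsub>Q\<^esub> z \<in> carrier Q" using yb(2) zQ(1) by simp
        have y: "y \<in> carrier (regular_module \<B>)" using submodule_in[OF sI yb(1)] .
        have biz: "b \<odot>\<^bsub>regular_module \<B>\<^esub> i z l \<in> carrier (regular_module \<B>)" by (rule RB.smult_closed[OF yb(2) izB])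
        have "i (x \<ominus>\<^bsub>Q\<^esub> b \<odot>\<^bsub>Q\<^esub> z) l = i x l \<ominus>\<^bsub>regular_module \<B>\<^esub> b \<odot>\<^bsub>regular_module \<B>\<^esub> i z l"
          using mod_hom_minus[OF Q.left_module_axioms RB.left_module_axioms h x bz] mod_hom_smult[OF h yb(2) zQ(1)] by (simp only:)
        also have "\<dots> = y" unfolding yb(3) by (rule RB.M.add_minus_cancel[OF y biz])
        finally have "x \<ominus>\<^bsub>Q\<^esub> b \<odot>\<^bsub>Q\<^esub> z \<in> ?N" using yb(1) Q.M.minus_closed[OF x bz] by simp
        moreover have "z \<in> a_kernel Q ?Y q" using zQ by (simp add: a_kernel_def')
        then have "b \<odot>\<^bsub>Q\<^esub> z \<in> a_kernel Q ?Y q" by (rule submodule_smult[OF sk yb(2)])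
        moreover have "x = (x \<ominus>\<^bsub>Q\<^esub> b \<odot>\<^bsub>Q\<^esub> z) \<oplus>\<^bsub>Q\<^esub> b \<odot>\<^bsub>Q\<^esub> z" by (rule Q.M.minus_add_cancel[OF x bz, symmetric])
        ultimately show "x \<in> ?N <+>\<^bsub>Q\<^esub> a_kernel Q ?Y q" unfolding set_add_def' by blast
      qed
      then have "?N <+>\<^bsub>Q\<^esub> a_kernel Q ?Y q = carrier Q" using submodule_sub[OF Q.submodule_sum[OF sN sk]] by blast
      from super[OF sN this] have "?N = carrier Q" .
      then show False using zQ(1) nI by blast
    qed
    then show ?thesis unfolding jacobson_radical_def using izB by simp
  qed
  let ?S = "i ` carrier ?Z"
  have iz: "i z \<in> carrier (free_module \<B> m)" if "z \<in> carrier ?Z" for z using mod_hom_closed[OF ir(1)] that by simp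
  have SA: "?S \<subseteq> carrier (free_module A m)" using free_restrict[OF iz] by blast
  have SJ: "v l \<in> \<J>" if "v \<in> ?S" "l < m" for v l using coord that by blast
  have sSB: "submodule ?S \<B> (free_module \<B> m)"
  proof -
    have "submodule (carrier ?Z) \<B> Q" using submodule_kernel[OF arrow_lm[OF a1] arrow_fg(3)[OF a1]] by (simp add: ker_mod_def)
    then show ?thesis by (rule submodule_image[OF Q.left_module_axioms FB.left_module_axioms ir(1)])
  qed
  have f1: "(\<lambda>v. i0 (q (r v))) \<in> mod_hom \<B> (free_module \<B> m) (free_module \<B> n0)"
    using mod_hom_comp[OF mod_hom_comp[OF ir(2) arrow_fg(3)[OF a1]] psi] .
  have f2: "(\<lambda>v. i (r v)) \<in> mod_hom \<B> (free_module \<B> m) (free_module \<B> m)" using mod_hom_comp[OF ir(2,1)] .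
  \<comment> \<open>\<open>S\<close> is the set of all \<open>v\<close> with \<open>g\<^sub>1 v = 0\<close> and \<open>g\<^sub>2 v = v\<close> among the vectors with entries in \<open>B\<close>\<close>
  obtain g1 where g1: "g1 \<in> mod_hom A (free_module A m) (free_module A n0)" "\<forall>v\<in>carrier (free_module \<B> m). g1 v = i0 (q (r v))"
    using extend_free_hom[OF f1] by blast
  obtain g2 where g2: "g2 \<in> mod_hom A (free_module A m) (free_module A m)" "\<forall>v\<in>carrier (free_module \<B> m). g2 v = i (r v)"
    using extend_free_hom[OF f2] by blast
  have sSA: "submodule ?S A (free_module A m)"
  proof (rule FA.submoduleI[OF SA])
    show "\<zero>\<^bsub>free_module A m\<^esub> \<in> ?S" using submodule_0[OF sSB] by simp
    show "x \<oplus>\<^bsub>free_module A m\<^esub> y \<in> ?S" if "x \<in> ?S" "y \<in> ?S" for x y using submodule_add[OF sSB that] by simp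
    fix a v assume a: "a \<in> carrier A" and "v \<in> ?S"
    then obtain z where z: "z \<in> carrier ?Z" "v = i z" by blast
    have vB: "v \<in> carrier (free_module \<B> m)" using iz[OF z(1)] z(2) by simp
    have vA: "v \<in> carrier (free_module A m)" by (rule free_restrict[OF vB])
    have rv: "r v = z" using ir(3) z by simp
    let ?w = "a \<odot>\<^bsub>free_module A m\<^esub> v"
    have "a \<otimes> v l \<in> B" if "l < m" for l using J.I_l_closed[OF coord[OF z(1) that] a] rad_in_B z(2) by simp
    then have wB: "?w \<in> carrier (free_module \<B> m)" by simp
    have "g1 v = \<zero>\<^bsub>free_module \<B> n0\<^esub>"
      using g1(2) vB rv z(1) mod_hom_zero[OF fg_left_module[OF fY] B.free_left_module psi] by simp
    then have "g1 ?w = a \<odot>\<^bsub>free_module A n0\<^esub> \<zero>\<^bsub>free_module A n0\<^esub>" using mod_hom_smult[OF g1(1) a vA] by simp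
    also have "\<dots> = \<zero>\<^bsub>free_module A n0\<^esub>" by (rule left_module.smult_zero_right[OF A.free_left_module a])
    finally have "i0 (q (r ?w)) = \<zero>\<^bsub>free_module \<B> n0\<^esub>" using g1(2) wB by simp
    then have "q (r ?w) = \<zero>\<^bsub>?Y\<^esub>" by (rule psi_inj[OF arrow_app[OF a1 mod_hom_closed[OF ir(2) wB]]])
    then have rw: "r ?w \<in> carrier ?Z" using mod_hom_closed[OF ir(2) wB] by simp
    have "g2 v = v" using g2(2) vB rv z(2) by simp
    then have "g2 ?w = ?w" using mod_hom_smult[OF g2(1) a vA] by simp
    then have "?w = i (r ?w)" using g2(2) wB by simp
    then show "?w \<in> ?S" using rw by (rule image_eqI)
  qed
  obtain PA where PA: "PA \<in> fg_modules A" "mod_isomorphic A (free_module A m) PA" using free_module_fg_copy[OF A.ring_axioms] by blast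
  obtain t t' where t: "t \<in> mod_hom A (free_module A m) PA" "t' \<in> mod_hom A PA (free_module A m)"
    "bij_betw t (carrier (free_module A m)) (carrier PA)"
    "\<And>x. x \<in> carrier (free_module A m) \<Longrightarrow> t' (t x) = x" "\<And>y. y \<in> carrier PA \<Longrightarrow> t (t' y) = y"
    using mod_isomorphicE[OF A.free_left_module fg_left_module[OF PA(1)] PA(2)] by blast
  have prA: "projective_mod A PA" by (rule projective_of_free_iso[OF A.ring_axioms PA])
  interpret PA: left_module A PA by (rule fg_left_module[OF PA(1)])
  have sT: "submodule (t ` ?S) A PA" by (rule submodule_image[OF FA.left_module_axioms PA.left_module_axioms t(1) sSA])
  obtain W :: "'a fg_mod" and w where W: "left_module A W" "w \<in> mod_hom A PA W" "w ` carrier PA = carrier W" "a_kernel PA W w = t ` ?S"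
    using PA.quotient_exists[OF sT] by (elim exE conjE) (rule that; assumption)
  have fW: "W \<in> fg_modules A"
    using fin_gen_image[OF PA.left_module_axioms W(1,2,3)] PA(1) W(1) by (simp add: fg_modules_def)
  have "N = carrier PA" if "submodule N A PA" "N <+>\<^bsub>PA\<^esub> t ` ?S = carrier PA" for N
    by (rule rad_superfluous[OF PA(1) t(1) SA _ that]) (rule SJ)
  then have "projective_cover A W PA w" unfolding projective_cover_def W(4) using prA W(2,3) by simp
  then have syz1: "is_syzygy A W (PA\<lparr>carrier := a_kernel PA W w\<rparr>)" unfolding is_syzygy_def by blast
  let ?Zm = "PA\<lparr>carrier := a_kernel PA W w\<rparr>"
  have fZm: "?Zm \<in> fg_modules A" unfolding W(4) by (rule A.submodule_fg[OF PA(1) sT])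
  obtain P1 p1 where P1: "projective_cover A ?Zm P1 p1" using A.projective_cover_exists[OF fZm] by blast
  let ?V = "P1\<lparr>carrier := a_kernel P1 ?Zm p1\<rparr>"
  note cP1 = projective_cover_cover[OF P1 fZm]
  note prP1 = coverD(1)[OF cP1] and p1 = coverD(2)[OF cP1] and surj1 = coverD(3)[OF cP1]
  have "is_syzygy A ?Zm ?V" unfolding is_syzygy_def using P1 by blast
  then have V: "?V \<in> second_syzygies A" unfolding second_syzygies_def is_second_syzygy_def using fW syz1 by blast
  have sV: "submodule (a_kernel P1 ?Zm p1) A P1" by (rule submodule_kernel[OF arrow_lm[OF p1] arrow_fg(3)[OF p1]])
  have fV: "?V \<in> fg_modules A" by (rule A.submodule_fg[OF arrow_fg(1)[OF p1] sV])
  have incl: "arrow A ?V P1 (\<lambda>x. x)" using submodule_in[OF sV] arrow_fg(1)[OF p1] fV by (intro arrowI) simp_all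
  have "short_exact \<B> ?V P1 ?Zm (\<lambda>x. x) p1"
  proof (rule short_exactI[OF restrict_arrow[OF incl] restrict_arrow[OF p1]])
    show "\<exists>y\<in>carrier P1. p1 y = z" if "z \<in> carrier ?Zm" for z using that unfolding surj1[symmetric] by blast
    show "p1 x = \<zero>\<^bsub>?Zm\<^esub>" if "x \<in> carrier ?V" for x using that by (simp add: a_kernel_def')
    show "\<exists>x\<in>carrier ?V. y = x" if "y \<in> carrier P1" "p1 y = \<zero>\<^bsub>?Zm\<^esub>" for y using that by (simp add: a_kernel_def')
  qed
  moreover have iso1: "arrow \<B> ?Z ?Zm (\<lambda>z. t (i z))"
  proof (intro arrowI fZ restrict_fg[OF fZm])
    note tB = restrict_hom[OF t(1)]
    fix x y assume x: "x \<in> carrier ?Z"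
    then show "t (i x) \<in> carrier ?Zm" using W(4) by simp
    assume y: "y \<in> carrier ?Z"
    note ixy = free_restrict[OF iz[OF x]] free_restrict[OF iz[OF y]]
    have "i (x \<oplus>\<^bsub>?Z\<^esub> y) = i x \<oplus>\<^bsub>free_module A m\<^esub> i y" using mod_hom_add[OF ir(1), of x y] x y by simp
    then show "t (i (x \<oplus>\<^bsub>?Z\<^esub> y)) = t (i x) \<oplus>\<^bsub>?Zm\<^esub> t (i y)" using mod_hom_add[OF t(1) ixy] by simp
  next
    fix a x assume a: "a \<in> carrier \<B>" and x: "x \<in> carrier ?Z"
    have "i (a \<odot>\<^bsub>?Z\<^esub> x) = a \<odot>\<^bsub>free_module A m\<^esub> i x" using mod_hom_smult[OF ir(1) a, of x] x by simp
    then show "t (i (a \<odot>\<^bsub>?Z\<^esub> x)) = a \<odot>\<^bsub>?Zm\<^esub> t (i x)" using mod_hom_smult[OF t(1) _ free_restrict[OF iz[OF x]], of a] a B_in by simp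
  qed
  have isob: "bij_betw (\<lambda>z. t (i z)) (carrier ?Z) (carrier ?Zm)" unfolding bij_betw_def
  proof
    show "inj_on (\<lambda>z. t (i z)) (carrier ?Z)"
    proof (rule inj_on_inverseI[where g = "\<lambda>y. r (t' y)"])
      fix z assume z: "z \<in> carrier ?Z"
      have "t' (t (i z)) = i z" by (rule t(4)[OF free_restrict[OF iz[OF z]]])
      then show "r (t' (t (i z))) = z" using ir(3) z by simp
    qed
    show "(\<lambda>z. t (i z)) ` carrier ?Z = carrier ?Zm" using W(4) by (simp add: image_image)
  qed
  obtain s where s: "arrow \<B> ?Zm ?Z s" "\<forall>x\<in>carrier ?Z. s (t (i x)) = x" "\<forall>y\<in>carrier ?Zm. t (i (s y)) = y"
    using arrow_inverse[OF iso1 isob] by (elim exE conjE) (rule that; assumption)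
  have "null \<B> (n + 2) M M (\<lambda>x. x)" if n: "null \<B> n ?Zm ?Zm (\<lambda>x. x)" for n
  proof -
    have "null \<B> n ?Z ?Z (\<lambda>x. x)" by (rule null_cong[OF B.null_comp[OF n iso1 s(1)]]) (use s(2) in simp)
    from B.null_id_unlift[OF B.null_id_unlift[OF this c1] c0] show ?thesis by simp
  qed
  moreover have "null \<B> n ?Zm ?Zm (\<lambda>x. x)" if n: "null \<B> n M M (\<lambda>x. x)" for n
  proof -
    have "null \<B> n ?Z ?Z (\<lambda>x. x)"
      by (rule B.null_id_lift[OF B.null_id_lift[OF B.null_Suc[OF B.null_Suc[OF n]] c0] c1])
    from B.null_comp[OF this s(1) iso1] show ?thesis by (rule null_cong) (use s(3) in simp)
  qed
  ultimately show ?thesis using V prP1 fV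
    by (intro exI[of _ ?Zm] exI[of _ ?V] exI[of _ P1] exI[of _ p1]) simp
qed

text \<open>
  Over \<open>A\<close>, a module all of whose indecomposable summands lie in a finite list is a direct sum of
  modules from the list; the same holds for its restriction to \<open>B\<close>.
\<close>

lemma stable_class_of_summands:
  assumes M: "M \<in> fg_modules A" and F: "\<And>i. i < r \<Longrightarrow> F i \<in> fg_modules A"
    and ind: "\<And>K L. complementary A M K L \<Longrightarrow> indecomposable_mod A (M\<lparr>carrier := K\<rparr>) \<Longrightarrow>
      \<exists>i<r. mod_isomorphic A (M\<lparr>carrier := K\<rparr>) (F i)"
  shows "\<exists>v. B.stable_class M = comm_monoid.multi_pow B.stable_monoid r (\<lambda>i. B.stable_class (F i)) v"
proof -
  interpret S: comm_monoid B.stable_monoid by (rule B.stable_comm_monoid)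
  let ?cls = "comm_monoid.multi_pow B.stable_monoid r (\<lambda>i. B.stable_class (F i))"
  have Fc: "B.stable_class (F i) \<in> carrier B.stable_monoid" if "i < r" for i
    using restrict_fg[OF F[OF that]] B.stable_carrier by blast
  define Q where "Q K \<longleftrightarrow> (\<exists>v. B.stable_class (M\<lparr>carrier := K\<rparr>) = ?cls v)" for K
  have "Q (carrier M)"
  proof (rule A.summand_induct[OF M])
    have "submodule {\<zero>\<^bsub>M\<^esub>} A M" by (rule left_module.submodule_zero[OF fg_left_module[OF M]])
    from restrict_fg[OF A.submodule_fg[OF M this]]
    have "\<one>\<^bsub>B.stable_monoid\<^esub> = B.stable_class (M\<lparr>carrier := {\<zero>\<^bsub>M\<^esub>}\<rparr>)" by (rule B.stable_one_class) simp
    then show "Q {\<zero>\<^bsub>M\<^esub>}" unfolding Q_def using S.multi_pow_zero by metis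
  next
    fix K L assume K: "complementary A M K L" "indecomposable_mod A (M\<lparr>carrier := K\<rparr>)"
    then obtain i where i: "i < r" "mod_isomorphic A (M\<lparr>carrier := K\<rparr>) (F i)" using ind by blast
    have fK: "M\<lparr>carrier := K\<rparr> \<in> fg_modules \<B>" by (rule restrict_fg[OF A.submodule_fg[OF M complementaryD(1)[OF K(1)]]])
    have "mod_isomorphic \<B> (M\<lparr>carrier := K\<rparr>) (F i)" using i(2) restrict_hom unfolding mod_isomorphic_def by blast
    then have "B.stable_class (M\<lparr>carrier := K\<rparr>) = B.stable_class (F i)"
      using B.stable_class_eq_iff[OF fK] B.stably_iso_iso[OF fK restrict_fg[OF F[OF i(1)]]] by blast
    then show "Q K" unfolding Q_def using S.multi_pow_unit[of r "\<lambda>i. B.stable_class (F i)", OF Fc i(1)] by metis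
  next
    fix K K1 K2 assume K: "submodule K A M" "complementary A (M\<lparr>carrier := K\<rparr>) K1 K2" "Q K1" "Q K2"
    obtain v1 v2 where v: "B.stable_class (M\<lparr>carrier := K1\<rparr>) = ?cls v1" "B.stable_class (M\<lparr>carrier := K2\<rparr>) = ?cls v2"
      using K(3,4) unfolding Q_def by blast
    obtain p q where "biproduct A (M\<lparr>carrier := K\<rparr>) (M\<lparr>carrier := K, carrier := K1\<rparr>) (M\<lparr>carrier := K, carrier := K2\<rparr>) (\<lambda>x. x) (\<lambda>x. x) p q"
      using A.complementary_biproduct[OF A.submodule_fg[OF M K(1)] K(2)] by blast
    then have B: "biproduct \<B> (M\<lparr>carrier := K\<rparr>) (M\<lparr>carrier := K1\<rparr>) (M\<lparr>carrier := K2\<rparr>) (\<lambda>x. x) (\<lambda>x. x) p q"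
      using restrict_biproduct by simp
    have "B.stable_class (M\<lparr>carrier := K\<rparr>) = ?cls (\<lambda>i. v1 i + v2 i)"
      using B.stable_sum_class[OF B] v S.multi_pow_add[of r "\<lambda>i. B.stable_class (F i)", OF Fc] B.stable_mult by simp
    then show "Q K" unfolding Q_def by blast
  qed
  then show ?thesis unfolding Q_def by simp
qed

text \<open>
  The finite list consists of representatives of the indecomposable summands of second syzygies, which exist by
  hypothesis, and of the indecomposable projectives; it serves both terms of the sequence \<open>0 \<rightarrow> V \<rightarrow> P \<rightarrow> Z \<rightarrow> 0\<close>.
\<close>

lemma fin_dim_finite:
  assumes "finite_type A (add_closure A (second_syzygies A))"
  shows "fin_dim \<B> < \<infinity>"
proof -
  obtain F0 where F0: "finite F0" "F0 \<subseteq> add_closure A (second_syzygies A)"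
    "\<forall>M\<in>add_closure A (second_syzygies A). indecomposable_mod A M \<longrightarrow> (\<exists>N\<in>F0. mod_isomorphic A M N)"
    using assms unfolding finite_type_def by (elim exE conjE) (rule that; assumption)
  obtain F1 where F1: "finite F1" "F1 \<subseteq> fg_modules A"
    "\<forall>L. projective_mod A L \<longrightarrow> indecomposable_mod A L \<longrightarrow> (\<exists>N\<in>F1. mod_isomorphic A L N)"
    using A.finitely_many_indecomposable_projectives by (elim exE conjE) (rule that; assumption)
  have fin: "finite (F0 \<union> F1)" using F0(1) F1(1) by simp
  obtain F and r :: nat where Fr: "F ` {..<r} = F0 \<union> F1"
    using finite_imp_nat_seg_image_inj_on[OF fin] by (auto simp: lessThan_def)
  have "F0 \<union> F1 \<subseteq> fg_modules A" using F0(2) F1(2) unfolding add_closure_def by blast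
  then have F: "F i \<in> fg_modules A" if "i < r" for i using Fr that by blast
  have pick: "\<exists>i<r. mod_isomorphic A L (F i)" if "\<exists>N\<in>F0 \<union> F1. mod_isomorphic A L N" for L
    using that unfolding Fr[symmetric] by blast
  have FB: "\<And>i. i < r \<Longrightarrow> F i \<in> fg_modules \<B>" by (rule restrict_fg[OF F])
  let ?cls = "comm_monoid.multi_pow B.stable_monoid r (\<lambda>i. B.stable_class (F i))"
  obtain b where b: "\<forall>V P Z f \<pi> d v w. short_exact \<B> V P Z f \<pi> \<and> B.stable_class V = ?cls v \<and> B.stable_class P = ?cls w \<and>
    null \<B> d Z Z (\<lambda>x. x) \<longrightarrow> null \<B> b Z Z (\<lambda>x. x)"
    by (rule exE[OF B.uniform_bound[of r F]], erule FB, rule that, assumption)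
  have "null \<B> (b + 2) M M (\<lambda>x. x)" if M: "M \<in> fg_modules \<B>" and n: "null \<B> n M M (\<lambda>x. x)" for M n
  proof -
    obtain Z V P p where V: "V \<in> second_syzygies A" "projective_mod A P" "V \<in> fg_modules A" and E: "short_exact \<B> V P Z (\<lambda>x. x) p"
      and up: "\<forall>n. null \<B> n Z Z (\<lambda>x. x) \<longrightarrow> null \<B> (n + 2) M M (\<lambda>x. x)"
      and down: "\<forall>n. null \<B> n M M (\<lambda>x. x) \<longrightarrow> null \<B> n Z Z (\<lambda>x. x)"
      using second_syzygy_over_A[OF M] by (elim exE conjE) (rule that; assumption)
    note fP = projective_fg[OF V(2)]
    have "\<exists>v. B.stable_class V = ?cls v"
    proof (rule stable_class_of_summands[OF V(3) F])
      fix K L assume K: "complementary A V K L" "indecomposable_mod A (V\<lparr>carrier := K\<rparr>)"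
      let ?K = "V\<lparr>carrier := K\<rparr>"
      have fK: "?K \<in> fg_modules A" by (rule A.submodule_fg[OF V(3) complementaryD(1)[OF K(1)]])
      interpret K: left_module A ?K by (rule fg_left_module[OF fK])
      have "direct_summand A ?K V" unfolding direct_summand_def
        using K(1) mod_isomorphicI[OF mod_hom_id mod_hom_id, of ?K] by blast
      moreover have "internal_direct_sum A ?K 1 (\<lambda>_. K)" unfolding internal_direct_sum_def
      proof (intro conjI allI impI ballI)
        show "submodule K A ?K" using K.submodule_carrier by simp
        fix x assume x: "x \<in> carrier ?K"
        have fs: "finsum ?K f {..<1} = f 0" if "f \<in> (\<Pi>\<^sub>E i\<in>{..<1::nat}. K)" for f
        proof -
          have "f 0 \<in> carrier ?K" using that by auto
          moreover have "{..<1::nat} = {0}" by auto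
          ultimately show ?thesis using K.M.finsum_insert[of "{}" 0 f] K.M.r_zero[of "f 0"] by simp
        qed
        show "\<exists>!f. f \<in> (\<Pi>\<^sub>E i\<in>{..<1::nat}. K) \<and> x = finsum ?K f {..<1::nat}"
        proof (rule ex1I[of _ "\<lambda>i\<in>{..<1::nat}. x"])
          have r: "(\<lambda>i\<in>{..<1::nat}. x) \<in> (\<Pi>\<^sub>E i\<in>{..<1::nat}. K)" using x by simp
          show "(\<lambda>i\<in>{..<1::nat}. x) \<in> (\<Pi>\<^sub>E i\<in>{..<1::nat}. K) \<and> x = finsum ?K (\<lambda>i\<in>{..<1::nat}. x) {..<1::nat}"
            by (rule conjI[OF r]) (simp only: fs[OF r], simp)
          fix f assume f: "f \<in> (\<Pi>\<^sub>E i\<in>{..<1::nat}. K) \<and> x = finsum ?K f {..<1::nat}"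
          then have "f 0 = x" using fs by simp
          then show "f = (\<lambda>i\<in>{..<1::nat}. x)" using f by (intro extensionalityI[of _ "{..<1::nat}"]) (auto simp: PiE_def)
        qed
      qed
      moreover have "?K\<lparr>carrier := K\<rparr> = ?K" by simp
      ultimately have "?K \<in> add_closure A (second_syzygies A)"
        unfolding add_closure_def using fK K(2) V(1) by (intro CollectI conjI exI[of _ 1] exI[of _ "\<lambda>_. K"]) auto
      then have "\<exists>N\<in>F0. mod_isomorphic A ?K N" using F0(3) K(2) by blast
      then show "\<exists>i<r. mod_isomorphic A ?K (F i)" by (intro pick) blast
    qed
    moreover have "\<exists>w. B.stable_class P = ?cls w"
    proof (rule stable_class_of_summands[OF fP F])
      fix K L assume K: "complementary A P K L" "indecomposable_mod A (P\<lparr>carrier := K\<rparr>)"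
      obtain p' q' where "biproduct A P (P\<lparr>carrier := K\<rparr>) (P\<lparr>carrier := L\<rparr>) (\<lambda>x. x) (\<lambda>x. x) p' q'"
        using A.complementary_biproduct[OF fP K(1)] by blast
      note D = biproductD[OF this]
      have "projective_mod A (P\<lparr>carrier := K\<rparr>)" by (rule projective_retract[OF V(2) D(1,3,5)])
      then have "\<exists>N\<in>F1. mod_isomorphic A (P\<lparr>carrier := K\<rparr>) N" using F1(3) K(2) by blast
      then show "\<exists>i<r. mod_isomorphic A (P\<lparr>carrier := K\<rparr>) (F i)" by (intro pick) blast
    qed
    moreover have "null \<B> n Z Z (\<lambda>x. x)" using down n by blast
    ultimately have "null \<B> b Z Z (\<lambda>x. x)" using b E by blast
    then show ?thesis using up by blast
  qed
  then have "fin_dim \<B> \<le> enat (b + 2)" by (rule B.fin_dim_le)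
  also have "\<dots> < \<infinity>" by simp
  finally show ?thesis .
qed

end

section \<open>Artin algebras\<close>

text \<open>Over an Artin algebra the image of the ground ring is a central artinian subring.\<close>

context artin_algebra begin

definition ground_image :: "'a set" where
  "ground_image = (\<lambda>r. r \<odot> \<one>) ` carrier R"

lemma ground_image_mult:
  assumes "r \<in> carrier R" "x \<in> carrier A"
  shows "(r \<odot> \<one>) \<otimes> x = r \<odot> x" "x \<otimes> (r \<odot> \<one>) = r \<odot> x"
  using smult_mult_left[OF assms(1) one_closed assms(2)] smult_mult_right[OF assms(1) assms(2) one_closed] assms(2) by simp_all

lemma ground_image_subring: "subring ground_image A"
proof (rule subringI)
  show "ground_image \<subseteq> carrier A" unfolding ground_image_def by auto
  have "\<one> = \<one>\<^bsub>R\<^esub> \<odot> \<one>" by simp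
  then show "\<one> \<in> ground_image" unfolding ground_image_def using R.one_closed by blast
next
  fix h1 h2 assume "h1 \<in> ground_image" "h2 \<in> ground_image"
  then obtain r s where rs: "r \<in> carrier R" "h1 = r \<odot> \<one>" "s \<in> carrier R" "h2 = s \<odot> \<one>" unfolding ground_image_def by blast
  have "h1 \<otimes> h2 = (r \<otimes>\<^bsub>R\<^esub> s) \<odot> \<one>" using ground_image_mult(1)[OF rs(1), of "s \<odot> \<one>"] rs by (simp add: smult_assoc1)
  then show "h1 \<otimes> h2 \<in> ground_image" unfolding ground_image_def using rs by blast
  have "h1 \<oplus> h2 = (r \<oplus>\<^bsub>R\<^esub> s) \<odot> \<one>" using rs by (simp add: smult_l_distr)
  then show "h1 \<oplus> h2 \<in> ground_image" unfolding ground_image_def using rs by blast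
next
  fix h assume "h \<in> ground_image"
  then obtain r where rs: "r \<in> carrier R" "h = r \<odot> \<one>" unfolding ground_image_def by blast
  have "\<ominus> h = (\<ominus>\<^bsub>R\<^esub> r) \<odot> \<one>" using rs smult_l_minus[of r \<one>] by simp
  then show "\<ominus> h \<in> ground_image" unfolding ground_image_def using rs by blast
qed

lemma ground_image_fin_length: "fin_length (A\<lparr>carrier := ground_image\<rparr>) (regular_module (A\<lparr>carrier := ground_image\<rparr>))"
proof (rule artinian_cring_fin_length)
  let ?K = "A\<lparr>carrier := ground_image\<rparr>"
  interpret K: ring ?K by (rule subring_is_ring[OF ground_image_subring])
  have gi: "t \<in> carrier A" if "t \<in> ground_image" for t using that subringE(1)[OF ground_image_subring] by blast
  have comm: "h1 \<otimes> h2 = h2 \<otimes> h1" if h: "h1 \<in> ground_image" "h2 \<in> ground_image" for h1 h2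
  proof -
    obtain r where "r \<in> carrier R" "h1 = r \<odot> \<one>" using h(1) unfolding ground_image_def by blast
    then show ?thesis using ground_image_mult[of r h2] gi[OF h(2)] by simp
  qed
  have K: "cring ?K"
    by (intro cring.intro comm_monoid.intro comm_monoid_axioms.intro K.ring_axioms K.is_monoid) (use comm in simp)
  have "\<exists>k. \<forall>n\<ge>k. I n = I k" if I: "\<forall>n::nat. ideal (I n) ?K \<and> I (Suc n) \<subseteq> I n" for I
  proof -
    define J where "J n = {r \<in> carrier R. r \<odot> \<one> \<in> I n}" for n
    have "ideal (J n) R" for n
    proof -
      interpret I: ideal "I n" ?K using I by blast
      have add: "x \<oplus> y \<in> I n" if "x \<in> I n" "y \<in> I n" for x y using I.a_closed[OF that] by simp
      have mul: "t \<otimes> x \<in> I n" if "x \<in> I n" "t \<in> ground_image" for x t using I.I_l_closed[OF that(1)] that(2) by simp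
      have g: "r \<odot> \<one> \<in> ground_image" if "r \<in> carrier R" for r unfolding ground_image_def using that by blast
      have sm: "s \<otimes>\<^bsub>R\<^esub> r \<in> J n" if "r \<in> J n" "s \<in> carrier R" for r s
      proof -
        have r: "r \<in> carrier R" "r \<odot> \<one> \<in> I n" using that(1) by (auto simp: J_def)
        have "(s \<otimes>\<^bsub>R\<^esub> r) \<odot> \<one> = (s \<odot> \<one>) \<otimes> (r \<odot> \<one>)" using ground_image_mult(1)[OF that(2), of "r \<odot> \<one>"] r that(2) by (simp add: smult_assoc1)
        then show ?thesis using mul[OF r(2) g[OF that(2)]] r that(2) by (simp add: J_def)
      qed
      show ?thesis
      proof (rule idealI)
        show "ring R" by (rule R.ring_axioms)
        show "subgroup (J n) (add_monoid R)"
        proof (rule group.subgroupI[OF R.a_group])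
          show "J n \<subseteq> carrier (add_monoid R)" by (auto simp: J_def)
          have "\<zero>\<^bsub>R\<^esub> \<in> J n" using I.zero_closed by (simp add: J_def)
          then show "J n \<noteq> {}" by blast
          fix a assume a: "a \<in> J n"
          then have ac: "a \<in> carrier R" by (simp add: J_def)
          have "\<ominus>\<^bsub>R\<^esub> a = (\<ominus>\<^bsub>R\<^esub> \<one>\<^bsub>R\<^esub>) \<otimes>\<^bsub>R\<^esub> a" using ac by (simp add: R.l_minus)
          then have "\<ominus>\<^bsub>R\<^esub> a \<in> J n" using sm[OF a, of "\<ominus>\<^bsub>R\<^esub> \<one>\<^bsub>R\<^esub>"] by simp
          then show "inv\<^bsub>add_monoid R\<^esub> a \<in> J n" by (simp add: a_inv_def)
          fix b assume "b \<in> J n"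
          then show "a \<otimes>\<^bsub>add_monoid R\<^esub> b \<in> J n" using a add by (simp add: J_def smult_l_distr)
        qed
        show "x \<otimes>\<^bsub>R\<^esub> a \<in> J n" if "a \<in> J n" "x \<in> carrier R" for a x using sm[OF that] .
        show "a \<otimes>\<^bsub>R\<^esub> x \<in> J n" if "a \<in> J n" "x \<in> carrier R" for a x
        proof -
          have "a \<otimes>\<^bsub>R\<^esub> x = x \<otimes>\<^bsub>R\<^esub> a" using that R.m_comm by (simp add: J_def)
          then show ?thesis using sm[OF that] by simp
        qed
      qed
    qed
    moreover have "J (Suc n) \<subseteq> J n" for n using I by (auto simp: J_def)
    ultimately have "\<exists>k. \<forall>n\<ge>k. J n = J k" using ground_artinian unfolding artinian_cring_def by blast
    then obtain k where k: "\<forall>n\<ge>k. J n = J k" ..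
    have im: "I n = (\<lambda>r. r \<odot> \<one>) ` J n" for n
    proof
      interpret I: ideal "I n" ?K using I by blast
      show "I n \<subseteq> (\<lambda>r. r \<odot> \<one>) ` J n" using I.a_subset by (auto simp: J_def ground_image_def)
      show "(\<lambda>r. r \<odot> \<one>) ` J n \<subseteq> I n" by (auto simp: J_def)
    qed
    have "I n = I k" if "n \<ge> k" for n unfolding im[of n] im[of k] using k[rule_format, OF that] by (rule arg_cong)
    then show ?thesis by blast
  qed
  then show "artinian_cring ?K" unfolding artinian_cring_def using K by blast
qed

lemma ground_image_fin_gen: "fin_gen (A\<lparr>carrier := ground_image\<rparr>) (regular_module A)"
proof -
  let ?K = "A\<lparr>carrier := ground_image\<rparr>"
  obtain S where S: "finite S" "S \<subseteq> carrier A" "\<And>N. submodule N R A \<Longrightarrow> S \<subseteq> N \<Longrightarrow> N = carrier A"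
    using finitely_generated by (auto simp: fin_gen_def)
  show ?thesis
  proof (rule fin_genI[of S])
    fix N assume N: "submodule N ?K (regular_module A)" "S \<subseteq> N"
    have Nc: "N \<subseteq> carrier A" using submodule_sub[OF N(1)] by simp
    have sm: "r \<odot> x \<in> N" if "r \<in> carrier R" "x \<in> N" for r x
    proof -
      have "r \<odot> \<one> \<in> ground_image" unfolding ground_image_def using that by blast
      then show ?thesis using submodule_smult[OF N(1), of "r \<odot> \<one>" x] that(2) ground_image_mult(1)[OF that(1)] Nc by auto
    qed
    have "submodule N R A"
    proof (rule submoduleI[OF Nc])
      show "\<zero> \<in> N" using submodule_0[OF N(1)] by simp
      show "a \<oplus> b \<in> N" if "a \<in> N" "b \<in> N" for a b using submodule_add[OF N(1) that] by simp
      show "\<ominus> a \<in> N" if "a \<in> N" for a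
      proof -
        have "\<ominus> a = (\<ominus>\<^bsub>R\<^esub> \<one>\<^bsub>R\<^esub>) \<odot> a" using smult_l_minus[of "\<one>\<^bsub>R\<^esub>" a] that Nc by auto
        then show ?thesis using sm[OF _ that] by simp
      qed
    qed (rule sm)
    then show "N = carrier (regular_module A)" using S(3) N(2) by simp
  qed (use S in auto)
qed

text \<open>
  A subalgebra is a submodule of a module of finite length over the image of the ground ring, hence again
  module-finite.
\<close>

lemma subalgebra_fin_gen:
  assumes S: "subring S A" "ground_image \<subseteq> S" and M: "left_module (A\<lparr>carrier := S\<rparr>) M" "fin_gen (A\<lparr>carrier := S\<rparr>) M"
  shows "left_module (A\<lparr>carrier := ground_image\<rparr>) M" "fin_gen (A\<lparr>carrier := ground_image\<rparr>) M"
    "fin_length (A\<lparr>carrier := ground_image\<rparr>) M"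
proof -
  let ?K = "A\<lparr>carrier := ground_image\<rparr>" and ?S = "A\<lparr>carrier := S\<rparr>"
  interpret S: ring ?S by (rule subring_is_ring[OF S(1)])
  interpret KA: left_module ?K "regular_module A" by (rule regular_left_module[OF ground_image_subring])
  have K: "ring ?K" by (rule subring_is_ring[OF ground_image_subring])
  have eq: "?S\<lparr>carrier := ground_image\<rparr> = ?K" by simp
  have KS: "subring ground_image ?S" by (rule S.ring_incl_imp_subring) (use S(2) K in simp_all)
  have "fin_length ?K (regular_module A)" by (rule KA.fin_gen_fin_length[OF ground_image_fin_length ground_image_fin_gen])
  moreover have "submodule S ?K (regular_module A)"
    by (rule KA.submoduleI) (use subringE(1,2,6,7)[OF S(1)] S(2) in auto)
  ultimately have "fin_gen ?K ((regular_module A)\<lparr>carrier := S\<rparr>)" by (rule KA.fin_length_submodule_fin_gen)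
  moreover have "(regular_module A)\<lparr>carrier := S\<rparr> = regular_module ?S" by (simp add: regular_module_def)
  ultimately have rg: "fin_gen ?K (regular_module ?S)" by simp
  show lm: "left_module ?K M" using left_module_subring[OF M(1) KS] unfolding eq .
  show fg: "fin_gen ?K M" using fin_gen_trans[OF M(1) KS] rg M(2) unfolding eq by blast
  show "fin_length ?K M" by (rule left_module.fin_gen_fin_length[OF lm ground_image_fin_length fg])
qed

lemma subalgebra_finite_length:
  assumes S: "subring S A" "ground_image \<subseteq> S"
  shows "finite_length_algebra (A\<lparr>carrier := S\<rparr>) ground_image"
proof -
  let ?K = "A\<lparr>carrier := ground_image\<rparr>" and ?S = "A\<lparr>carrier := S\<rparr>"
  interpret S: ring ?S by (rule subring_is_ring[OF S(1)])
  have K: "ring ?K" by (rule subring_is_ring[OF ground_image_subring])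
  have Sc: "s \<in> carrier A" if "s \<in> S" for s using that subringE(1)[OF S(1)] by blast
  note fin = subalgebra_fin_gen[OF S]
  show ?thesis
  proof (intro finite_length_algebra.intro noetherian_ring.intro noetherian_ring_axioms.intro finite_length_algebra_axioms.intro S.ring_axioms)
    fix M N assume M: "M \<in> fg_modules ?S" and N: "submodule N ?S M"
    then have lm: "left_module ?S M" "fin_gen ?S M" by (auto simp: fg_modules_def)
    have "submodule N ?K M" by (rule submodule_ring_mono[OF _ N]) (use S(2) in simp)
    then have "fin_gen ?K (M\<lparr>carrier := N\<rparr>)" by (rule left_module.fin_length_submodule_fin_gen[OF fin(1)[OF lm] fin(3)[OF lm]])
    then have "fin_gen ?S (M\<lparr>carrier := N\<rparr>)" by (rule fin_gen_ring_mono[rotated]) (use S(2) in simp)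
    then show "M\<lparr>carrier := N\<rparr> \<in> fg_modules ?S"
      using left_module.submodule_left_module[OF lm(1) N] by (simp add: fg_modules_def)
  next
    show "subring ground_image ?S" by (rule S.ring_incl_imp_subring) (use S(2) K in simp_all)
  next
    fix t a assume "t \<in> ground_image" "a \<in> carrier ?S"
    then show "t \<otimes>\<^bsub>?S\<^esub> a = a \<otimes>\<^bsub>?S\<^esub> t" using ground_image_mult Sc unfolding ground_image_def by auto
  next
    fix M assume "M \<in> fg_modules ?S"
    then show "fin_length (?S\<lparr>carrier := ground_image\<rparr>) M" by (simp add: fg_modules_def fin(3))
  qed
qed

end

text \<open>
  Both algebras are module-finite over the image of the ground ring, a central artinian subring, and the
  restriction of scalars from \<open>A\<close> to \<open>B\<close> preserves finitely generated modules.
\<close>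

theorem theorem3p3:
  fixes R :: "'r ring" and A :: "('r, 'a) module" and B :: "'a set"
  assumes "artin_algebra R A"
    and "is_subalgebra B R A"
    and "ideal (jacobson_radical (A\<lparr>carrier := B\<rparr>)) A"
    and "finite_type A (add_closure A (second_syzygies A))"
  shows "fin_dim (A\<lparr>carrier := B\<rparr>) < \<infinity>"
proof -
  interpret artin_algebra R A by (rule assms(1))
  have B: "subring B A" "submodule B R A" using assms(2) by (simp_all add: is_subalgebra_def)
  have TB: "ground_image \<subseteq> B"
    using submodule_smult[OF B(2)] subringE(3)[OF B(1)] by (auto simp: ground_image_def)
  have A: "finite_length_algebra A ground_image"
    using subalgebra_finite_length[OF carrier_is_subring] subringE(1)[OF ground_image_subring] by simp
  have "M \<in> fg_modules (A\<lparr>carrier := B\<rparr>)" if M: "M \<in> fg_modules A" for M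
  proof -
    have lm: "left_module A M" "fin_gen A M" using M by (auto simp: fg_modules_def)
    have "fin_gen (A\<lparr>carrier := ground_image\<rparr>) M"
      using subalgebra_fin_gen(2)[OF carrier_is_subring] subringE(1)[OF ground_image_subring] lm by simp
    then have "fin_gen (A\<lparr>carrier := B\<rparr>) M" by (rule fin_gen_ring_mono[rotated]) (use TB in simp)
    then show ?thesis using left_module_subring[OF lm(1) B(1)] by (simp add: fg_modules_def)
  qed
  then interpret radical_pair A ground_image B
    by (intro radical_pair.intro radical_pair_axioms.intro A subalgebra_finite_length[OF B(1) TB] B(1) assms(3))
  show ?thesis by (rule fin_dim_finite[OF assms(4)])
qed

end
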